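(* Let $H$ be a semisimple Hopf algebra of dimension $56$ over $k$. Then $H$ is not simple, that is, $H$ contains a proper normal Hopf subalgebra.
   Context: $k$ is an algebraically closed field of characteristic zero. A Hopf subalgebra $A\subseteq H$ is normal if $h_1A\mathcal S(h_2)\subseteq A$ for all $h\in H$. Proper means different from $k1$ and from $H$. *)

theory Defs
  imports
    "HOL-Library.Poly_Mapping"
    "HOL-Computational_Algebra.Polynomial"
begin

section \<open>Free vector spaces and tensor products\<close>

text \<open>
  \<open>'b \<Rightarrow>\<^sub>0 'k\<close> is the \<open>'k\<close>-vector space with basis \<open>'b\<close>;
  the basis vector belonging to \<open>b\<close> is \<open>Poly_Mapping.single b 1\<close>.
\<close>

definition free_scale :: "'k::field \<Rightarrow> ('b \<Rightarrow>\<^sub>0 'k) \<Rightarrow> ('b \<Rightarrow>\<^sub>0 'k)" where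
  "free_scale c t = Poly_Mapping.map (\<lambda>a. c * a) t"

lemma lookup_free_scale [simp]:
  "Poly_Mapping.lookup (free_scale c t) b = c * Poly_Mapping.lookup t b"
  by (simp add: free_scale_def Poly_Mapping.map.rep_eq when_def)

interpretation free: vector_space free_scale
  by unfold_locales
    (auto intro!: poly_mapping_eqI simp: lookup_add algebra_simps)

text \<open>The linear extension of a map \<open>f\<close> on the basis to the free vector space.\<close>

definition lin_ext ::
    "('k::field \<Rightarrow> 'v::ab_group_add \<Rightarrow> 'v) \<Rightarrow> ('b \<Rightarrow> 'v) \<Rightarrow> ('b \<Rightarrow>\<^sub>0 'k) \<Rightarrow> 'v" where
  "lin_ext s f t = (\<Sum>b\<in>Poly_Mapping.keys t. s (Poly_Mapping.lookup t b) (f b))"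

text \<open>
  The tensor product of two copies of a vector space \<open>V\<close> is the free vector space on \<open>V \<times> V\<close>
  modulo the span of the bilinearity relations, and that of three copies is the free vector
  space on \<open>V \<times> V \<times> V\<close> modulo the trilinearity relations. Tensors are handled through
  representatives in the free vector space (formal sums of pure tensors), and equality of tensors
  is the congruence \<open>tensor2_eq\<close>, resp. \<open>tensor3_eq\<close>.
\<close>

definition tensor2_null :: "('k::field \<Rightarrow> 'v::ab_group_add \<Rightarrow> 'v) \<Rightarrow> ('v \<times> 'v \<Rightarrow>\<^sub>0 'k) set" where
  "tensor2_null s = free.span
     ({Poly_Mapping.single (x + x', y) 1 - Poly_Mapping.single (x, y) 1
         - Poly_Mapping.single (x', y) 1 | x x' y. True}
    \<union> {Poly_Mapping.single (x, y + y') 1 - Poly_Mapping.single (x, y) 1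
         - Poly_Mapping.single (x, y') 1 | x y y'. True}
    \<union> {Poly_Mapping.single (s c x, y) 1 - Poly_Mapping.single (x, y) c | c x y. True}
    \<union> {Poly_Mapping.single (x, s c y) 1 - Poly_Mapping.single (x, y) c | c x y. True})"

definition tensor3_null :: "('k::field \<Rightarrow> 'v::ab_group_add \<Rightarrow> 'v) \<Rightarrow> ('v \<times> 'v \<times> 'v \<Rightarrow>\<^sub>0 'k) set" where
  "tensor3_null s = free.span
     ({Poly_Mapping.single (x + x', y, z) 1 - Poly_Mapping.single (x, y, z) 1
         - Poly_Mapping.single (x', y, z) 1 | x x' y z. True}
    \<union> {Poly_Mapping.single (x, y + y', z) 1 - Poly_Mapping.single (x, y, z) 1
         - Poly_Mapping.single (x, y', z) 1 | x y y' z. True}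
    \<union> {Poly_Mapping.single (x, y, z + z') 1 - Poly_Mapping.single (x, y, z) 1
         - Poly_Mapping.single (x, y, z') 1 | x y z z'. True}
    \<union> {Poly_Mapping.single (s c x, y, z) 1 - Poly_Mapping.single (x, y, z) c | c x y z. True}
    \<union> {Poly_Mapping.single (x, s c y, z) 1 - Poly_Mapping.single (x, y, z) c | c x y z. True}
    \<union> {Poly_Mapping.single (x, y, s c z) 1 - Poly_Mapping.single (x, y, z) c | c x y z. True})"

definition tensor2_eq ::
    "('k::field \<Rightarrow> 'v::ab_group_add \<Rightarrow> 'v) \<Rightarrow> ('v \<times> 'v \<Rightarrow>\<^sub>0 'k) \<Rightarrow> ('v \<times> 'v \<Rightarrow>\<^sub>0 'k) \<Rightarrow> bool" where
  "tensor2_eq s t u \<longleftrightarrow> t - u \<in> tensor2_null s"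

definition tensor3_eq ::
    "('k::field \<Rightarrow> 'v::ab_group_add \<Rightarrow> 'v) \<Rightarrow> ('v \<times> 'v \<times> 'v \<Rightarrow>\<^sub>0 'k) \<Rightarrow> ('v \<times> 'v \<times> 'v \<Rightarrow>\<^sub>0 'k) \<Rightarrow> bool" where
  "tensor3_eq s t u \<longleftrightarrow> t - u \<in> tensor3_null s"

lemma (in vector_space) lin_ext_superset:
  assumes "finite K" "Poly_Mapping.keys t \<subseteq> K"
  shows "lin_ext scale f t = (\<Sum>b\<in>K. scale (Poly_Mapping.lookup t b) (f b))"
  unfolding lin_ext_def
  by (rule sum.mono_neutral_left) (use assms in \<open>auto simp: in_keys_iff\<close>)

lemma (in vector_space) linear_lin_ext: "Vector_Spaces.linear free_scale scale (lin_ext scale f)"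
proof unfold_locales
  fix t u :: "'c \<Rightarrow>\<^sub>0 'a" and c :: 'a
  let ?K = "Poly_Mapping.keys t \<union> Poly_Mapping.keys u"
  have "Poly_Mapping.keys (t + u) \<subseteq> ?K"
    by (rule keys_add)
  then show "lin_ext scale f (t + u) = lin_ext scale f t + lin_ext scale f u"
    by (simp add: lin_ext_superset[of ?K] lookup_add scale_left_distrib sum.distrib)
  have "Poly_Mapping.keys (free_scale c t) \<subseteq> Poly_Mapping.keys t"
    by (auto simp: in_keys_iff)
  then show "lin_ext scale f (free_scale c t) = scale c (lin_ext scale f t)"
    by (simp add: lin_ext_superset[of "Poly_Mapping.keys t"] scale_sum_right)
qed

lemma (in vector_space) lin_ext_single [simp]:
  "lin_ext scale f (Poly_Mapping.single b c) = scale c (f b)"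
  by (simp add: lin_ext_def)

text \<open>The linear extension of a bilinear map does not depend on the representative of a tensor.\<close>

lemma (in vector_space) lin_ext_cong:
  assumes add_left: "\<And>x x' y. f (x + x', y) = f (x, y) + f (x', y)"
    and add_right: "\<And>x y y'. f (x, y + y') = f (x, y) + f (x, y')"
    and scale_left: "\<And>c x y. f (s c x, y) = scale c (f (x, y))"
    and scale_right: "\<And>c x y. f (x, s c y) = scale c (f (x, y))"
    and eq: "tensor2_eq s t u"
  shows "lin_ext scale f t = lin_ext scale f u"
proof -
  interpret L: Vector_Spaces.linear free_scale scale "lin_ext scale f"
    by (rule linear_lin_ext)
  have "lin_ext scale f d = 0" if "d \<in> tensor2_null s" for d
    using that unfolding tensor2_null_def
    by (rule L.eq_0_on_span[rotated])
      (auto simp: L.diff add_left add_right scale_left scale_right)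
  with eq have "lin_ext scale f (t - u) = 0"
    by (simp add: tensor2_eq_def)
  then show ?thesis
    by (simp add: L.diff)
qed

section \<open>Algebras, coalgebras and Hopf algebras\<close>

locale k_algebra = vector_space scale
  for scale :: "'k::field \<Rightarrow> 'h::ring_1 \<Rightarrow> 'h" +
  assumes scale_mult_left: "scale c x * y = scale c (x * y)"
    and scale_mult_right: "x * scale c y = scale c (x * y)"
begin

definition left_ideal :: "'h set \<Rightarrow> bool" where
  "left_ideal I \<longleftrightarrow> subspace I \<and> (\<forall>h. \<forall>x\<in>I. h * x \<in> I)"

text \<open>The left regular module is completely reducible.\<close>

definition semisimple :: bool where
  "semisimple \<longleftrightarrow> (\<forall>I. left_ideal I \<longrightarrow>
     (\<exists>J. left_ideal J \<and> I \<inter> J = {0} \<and> (\<forall>h. \<exists>x\<in>I. \<exists>y\<in>J. h = x + y)))"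

end

text \<open>
  \<open>comult h\<close> is a formal sum of pairs \<open>(h\<^sub>1, h\<^sub>2)\<close> which represents the coproduct
  of \<open>h\<close>. Only its class in the tensor product matters: comultiplication is linear as a map
  into the tensor product, not as a map into formal sums.
\<close>

locale k_coalgebra = vector_space scale
  for scale :: "'k::field \<Rightarrow> 'h::ab_group_add \<Rightarrow> 'h" +
  fixes comult :: "'h \<Rightarrow> ('h \<times> 'h \<Rightarrow>\<^sub>0 'k)"
    and counit :: "'h \<Rightarrow> 'k"
  assumes comult_add: "tensor2_eq scale (comult (x + y)) (comult x + comult y)"
    and comult_scale: "tensor2_eq scale (comult (scale c x)) (free_scale c (comult x))"
    and counit_linear: "Vector_Spaces.linear scale (*) counit"
    and coassoc: "tensor3_eq scale
      (lin_ext free_scale (\<lambda>(x, y).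
         lin_ext free_scale (\<lambda>(a, b). Poly_Mapping.single (a, b, y) 1) (comult x)) (comult h))
      (lin_ext free_scale (\<lambda>(x, y).
         lin_ext free_scale (\<lambda>(a, b). Poly_Mapping.single (x, a, b) 1) (comult y)) (comult h))"
    and counit_left: "lin_ext scale (\<lambda>(x, y). scale (counit x) y) (comult h) = h"
    and counit_right: "lin_ext scale (\<lambda>(x, y). scale (counit y) x) (comult h) = h"

text \<open>The product of the tensor square of an algebra: \<open>(x \<otimes> y)(x' \<otimes> y') = xx' \<otimes> yy'\<close>.\<close>

definition tensor2_mult ::
    "('h::ring_1 \<times> 'h \<Rightarrow>\<^sub>0 'k::field) \<Rightarrow> ('h \<times> 'h \<Rightarrow>\<^sub>0 'k) \<Rightarrow> ('h \<times> 'h \<Rightarrow>\<^sub>0 'k)" where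
  "tensor2_mult t u =
     lin_ext free_scale (\<lambda>(x, y).
       lin_ext free_scale (\<lambda>(x', y'). Poly_Mapping.single (x * x', y * y') 1) u) t"

locale bialgebra = k_algebra scale + k_coalgebra scale comult counit
  for scale :: "'k::field \<Rightarrow> 'h::ring_1 \<Rightarrow> 'h"
    and comult :: "'h \<Rightarrow> ('h \<times> 'h \<Rightarrow>\<^sub>0 'k)"
    and counit :: "'h \<Rightarrow> 'k" +
  assumes comult_mult: "tensor2_eq scale (comult (x * y)) (tensor2_mult (comult x) (comult y))"
    and comult_one: "tensor2_eq scale (comult 1) (Poly_Mapping.single (1, 1) 1)"
    and counit_mult: "counit (x * y) = counit x * counit y"
    and counit_one: "counit 1 = 1"

locale hopf_algebra = bialgebra scale comult counit
  for scale :: "'k::field \<Rightarrow> 'h::ring_1 \<Rightarrow> 'h"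
    and comult :: "'h \<Rightarrow> ('h \<times> 'h \<Rightarrow>\<^sub>0 'k)"
    and counit :: "'h \<Rightarrow> 'k" +
  fixes antipode :: "'h \<Rightarrow> 'h"
  assumes antipode_linear: "Vector_Spaces.linear scale scale antipode"
    and antipode_left: "lin_ext scale (\<lambda>(x, y). antipode x * y) (comult h) = scale (counit h) 1"
    and antipode_right: "lin_ext scale (\<lambda>(x, y). x * antipode y) (comult h) = scale (counit h) 1"
begin

text \<open>
  The condition on \<open>comult\<close> says that the coproduct of \<open>a\<close> lies in the image of
  \<open>A \<otimes> A\<close>, i.e. can be written as a sum of pure tensors with both entries in \<open>A\<close>.
\<close>

definition hopf_subalgebra :: "'h set \<Rightarrow> bool" where
  "hopf_subalgebra A \<longleftrightarrow>
     subspace A \<and> 1 \<in> A \<and> (\<forall>x\<in>A. \<forall>y\<in>A. x * y \<in> A) \<and>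
     (\<forall>a\<in>A. \<exists>t. Poly_Mapping.keys t \<subseteq> A \<times> A \<and> tensor2_eq scale (comult a) t) \<and>
     (\<forall>a\<in>A. antipode a \<in> A)"

definition normal :: "'h set \<Rightarrow> bool" where
  "normal A \<longleftrightarrow>
     (\<forall>h. \<forall>a\<in>A. lin_ext scale (\<lambda>(x, y). x * a * antipode y) (comult h) \<in> A)"

definition proper :: "'h set \<Rightarrow> bool" where
  "proper A \<longleftrightarrow> A \<noteq> range (\<lambda>c. scale c 1) \<and> A \<noteq> UNIV"

definition simple :: bool where
  "simple \<longleftrightarrow> \<not> (\<exists>A. hopf_subalgebra A \<and> normal A \<and> proper A)"

end

end

theory Submission
 imports Defs "HOL-Analysis.Determinants" "HOL-Computational_Algebra.Fundamental_Theorem_Algebra"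
begin

text \<open>
 In a basis, \<open>H\<close> becomes \<open>k\<^sup>n\<close> with \<open>n = 56\<close>, and its comultiplication becomes the product \<open>cm\<close> of the
 dual. By Larson and Radford the dual is semisimple as well and the antipode is an involution, so the irreducible
 characters (the set \<open>IX\<close>) span a ring in which products decompose with multiplicities \<open>mu\<close> in \<open>nat\<close>, and the
 squares of the degrees of any subset closed under products and duals sum to a divisor of 56. Degree counts show
 that the group \<open>Gd\<close> of one-dimensional characters has order 4 or 8 with all other degrees even, or order 7 with a
 single further irreducible character, or order 28 or 56. The same holds for the dual.

 A group \<open>P\<close> of grouplike elements of \<open>H\<close> or of its dual with central average \<open>avg P\<close> yields a normal Hopf
 subalgebra: the span of \<open>P\<close>, respectively the elements fixed by translation by \<open>P\<close>. Orders 28 and 56 give such a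
 group at once, and for order 7 the fixed algebra of \<open>Gd\<close> turns out to be the same on both sides. In the remaining
 cases let \<open>z\<close> be a grouplike involution. The sum of the squares \<open>\<chi>(z)\<^sup>2\<close> over the irreducible characters divides
 56, and parity leaves the values 56, where \<open>z\<close> is central, and 8. If all these sums are 8, then many characters vanish at the involutions, and
 the ranks of suitable idempotents violate a divisibility.
\<close>

section \<open>Linear algebra in coordinates\<close>

text \<open>Most divisors of 56 arise in one way: if R in the dual satisfies R R = c R and takes the
  value 1 at the normalised integral, then left multiplication by the idempotent R / c has trace 56
  / c, and the trace of a projection is a natural number. Sums of squared degrees, orders of groups
  of one-dimensional characters and the sums of chi(z)^2 are such constants c. In the last case R is
  the sum of chi(z) chi. The regular character of the dual takes the value 56 / c at R / c, where z
  contributes 1, the other grouplike elements contribute 0 and the remaining characters even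
  numbers; so 56 / c is odd.

  The obstacle at the start is that k carries no conjugation and hence no positivity. That Tr S^2 is
  nonzero is therefore proved with complex roots of unity satisfying the same rational relations as
  those in k; afterwards the quantities to be bounded are integers.

  When one of the two groups has order 4, the contradiction is that rho(L) = 7 for an idempotent L,
  of which the trivial character contributes 1 and everything else a multiple of 4.\<close>

abbreviation ax :: "'n::finite \<Rightarrow> 'k::field^'n" where "ax i \<equiv> axis i 1"

text \<open>Identifies k^n with its dual space, so that H and its dual live on one type and a linear
  form is stored as the vector \<open>repf\<close> of its values on the basis.\<close>

definition dot :: "'k::field^'n::finite \<Rightarrow> 'k^'n \<Rightarrow> 'k" where
 "dot x y = (\<Sum>i\<in>UNIV. x$i * y$i)"

lemma dot_sym: "dot x y = dot y x" by (simp add: dot_def mult.commute)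
lemma dot_add [simp]: "dot (x + y) z = dot x z + dot y z" "dot z (x + y) = dot z x + dot z y"
 by (simp_all add: dot_def algebra_simps sum.distrib)
lemma dot_scale [simp]: "dot (c *s x) z = c * dot x z" "dot z (c *s x) = c * dot z x"
 by (simp_all add: dot_def algebra_simps sum_distrib_left)
lemma dot_0 [simp]: "dot 0 z = 0" "dot z 0 = 0" by (simp_all add: dot_def)
lemma dot_minus [simp]: "dot (- x) z = - dot x z" "dot z (- x) = - dot z x"
 by (simp_all add: dot_def sum_negf)
lemma dot_diff [simp]: "dot (x - y) z = dot x z - dot y z" "dot z (x - y) = dot z x - dot z y"
 by (simp_all add: dot_def algebra_simps sum_subtractf)
lemma dot_sum: "dot (\<Sum>i\<in>A. f i) z = (\<Sum>i\<in>A. dot (f i) z)" "dot z (\<Sum>i\<in>A. f i) = (\<Sum>i\<in>A. dot z (f i))"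
 by (induction A rule: infinite_finite_induct) simp_all
lemma dot_ax [simp]: "dot (ax i) x = x $ i" "dot x (ax i) = x $ i"
 by (simp_all add: dot_def axis_def if_distrib[of "\<lambda>t. t * _"] if_distrib[of "\<lambda>t. _ * t"] cong: if_cong)
lemma dot_eqI: "(\<And>f. dot f x = dot f y) \<Longrightarrow> x = y"
 by (metis dot_ax(1) vec_eq_iff)

lemma vec_expand: "(x::'k::field^'n::finite) = (\<Sum>i\<in>UNIV. (x$i) *s ax i)"
 by (rule dot_eqI) (simp add: dot_sum, simp add: dot_def mult.commute)

lemma sum_const_vec: "(\<Sum>a\<in>A. x) = of_nat (card A) *s (x :: 'k::field^'n::finite)"
 using vec.scale_sum_left[of "\<lambda>_. 1" A x] by simp

definition lin :: "('k::field^'n::finite \<Rightarrow> 'k^'m::finite) \<Rightarrow> bool" where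
 "lin F \<longleftrightarrow> (\<forall>x y. F (x + y) = F x + F y) \<and> (\<forall>c x. F (c *s x) = c *s F x)"
definition linf :: "('k::field^'n::finite \<Rightarrow> 'k) \<Rightarrow> bool" where
 "linf F \<longleftrightarrow> (\<forall>x y. F (x + y) = F x + F y) \<and> (\<forall>c x. F (c *s x) = c * F x)"
definition blin :: "('k::field^'n::finite \<Rightarrow> 'k^'n \<Rightarrow> 'k) \<Rightarrow> bool" where
 "blin F \<longleftrightarrow> (\<forall>x. linf (F x)) \<and> (\<forall>y. linf (\<lambda>x. F x y))"
definition tlin :: "('k::field^'n::finite \<Rightarrow> 'k^'n \<Rightarrow> 'k^'n \<Rightarrow> 'k) \<Rightarrow> bool" where
 "tlin F \<longleftrightarrow> (\<forall>x. blin (F x)) \<and> (\<forall>y z. linf (\<lambda>x. F x y z))"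

lemma linD: "lin F \<Longrightarrow> F (x + y) = F x + F y" "lin F \<Longrightarrow> F (c *s x) = c *s F x"
 by (simp_all add: lin_def)
lemma linfD: "linf F \<Longrightarrow> F (x + y) = F x + F y" "linf F \<Longrightarrow> F (c *s x) = c * F x"
 by (simp_all add: linf_def)
lemma lin_0: "lin F \<Longrightarrow> F 0 = 0"
 using linD(2)[of F 0 0] by simp
lemma linf_0: "linf F \<Longrightarrow> F 0 = 0"
 using linfD(2)[of F 0 0] by simp
lemma lin_sum: assumes "lin F" shows "F (\<Sum>i\<in>A. g i) = (\<Sum>i\<in>A. F (g i))"
 by (induction A rule: infinite_finite_induct) (simp_all add: lin_0 assms linD)
lemma linf_sum: assumes "linf F" shows "F (\<Sum>i\<in>A. g i) = (\<Sum>i\<in>A. F (g i))"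
 by (induction A rule: infinite_finite_induct) (simp_all add: linf_0 assms linfD)
lemma lin_minus: "lin F \<Longrightarrow> F (- x) = - F x"
 using linD(2)[of F "-1" x] by simp
lemma lin_diff: "lin F \<Longrightarrow> F (x - y) = F x - F y"
 using linD(1)[of F x "-y"] by (simp add: lin_minus)
lemma linf_minus: "linf F \<Longrightarrow> F (- x) = - F x"
 using linfD(2)[of F "-1" x] by simp
lemma linf_diff: "linf F \<Longrightarrow> F (x - y) = F x - F y"
 using linfD(1)[of F x "-y"] by (simp add: linf_minus)
lemma lin_expand: "lin F \<Longrightarrow> F x = (\<Sum>i\<in>UNIV. (x$i) *s F (ax i))"
 using arg_cong[OF vec_expand[of x], of F] by (simp add: lin_sum linD)
lemma linf_expand: "linf F \<Longrightarrow> F x = (\<Sum>i\<in>UNIV. (x$i) * F (ax i))"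
 using arg_cong[OF vec_expand[of x], of F] by (simp add: linf_sum linfD)

lemma lin_id: "lin (\<lambda>x. x)" by (simp add: lin_def)
lemma lin_comp: "lin F \<Longrightarrow> lin G \<Longrightarrow> lin (\<lambda>x. F (G x))" by (simp add: lin_def)
lemma linf_comp: "linf F \<Longrightarrow> lin G \<Longrightarrow> linf (\<lambda>x. F (G x))" by (simp add: lin_def linf_def)
lemma linf_dot: "linf (dot f)" "linf (\<lambda>x. dot x f)" by (simp_all add: linf_def)
lemma linf_dot_comp: "lin F \<Longrightarrow> linf (\<lambda>x. dot f (F x))" by (simp add: lin_def linf_def)

definition repf :: "('k::field^'n::finite \<Rightarrow> 'k) \<Rightarrow> 'k^'n" where "repf F = (\<chi> i. F (ax i))"
lemma dot_repf: "linf F \<Longrightarrow> dot (repf F) x = F x"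
 by (subst linf_expand[of F x]) (simp_all add: dot_def repf_def mult.commute)

text \<open>The transpose of F with respect to \<open>dot\<close>.\<close>

definition adj :: "('k::field^'n::finite \<Rightarrow> 'k^'n) \<Rightarrow> 'k^'n \<Rightarrow> 'k^'n" where
 "adj F f = repf (\<lambda>x. dot f (F x))"
lemma dot_adj: "lin F \<Longrightarrow> dot (adj F f) x = dot f (F x)"
 by (simp add: adj_def dot_repf linf_dot_comp)
lemma lin_adj: "lin F \<Longrightarrow> lin (adj F)"
 unfolding lin_def by (auto intro!: vec_eq_iff[THEN iffD2] simp: adj_def repf_def lin_def)
lemma adj_adj: "lin F \<Longrightarrow> adj (adj F) = F"
 by (rule ext, rule dot_eqI) (metis dot_adj dot_sym lin_adj)

section \<open>Traces and idempotent matrices\<close>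

definition tr :: "('k::field^'n::finite \<Rightarrow> 'k^'n) \<Rightarrow> 'k" where "tr F = (\<Sum>i\<in>UNIV. F (ax i) $ i)"

lemma tr_comm: assumes "lin F" "lin G" shows "tr (\<lambda>x. F (G x)) = tr (\<lambda>x. G (F x))"
proof -
 have "tr (\<lambda>x. F (G x)) = (\<Sum>i\<in>UNIV. \<Sum>j\<in>UNIV. G (ax i) $ j * F (ax j) $ i)"
  unfolding tr_def by (subst lin_expand[OF assms(1)]) (simp add: sum_component)
 moreover have "tr (\<lambda>x. G (F x)) = (\<Sum>i\<in>UNIV. \<Sum>j\<in>UNIV. F (ax i) $ j * G (ax j) $ i)"
  unfolding tr_def by (subst lin_expand[OF assms(2)]) (simp add: sum_component)
 moreover have "(\<Sum>i\<in>UNIV. \<Sum>j\<in>UNIV. G (ax i) $ j * F (ax j) $ i) = (\<Sum>i\<in>UNIV. \<Sum>j\<in>UNIV. F (ax i) $ j * G (ax j) $ i)"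
  by (subst sum.swap) (simp add: mult.commute)
 ultimately show ?thesis by simp
qed
lemma tr_add: "tr (\<lambda>x. F x + G x) = tr F + tr G" by (simp add: tr_def sum.distrib)
lemma tr_scale: "tr (\<lambda>x. c *s F x) = c * tr F" by (simp add: tr_def sum_distrib_left)
lemma tr_sum: "tr (\<lambda>x. \<Sum>i\<in>A. F i x) = (\<Sum>i\<in>A. tr (F i))"
 by (simp add: tr_def sum_component) (rule sum.swap)
lemma tr_id: "tr (\<lambda>x. x :: 'k::field^'n) = of_nat CARD('n::finite)" by (simp add: tr_def)
lemma tr_rank1: "linf g \<Longrightarrow> tr (\<lambda>x. g x *s v) = g v"
 by (subst (2) linf_expand) (auto simp: tr_def mult.commute)
lemma tr_adj: "lin F \<Longrightarrow> tr (adj F) = tr F"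
 unfolding tr_def by (rule sum.cong[OF refl]) (metis dot_adj dot_ax(1) dot_ax(2))
lemma tr_expand: assumes "lin F" "\<And>x. x = (\<Sum>a\<in>A. dot (f a) x *s e a)"
 shows "tr F = (\<Sum>a\<in>A. dot (f a) (F (e a)))"
proof -
 have "tr F = tr (\<lambda>x. \<Sum>a\<in>A. dot (f a) x *s F (e a))"
  by (rule arg_cong[of _ _ tr], rule ext) (subst assms(2), simp add: lin_sum[OF assms(1)] linD[OF assms(1)])
 also have "\<dots> = (\<Sum>a\<in>A. dot (f a) (F (e a)))"
  by (simp add: tr_sum tr_rank1 linf_dot)
 finally show ?thesis .
qed

text \<open>Stated for an indexed family, in which a repetition is itself a dependence; this is why
  injectivity is treated separately.\<close>

lemma fam_dep:
 fixes v :: "nat \<Rightarrow> 'k::field^'n::finite"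
 shows "\<exists>u. (\<exists>i\<le>CARD('n). u i \<noteq> 0) \<and> (\<Sum>i\<le>CARD('n). u i *s v i) = 0"
proof (cases "inj_on v {..CARD('n)}")
 case True
 have "\<not> vec.independent (v ` {..CARD('n)})"
 proof
  assume "vec.independent (v ` {..CARD('n)})"
  then have "card (v ` {..CARD('n)}) \<le> CARD('n)" using vec.independent_card_le_dim[of "v ` {..CARD('n)}" UNIV]
   by (simp add: vec.dim_UNIV card_cart_basis)
  then show False by (simp add: card_image[OF True])
 qed
 then obtain u where u: "\<exists>x\<in>v ` {..CARD('n)}. u x \<noteq> 0" "(\<Sum>x\<in>v ` {..CARD('n)}. u x *s x) = 0"
  using vec.dependent_finite[of "v ` {..CARD('n)}"] by auto
 have "(\<Sum>i\<le>CARD('n). u (v i) *s v i) = 0" using u(2) by (simp add: sum.reindex[OF True])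
 with u(1) show ?thesis by (intro exI[of _ "u \<circ> v"]) auto
next
 case False
 then obtain i j where ij: "i \<le> CARD('n)" "j \<le> CARD('n)" "i \<noteq> j" "v i = v j" by (auto simp: inj_on_def)
 let ?u = "\<lambda>t. if t = i then 1 else if t = j then -1 else (0::'k)"
 have "(\<Sum>t\<le>CARD('n). ?u t *s v t) = (\<Sum>t\<le>CARD('n). (if t = i then v i else 0) + (if t = j then - v i else 0))"
  by (rule sum.cong) (use ij in auto)
 also have "\<dots> = 0" using ij by (simp add: sum.distrib)
 finally show ?thesis using ij by (intro exI[of _ ?u]) auto
qed
text \<open>Pairing a linear relation among the \<open>e j\<close> with \<open>w i\<close> isolates
  its i-th coefficient. Families of orthogonal idempotents and of grouplike elements are bounded in
  this way.\<close>

lemma biorth_bound: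
 fixes w e :: "nat \<Rightarrow> 'k::field^'n::finite"
 assumes "\<And>i j. i < m \<Longrightarrow> j < m \<Longrightarrow> (\<Sum>a\<in>UNIV. w i $ a * e j $ a) = (if i = j then 1 else 0)"
 shows "m \<le> CARD('n)"
proof (rule ccontr)
 assume m: "\<not> ?thesis"
 obtain u where u: "\<exists>i\<le>CARD('n). u i \<noteq> 0" "(\<Sum>i\<le>CARD('n). u i *s e i) = 0" using fam_dep by blast
 have "u i = 0" if i: "i \<le> CARD('n)" for i
 proof -
  have "(\<Sum>a\<in>UNIV. w i $ a * (\<Sum>j\<le>CARD('n). u j *s e j) $ a) = (\<Sum>j\<le>CARD('n). u j * (\<Sum>a\<in>UNIV. w i $ a * e j $ a))"
   by (simp add: sum_distrib_left mult.left_commute, subst sum.swap, simp)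
  also have "\<dots> = (\<Sum>j\<le>CARD('n). if i = j then u j else 0)"
   by (rule sum.cong) (use m i assms in auto)
  finally show ?thesis using u(2) i by simp
 qed
 with u(1) show False by blast
qed
text \<open>Deflation takes the place of diagonalisation: subtracting the rank-one matrix formed
  from column b and row a keeps M idempotent, lowers the trace by one and clears row a, so the
  number of nonzero rows drops. The clause for r = 0 lets trace zero detect the zero matrix in
  characteristic zero.\<close>

lemma idem_trace:
 fixes M :: "'a \<Rightarrow> 'a \<Rightarrow> 'k::field"
 assumes fin: "finite A" and id: "\<And>a b. a \<in> A \<Longrightarrow> b \<in> A \<Longrightarrow> (\<Sum>c\<in>A. M a c * M c b) = M a b"
 shows "\<exists>r\<le>card A. (\<Sum>a\<in>A. M a a) = of_nat r \<and> (r = 0 \<longrightarrow> (\<forall>a\<in>A. \<forall>b\<in>A. M a b = 0))"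
proof -
 define N where "N M = {a \<in> A. \<exists>b\<in>A. M a b \<noteq> 0}" for M :: "'a \<Rightarrow> 'a \<Rightarrow> 'k"
 have "\<exists>r\<le>card (N M). (\<Sum>a\<in>A. M a a) = of_nat r \<and> (r = 0 \<longrightarrow> N M = {})"
  using id
 proof (induction "card (N M)" arbitrary: M rule: less_induct)
  case less
  show ?case
  proof (cases "N M = {}")
   case True
   then show ?thesis by (auto simp: N_def)
  next
   case False
   then obtain a b where ab: "a \<in> A" "b \<in> A" "M a b \<noteq> 0" by (auto simp: N_def)
   define Q where "Q x y = M x y - M x b * M a y / M a b" for x y
   have "N Q \<subseteq> N M" "a \<in> N M" "a \<notin> N Q"
    using ab by (auto simp: N_def Q_def) (metis div_0 mult_zero_left)
   then have "N Q \<subset> N M" by blast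
   then have lt: "card (N Q) < card (N M)" by (intro psubset_card_mono) (auto simp: N_def fin)
   have "(\<Sum>c\<in>A. Q x c * Q c y) = (\<Sum>c\<in>A. M x c * M c y) - (\<Sum>c\<in>A. M x c * M c b) * M a y / M a b
     - M x b / M a b * (\<Sum>c\<in>A. M a c * M c y) + M x b * M a y * (\<Sum>c\<in>A. M a c * M c b) / (M a b * M a b)" for x y
    unfolding Q_def sum_distrib_left sum_distrib_right sum_divide_distrib sum.distrib[symmetric] sum_subtractf[symmetric]
    by (rule sum.cong) (use ab in \<open>auto simp: field_simps\<close>)
   then have "(\<Sum>c\<in>A. Q x c * Q c y) = Q x y" if "x \<in> A" "y \<in> A" for x y
    using ab that by (simp add: less.prems Q_def)
   from less.hyps[OF lt this] obtain r where r: "r \<le> card (N Q)" "(\<Sum>a\<in>A. Q a a) = of_nat r" by blast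
   have "(\<Sum>c\<in>A. M a c * M c b) / M a b = 1" using ab less.prems by simp
   then have "(\<Sum>x\<in>A. M x x) = of_nat (Suc r)"
    using r(2) by (simp add: Q_def sum_subtractf sum_divide_distrib mult.commute diff_eq_eq add.commute)
   then show ?thesis using r(1) lt by (intro exI[of _ "Suc r"]) auto
  qed
 qed
 moreover have "card (N M) \<le> card A" by (intro card_mono) (auto simp: N_def fin)
 moreover have "N M = {} \<Longrightarrow> \<forall>a\<in>A. \<forall>b\<in>A. M a b = 0" by (auto simp: N_def)
 ultimately show ?thesis by (meson le_trans)
qed

lemma tr_idem:
 fixes F :: "'k::field^'n::finite \<Rightarrow> 'k^'n"
 assumes "lin F" "\<And>x. F (F x) = F x"
 shows "\<exists>r\<le>CARD('n). tr F = of_nat r"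
proof -
 have "(\<Sum>c\<in>UNIV. F (ax c) $ a * F (ax b) $ c) = F (ax b) $ a" for a b
 proof -
  have "F (F (ax b)) $ a = (\<Sum>c\<in>UNIV. F (ax b) $ c * F (ax c) $ a)"
   by (subst lin_expand[OF assms(1)]) (simp add: sum_component)
  then show ?thesis by (simp add: assms(2) mult.commute)
 qed
 from idem_trace[of "UNIV::'n set" "\<lambda>a b. F (ax b) $ a", OF finite this]
 show ?thesis unfolding tr_def by blast
qed

section \<open>Sweedler sums in coordinates\<close>

named_theorems lins

definition bop :: "('k::field^'n::finite \<Rightarrow> 'k^'n \<Rightarrow> 'k^'n) \<Rightarrow> bool" where
 "bop m \<longleftrightarrow> (\<forall>x. lin (m x)) \<and> (\<forall>y. lin (\<lambda>x. m x y))"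

text \<open>If \<open>m\<close> is the product of the dual, this is the Sweedler sum of \<open>F(x\<^sub>1, x\<^sub>2)\<close>.\<close>

definition sw :: "('k::field^'n::finite \<Rightarrow> 'k^'n \<Rightarrow> 'k^'n) \<Rightarrow> 'k^'n \<Rightarrow> ('k^'n \<Rightarrow> 'k^'n \<Rightarrow> 'k) \<Rightarrow> 'k" where
 "sw m x F = (\<Sum>i\<in>UNIV. \<Sum>j\<in>UNIV. dot (m (ax i) (ax j)) x * F (ax i) (ax j))"

lemma blinI [lins]: "(\<And>x. linf (\<lambda>y. F x y)) \<Longrightarrow> (\<And>y. linf (\<lambda>x. F x y)) \<Longrightarrow> blin F"
 by (simp add: blin_def)
lemma tlinI [lins]: "(\<And>x y. linf (\<lambda>z. F x y z)) \<Longrightarrow> (\<And>x z. linf (\<lambda>y. F x y z)) \<Longrightarrow> (\<And>y z. linf (\<lambda>x. F x y z)) \<Longrightarrow> tlin F"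
 by (simp add: tlin_def blin_def)
lemma bopI: "(\<And>x. lin (\<lambda>y. m x y)) \<Longrightarrow> (\<And>y. lin (\<lambda>x. m x y)) \<Longrightarrow> bop m"
 by (simp add: bop_def)
lemma blinD: "blin F \<Longrightarrow> linf (F x)" "blin F \<Longrightarrow> linf (\<lambda>x. F x y)" by (simp_all add: blin_def)
lemma tlinD: "tlin F \<Longrightarrow> linf (F x y)" "tlin F \<Longrightarrow> linf (\<lambda>y. F x y z)" "tlin F \<Longrightarrow> linf (\<lambda>x. F x y z)"
 by (simp_all add: tlin_def blin_def)

lemma linf_dot1 [lins]: "lin H \<Longrightarrow> linf (\<lambda>x. dot f (H x))" by (rule linf_dot_comp)
lemma linf_dot2 [lins]: "lin H \<Longrightarrow> linf (\<lambda>x. dot (H x) f)" by (simp add: lin_def linf_def)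
lemma linf_mult1 [lins]: "linf A \<Longrightarrow> linf (\<lambda>x. A x * c)" by (simp add: linf_def algebra_simps)
lemma linf_mult2 [lins]: "linf A \<Longrightarrow> linf (\<lambda>x. c * A x)" by (simp add: linf_def algebra_simps)
lemma linf_plus [lins]: "linf A \<Longrightarrow> linf B \<Longrightarrow> linf (\<lambda>x. A x + B x)" by (simp add: linf_def algebra_simps)
lemma linf_minus' [lins]: "linf A \<Longrightarrow> linf B \<Longrightarrow> linf (\<lambda>x. A x - B x)" by (simp add: linf_def algebra_simps)
lemma linf_sum' [lins]: "(\<And>i. linf (A i)) \<Longrightarrow> linf (\<lambda>x. \<Sum>i\<in>I. A i x)"
 by (simp add: linf_def sum.distrib sum_distrib_left)
lemma lin_id' [lins]: "lin (\<lambda>x. x)" by (rule lin_id)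
lemma lin_plus [lins]: "lin A \<Longrightarrow> lin B \<Longrightarrow> lin (\<lambda>x. A x + B x)" by (simp add: lin_def algebra_simps vec.scale_right_distrib)
lemma lin_minus' [lins]: "lin A \<Longrightarrow> lin B \<Longrightarrow> lin (\<lambda>x. A x - B x)" by (simp add: lin_def algebra_simps vec.scale_right_diff_distrib)
lemma lin_scale1 [lins]: "lin A \<Longrightarrow> lin (\<lambda>x. c *s A x)" by (simp add: lin_def vec.scale_right_distrib vec.scale_left_commute)
lemma lin_scale2 [lins]: "linf A \<Longrightarrow> lin (\<lambda>x. A x *s v)" by (simp add: lin_def linf_def vec.scale_left_distrib)
lemma lin_sum' [lins]: "(\<And>i. lin (A i)) \<Longrightarrow> lin (\<lambda>x. \<Sum>i\<in>I. A i x)"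
 by (simp add: lin_def sum.distrib vec.scale_sum_right)
lemma lin_adj' [lins]: "lin F \<Longrightarrow> lin H \<Longrightarrow> lin (\<lambda>x. adj F (H x))"
 by (simp add: lin_adj lin_comp)

lemma linf_sw1 [lins]: "lin H \<Longrightarrow> linf (\<lambda>x. sw m (H x) F)"
 unfolding sw_def by (intro lins)
lemma linf_sw2 [lins]: "(\<And>a b. linf (\<lambda>x. G x a b)) \<Longrightarrow> linf (\<lambda>x. sw m y (\<lambda>a b. G x a b))"
 unfolding sw_def by (intro lins)

lemma sw_mult: "sw m x (\<lambda>a b. c * F a b) = c * sw m x F" "sw m x (\<lambda>a b. F a b * c) = sw m x F * c"
 by (simp_all add: sw_def sum_distrib_left sum_distrib_right mult.left_commute mult.assoc)
lemma sw_sum: "sw m x (\<lambda>a b. \<Sum>i\<in>I. F i a b) = (\<Sum>i\<in>I. sw m x (F i))"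
proof -
 have "sw m x (\<lambda>a b. \<Sum>i\<in>I. F i a b) = (\<Sum>a\<in>UNIV. \<Sum>b\<in>UNIV. \<Sum>i\<in>I. dot (m (ax a) (ax b)) x * F i (ax a) (ax b))"
  by (simp add: sw_def sum_distrib_left)
 also have "\<dots> = (\<Sum>a\<in>UNIV. \<Sum>i\<in>I. \<Sum>b\<in>UNIV. dot (m (ax a) (ax b)) x * F i (ax a) (ax b))"
  by (intro sum.cong refl sum.swap)
 also have "\<dots> = (\<Sum>i\<in>I. sw m x (F i))" unfolding sw_def by (rule sum.swap)
 finally show ?thesis .
qed
lemma sw_plus: "sw m x (\<lambda>a b. F a b + G a b) = sw m x F + sw m x G"
 by (simp add: sw_def sum.distrib distrib_left)
lemma sw_diff: "sw m x (\<lambda>a b. F a b - G a b) = sw m x F - sw m x G"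
 by (simp add: sw_def sum_subtractf right_diff_distrib)
lemma sw_swap: "sw m x (\<lambda>a b. sw m' y (\<lambda>c d. F a b c d)) = sw m' y (\<lambda>c d. sw m x (\<lambda>a b. F a b c d))"
 unfolding sw_def[of m' y] by (simp add: sw_sum sw_mult)
text \<open>Reduces Sweedler identities to the case of a product of linear forms, where
  \<open>sw_dot\<close> turns the sum into a product in the dual algebra.\<close>

lemma blin_expand: assumes "blin F"
 shows "F a b = (\<Sum>i\<in>UNIV. \<Sum>j\<in>UNIV. F (ax i) (ax j) * (dot (ax i) a * dot (ax j) b))"
proof -
 have "F a b = (\<Sum>i\<in>UNIV. a$i * F (ax i) b)" by (rule linf_expand[OF blinD(2)[OF assms]])
 also have "\<dots> = (\<Sum>i\<in>UNIV. a$i * (\<Sum>j\<in>UNIV. b$j * F (ax i) (ax j)))"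
  by (intro sum.cong refl arg_cong2[of _ _ _ _ "(*)"] linf_expand blinD(1)[OF assms])
 finally show ?thesis by (simp add: sum_distrib_left mult_ac)
qed
lemma blin_ex: assumes "blin F"
 obtains c where "F = (\<lambda>a b. \<Sum>i\<in>UNIV. \<Sum>j\<in>UNIV. c i j * (dot (ax i) a * dot (ax j) b))"
 by (rule that[of "\<lambda>i j. F (ax i) (ax j)"], intro ext, rule blin_expand[OF assms])
lemma tlin_expand: assumes "tlin F"
 shows "F a b c = (\<Sum>i\<in>UNIV. \<Sum>j\<in>UNIV. \<Sum>k\<in>UNIV. F (ax i) (ax j) (ax k) * (dot (ax i) a * (dot (ax j) b * dot (ax k) c)))"
proof -
 have "F a b c = (\<Sum>i\<in>UNIV. a$i * F (ax i) b c)" by (rule linf_expand[OF tlinD(3)[OF assms]])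
 also have "\<dots> = (\<Sum>i\<in>UNIV. a$i * (\<Sum>j\<in>UNIV. \<Sum>k\<in>UNIV. F (ax i) (ax j) (ax k) * (dot (ax j) b * dot (ax k) c)))"
  by (intro sum.cong refl arg_cong2[of _ _ _ _ "(*)"] blin_expand) (use assms in \<open>simp add: tlin_def\<close>)
 finally show ?thesis by (simp add: sum_distrib_left mult_ac)
qed

lemma sw_dot: assumes "bop m" shows "sw m x (\<lambda>a b. dot f a * dot g b) = dot (m f g) x"
proof -
 have b: "blin (\<lambda>f g. dot (m f g) x)" using assms by (auto simp: bop_def blin_def intro: lins)
 show ?thesis by (subst blin_expand[OF b]) (simp add: sw_def mult.commute)
qed

lemma sw_coassoc_gen:
 assumes "bop m" "\<And>f g h. m (m f g) h = m f (m g h)" "tlin F"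
 shows "sw m x (\<lambda>u c. sw m u (\<lambda>a b. F a b c)) = sw m x (\<lambda>a u. sw m u (\<lambda>b c. F a b c))"
 apply (subst (1 2) tlin_expand[OF assms(3)])
 apply (simp only: sw_sum sw_mult)
 apply (intro sum.cong refl arg_cong2[of _ _ _ _ "(*)"])
 apply (simp only: sw_mult sw_dot[OF assms(1)] mult.assoc[symmetric])
 apply (simp only: sw_mult sw_dot[OF assms(1)] mult.assoc assms(2))
 done

text \<open>The comultiplication is stored as its transpose \<open>cm\<close>, the product of the
  dual. The axioms become symmetric under exchange of (\<open>mul\<close>, \<open>one\<close>) with
  (\<open>cm\<close>, \<open>eps\<close>) and transposition of S, so every result about H is at once
  a result about its dual.\<close>

locale hopf =
 fixes mul cm :: "'k::field^'n::finite \<Rightarrow> 'k^'n \<Rightarrow> 'k^'n" and one eps :: "'k^'n" and S :: "'k^'n \<Rightarrow> 'k^'n"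
 assumes bop_mul: "bop mul" and bop_cm: "bop cm" and lin_S: "lin S"
  and mul_assoc: "mul (mul x y) z = mul x (mul y z)"
  and mul_one [simp]: "mul one x = x" "mul x one = x"
  and cm_assoc: "cm (cm x y) z = cm x (cm y z)"
  and cm_eps [simp]: "cm eps x = x" "cm x eps = x"
  and compat: "dot (cm f g) (mul x y) =
    sw cm x (\<lambda>a b. sw cm y (\<lambda>c d. dot f (mul a c) * dot g (mul b d)))"
  and eps_mul: "dot eps (mul x y) = dot eps x * dot eps y"
  and one_cm: "dot (cm f g) one = dot f one * dot g one"
  and eps_one [simp]: "dot eps one = 1"
  and antil: "sw cm x (\<lambda>a b. dot f (mul (S a) b)) = dot eps x * dot f one"
  and antir: "sw cm x (\<lambda>a b. dot f (mul a (S b))) = dot eps x * dot f one"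
begin

lemma lin_S' [lins]: "lin H \<Longrightarrow> lin (\<lambda>x. S (H x))" by (rule lin_comp[OF lin_S])
lemma lin_mul1 [lins]: "lin H \<Longrightarrow> lin (\<lambda>x. mul (H x) c)"
 using bop_mul lin_comp[of "\<lambda>x. mul x c" H] by (auto simp: bop_def)
lemma lin_mul2 [lins]: "lin H \<Longrightarrow> lin (\<lambda>x. mul c (H x))"
 using bop_mul lin_comp[of "\<lambda>x. mul c x" H] by (auto simp: bop_def)
lemma lin_cm1 [lins]: "lin H \<Longrightarrow> lin (\<lambda>x. cm (H x) c)"
 using bop_cm lin_comp[of "\<lambda>x. cm x c" H] by (auto simp: bop_def)
lemma lin_cm2 [lins]: "lin H \<Longrightarrow> lin (\<lambda>x. cm c (H x))"
 using bop_cm lin_comp[of "\<lambda>x. cm c x" H] by (auto simp: bop_def)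

lemmas sw_coassoc = sw_coassoc_gen[OF bop_cm cm_assoc]
lemmas sw_cm = sw_dot[OF bop_cm]

lemma sw_counitl: "linf f \<Longrightarrow> sw cm x (\<lambda>a b. dot eps a * f b) = f x"
 using sw_cm[of x eps "repf f"] by (simp add: dot_repf)
lemma sw_counitr: "linf f \<Longrightarrow> sw cm x (\<lambda>a b. dot eps b * f a) = f x"
 using sw_cm[of x "repf f" eps] by (simp add: dot_repf mult.commute)
lemma sw_antil: "linf f \<Longrightarrow> sw cm x (\<lambda>a b. f (mul (S a) b)) = dot eps x * f one"
 using antil[of x "repf f"] by (simp add: dot_repf)
lemma sw_antir: "linf f \<Longrightarrow> sw cm x (\<lambda>a b. f (mul a (S b))) = dot eps x * f one"
 using antir[of x "repf f"] by (simp add: dot_repf)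
lemma sw_one: assumes "blin F" shows "sw cm one F = F one one"
proof -
 obtain c where c: "F = (\<lambda>a b. \<Sum>i\<in>UNIV. \<Sum>j\<in>UNIV. c i j * (dot (ax i) a * dot (ax j) b))"
  using blin_ex[OF assms] by blast
 show ?thesis by (simp only: c sw_sum sw_mult sw_cm one_cm)
qed
lemma sw_mul: assumes "blin F"
 shows "sw cm (mul x y) F = sw cm x (\<lambda>a b. sw cm y (\<lambda>c d. F (mul a c) (mul b d)))"
proof -
 obtain c where c: "F = (\<lambda>a b. \<Sum>i\<in>UNIV. \<Sum>j\<in>UNIV. c i j * (dot (ax i) a * dot (ax j) b))"
  using blin_ex[OF assms] by blast
 show ?thesis by (simp only: c sw_sum sw_mult sw_cm compat)
qed

text \<open>Both sides are convolution inverses of the product. The chain inserts x_2 y_2 S(x_3 y_3)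
  behind S(y_1) S(x_1) and cancels from the inside, first S(x_1) x_2 and then S(y_1) y_2.\<close>

lemma S_mul: "S (mul x y) = mul (S y) (S x)"
proof (rule dot_eqI)
 fix f
 have r: "sw cm z (\<lambda>p q. dot f (mul W (mul p (S q)))) = dot eps z * dot f W" for z W
  using sw_antir[of "\<lambda>t. dot f (mul W t)" z] by (simp add: lins)
 have l: "sw cm z (\<lambda>p q. dot f (mul W (mul (mul (S p) q) U))) = dot eps z * dot f (mul W U)" for z W U
  using sw_antil[of "\<lambda>t. dot f (mul W (mul t U))" z] by (simp add: lins)
 have l': "sw cm z (\<lambda>p q. dot f (mul (mul (S p) q) U)) = dot eps z * dot f U" for z U
  using sw_antil[of "\<lambda>t. dot f (mul t U)" z] by (simp add: lins)
 have "dot f (mul (S y) (S x)) = sw cm x (\<lambda>x1 x2. dot eps x2 * sw cm y (\<lambda>y1 y2. dot eps y2 * dot f (mul (S y1) (S x1))))"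
  by (subst sw_counitr, intro lins, subst sw_counitr, intro lins, rule refl)
 also have "\<dots> = sw cm x (\<lambda>x1 x2. sw cm y (\<lambda>y1 y2. sw cm (mul x2 y2) (\<lambda>p q. dot f (mul (mul (S y1) (S x1)) (mul p (S q))))))"
  by (simp only: r eps_mul sw_mult[symmetric] mult.assoc)
 also have "\<dots> = sw cm x (\<lambda>x1 x2. sw cm y (\<lambda>y1 y2. sw cm x2 (\<lambda>a b. sw cm y2 (\<lambda>c d.
   dot f (mul (mul (S y1) (S x1)) (mul (mul a c) (S (mul b d))))))))"
  by (subst sw_mul, intro lins, rule refl)
 also have "\<dots> = sw cm x (\<lambda>x1 x2. sw cm x2 (\<lambda>a b. sw cm y (\<lambda>y1 y2. sw cm y2 (\<lambda>c d.
   dot f (mul (mul (S y1) (S x1)) (mul (mul a c) (S (mul b d))))))))"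
  by (subst (2) sw_swap) (rule refl)
 also have "\<dots> = sw cm x (\<lambda>x1 x2. sw cm x2 (\<lambda>a b. sw cm y (\<lambda>v d. sw cm v (\<lambda>y1 c.
   dot f (mul (mul (S y1) (S x1)) (mul (mul a c) (S (mul b d))))))))"
  by (subst sw_coassoc[of "\<lambda>y1 c d. dot f (mul (mul (S y1) (S _)) (mul (mul _ c) (S (mul _ d))))"], intro lins) (rule refl)
 also have "\<dots> = sw cm x (\<lambda>u b. sw cm u (\<lambda>x1 a. sw cm y (\<lambda>v d. sw cm v (\<lambda>y1 c.
   dot f (mul (mul (S y1) (S x1)) (mul (mul a c) (S (mul b d))))))))"
  by (rule sw_coassoc[symmetric], intro lins)
 also have "\<dots> = sw cm x (\<lambda>u b. sw cm y (\<lambda>v d. sw cm v (\<lambda>y1 c. sw cm u (\<lambda>x1 a.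
   dot f (mul (S y1) (mul (mul (S x1) a) (mul c (S (mul b d)))))))))"
  by (subst (2) sw_swap, subst (3) sw_swap) (simp add: mul_assoc)
 also have "\<dots> = sw cm x (\<lambda>u b. sw cm y (\<lambda>v d. sw cm v (\<lambda>y1 c. dot eps u * dot f (mul (mul (S y1) c) (S (mul b d))))))"
  by (simp only: l) (simp only: mul_assoc)
 also have "\<dots> = sw cm x (\<lambda>u b. dot eps u * sw cm y (\<lambda>v d. dot eps v * dot f (S (mul b d))))"
  by (simp only: sw_mult l')
 also have "\<dots> = dot f (S (mul x y))"
  by (subst (2) sw_counitl, intro lins, subst sw_counitl, intro lins, rule refl)
 finally show "dot f (S (mul x y)) = dot f (mul (S y) (S x))" by simp
qed

lemma S_one [simp]: "S one = one"
proof (rule dot_eqI)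
 fix f
 have "blin (\<lambda>a b. dot f (mul (S a) b))" by (intro lins)
 from sw_one[OF this] antil[of one f] show "dot f (S one) = dot f one" by simp
qed

text \<open>The compatibility law turns into itself after exchanging the two middle summation
  indices, and each antipode law turns into the same law tested in the other variable.\<close>

lemma hopf_dual: "hopf cm mul eps one (adj S)"
proof
 show "dot (mul x y) (cm f g) = sw mul f (\<lambda>a b. sw mul g (\<lambda>c d. dot x (cm a c) * dot y (cm b d)))" for f g x y
 proof -
  have "dot (mul x y) (cm f g) = sw cm x (\<lambda>a b. sw cm y (\<lambda>c d. dot f (mul a c) * dot g (mul b d)))"
   by (simp add: compat dot_sym[of "mul x y"])
  also have "\<dots> = (\<Sum>i\<in>UNIV. \<Sum>j\<in>UNIV. \<Sum>k\<in>UNIV. \<Sum>l\<in>UNIV. dot (mul (ax i) (ax k)) f * (dot (mul (ax j) (ax l)) g * (dot x (cm (ax i) (ax j)) * dot y (cm (ax k) (ax l)))))"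
   unfolding sw_def by (simp only: sum_distrib_left dot_sym mult.assoc mult.commute mult.left_commute)
  also have "\<dots> = (\<Sum>i\<in>UNIV. \<Sum>k\<in>UNIV. \<Sum>j\<in>UNIV. \<Sum>l\<in>UNIV. dot (mul (ax i) (ax k)) f * (dot (mul (ax j) (ax l)) g * (dot x (cm (ax i) (ax j)) * dot y (cm (ax k) (ax l)))))"
   by (rule sum.cong[OF refl], rule sum.swap)
  finally show ?thesis unfolding sw_def by (simp only: sum_distrib_left)
 qed
 have *: "sw mul f (\<lambda>a b. dot x (cm (adj S a) b)) = sw cm x (\<lambda>a b. dot f (mul (S a) b))" for f x
 proof -
  have "dot x (cm (adj S a) b) = sw cm x (\<lambda>p q. dot (S p) a * dot q b)" for a b
   by (simp only: dot_sym[of x "cm _ _"] sw_cm[symmetric] dot_adj lin_S dot_sym[of a] dot_sym[of b])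
  then have "sw mul f (\<lambda>a b. dot x (cm (adj S a) b)) = sw cm x (\<lambda>p q. sw mul f (\<lambda>a b. dot (S p) a * dot q b))"
   by (simp only: sw_swap[of cm])
  then show ?thesis by (simp only: sw_dot[OF bop_mul] dot_sym[of "mul _ _"])
 qed
 have **: "sw mul f (\<lambda>a b. dot x (cm a (adj S b))) = sw cm x (\<lambda>a b. dot f (mul a (S b)))" for f x
 proof -
  have "dot x (cm a (adj S b)) = sw cm x (\<lambda>p q. dot p a * dot (S q) b)" for a b
   by (simp only: dot_sym[of x "cm _ _"] sw_cm[symmetric] dot_adj lin_S dot_sym[of a] dot_sym[of b])
  then have "sw mul f (\<lambda>a b. dot x (cm a (adj S b))) = sw cm x (\<lambda>p q. sw mul f (\<lambda>a b. dot p a * dot (S q) b))"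
   by (simp only: sw_swap[of cm])
  then show ?thesis by (simp only: sw_dot[OF bop_mul] dot_sym[of "mul _ _"])
 qed
 show "sw mul f (\<lambda>a b. dot x (cm (adj S a) b)) = dot one f * dot x eps" for f x
  by (simp add: * antil dot_sym mult.commute)
 show "sw mul f (\<lambda>a b. dot x (cm a (adj S b))) = dot one f * dot x eps" for f x
  by (simp add: ** antir dot_sym mult.commute)
 show "dot one (cm x y) = dot one x * dot one y" for x y using one_cm[of x y] by (simp add: dot_sym)
 show "dot (mul f g) eps = dot f eps * dot g eps" for f g using eps_mul[of f g] by (simp add: dot_sym)
 show "dot one eps = 1" using eps_one by (simp add: dot_sym)
qed (auto simp: bop_mul bop_cm lin_S lin_adj mul_assoc cm_assoc)

lemma dot_adjS: "dot (adj S f) x = dot f (S x)" by (simp add: dot_adj lin_S)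
lemma adj_adjS: "adj (adj S) = S" by (simp add: adj_adj lin_S)

lemma S_cm: "dot (cm f g) (S x) = dot (cm (adj S g) (adj S f)) x"
proof -
 interpret D: hopf cm mul eps one "adj S" by (rule hopf_dual)
 show ?thesis using D.S_mul[of f g] by (metis dot_adjS)
qed
lemma eps_S [simp]: "dot eps (S x) = dot eps x"
proof -
 interpret D: hopf cm mul eps one "adj S" by (rule hopf_dual)
 show ?thesis using D.S_one by (metis dot_adjS)
qed
lemma sw_S: assumes "blin F" shows "sw cm (S x) F = sw cm x (\<lambda>a b. F (S b) (S a))"
proof -
 obtain c where c: "F = (\<lambda>a b. \<Sum>i\<in>UNIV. \<Sum>j\<in>UNIV. c i j * (dot (ax i) a * dot (ax j) b))"
  using blin_ex[OF assms] by blast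
 have "sw cm x (\<lambda>a b. dot (ax i) (S b) * dot (ax j) (S a)) = dot (cm (ax i) (ax j)) (S x)" for i j
  by (simp only: S_cm, simp only: sw_cm[symmetric], simp only: dot_adjS mult.commute)
 then show ?thesis by (simp only: c sw_sum sw_mult sw_cm)
qed

end

section \<open>Wedderburn decomposition\<close>

text \<open>A Wedderburn decomposition as data: the indices below m number a complete family of
  primitive idempotents, \<open>r i\<close> labels the block of i, and for equal labels
  \<open>E i j\<close> are matrix units and \<open>p i j\<close> the matrix coefficients dual to
  them.\<close>

locale wed =
 fixes mul :: "'k::field^'n::finite \<Rightarrow> 'k^'n \<Rightarrow> 'k^'n" and one :: "'k^'n" and m :: nat and r :: "nat \<Rightarrow> nat" and E p :: "nat \<Rightarrow> nat \<Rightarrow> 'k^'n"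
 assumes bopm: "bop mul" and assoc: "mul (mul x y) z = mul x (mul y z)"
  and E_mul: "i < m \<Longrightarrow> j < m \<Longrightarrow> k < m \<Longrightarrow> l < m \<Longrightarrow> r i = r j \<Longrightarrow> r k = r l \<Longrightarrow>
    mul (E i j) (E k l) = (if j = k then E i l else 0)"
  and E_one: "(\<Sum>i<m. E i i) = one"
  and pE: "i < m \<Longrightarrow> j < m \<Longrightarrow> k < m \<Longrightarrow> l < m \<Longrightarrow> r i = r j \<Longrightarrow> r k = r l \<Longrightarrow>
    dot (p i j) (E k l) = (if i = k \<and> j = l then 1 else 0)"
  and exp: "x = (\<Sum>i<m. \<Sum>j\<in>{j. j < m \<and> r j = r i}. dot (p i j) x *s E i j)"

text \<open>Semisimplicity enters as von Neumann regularity, an equational condition that yields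
  inverses in the corners e A f without any module theory.\<close>

locale vnalg =
 fixes mul :: "'k::alg_closed_field^'n::finite \<Rightarrow> 'k^'n \<Rightarrow> 'k^'n" and one :: "'k^'n"
 assumes bopm: "bop mul" and assoc: "mul (mul x y) z = mul x (mul y z)"
  and one [simp]: "mul one x = x" "mul x one = x"
  and vn: "\<exists>b. mul (mul a b) a = a"
begin

lemma l1 [lins]: "lin H \<Longrightarrow> lin (\<lambda>x. mul (H x) c)"
 using bopm lin_comp[of "\<lambda>x. mul x c" H] by (auto simp: bop_def)
lemma l2 [lins]: "lin H \<Longrightarrow> lin (\<lambda>x. mul c (H x))"
 using bopm lin_comp[of "\<lambda>x. mul c x" H] by (auto simp: bop_def)
lemma mdist: "mul (x + y) z = mul x z + mul y z" "mul z (x + y) = mul z x + mul z y"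
 "mul (x - y) z = mul x z - mul y z" "mul z (x - y) = mul z x - mul z y"
 "mul (c *s x) z = c *s mul x z" "mul z (c *s x) = c *s mul z x" "mul 0 z = 0" "mul z 0 = 0"
 using l1[OF lin_id, of z] l2[OF lin_id, of z]
 by (simp_all add: linD(1) linD(2) lin_diff lin_0 linD(1)[of "\<lambda>x. mul x z"] linD(2)[of "\<lambda>x. mul x z"] lin_diff[of "\<lambda>x. mul x z"] lin_0[of "\<lambda>x. mul x z"])
lemma msum: "mul (\<Sum>i\<in>I. f i) z = (\<Sum>i\<in>I. mul (f i) z)" "mul z (\<Sum>i\<in>I. f i) = (\<Sum>i\<in>I. mul z (f i))"
 using lin_sum[OF l1[OF lin_id, of z]] lin_sum[OF l2[OF lin_id, of z]] by auto

lemma one_nz: "one \<noteq> 0"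
proof
 assume "one = 0"
 then have "x = 0" for x :: "'k^'n" using one(1)[of x] mdist(7)[of x] by simp
 from this[of "ax undefined"] show False by (simp add: axis_eq_0_iff)
qed

definition prim :: "'k^'n \<Rightarrow> bool" where
 "prim e \<longleftrightarrow> mul e e = e \<and> e \<noteq> 0 \<and> (\<forall>f. mul f f = f \<longrightarrow> mul e f = f \<longrightarrow> mul f e = f \<longrightarrow> f = 0 \<or> f = e)"

definition fam :: "nat \<Rightarrow> (nat \<Rightarrow> 'k^'n) \<Rightarrow> bool" where
 "fam m e \<longleftrightarrow> (\<forall>i<m. \<forall>j<m. mul (e i) (e j) = (if i = j then e i else 0)) \<and> (\<forall>i<m. e i \<noteq> 0) \<and> (\<Sum>i<m. e i) = one"

lemma nz_functional: assumes "(x::'k^'n) \<noteq> 0" obtains t where "dot t x = 1"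
proof -
 from assms obtain i where "x $ i \<noteq> 0" by (metis vec_eq_iff zero_index)
 then have "dot ((1 / x$i) *s ax i) x = 1" by simp
 then show ?thesis using that by blast
qed

lemma fam_bound: assumes "fam m e" shows "m \<le> CARD('n)"
proof -
 have "\<exists>t. dot t (e i) = 1" if "i < m" for i using assms that nz_functional by (metis fam_def)
 then obtain t where t: "\<And>i. i < m \<Longrightarrow> dot (t i) (e i) = 1" by metis
 define w where "w i = repf (\<lambda>x. dot (t i) (mul (e i) x))" for i
 have lw: "linf (\<lambda>x. dot (t i) (mul (e i) x))" for i by (intro lins)
 have "dot (w i) (e j) = (if i = j then 1 else 0)" if "i < m" "j < m" for i j
  using assms that t unfolding w_def fam_def by (simp add: dot_repf[OF lw])
 then show ?thesis
  using biorth_bound[of m w e] by (simp add: dot_def)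
qed

text \<open>Orthogonal idempotents are biorthogonal to suitable functionals, so a family of maximal
  length exists; a member that is not primitive could be split in two, which would give a longer
  family.\<close>

lemma ex_prim_fam: "\<exists>m e. fam m e \<and> (\<forall>i<m. prim (e i))"
proof -
 have f1: "\<exists>e. fam 1 e" by (rule exI[of _ "\<lambda>_. one"]) (simp add: fam_def one_nz)
 have bd: "m \<le> CARD('n)" if "\<exists>e. fam m e" for m using that fam_bound by blast
 define K where "K = (GREATEST k. \<exists>e. fam k e)"
 have K: "\<exists>e. fam K e" unfolding K_def
  by (rule GreatestI_nat[where P="\<lambda>k. \<exists>e. fam k e", OF f1]) (use bd in blast)
 have Kmax: "k \<le> K" if "\<exists>e. fam k e" for k
  unfolding K_def by (rule Greatest_le_nat[where P="\<lambda>k. \<exists>e. fam k e", OF that]) (use bd in blast)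
 obtain e where e: "fam K e" using K by blast
 have ee: "mul (e i) (e j) = (if i = j then e i else 0)" if "i < K" "j < K" for i j using e that by (simp add: fam_def)
 have "prim (e i)" if i: "i < K" for i
  unfolding prim_def
 proof (intro conjI allI impI)
  show "mul (e i) (e i) = e i" "e i \<noteq> 0" using e i by (auto simp: fam_def)
  fix f assume f: "mul f f = f" "mul (e i) f = f" "mul f (e i) = f"
  show "f = 0 \<or> f = e i"
  proof (rule ccontr)
   assume n: "\<not> ?thesis"
   define e' where "e' j = (if j = i then f else if j = K then e i - f else e j)" for j
   have fe: "mul f (e j) = 0" if "j < K" "j \<noteq> i" for j
   proof -
    have "mul f (e j) = mul (mul f (e i)) (e j)" by (simp add: f)
    also have "\<dots> = mul f (mul (e i) (e j))" by (rule assoc)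
    also have "\<dots> = 0" using ee[OF i that(1)] that by (simp add: mdist)
    finally show ?thesis .
   qed
   have ef: "mul (e j) f = 0" if "j < K" "j \<noteq> i" for j
   proof -
    have "mul (e j) f = mul (mul (e j) (e i)) f" by (simp add: f assoc)
    then show ?thesis using ee[OF that(1) i] that by (simp add: mdist)
   qed
   have "fam (Suc K) e'"
    unfolding fam_def
   proof (intro conjI allI impI)
    fix j k assume "j < Suc K" "k < Suc K"
    then show "mul (e' j) (e' k) = (if j = k then e' j else 0)"
     using i by (auto simp: e'_def less_Suc_eq mdist f ee fe ef)
   next
    fix j assume "j < Suc K"
    then show "e' j \<noteq> 0" using n i e by (auto simp: e'_def less_Suc_eq fam_def)
   next
    have "(\<Sum>j<Suc K. e' j) = (\<Sum>j<K. e' j) + (e i - f)" using i by (simp add: e'_def)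
    also have "(\<Sum>j<K. e' j) = (\<Sum>j<K. e j + (if j = i then f - e i else 0))"
     by (rule sum.cong) (auto simp: e'_def)
    also have "\<dots> = one + (f - e i)" using i e by (simp add: sum.distrib fam_def)
    finally show "(\<Sum>j<Suc K. e' j) = one" by simp
   qed
   then have "Suc K \<le> K" using Kmax by blast
   then show False by simp
  qed
 qed
 with e show ?thesis by blast
qed

text \<open>If x b_0 x = x, then x b is a nonzero idempotent of the corner e A e, where b is b_0 cut
  down to f A e. Primitivity leaves only e.\<close>

lemma prim_inv:
 assumes e: "prim e" and f: "mul f f = f" and x: "mul (mul e x) f = x" "x \<noteq> 0"
 obtains b where "mul (mul f b) e = b" "mul x b = e" "mul x (mul b x) = x"
proof -
 have ee: "mul e e = e" using e by (simp add: prim_def)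
 have ex: "mul e x = x" by (metis x(1) assoc ee)
 have xf: "mul x f = x" by (metis x(1) assoc f)
 obtain b0 where b0: "mul (mul x b0) x = x" using vn by blast
 define b where "b = mul (mul f b0) e"
 have xbx: "mul x (mul b x) = x"
  unfolding b_def by (metis assoc ex xf b0)
 have i: "mul (mul x b) (mul x b) = mul x b" by (metis assoc xbx)
 have be: "mul (mul f b) e = b" unfolding b_def by (metis assoc ee f)
 have "mul e (mul x b) = mul x b" by (metis assoc ex)
 moreover have "mul (mul x b) e = mul x b" unfolding b_def by (metis assoc ee)
 moreover have "mul x b \<noteq> 0" using xbx x(2) by (metis assoc mdist(7))
 ultimately have "mul x b = e" using e i unfolding prim_def by blast
 then show ?thesis using that be xbx by blast
qed

text \<open>Horner evaluation in the corner algebra, whose unit is e: the constant coefficient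
  multiplies e and not \<open>one\<close>.\<close>

definition evp :: "'k^'n \<Rightarrow> 'k^'n \<Rightarrow> 'k poly \<Rightarrow> 'k^'n" where
 "evp e x p = fold_coeffs (\<lambda>a v. a *s e + mul x v) p 0"

lemma evp_pCons: "evp e x (pCons a p) = a *s e + mul x (evp e x p)"
 by (cases "p = 0 \<and> a = 0") (auto simp: evp_def mdist)
lemma evp_0: "evp e x 0 = 0" by (simp add: evp_def)
lemma evp_add: "evp e x (p + q) = evp e x p + evp e x q"
 by (induction p q rule: poly_induct2) (simp_all add: evp_0 evp_pCons mdist vec.scale_left_distrib)
lemma evp_smult: "evp e x (smult c p) = c *s evp e x p"
 by (induction p) (simp_all add: evp_0 evp_pCons mdist vec.scale_right_distrib)

text \<open>The corner e A e is a division algebra by \<open>prim_inv\<close>. Of an annihilating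
  polynomial with linear factor x - c e, either the cofactor already annihilates x, or that factor
  is not invertible and hence zero.\<close>

lemma prim_scalar_aux:
 assumes e: "prim e" and x: "mul (mul e x) e = x"
 shows "p \<noteq> 0 \<Longrightarrow> evp e x p = 0 \<Longrightarrow> \<exists>c. x = c *s e"
proof (induction "degree p" arbitrary: p rule: less_induct)
 case less
 have ee: "mul e e = e" "e \<noteq> 0" using e by (auto simp: prim_def)
 show ?case
 proof (cases "degree p = 0")
  case True
  then obtain a where a: "p = [:a:]" using degree_eq_zeroE by blast
  with less.prems have "a *s e = 0" "a \<noteq> 0" by (auto simp: evp_pCons evp_0 mdist)
  then show ?thesis using ee by simp
 next
  case False
  then obtain c where "poly p c = 0" using alg_closed_imp_poly_has_root by blast
  then obtain q where q: "p = [:-c, 1:] * q" by (metis poly_eq_0_iff_dvd dvdE)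
  then have q0: "q \<noteq> 0" using less.prems by auto
  have dq: "degree q < degree p" using q0 by (subst q, subst degree_mult_eq) auto
  have pq: "p = pCons 0 q + smult (-c) q" by (simp add: q)
  have eq: "mul e (evp e x r) = evp e x r" for r
  proof -
   have "mul e x = x" by (metis x assoc ee(1))
   then show ?thesis by (cases r) (simp add: evp_pCons mdist ee assoc[symmetric] vec.scale_right_distrib)
  qed
  have "evp e x p = mul (x - c *s e) (evp e x q)"
   by (simp only: pq evp_add evp_smult evp_pCons) (simp add: mdist eq)
  with less.prems have z: "mul (x - c *s e) (evp e x q) = 0" by simp
  show ?thesis
  proof (cases "evp e x q = 0")
   case True then show ?thesis using less.hyps[OF dq q0] by blast
  next
   case False
   have "x - c *s e = 0"
   proof (rule ccontr)
    assume n: "x - c *s e \<noteq> 0"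
    have y: "mul (mul e (x - c *s e)) e = x - c *s e" by (simp add: mdist x ee)
    obtain b where b: "mul (mul e b) e = b" "mul (x - c *s e) b = e" using prim_inv[OF e ee(1) y n] by metis
    have "b \<noteq> 0" using b ee by (auto simp: mdist)
    then obtain b' where b': "mul (mul e b') e = b'" "mul b b' = e" using prim_inv[OF e ee(1) b(1)] by metis
    have "mul b (x - c *s e) = e"
    proof -
     have "x - c *s e = mul (x - c *s e) (mul b b')" using y b'(2) by (metis assoc ee(1))
     also have "\<dots> = b'" using b b' by (metis assoc ee(1))
     finally show ?thesis using b' by simp
    qed
    then have "mul e (evp e x q) = 0" using z by (metis assoc mdist(8))
    then show False using False eq by simp
   qed
   then show ?thesis by auto
  qed
 qed
qed

text \<open>Schur's lemma for a primitive idempotent; n + 1 powers of x are dependent, which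
  supplies the annihilating polynomial.\<close>

lemma prim_scalar:
 assumes e: "prim e" and x: "mul (mul e x) e = x"
 shows "\<exists>c. x = c *s e"
proof -
 define pw where "pw = (\<lambda>i. ((mul x) ^^ i) e)"
 obtain u where u: "\<exists>i\<le>CARD('n). u i \<noteq> 0" "(\<Sum>i\<le>CARD('n). u i *s pw i) = 0" using fam_dep[of pw] by blast
 define p where "p = (\<Sum>i\<le>CARD('n). monom (u i) i)"
 have m: "evp e x (monom c i) = c *s pw i" for c i
  by (induction i) (simp_all add: monom_0 monom_Suc evp_pCons evp_0 mdist pw_def)
 have "evp e x (\<Sum>i\<in>I. monom (u i) i) = (\<Sum>i\<in>I. u i *s pw i)" for I
  by (induction I rule: infinite_finite_induct) (simp_all add: evp_0 evp_add m)
 then have "evp e x p = 0" using u(2) by (simp add: p_def)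
 moreover have "p \<noteq> 0"
 proof -
  obtain i where i: "i \<le> CARD('n)" "u i \<noteq> 0" using u(1) by blast
  then have "coeff p i = u i" by (simp add: p_def coeff_sum)
  with i show ?thesis by auto
 qed
 ultimately show ?thesis using prim_scalar_aux[OF e x] by blast
qed

text \<open>\<open>R i j\<close> means that the left ideals generated by e_i and e_j are isomorphic.
  The least index of a class is its base point, u_i and v_i transport between it and i, and the
  matrix unit \<open>E i j\<close> = v_i u_j passes through the base point.\<close>

theorem wedderburn: "\<exists>m r E p. wed mul one m r E p"
proof -
 obtain m e where f: "fam m e" and pr: "\<And>i. i < m \<Longrightarrow> prim (e i)" using ex_prim_fam by blast
 have ee: "mul (e i) (e j) = (if i = j then e i else 0)" if "i < m" "j < m" for i j using f that by (simp add: fam_def)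
 have id: "mul (e i) (e i) = e i" if "i < m" for i using ee that by simp
 have nz: "e i \<noteq> 0" if "i < m" for i using f that by (simp add: fam_def)
 define R where "R i j \<longleftrightarrow> (\<exists>x. mul (mul (e i) x) (e j) = x \<and> x \<noteq> 0)" for i j
 have get: "\<exists>x y. mul (mul (e i) x) (e j) = x \<and> mul (mul (e j) y) (e i) = y \<and> mul x y = e i \<and> mul y x = e j"
  if a: "i < m" "j < m" "R i j" for i j
 proof -
  obtain x where x: "mul (mul (e i) x) (e j) = x" "x \<noteq> 0" using a(3) unfolding R_def by blast
  obtain y where y: "mul (mul (e j) y) (e i) = y" "mul x y = e i" "mul x (mul y x) = x"
   using prim_inv[OF pr[OF a(1)] id[OF a(2)] x] by blast
  have y0: "y \<noteq> 0" using y nz a by (auto simp: mdist)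
  obtain z where z: "mul (mul (e i) z) (e j) = z" "mul y z = e j"
   using prim_inv[OF pr[OF a(2)] id[OF a(1)] y(1) y0] by blast
  have "mul (e i) x = x" "mul (e i) z = z" using x z id a by (metis assoc)+
  have "mul x (e j) = x" using x id a by (metis assoc)
  have "x = z"
  proof -
   have "x = mul x (mul y z)" using z \<open>mul x (e j) = x\<close> by simp
   also have "\<dots> = mul (mul x y) z" by (simp add: assoc)
   finally show ?thesis using y \<open>mul (e i) z = z\<close> by simp
  qed
  then show ?thesis using x y z by blast
 qed
 have Rrefl: "R i i" if "i < m" for i using id[OF that] nz[OF that] unfolding R_def by (metis)
 have Rsym: "R j i" if a: "i < m" "j < m" "R i j" for i j
 proof -
  obtain x y where xy: "mul (mul (e i) x) (e j) = x" "mul (mul (e j) y) (e i) = y" "mul x y = e i" "mul y x = e j"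
   using get[OF a] by blast
  have "y \<noteq> 0" using xy nz a by (auto simp: mdist)
  then show ?thesis using xy unfolding R_def by blast
 qed
 have Rtrans: "R i k" if a: "i < m" "j < m" "k < m" "R i j" "R j k" for i j k
 proof -
  obtain x y where xy: "mul (mul (e i) x) (e j) = x" "mul (mul (e j) y) (e i) = y" "mul x y = e i" "mul y x = e j"
   using get[OF a(1,2,4)] by blast
  obtain x' y' where xy': "mul (mul (e j) x') (e k) = x'" "mul (mul (e k) y') (e j) = y'" "mul x' y' = e j" "mul y' x' = e k"
   using get[OF a(2,3,5)] by blast
  have ex: "mul (e i) x = x" "mul x' (e k) = x'" "mul (e j) x' = x'" "mul y (e i) = y"
   using xy xy' id a by (metis assoc)+
  have "mul (mul (e i) (mul x x')) (e k) = mul x x'" using ex by (metis assoc)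
  moreover have "mul y (mul x x') = x'" using xy ex by (metis assoc)
  then have "mul x x' \<noteq> 0" using xy' nz a by (auto simp: mdist)
  ultimately show ?thesis unfolding R_def by blast
 qed
 define r where "r i = (LEAST j. j < m \<and> R i j)" for i
 have rm: "r i < m \<and> R i (r i)" if "i < m" for i
  unfolding r_def by (rule LeastI[where P="\<lambda>j. j < m \<and> R i j" and k=i]) (simp add: that Rrefl)
 have rR: "r i = r j \<longleftrightarrow> R i j" if "i < m" "j < m" for i j
 proof
  assume "r i = r j" then show "R i j" using rm that Rsym Rtrans by metis
 next
  assume "R i j"
  then have "(j' < m \<and> R i j') = (j' < m \<and> R j j')" for j' using that Rsym Rtrans by blast
  then show "r i = r j" by (simp add: r_def)
 qed
 have "\<exists>u v. mul (mul (e (r i)) u) (e i) = u \<and> mul (mul (e i) v) (e (r i)) = v \<and> mul u v = e (r i) \<and> mul v u = e i"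
  if "i < m" for i using get[of i "r i"] rm that by blast
 then obtain u v where uv: "\<And>i. i < m \<Longrightarrow> mul (mul (e (r i)) (u i)) (e i) = u i"
   "\<And>i. i < m \<Longrightarrow> mul (mul (e i) (v i)) (e (r i)) = v i"
   "\<And>i. i < m \<Longrightarrow> mul (u i) (v i) = e (r i)" "\<And>i. i < m \<Longrightarrow> mul (v i) (u i) = e i" by metis
 have uv1: "mul (e (r i)) (u i) = u i" "mul (u i) (e i) = u i" "mul (e i) (v i) = v i" "mul (v i) (e (r i)) = v i" if "i < m" for i
  using uv(1,2)[OF that] id[OF that] id rm[OF that] by (metis assoc)+
 have uv0: "mul (u i) (v j) = 0" if "i < m" "j < m" "i \<noteq> j" for i j
 proof -
  have "mul (u i) (v j) = mul (mul (u i) (mul (e i) (e j))) (v j)" using uv1 that by (metis assoc)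
  then show ?thesis using ee that by (simp add: mdist)
 qed
 define E where "E i j = mul (v i) (u j)" for i j
 have "\<exists>t. dot t (e i) = 1" if "i < m" for i using nz_functional[OF nz[OF that]] by metis
 then obtain t where t: "\<And>i. i < m \<Longrightarrow> dot (t i) (e i) = 1" by metis
 \<comment> \<open>Moved back to the base point, the (i,j) corner of x is a multiple of the
   primitive idempotent there by Schur's lemma, and t reads off the scalar.\<close>
 define p where "p i j = repf (\<lambda>x. dot (t (r i)) (mul (mul (u i) x) (v j)))" for i j
 have lp: "linf (\<lambda>x. dot (t (r i)) (mul (mul (u i) x) (v j)))" for i j by (intro lins)
 have dp: "dot (p i j) x = dot (t (r i)) (mul (mul (u i) x) (v j))" for i j x
  unfolding p_def by (rule dot_repf[OF lp])
 have "wed mul one m r E p"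
 proof (rule wed.intro[OF bopm assoc])
  fix i j k l assume a: "i < m" "j < m" "k < m" "l < m" "r i = r j" "r k = r l"
  have "mul (E i j) (E k l) = mul (v i) (mul (mul (u j) (v k)) (u l))" by (simp add: E_def assoc)
  also have "\<dots> = (if j = k then mul (v i) (mul (e (r l)) (u l)) else 0)"
   using a uv(3) uv0 by (auto simp: mdist)
  also have "\<dots> = (if j = k then E i l else 0)" using uv1 a by (simp add: E_def)
  finally show "mul (E i j) (E k l) = (if j = k then E i l else 0)" .
  have "mul (mul (u i) (E k l)) (v j) = mul (mul (u i) (v k)) (mul (u l) (v j))" by (simp add: E_def assoc)
  also have "\<dots> = (if i = k \<and> j = l then e (r i) else 0)"
   using a uv(3) uv0 id rm by (auto simp: mdist)
  finally show "dot (p i j) (E k l) = (if i = k \<and> j = l then 1 else 0)" using t a rm by (simp add: dp)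
 next
  show "(\<Sum>i<m. E i i) = one" using f uv(4) by (simp add: E_def fam_def)
 next
  fix x
  have comp: "mul (mul (e i) x) (e j) = (if r j = r i then dot (p i j) x *s E i j else 0)" if a: "i < m" "j < m" for i j
  proof (cases "r j = r i")
   case True
   let ?y = "mul (mul (u i) x) (v j)"
   have "mul (mul (e (r i)) ?y) (e (r i)) = ?y" using uv1 a True by (metis assoc)
   then obtain c where c: "?y = c *s e (r i)" using prim_scalar pr rm a by blast
   then have cp: "dot (p i j) x = c" using t rm a by (simp add: dp)
   have "mul (mul (e i) x) (e j) = mul (mul (v i) ?y) (u j)" using uv(4) a by (metis assoc)
   also have "\<dots> = c *s mul (mul (v i) (e (r i))) (u j)" by (simp add: c mdist)
   also have "\<dots> = c *s E i j" using uv1 a by (simp add: E_def)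
   finally show ?thesis using True cp by simp
  next
   case False
   then have "\<not> R i j" using rR[OF a] by auto
   moreover have "mul (mul (e i) (mul (mul (e i) x) (e j))) (e j) = mul (mul (e i) x) (e j)"
    using id a by (metis assoc)
   ultimately show ?thesis using False unfolding R_def by auto
  qed
  have "x = mul (mul (\<Sum>i<m. e i) x) (\<Sum>j<m. e j)" using f by (simp add: fam_def)
  also have "\<dots> = (\<Sum>i<m. \<Sum>j<m. mul (mul (e i) x) (e j))" by (simp only: msum) (rule sum.swap)
  also have "\<dots> = (\<Sum>i<m. \<Sum>j<m. if r j = r i then dot (p i j) x *s E i j else 0)"
   by (intro sum.cong refl comp) auto
  also have "\<dots> = (\<Sum>i<m. \<Sum>j\<in>{j. j < m \<and> r j = r i}. dot (p i j) x *s E i j)"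
   by (rule sum.cong[OF refl], subst sum.inter_filter[symmetric], simp, rule sum.cong) auto
  finally show "x = (\<Sum>i<m. \<Sum>j\<in>{j. j < m \<and> r j = r i}. dot (p i j) x *s E i j)" .
 qed
 then show ?thesis by blast
qed

end

section \<open>Hopf algebras in coordinates\<close>

lemma lin_iff: "lin F \<longleftrightarrow> Vector_Spaces.linear (*s) (*s) F"
 unfolding lin_def Vector_Spaces.linear_iff by (auto simp: vec.vector_space_axioms)

lemma lin_inj_surj: fixes F :: "'k::field^'n::finite \<Rightarrow> 'k^'n" assumes "lin F" "\<And>x. F x = 0 \<Longrightarrow> x = 0"
 shows "bij F"
proof -
 have "inj F"
 proof (rule injI)
  fix x y assume "F x = F y"
  then have "F (x - y) = 0" using assms(1) by (simp add: lin_diff)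
  then show "x = y" using assms(2) by fastforce
 qed
 then show ?thesis using vec.linear_injective_imp_surjective assms(1) by (auto simp: bij_def lin_iff)
qed
lemma lin_inv: fixes F :: "'k::field^'n::finite \<Rightarrow> 'k^'n" assumes "lin F" "bij F" shows "lin (inv F)"
proof -
 have i: "F (inv F x) = x" "inv F (F x) = x" for x using assms(2) by (simp_all add: bij_def surj_f_inv_f)
 show ?thesis unfolding lin_def
  by (intro conjI allI) (metis i linD(1)[OF assms(1)], metis i linD(2)[OF assms(1)])
qed

lemma lin_geninv: fixes F :: "'k::field^'n::finite \<Rightarrow> 'k^'n" assumes "lin F" shows "\<exists>g. lin g \<and> (\<forall>x. F (g (F x)) = F x)"
proof -
 from assms have "Vector_Spaces.linear (*s) (*s) F" by (simp add: lin_iff)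
 from vec.linear_exists_right_inverse_on[OF this vec.subspace_UNIV]
 show ?thesis by (auto simp: lin_iff)
qed

lemma linf_tr [lins]: "(\<And>x. lin (\<lambda>h. G h x)) \<Longrightarrow> linf (\<lambda>h. tr (G h))"
 unfolding tr_def dot_ax(1)[symmetric] by (intro lins)

context hopf begin

lemma mdist: "mul (x + y) z = mul x z + mul y z" "mul z (x + y) = mul z x + mul z y"
 "mul (x - y) z = mul x z - mul y z" "mul z (x - y) = mul z x - mul z y"
 "mul (c *s x) z = c *s mul x z" "mul z (c *s x) = c *s mul z x" "mul 0 z = 0" "mul z 0 = 0"
 using lin_mul1[OF lin_id, of z] lin_mul2[OF lin_id, of z]
 by (simp_all add: linD(1) linD(2) lin_diff lin_0 linD(1)[of "\<lambda>x. mul x z"] linD(2)[of "\<lambda>x. mul x z"] lin_diff[of "\<lambda>x. mul x z"] lin_0[of "\<lambda>x. mul x z"])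
lemma msum: "mul (\<Sum>i\<in>I. f i) z = (\<Sum>i\<in>I. mul (f i) z)" "mul z (\<Sum>i\<in>I. f i) = (\<Sum>i\<in>I. mul z (f i))"
 using lin_sum[OF lin_mul1[OF lin_id, of z]] lin_sum[OF lin_mul2[OF lin_id, of z]] by auto
lemma cdist: "cm (x + y) z = cm x z + cm y z" "cm z (x + y) = cm z x + cm z y"
 "cm (x - y) z = cm x z - cm y z" "cm z (x - y) = cm z x - cm z y"
 "cm (c *s x) z = c *s cm x z" "cm z (c *s x) = c *s cm z x" "cm 0 z = 0" "cm z 0 = 0"
 using lin_cm1[OF lin_id, of z] lin_cm2[OF lin_id, of z]
 by (simp_all add: linD(1) linD(2) lin_diff lin_0 linD(1)[of "\<lambda>x. cm x z"] linD(2)[of "\<lambda>x. cm x z"] lin_diff[of "\<lambda>x. cm x z"] lin_0[of "\<lambda>x. cm x z"])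
lemma csum: "cm (\<Sum>i\<in>I. f i) z = (\<Sum>i\<in>I. cm (f i) z)" "cm z (\<Sum>i\<in>I. f i) = (\<Sum>i\<in>I. cm z (f i))"
 using lin_sum[OF lin_cm1[OF lin_id, of z]] lin_sum[OF lin_cm2[OF lin_id, of z]] by auto

text \<open>Transposes of multiplication in the dual: \<open>T f x\<close> is f(x_1) x_2 and
  \<open>T' f x\<close> is x_1 f(x_2). For a one-dimensional character f these are the two
  translations by f.\<close>

definition T :: "'k^'n \<Rightarrow> 'k^'n \<Rightarrow> 'k^'n" where "T f = adj (\<lambda>g. cm f g)"
definition T' :: "'k^'n \<Rightarrow> 'k^'n \<Rightarrow> 'k^'n" where "T' f = adj (\<lambda>g. cm g f)"
lemma dot_T: "dot g (T f x) = dot (cm f g) x"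
 unfolding T_def by (subst dot_sym, subst dot_adj) (auto intro: lins simp: dot_sym)
lemma dot_T': "dot g (T' f x) = dot (cm g f) x"
 unfolding T'_def by (subst dot_sym, subst dot_adj) (auto intro: lins simp: dot_sym)
lemma lin_T [lins]: "lin H \<Longrightarrow> lin (\<lambda>x. T f (H x))" "lin H \<Longrightarrow> lin (\<lambda>x. T' f (H x))"
 unfolding T_def T'_def by (intro lins; assumption)+
lemma sw_T: "blin F \<Longrightarrow> sw cm (T f x) F = sw cm x (\<lambda>a b. dot f a * sw cm b F)"
proof -
 assume "blin F"
 then obtain c where c: "F = (\<lambda>a b. \<Sum>i\<in>UNIV. \<Sum>j\<in>UNIV. c i j * (dot (ax i) a * dot (ax j) b))"
  using blin_ex by blast
 have "sw cm x (\<lambda>a b. dot f a * dot g b) = dot g (T f x)" for g by (simp add: sw_cm dot_T)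
 then show ?thesis by (simp only: c sw_sum sw_mult sw_cm sum_distrib_left mult.left_commute[of "dot f _"])
qed
lemma linf_T: "linf F \<Longrightarrow> F (T f x) = sw cm x (\<lambda>a b. dot f a * F b)"
 using dot_T[of "repf F" f x] sw_cm[of x f "repf F"] by (simp add: dot_repf)
lemma linf_T': "linf F \<Longrightarrow> F (T' f x) = sw cm x (\<lambda>a b. F a * dot f b)"
 using dot_T'[of "repf F" f x] sw_cm[of x "repf F" f] by (simp add: dot_repf)

end

text \<open>As in Maschke's theorem, semisimplicity is encoded by a left integral with counit
  1.\<close>

locale hopf_int = hopf mul cm one eps S for mul cm :: "'k::{alg_closed_field,field_char_0}^'n::finite \<Rightarrow> 'k^'n \<Rightarrow> 'k^'n" and one eps :: "'k^'n" and S +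
 fixes Lam :: "'k^'n"
 assumes Lam_l: "mul h Lam = dot eps h *s Lam" and eps_Lam [simp]: "dot eps Lam = 1"
begin

text \<open>Insert S(h_1) h_2 in front of the first leg; then h_2 and h_3 together act on the
  coproduct of the integral through the counit.\<close>

lemma Lam_S: assumes "blin F"
 shows "sw cm Lam (\<lambda>p q. F p (mul h q)) = sw cm Lam (\<lambda>p q. F (mul (S h) p) q)"
proof -
 have f1: "linf (\<lambda>t. F (H t) q)" "linf (\<lambda>t. F q (H t))" if "lin H" for H q
  using linf_comp[OF blinD(2)[OF assms] that] linf_comp[OF blinD(1)[OF assms] that] by auto
 have "sw cm Lam (\<lambda>p q. F p (mul h q)) = sw cm h (\<lambda>h1 h2. dot eps h1 * sw cm Lam (\<lambda>p q. F p (mul h2 q)))"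
  by (rule sw_counitl[symmetric]) (intro lins f1)
 also have "\<dots> = sw cm h (\<lambda>u h2. sw cm u (\<lambda>a b. sw cm Lam (\<lambda>p q. F (mul (mul (S a) b) p) (mul h2 q))))"
  by (subst sw_antil[where f="\<lambda>t. sw cm Lam (\<lambda>p q. F (mul t p) (mul _ q))"]) (intro lins f1, simp)
 also have "\<dots> = sw cm h (\<lambda>a u. sw cm u (\<lambda>b h2. sw cm Lam (\<lambda>p q. F (mul (mul (S a) b) p) (mul h2 q))))"
  by (rule sw_coassoc) (intro lins f1)
 also have "\<dots> = sw cm h (\<lambda>a u. sw cm (mul u Lam) (\<lambda>p q. F (mul (S a) p) q))"
  by (subst sw_mul) (intro lins f1, simp add: mul_assoc)
 also have "\<dots> = sw cm h (\<lambda>a u. dot eps u * sw cm Lam (\<lambda>p q. F (mul (S a) p) q))"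
  by (simp only: Lam_l linfD(2)[OF linf_sw1[OF lin_id]])
 also have "\<dots> = sw cm Lam (\<lambda>p q. F (mul (S h) p) q)"
  by (rule sw_counitr) (intro lins f1)
 finally show ?thesis .
qed

text \<open>With L = \<open>Lam\<close>, the tensor of L_1 and S(L_2) is a Casimir element: h passes
  from its first leg to its second, so it averages linear maps into module maps.\<close>

lemma Lam_cas: assumes "blin F"
 shows "sw cm Lam (\<lambda>p q. F (mul h p) (S q)) = sw cm Lam (\<lambda>p q. F p (mul (S q) h))"
proof -
 have f1: "linf (\<lambda>t. F (H t) q)" "linf (\<lambda>t. F q (H t))" if "lin H" for H q
  using linf_comp[OF blinD(2)[OF assms] that] linf_comp[OF blinD(1)[OF assms] that] by auto
 have "sw cm Lam (\<lambda>p q. F (mul h p) (S q)) = sw cm h (\<lambda>h1 h2. dot eps h2 * sw cm Lam (\<lambda>p q. F (mul h1 p) (S q)))"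
  by (rule sw_counitr[symmetric]) (intro lins f1)
 also have "\<dots> = sw cm h (\<lambda>h1 u. sw cm u (\<lambda>a b. sw cm Lam (\<lambda>p q. F (mul h1 p) (mul (S q) (mul (S a) b)))))"
  by (subst sw_antil[where f="\<lambda>t. sw cm Lam (\<lambda>p q. F (mul _ p) (mul (S q) t))"]) (intro lins f1, simp)
 also have "\<dots> = sw cm h (\<lambda>u b. sw cm u (\<lambda>h1 a. sw cm Lam (\<lambda>p q. F (mul h1 p) (mul (S q) (mul (S a) b)))))"
  by (rule sw_coassoc[symmetric]) (intro lins f1)
 also have "\<dots> = sw cm h (\<lambda>u b. sw cm (mul u Lam) (\<lambda>p q. F p (mul (S q) b)))"
  by (subst sw_mul) (intro lins f1, simp add: mul_assoc S_mul)
 also have "\<dots> = sw cm h (\<lambda>u b. dot eps u * sw cm Lam (\<lambda>p q. F p (mul (S q) b)))"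
  by (simp only: Lam_l linfD(2)[OF linf_sw1[OF lin_id]])
 also have "\<dots> = sw cm Lam (\<lambda>p q. F p (mul (S q) h))"
  by (rule sw_counitl) (intro lins f1)
 finally show ?thesis .
qed

text \<open>Maschke averaging: g is a linear generalised inverse of right multiplication by a, and b
  = L_1 g(S(L_2)) with L = \<open>Lam\<close> is the value at \<open>one\<close> of its
  average.\<close>

lemma vn_regular: "\<exists>b. mul (mul a b) a = a"
proof -
 have la: "lin (\<lambda>x. mul x a)" by (intro lins)
 obtain g where g: "lin g" "\<And>x. mul (g (mul x a)) a = mul x a" using lin_geninv[OF la] by blast
 have lg [lins]: "lin H \<Longrightarrow> lin (\<lambda>x. g (H x))" for H by (rule lin_comp[OF g(1)])
 define b where "b = repf (\<lambda>f. sw cm Lam (\<lambda>p q. dot f (mul p (g (S q)))))"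
 have b: "F b = sw cm Lam (\<lambda>p q. F (mul p (g (S q))))" if F: "linf F" for F
 proof -
  have "dot b f = sw cm Lam (\<lambda>p q. dot f (mul p (g (S q))))" for f
   unfolding b_def by (rule dot_repf) (intro lins)
  from this[of "repf F"] show ?thesis using F by (simp add: dot_sym[of b] dot_repf)
 qed
 have "mul (mul a b) a = a"
 proof (rule dot_eqI)
  fix f
  have "dot f (mul (mul a b) a) = sw cm Lam (\<lambda>p q. dot f (mul (mul a (mul p (g (S q)))) a))"
   by (rule b) (intro lins)
  also have "\<dots> = sw cm Lam (\<lambda>p q. dot f (mul (mul (mul a p) (g (S q))) a))" by (simp add: mul_assoc)
  also have "\<dots> = sw cm Lam (\<lambda>p q. dot f (mul (mul p (g (mul (S q) a))) a))"
   by (rule Lam_cas) (intro lins)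
  also have "\<dots> = sw cm Lam (\<lambda>p q. dot f (mul (mul p (S q)) a))" by (simp add: mul_assoc g)
  also have "\<dots> = dot f a" by (subst sw_antir[where f="\<lambda>t. dot f (mul t a)"]) (intro lins, simp)
  finally show "dot f (mul (mul a b) a) = dot f a" .
 qed
 then show ?thesis by blast
qed

sublocale vn: vnalg mul one
 by unfold_locales (rule bop_mul mul_assoc mul_one vn_regular)+

end

context wed begin

text \<open>\<open>PP\<close> indexes the matrix units and \<open>Irr\<close> the blocks;
  \<open>chi c\<close>, \<open>d c\<close> and \<open>ce c\<close> are the irreducible character,
  the degree and the central idempotent of block c.\<close>

definition PP where "PP = {(i,j). i < m \<and> j < m \<and> r j = r i}"
definition blk :: "nat \<Rightarrow> nat set" where "blk c = {i. i < m \<and> r i = c}"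
definition Irr where "Irr = r ` {..<m}"
definition chi where "chi c = (\<Sum>i\<in>blk c. p i i)"
definition d :: "nat \<Rightarrow> nat" where "d c = card (blk c)"
definition ce where "ce c = (\<Sum>i\<in>blk c. E i i)"

lemma finP [simp]: "finite PP" "finite (blk c)" "finite Irr"
proof -
 have "PP \<subseteq> {..<m} \<times> {..<m}" by (auto simp: PP_def)
 then show "finite PP" by (rule finite_subset) simp
qed (auto simp: blk_def Irr_def)

lemma blk_iff: "i \<in> blk c \<longleftrightarrow> i < m \<and> r i = c" by (simp add: blk_def)
lemma PP_iff: "(i,j) \<in> PP \<longleftrightarrow> i < m \<and> j < m \<and> r j = r i" by (simp add: PP_def)
lemma sumP: "(\<Sum>(i,j)\<in>PP. f i j) = (\<Sum>c\<in>Irr. \<Sum>i\<in>blk c. \<Sum>j\<in>blk c. f i j)"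
proof -
 have P: "PP = (SIGMA i:{..<m}. {j. j < m \<and> r j = r i})" by (auto simp: PP_def)
 have "(\<Sum>(i,j)\<in>PP. f i j) = (\<Sum>i<m. \<Sum>j\<in>{j. j < m \<and> r j = r i}. f i j)"
  unfolding P by (rule sum.Sigma[symmetric]) auto
 also have "\<dots> = (\<Sum>c\<in>Irr. \<Sum>i\<in>{i \<in> {..<m}. r i = c}. \<Sum>j\<in>{j. j < m \<and> r j = r i}. f i j)"
  unfolding Irr_def by (rule sum.image_gen) simp
 also have "\<dots> = (\<Sum>c\<in>Irr. \<Sum>i\<in>blk c. \<Sum>j\<in>blk c. f i j)"
  by (intro sum.cong refl) (auto simp: blk_def)
 finally show ?thesis .
qed
lemma expP: "x = (\<Sum>a\<in>PP. dot (case_prod p a) x *s case_prod E a)"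
proof -
 have P: "PP = (SIGMA i:{..<m}. {j. j < m \<and> r j = r i})" by (auto simp: PP_def)
 have "(\<Sum>i<m. \<Sum>j\<in>{j. j < m \<and> r j = r i}. dot (p i j) x *s E i j) = (\<Sum>(i,j)\<in>PP. dot (p i j) x *s E i j)"
  unfolding P by (rule sum.Sigma) auto
 then show ?thesis using exp[of x] by (simp add: case_prod_beta)
qed
lemma p_eqI: "(\<And>i j. (i,j) \<in> PP \<Longrightarrow> dot (p i j) x = dot (p i j) y) \<Longrightarrow> x = y"
 by (subst expP[of x], subst expP[of y], rule sum.cong) auto
lemma pE': "(i,j) \<in> PP \<Longrightarrow> (k,l) \<in> PP \<Longrightarrow> dot (p i j) (E k l) = (if i = k \<and> j = l then 1 else 0)"
 by (simp add: PP_iff pE)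
lemma E_mul': "(i,j) \<in> PP \<Longrightarrow> (k,l) \<in> PP \<Longrightarrow> mul (E i j) (E k l) = (if j = k then E i l else 0)"
 by (simp add: PP_iff E_mul)
lemma p_exp: "f = (\<Sum>a\<in>PP. dot f (case_prod E a) *s case_prod p a)"
proof (rule dot_eqI)
 fix x
 have "dot x f = dot f (\<Sum>a\<in>PP. dot (case_prod p a) x *s case_prod E a)" using expP[of x] by (metis dot_sym)
 then show "dot x f = dot x (\<Sum>a\<in>PP. dot f (case_prod E a) *s case_prod p a)"
  by (simp add: dot_sum dot_sym[of x] mult.commute)
qed
lemma f_eqI: "(\<And>i j. (i,j) \<in> PP \<Longrightarrow> dot f (E i j) = dot g (E i j)) \<Longrightarrow> f = g"
 by (subst p_exp[of f], subst p_exp[of g], rule sum.cong) auto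
lemma l1 [lins]: "lin H \<Longrightarrow> lin (\<lambda>x. mul (H x) c)"
 using bopm lin_comp[of "\<lambda>x. mul x c" H] by (auto simp: bop_def)
lemma l2 [lins]: "lin H \<Longrightarrow> lin (\<lambda>x. mul c (H x))"
 using bopm lin_comp[of "\<lambda>x. mul c x" H] by (auto simp: bop_def)
lemma p_mul: assumes ij: "(i,j) \<in> PP" shows "dot (p i j) (mul x y) = (\<Sum>k\<in>blk (r i). dot (p i k) x * dot (p k j) y)"
proof -
 have "dot (p i j) (mul x y) = (\<Sum>a\<in>PP. \<Sum>b\<in>PP. dot (case_prod p a) x * (dot (case_prod p b) y * dot (p i j) (mul (case_prod E a) (case_prod E b))))"
  by (subst expP[of x], subst expP[of y])
   (simp add: lin_sum[OF l1[OF lin_id]] lin_sum[OF l2[OF lin_id]] linD(2)[OF l1[OF lin_id]] linD(2)[OF l2[OF lin_id]] dot_sum sum_distrib_left, subst sum.swap, simp add: mult.left_commute)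
 also have "\<dots> = (\<Sum>(i1,j1)\<in>PP. \<Sum>(i2,j2)\<in>PP. if j1 = i2 \<and> i1 = i \<and> j2 = j then dot (p i1 j1) x * dot (p i2 j2) y else 0)"
 proof (intro sum.cong refl, clarify, intro sum.cong refl, clarify)
  fix i1 j1 i2 j2 assume a: "(i1,j1) \<in> PP" "(i2,j2) \<in> PP"
  show "dot (p i1 j1) x * (dot (p i2 j2) y * dot (p i j) (mul (E i1 j1) (E i2 j2))) =
    (if j1 = i2 \<and> i1 = i \<and> j2 = j then dot (p i1 j1) x * dot (p i2 j2) y else 0)"
   using a ij by (auto simp: E_mul' pE PP_iff)
 qed
 also have "\<dots> = (\<Sum>(i1,j1)\<in>PP. if i1 = i then dot (p i1 j1) x * dot (p j1 j) y else 0)"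
 proof (intro sum.cong refl, clarify)
  fix i1 j1 assume a: "(i1,j1) \<in> PP"
  have "(\<Sum>(i2,j2)\<in>PP. if j1 = i2 \<and> i1 = i \<and> j2 = j then dot (p i1 j1) x * dot (p i2 j2) y else 0) =
   (\<Sum>c\<in>PP. if c = (j1,j) then (if i1 = i then dot (p i1 j1) x * dot (p j1 j) y else 0) else 0)"
   by (rule sum.cong) (auto split: if_splits)
  also have "\<dots> = (if i1 = i then dot (p i1 j1) x * dot (p j1 j) y else 0)"
   using a ij by (auto simp: PP_iff)
  finally show "(\<Sum>(i2,j2)\<in>PP. if j1 = i2 \<and> i1 = i \<and> j2 = j then dot (p i1 j1) x * dot (p i2 j2) y else 0) =
   (if i1 = i then dot (p i1 j1) x * dot (p j1 j) y else 0)" .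
 qed
 also have "\<dots> = (\<Sum>c\<in>Irr. \<Sum>i1\<in>blk c. \<Sum>j1\<in>blk c. if i1 = i then dot (p i1 j1) x * dot (p j1 j) y else 0)"
  by (rule sumP)
 also have "\<dots> = (\<Sum>c\<in>Irr. if c = r i then \<Sum>j1\<in>blk c. dot (p i j1) x * dot (p j1 j) y else 0)"
 proof (rule sum.cong[OF refl])
  fix c
  have "(\<Sum>i1\<in>blk c. \<Sum>j1\<in>blk c. if i1 = i then dot (p i1 j1) x * dot (p j1 j) y else 0) =
    (\<Sum>i1\<in>blk c. if i1 = i then (\<Sum>j1\<in>blk c. dot (p i j1) x * dot (p j1 j) y) else 0)"
   by (rule sum.cong) auto
  then show "(\<Sum>i1\<in>blk c. \<Sum>j1\<in>blk c. if i1 = i then dot (p i1 j1) x * dot (p j1 j) y else 0) =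
    (if c = r i then \<Sum>j1\<in>blk c. dot (p i j1) x * dot (p j1 j) y else 0)"
   using ij by (auto simp: blk_iff PP_iff)
 qed
 also have "\<dots> = (\<Sum>k\<in>blk (r i). dot (p i k) x * dot (p k j) y)" using ij by (auto simp: Irr_def PP_iff)
 finally show ?thesis .
qed
lemma p_one: "(i,j) \<in> PP \<Longrightarrow> dot (p i j) one = (if i = j then 1 else 0)"
proof -
 assume a: "(i,j) \<in> PP"
 have "dot (p i j) one = (\<Sum>k<m. if k = i then (if i = j then 1 else 0) else 0)"
  unfolding E_one[symmetric] dot_sum
 proof (rule sum.cong[OF refl])
  fix k assume "k \<in> {..<m}"
  then have "(k,k) \<in> PP" by (simp add: PP_iff)
  then show "dot (p i j) (E k k) = (if k = i then if i = j then 1 else 0 else 0)" using a by (simp add: pE')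
 qed
 then show ?thesis using a by (simp add: PP_iff)
qed
lemma p_ce: "(i,j) \<in> PP \<Longrightarrow> c \<in> Irr \<Longrightarrow> dot (p i j) (ce c) = (if i = j \<and> r i = c then 1 else 0)"
proof -
 assume a: "(i,j) \<in> PP" "c \<in> Irr"
 have im: "i < m" using a by (simp add: PP_iff)
 have "dot (p i j) (ce c) = (\<Sum>k\<in>blk c. if i = k \<and> j = k then 1 else 0)"
  unfolding ce_def dot_sum
 proof (rule sum.cong[OF refl])
  fix k assume "k \<in> blk c"
  then have "(k,k) \<in> PP" by (simp add: PP_iff blk_iff)
  then show "dot (p i j) (E k k) = (if i = k \<and> j = k then 1 else 0)" using a by (simp add: pE')
 qed
 also have "\<dots> = (\<Sum>k\<in>blk c. if k = i then (if i = j then 1 else 0) else 0)" by (rule sum.cong[OF refl]) simp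
 also have "\<dots> = (if i \<in> blk c then if i = j then 1 else 0 else 0)" by simp
 also have "\<dots> = (if i = j \<and> r i = c then 1 else 0)" by (simp add: blk_iff im)
 finally show ?thesis .
qed
lemma ce_central: assumes c: "c \<in> Irr" shows "mul (ce c) x = mul x (ce c)"
proof (rule p_eqI)
 fix i j assume ij: "(i,j) \<in> PP"
 have "dot (p i j) (mul (ce c) x) = (\<Sum>k\<in>blk (r i). if k = i then (if r i = c then dot (p i j) x else 0) else 0)"
  unfolding p_mul[OF ij] by (rule sum.cong) (use ij c in \<open>auto simp: p_ce PP_iff blk_iff\<close>)
 moreover have "dot (p i j) (mul x (ce c)) = (\<Sum>k\<in>blk (r i). if k = j then (if r i = c then dot (p i j) x else 0) else 0)"
  unfolding p_mul[OF ij] by (rule sum.cong) (use ij c in \<open>auto simp: p_ce PP_iff blk_iff\<close>)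
 ultimately show "dot (p i j) (mul (ce c) x) = dot (p i j) (mul x (ce c))" using ij by (auto simp: blk_iff PP_iff)
qed
lemma E_mul_x: assumes "(i,j) \<in> PP" "(k,l) \<in> PP" "r i = r k"
 shows "mul (mul (E i j) x) (E k l) = dot (p j k) x *s E i l"
proof (rule p_eqI)
 fix a b assume ab: "(a,b) \<in> PP"
 have m1: "dot (p a t) (mul (E i j) x) = (if a = i then dot (p j t) x else 0)" if "(a,t) \<in> PP" for t
 proof -
  have "dot (p a t) (mul (E i j) x) = (\<Sum>k\<in>blk (r a). if k = j then (if a = i then dot (p j t) x else 0) else 0)"
   unfolding p_mul[OF that] by (rule sum.cong) (use that assms in \<open>auto simp: pE PP_iff blk_iff\<close>)
  then show ?thesis using that assms by (auto simp: blk_iff PP_iff)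
 qed
 have "dot (p a b) (mul (mul (E i j) x) (E k l)) = (\<Sum>t\<in>blk (r a). if t = k then (if a = i \<and> b = l then dot (p j k) x else 0) else 0)"
  unfolding p_mul[OF ab]
 proof (rule sum.cong[OF refl])
  fix t assume t: "t \<in> blk (r a)"
  then have "(a,t) \<in> PP" "(t,b) \<in> PP" using ab by (auto simp: PP_iff blk_iff)
  then show "dot (p a t) (mul (E i j) x) * dot (p t b) (E k l) = (if t = k then (if a = i \<and> b = l then dot (p j k) x else 0) else 0)"
   using assms by (auto simp: m1 pE')
 qed
 also have "\<dots> = (if a = i \<and> b = l then dot (p j k) x else 0)"
  using assms ab by (auto simp: blk_iff PP_iff)
 finally show "dot (p a b) (mul (mul (E i j) x) (E k l)) = dot (p a b) (dot (p j k) x *s E i l)"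
  using assms ab by (auto simp: pE PP_iff)
qed

end

section \<open>Bijectivity of the antipode and integrals of the dual\<close>

context hopf_int begin

lemma ex_wed: "\<exists>m r E p. wed mul one m r E p" by (rule vn.wedderburn)

text \<open>The kernel of S is a two-sided ideal, so if it is nonzero it contains the central
  idempotent z of a block. With L = \<open>Lam\<close> this gives z = S(L_1) L_2 z = S(L_1) z L_2 =
  S(S(z) L_1) L_2 = 0.\<close>

lemma S_inj: assumes "S h = 0" shows "h = 0"
proof (rule ccontr)
 assume h: "h \<noteq> 0"
 obtain m r E p where "wed mul one m r E p" using ex_wed by blast
 then interpret w: wed mul one m r E p .
 obtain i j where ij: "(i,j) \<in> w.PP" "dot (p i j) h \<noteq> 0" using w.p_eqI[of h 0] h by auto
 have i: "i < m" "j < m" "r j = r i" using ij(1) by (simp_all add: w.PP_iff)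
 have S0: "S (mul (mul (E k i) h) (E j k)) = 0" for k by (simp add: S_mul assms mdist)
 have z: "w.ce (r i) = (\<Sum>k\<in>w.blk (r i). (1 / dot (p i j) h) *s mul (mul (E k i) h) (E j k))"
  unfolding w.ce_def
 proof (rule sum.cong[OF refl])
  fix k assume "k \<in> w.blk (r i)"
  then have k: "(k,i) \<in> w.PP" "(j,k) \<in> w.PP" using i by (auto simp: w.PP_iff w.blk_iff)
  have "mul (mul (E k i) h) (E j k) = dot (p i j) h *s E k k"
   by (rule w.E_mul_x[OF k]) (use k i in \<open>auto simp: w.PP_iff\<close>)
  then show "E k k = (1 / dot (p i j) h) *s mul (mul (E k i) h) (E j k)" using ij(2) by simp
 qed
 have c: "r i \<in> w.Irr" using i by (simp add: w.Irr_def)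
 have Sz: "S (w.ce (r i)) = 0" unfolding z by (simp add: lin_sum[OF lin_S] linD(2)[OF lin_S] S0)
 have "dot f (w.ce (r i)) = 0" for f
 proof -
  have "sw cm Lam (\<lambda>p q. dot f (mul (S p) (mul (w.ce (r i)) q))) = sw cm Lam (\<lambda>p q. dot f (mul (S (mul (S (w.ce (r i))) p)) q))"
   by (rule Lam_S) (intro lins)
  also have "\<dots> = 0" by (simp add: Sz mdist lin_0[OF lin_S] sw_def)
  finally have "sw cm Lam (\<lambda>p q. dot f (mul (mul (S p) q) (w.ce (r i)))) = 0"
   by (simp add: w.ce_central[OF c] mul_assoc)
  then show ?thesis by (subst (asm) sw_antil[where f="\<lambda>t. dot f (mul t _)"]) (intro lins, simp)
 qed
 from this[of "p i i"] show False using i c by (simp add: w.p_ce w.PP_iff)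
qed

lemma bij_S: "bij S" by (rule lin_inj_surj[OF lin_S]) (rule S_inj)
definition Si where "Si = inv S"
lemma Si [simp]: "S (Si x) = x" "Si (S x) = x"
 using bij_S unfolding Si_def by (simp_all add: bij_def surj_f_inv_f)
lemma lin_Si [lins]: "lin H \<Longrightarrow> lin (\<lambda>x. Si (H x))"
 using lin_comp[OF lin_inv[OF lin_S bij_S]] unfolding Si_def .
lemma Si_mul: "Si (mul x y) = mul (Si y) (Si x)" by (metis S_mul Si)
lemma Si_one [simp]: "Si one = one" by (metis S_one Si(2))
lemma eps_Si [simp]: "dot eps (Si x) = dot eps x" by (metis Si(1) eps_S)

lemma S_Lam [simp]: "S Lam = Lam" and Lam_r: "mul Lam h = dot eps h *s Lam"
proof -
 have r: "mul (S Lam) y = dot eps y *s S Lam" for y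
 proof -
  have "mul (S Lam) (S (Si y)) = S (mul (Si y) Lam)" by (simp only: S_mul)
  also have "\<dots> = dot eps y *s S Lam" by (simp add: Lam_l linD(2)[OF lin_S])
  finally show ?thesis by simp
 qed
 have "S Lam = mul (S Lam) Lam" by (simp add: r)
 also have "\<dots> = Lam" by (simp add: Lam_l)
 finally show SL: "S Lam = Lam" .
 show "mul Lam h = dot eps h *s Lam" using r[of h] SL by simp
qed

lemma Lam_unique: assumes "\<And>h. mul h x = dot eps h *s x" shows "x = dot eps x *s Lam"
 using assms[of Lam] Lam_r[of x] by simp

text \<open>Used for \<open>phi = S\<^sup>2\<close>, where it says that \<open>h \<mapsto> Tr (L_h S\<^sup>2)\<close> is an integral, and for \<open>phi = id\<close>.\<close>

lemma tr_conv:
 assumes phi: "lin phi"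
  and K: "lin K" "\<And>g x. dot g (K x) = sw cm x (\<lambda>u v. sw cm (phi v) (\<lambda>a b. dot f (mul u (Si a)) * dot g b))"
 shows "sw cm h (\<lambda>a b. dot f a * tr (\<lambda>x. mul b (phi x))) = tr (\<lambda>x. mul h (K x))"
proof -
 \<comment> \<open>The \<open>c i j\<close> are the coefficients of f(ab) on coordinates. They split
   x |-> f(h_1) h_2 phi(x) into a sum of composites of phi, \<open>V j\<close>, left multiplication
   by h and \<open>T (ax i)\<close>; cyclicity of the trace then moves \<open>T (ax i)\<close> to
   the other end.\<close>
 define c where "c i j = dot (mul (ax i) (ax j)) f" for i j :: 'n
 define V where "V j = adj (\<lambda>g. cm (adj Si (ax j)) g)" for j :: 'n
 have lphi [lins]: "lin H \<Longrightarrow> lin (\<lambda>x. phi (H x))" for H by (rule lin_comp[OF phi])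
 have lK [lins]: "lin H \<Longrightarrow> lin (\<lambda>x. K (H x))" for H by (rule lin_comp[OF K(1)])
 have linSi: "lin Si" using lin_Si[OF lin_id] .
 have V: "V j y = T (adj Si (ax j)) y" for j y by (simp add: V_def T_def)
 have lV [lins]: "lin H \<Longrightarrow> lin (\<lambda>x. V j (H x))" for H j unfolding V by (rule lin_T)
 have fc: "F2 = (\<Sum>i\<in>UNIV. \<Sum>j\<in>UNIV. c i j * (dot (ax i) a * dot (ax j) b))" if "F2 = dot f (mul a b)" for F2 a b
  using blin_expand[of "\<lambda>a b. dot f (mul a b)" a b] unfolding c_def that by (simp add: lins dot_sym[of f])
 have swV: "sw cm (V j y) F = sw cm y (\<lambda>p q. dot (ax j) (Si p) * sw cm q F)" if "blin F" for F j y
  unfolding V sw_T[OF that] by (simp add: dot_adj[OF linSi])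
 have dV: "dot g (V j y) = sw cm y (\<lambda>p q. dot (ax j) (Si p) * dot g q)" for g j y
  unfolding V dot_T sw_cm[symmetric] by (simp add: dot_adj[OF linSi])
 have fold: "(\<Sum>i\<in>UNIV. \<Sum>j\<in>UNIV. c i j * (dot (ax i) a * (dot (ax j) b * w))) = dot f (mul a b) * w" for a b w
  unfolding fc[OF refl] by (simp add: sum_distrib_right mult.assoc)
 have key: "(\<Sum>i\<in>UNIV. \<Sum>j\<in>UNIV. c i j *s T (ax i) (mul h (V j y))) = repf (\<lambda>g. sw cm h (\<lambda>a b. dot f a * dot g (mul b y)))" (is "?l = ?r") for y
 proof (rule dot_eqI)
  fix g
  have "dot g ?l = (\<Sum>i\<in>UNIV. \<Sum>j\<in>UNIV. c i j * dot (cm (ax i) g) (mul h (V j y)))"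
   by (simp add: dot_sum dot_T)
  also have "\<dots> = (\<Sum>i\<in>UNIV. \<Sum>j\<in>UNIV. c i j * sw cm h (\<lambda>a b. sw cm y (\<lambda>p q. dot (ax j) (Si p) * sw cm q (\<lambda>c d. dot (ax i) (mul a c) * dot g (mul b d)))))"
   unfolding compat by (subst swV) (intro lins, rule refl)
  also have "\<dots> = (\<Sum>i\<in>UNIV. \<Sum>j\<in>UNIV. c i j * sw cm h (\<lambda>a b. sw cm y (\<lambda>p q. sw cm q (\<lambda>x d. dot (ax i) (mul a x) * (dot (ax j) (Si p) * dot g (mul b d))))))"
   by (simp only: sw_mult[symmetric] mult.left_commute)
  also have "\<dots> = sw cm h (\<lambda>a b. sw cm y (\<lambda>p q. sw cm q (\<lambda>x d. \<Sum>i\<in>UNIV. \<Sum>j\<in>UNIV. c i j * (dot (ax i) (mul a x) * (dot (ax j) (Si p) * dot g (mul b d))))))"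
   by (simp only: sw_sum sw_mult)
  also have "\<dots> = sw cm h (\<lambda>a b. sw cm y (\<lambda>p q. sw cm q (\<lambda>x d. dot f (mul (mul a x) (Si p)) * dot g (mul b d))))"
   by (simp only: fold)
  also have "\<dots> = sw cm h (\<lambda>a b. sw cm y (\<lambda>u d. sw cm u (\<lambda>p x. dot f (mul (mul a x) (Si p)) * dot g (mul b d))))"
   by (subst sw_coassoc[of "\<lambda>p x d. dot f (mul (mul _ x) (Si p)) * dot g (mul _ d)"]) (intro lins, rule refl)
  also have "\<dots> = sw cm h (\<lambda>a b. sw cm y (\<lambda>u d. dot eps u * (dot f a * dot g (mul b d))))"
  proof -
   have "sw cm u (\<lambda>p x. dot f (mul (mul a x) (Si p))) = dot eps u * dot f a" for a u
   proof -
    have "mul (mul a x) (Si p) = mul a (Si (mul p (S x)))" for p x by (simp add: Si_mul mul_assoc)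
    then show ?thesis using sw_antir[of "\<lambda>t. dot f (mul a (Si t))" u] by (simp add: lins)
   qed
   then show ?thesis by (simp only: sw_mult mult.assoc)
  qed
  also have "\<dots> = sw cm h (\<lambda>a b. dot f a * dot g (mul b y))"
   by (subst sw_counitl, intro lins, rule refl)
  also have "\<dots> = dot g ?r" by (subst dot_sym, rule dot_repf[symmetric]) (intro lins)
  finally show "dot g ?l = dot g ?r" .
 qed
 have "sw cm h (\<lambda>a b. dot f a * tr (\<lambda>x. mul b (phi x))) = tr (\<lambda>x. repf (\<lambda>g. sw cm h (\<lambda>a b. dot f a * dot g (mul b (phi x)))))"
 proof -
  have "dot (ax i) (repf (\<lambda>g. sw cm h (\<lambda>a b. dot f a * dot g (mul b (phi x))))) = sw cm h (\<lambda>a b. dot f a * dot (ax i) (mul b (phi x)))" for i x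
   by (subst dot_sym, rule dot_repf) (intro lins)
  then show ?thesis unfolding tr_def by (simp add: sw_sum sum_distrib_left)
 qed
 also have "\<dots> = tr (\<lambda>x. \<Sum>i\<in>UNIV. \<Sum>j\<in>UNIV. c i j *s T (ax i) (mul h (V j (phi x))))" by (simp only: key)
 also have "\<dots> = (\<Sum>i\<in>UNIV. \<Sum>j\<in>UNIV. c i j * tr (\<lambda>x. T (ax i) (mul h (V j (phi x)))))"
  by (simp add: tr_sum tr_scale)
 also have "\<dots> = (\<Sum>i\<in>UNIV. \<Sum>j\<in>UNIV. c i j * tr (\<lambda>x. mul h (V j (phi (T (ax i) x)))))"
 proof -
  have "tr (\<lambda>x. T (ax i) (mul h (V j (phi x)))) = tr (\<lambda>x. mul h (V j (phi (T (ax i) x))))" for i j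
  proof (rule tr_comm[of "T (ax i)" "\<lambda>x. mul h (V j (phi x))"])
   show "lin (T (ax i))" using lin_T(1)[OF lin_id] by simp
   show "lin (\<lambda>x. mul h (V j (phi x)))" by (intro lins)
  qed
  then show ?thesis by simp
 qed
 also have "\<dots> = tr (\<lambda>x. mul h (\<Sum>i\<in>UNIV. \<Sum>j\<in>UNIV. c i j *s V j (phi (T (ax i) x))))"
  by (simp add: tr_sum tr_scale msum mdist)
 also have "(\<lambda>x. \<Sum>i\<in>UNIV. \<Sum>j\<in>UNIV. c i j *s V j (phi (T (ax i) x))) = K"
 proof (rule ext, rule dot_eqI)
  fix x g
  have l: "linf (\<lambda>z. sw cm (phi z) (\<lambda>p q. dot (ax j) (Si p) * dot g q))" for j by (intro lins)
  have "dot g (\<Sum>i\<in>UNIV. \<Sum>j\<in>UNIV. c i j *s V j (phi (T (ax i) x))) = (\<Sum>i\<in>UNIV. \<Sum>j\<in>UNIV. c i j * sw cm x (\<lambda>a b. dot (ax i) a * sw cm (phi b) (\<lambda>p q. dot (ax j) (Si p) * dot g q)))"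
   by (simp add: dot_sum dV linf_T[OF l] del: dot_ax)
  also have "\<dots> = sw cm x (\<lambda>a b. sw cm (phi b) (\<lambda>p q. \<Sum>i\<in>UNIV. \<Sum>j\<in>UNIV. c i j * (dot (ax i) a * (dot (ax j) (Si p) * dot g q))))"
   by (simp only: sw_sum sw_mult)
  also have "\<dots> = dot g (K x)" by (simp only: fold K(2))
  finally show "dot g (\<Sum>i\<in>UNIV. \<Sum>j\<in>UNIV. c i j *s V j (phi (T (ax i) x))) = dot g (K x)" .
 qed
 finally show ?thesis .
qed

text \<open>The candidate of Larson and Radford for an integral of the dual. Its value at
  \<open>one\<close> is Tr S^2, and the dual is semisimple once this is nonzero.\<close>

definition lam where "lam = repf (\<lambda>h. tr (\<lambda>x. mul h (S (S x))))"
lemma dot_lam: "dot lam h = tr (\<lambda>x. mul h (S (S x)))"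
 unfolding lam_def by (rule dot_repf) (intro lins)
lemma lam_Lam [simp]: "dot lam Lam = 1"
proof -
 have "linf (\<lambda>x. dot eps (S (S x)))" by (intro lins)
 from tr_rank1[OF this, of Lam] show ?thesis by (simp add: dot_lam Lam_r)
qed
lemma cm_lam: "cm f lam = dot f one *s lam"
proof (rule dot_eqI, subst (1 2) dot_sym)
 fix h
 have "dot (cm f lam) h = sw cm h (\<lambda>a b. dot f a * tr (\<lambda>x. mul b (S (S x))))"
  by (simp add: sw_cm[symmetric] dot_lam)
 also have "\<dots> = tr (\<lambda>x. mul h (dot f one *s S (S x)))"
 proof (rule tr_conv)
  show "lin (\<lambda>x. S (S x))" "lin (\<lambda>x. dot f one *s S (S x))" by (intro lins)+
  fix g x
  have "sw cm x (\<lambda>u v. sw cm (S (S v)) (\<lambda>a b. dot f (mul u (Si a)) * dot g b)) =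
    sw cm x (\<lambda>u v. sw cm v (\<lambda>a b. dot f (mul u (S a)) * dot g (S (S b))))"
   by (subst sw_S, intro lins, subst sw_S, intro lins) simp
  also have "\<dots> = sw cm x (\<lambda>w b. sw cm w (\<lambda>u a. dot f (mul u (S a)) * dot g (S (S b))))"
   by (rule sw_coassoc[symmetric]) (intro lins)
  also have "\<dots> = sw cm x (\<lambda>w b. dot eps w * (dot f one * dot g (S (S b))))"
   by (simp only: sw_mult antir mult.assoc)
  also have "\<dots> = dot g (dot f one *s S (S x))"
   by (subst sw_counitl) (intro lins, simp)
  finally show "dot g (dot f one *s S (S x)) = sw cm x (\<lambda>u v. sw cm (S (S v)) (\<lambda>a b. dot f (mul u (Si a)) * dot g b))" by simp
 qed
 also have "\<dots> = dot (dot f one *s lam) h" by (simp add: dot_lam mdist tr_scale)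
 finally show "dot (cm f lam) h = dot (dot f one *s lam) h" .
qed

definition rho where "rho = repf (\<lambda>h. tr (\<lambda>x. mul h x))"
lemma dot_rho: "dot rho h = tr (\<lambda>x. mul h x)"
 unfolding rho_def by (rule dot_repf) (intro lins)
lemma rho_Lam [simp]: "dot rho Lam = 1"
 using tr_rank1[OF linf_dot(1)[of eps], of Lam] by (simp add: dot_rho Lam_r)
lemma rho_one [simp]: "dot rho one = of_nat CARD('n)" by (simp add: dot_rho tr_id)
lemma rho_trace: "dot rho (mul x y) = dot rho (mul y x)"
 unfolding dot_rho mul_assoc by (rule tr_comm) (intro lins)+
text \<open>Without S^2 the factors u and S^-1(a) stand in an order in which the antipode law does
  not cancel them; the trace property of f exchanges them.\<close>

lemma cm_rho: assumes f: "\<And>x y. dot f (mul x y) = dot f (mul y x)" shows "cm f rho = dot f one *s rho"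
proof (rule dot_eqI, subst (1 2) dot_sym)
 fix h
 have "dot (cm f rho) h = sw cm h (\<lambda>a b. dot f a * tr (\<lambda>x. mul b x))"
  by (simp add: sw_cm[symmetric] dot_rho)
 also have "\<dots> = tr (\<lambda>x. mul h (dot f one *s x))"
 proof (rule tr_conv)
  show "lin (\<lambda>x. x)" "lin (\<lambda>x. dot f one *s x)" by (intro lins)+
  fix g x
  have "sw cm x (\<lambda>u v. sw cm v (\<lambda>a b. dot f (mul u (Si a)) * dot g b)) =
    sw cm x (\<lambda>w b. sw cm w (\<lambda>u a. dot f (mul u (Si a)) * dot g b))"
   by (rule sw_coassoc[symmetric]) (intro lins)
  also have "\<dots> = sw cm x (\<lambda>w b. sw cm w (\<lambda>u a. dot f (Si (mul (S u) a))) * dot g b)"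
   by (simp add: Si_mul f sw_mult)
  also have "\<dots> = sw cm x (\<lambda>w b. dot eps w * (dot f one * dot g b))"
  proof -
   have "sw cm w (\<lambda>u a. dot f (Si (mul (S u) a))) = dot eps w * dot f one" for w
    using sw_antil[of "\<lambda>t. dot f (Si t)" w] by (simp add: lins)
   then show ?thesis by (simp add: mult.assoc)
  qed
  also have "\<dots> = dot g (dot f one *s x)"
   by (subst sw_counitl) (intro lins, simp)
  finally show "dot g (dot f one *s x) = sw cm x (\<lambda>u v. sw cm v (\<lambda>a b. dot f (mul u (Si a)) * dot g b))" by simp
 qed
 also have "\<dots> = dot (dot f one *s rho) h" by (simp add: dot_rho mdist tr_scale)
 finally show "dot (cm f rho) h = dot (dot f one *s rho) h" .
qed

end

section \<open>Traces and roots of unity\<close>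

definition ratev :: "'a::field_char_0 \<Rightarrow> rat poly \<Rightarrow> 'a" where
 "ratev x p = poly (map_poly of_rat p) x"

lemma ratev_0 [simp]: "ratev x 0 = 0" by (simp add: ratev_def)
lemma ratev_pCons [simp]: "ratev x (pCons a p) = of_rat a + x * ratev x p" by (simp add: ratev_def map_poly_pCons)
lemma ratev_add: "ratev x (p + q) = ratev x p + ratev x q"
 by (induction p q rule: poly_induct2) (simp_all add: of_rat_add algebra_simps)
lemma ratev_smult: "ratev x (smult c p) = of_rat c * ratev x p"
 by (induction p) (simp_all add: of_rat_mult algebra_simps)
lemma ratev_mult: "ratev x (p * q) = ratev x p * ratev x q"
 by (induction p) (simp_all add: ratev_add ratev_smult algebra_simps)
lemma ratev_monom: "ratev x (monom c n) = of_rat c * x ^ n"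
 by (induction n) (simp_all add: monom_0 monom_Suc)
lemma ratev_sum: "ratev x (\<Sum>i\<in>I. p i) = (\<Sum>i\<in>I. ratev x (p i))"
 by (induction I rule: infinite_finite_induct) (simp_all add: ratev_add)

lemma ratev_min:
 fixes x :: "'a::field_char_0"
 assumes "q \<noteq> 0" "ratev x q = 0"
 obtains f where "f \<noteq> 0" "ratev x f = 0" "\<And>p. ratev x p = 0 \<Longrightarrow> f dvd p"
proof -
 define f where "f = arg_min degree (\<lambda>p. p \<noteq> 0 \<and> ratev x p = 0)"
 have f: "f \<noteq> 0 \<and> ratev x f = 0"
  unfolding f_def by (rule arg_min_natI[of _ q]) (use assms in simp)
 have min: "degree f \<le> degree p" if "p \<noteq> 0" "ratev x p = 0" for p
  unfolding f_def by (rule arg_min_nat_le) (use that in simp)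
 have "f dvd p" if "ratev x p = 0" for p
 proof -
  have "ratev x (p mod f) = 0"
   using that ratev_add[of x "p div f * f" "p mod f"] f by (simp add: ratev_mult)
  moreover have "p mod f = 0 \<or> degree (p mod f) < degree f" using f degree_mod_less by blast
  ultimately have "p mod f = 0" using min by fastforce
  then show ?thesis by blast
 qed
 with f that show ?thesis by blast
qed

text \<open>Makes positivity available over k: an algebraic complex number has a counterpart in k
  with the same minimal polynomial, so vanishing of a rational polynomial may be decided in the
  complex numbers.\<close>

lemma root_transfer:
 fixes w :: complex
 assumes "q \<noteq> 0" "ratev w q = 0"
 shows "\<exists>z :: 'k::{alg_closed_field,field_char_0}. \<forall>p. ratev z p = 0 \<longleftrightarrow> ratev w p = 0"
proof -
 obtain f where f: "f \<noteq> 0" "ratev w f = 0" "\<And>p. ratev w p = 0 \<Longrightarrow> f dvd p" using ratev_min[OF assms] by blast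
 have df: "degree f > 0"
 proof (rule ccontr)
  assume "\<not> ?thesis"
  then obtain a where "f = [:a:]" using degree_eq_zeroE by blast
  then show False using f by simp
 qed
 have "degree (map_poly of_rat f :: 'k poly) > 0" using df by (simp add: degree_map_poly)
 then obtain z :: 'k where z: "ratev z f = 0" using alg_closed_imp_poly_has_root unfolding ratev_def by blast
 obtain g where g: "g \<noteq> 0" "ratev z g = 0" "\<And>p. ratev z p = 0 \<Longrightarrow> g dvd p" using ratev_min[OF f(1) z] by blast
 obtain h where h: "f = g * h" using g(3)[OF z] by blast
 have h0: "h \<noteq> 0" using h f by auto
 have gw: "ratev w g = 0"
 proof (rule ccontr)
  assume "ratev w g \<noteq> 0"
  then have "ratev w h = 0" using f(2) by (simp add: h ratev_mult)
  then have "f dvd h" by (rule f(3))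
  then have "degree f \<le> degree h" using h0 by (rule dvd_imp_degree_le)
  then have "degree g = 0" using h g(1) h0 by (simp add: degree_mult_eq)
  then obtain a where "g = [:a:]" using degree_eq_zeroE by blast
  then show False using g by simp
 qed
 have "ratev z p = 0 \<longleftrightarrow> ratev w p = 0" for p
 proof
  assume "ratev z p = 0"
  then have "g dvd p" by (rule g(3))
  then show "ratev w p = 0" using gw by (auto simp: ratev_mult elim!: dvdE)
 next
  assume "ratev w p = 0"
  then have "f dvd p" by (rule f(3))
  then show "ratev z p = 0" using z by (auto simp: ratev_mult elim!: dvdE)
 qed
 then show ?thesis by blast
qed

definition cw :: "nat \<Rightarrow> complex" where "cw M = cis (2 * pi / real M)"
lemma cw_pow: "M > 0 \<Longrightarrow> cw M ^ M = 1" by (simp add: cw_def DeMoivre)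
lemma cw_prim: assumes "0 < j" "j < M" shows "cw M ^ j \<noteq> 1"
proof
 assume "cw M ^ j = 1"
 then have "cis (2 * pi * (real j / real M)) = 1" by (simp add: cw_def DeMoivre mult_ac)
 then have c: "cos (2 * pi * (real j / real M)) = 1" by (simp add: complex_eq_iff)
 then obtain n :: int where "2 * pi * (real j / real M) = of_int n * 2 * pi" unfolding cos_one_2pi_int by blast
 then have "(2 * pi) * (real j / real M) = (2 * pi) * of_int n" by (simp only: mult_ac)
 then have "real j / real M = of_int n" by (subst (asm) mult_left_cancel) simp_all
 moreover have "0 < real j / real M" "real j / real M < 1" using assms by simp_all
 ultimately show False by simp
qed
lemma cw_cnj: "M > 0 \<Longrightarrow> cw M ^ (M - 1) = cnj (cw M)"
proof -
 assume M: "M > 0"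
 have n: "cw M * cnj (cw M) = 1" by (simp add: cw_def complex_mult_cnj cmod_def flip: complex_norm_square)
 have "cw M * cw M ^ (M - 1) = 1" using cw_pow[OF M] M by (simp flip: power_Suc)
 then show ?thesis using n by (metis mult.left_commute mult.right_neutral mult.assoc mult.commute)
qed

lemma ex_root:
 assumes M: "M > 0"
 shows "\<exists>z :: 'k::{alg_closed_field,field_char_0}. \<forall>p. ratev z p = 0 \<longleftrightarrow> ratev (cw M) p = 0"
proof (rule root_transfer)
 show "monom 1 M - 1 \<noteq> (0 :: rat poly)"
 proof
  assume "monom 1 M - 1 = (0 :: rat poly)"
  then have "coeff (monom 1 M - 1 :: rat poly) M = 0" by simp
  then show False using M by (simp add: coeff_1)
 qed
 have "ratev (cw M) (monom 1 M - 1 + 1) = ratev (cw M) (monom 1 M - 1) + ratev (cw M) 1" by (rule ratev_add)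
 then show "ratev (cw M) (monom 1 M - 1) = 0" using cw_pow[OF M] by (simp add: ratev_monom one_pCons)
qed

lemma root_pow:
 fixes z :: "'k::{alg_closed_field,field_char_0}"
 assumes "M > 0" "\<And>p. ratev z p = 0 \<longleftrightarrow> ratev (cw M) p = 0"
 shows "z ^ M = 1" "0 < j \<Longrightarrow> j < M \<Longrightarrow> z ^ j \<noteq> 1"
proof -
 have r: "ratev x (monom 1 j + [:-1:]) = x ^ j - 1" for x :: "'b::field_char_0" and j
  by (simp add: ratev_add ratev_monom)
 show "z ^ M = 1" using assms(2)[of "monom 1 M + [:-1:]"] cw_pow[OF assms(1)] by (simp add: r)
 show "0 < j \<Longrightarrow> j < M \<Longrightarrow> z ^ j \<noteq> 1" using assms(2)[of "monom 1 j + [:-1:]"] cw_prim by (simp add: r)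
qed

text \<open>Replacing \<open>z\<close> by a complex primitive root of unity turns each summand into a squared modulus.\<close>

lemma norm_sum_nz:
 fixes z :: "'k::{alg_closed_field,field_char_0}" and a :: "'c \<Rightarrow> nat \<Rightarrow> nat"
 assumes M: "M > 0" and z: "\<And>p. ratev z p = 0 \<longleftrightarrow> ratev (cw M) p = 0" and fin: "finite C"
  and nz: "\<exists>c\<in>C. (\<Sum>j<M. of_nat (a c j) * z ^ j) \<noteq> 0"
 shows "(\<Sum>c\<in>C. (\<Sum>j<M. of_nat (a c j) * z ^ j) * (\<Sum>j<M. of_nat (a c j) * z ^ ((M - 1) * j))) \<noteq> 0"
proof
 define A where "A c = (\<Sum>j<M. monom (of_nat (a c j) :: rat) j)" for c
 \<comment> \<open>The exponent (M - 1) j represents -j; at the complex root \<open>cw M\<close>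
   this makes \<open>B c\<close> the conjugate of \<open>A c\<close>.\<close>
 define B where "B c = (\<Sum>j<M. monom (of_nat (a c j) :: rat) ((M - 1) * j))" for c
 have A: "ratev x (A c) = (\<Sum>j<M. of_nat (a c j) * x ^ j)" for x :: "'b::field_char_0" and c
  by (simp add: A_def ratev_sum ratev_monom)
 have B: "ratev x (B c) = (\<Sum>j<M. of_nat (a c j) * x ^ ((M - 1) * j))" for x :: "'b::field_char_0" and c
  by (simp add: B_def ratev_sum ratev_monom)
 assume "(\<Sum>c\<in>C. (\<Sum>j<M. of_nat (a c j) * z ^ j) * (\<Sum>j<M. of_nat (a c j) * z ^ ((M - 1) * j))) = 0"
 then have "ratev z (\<Sum>c\<in>C. A c * B c) = 0" by (simp add: ratev_sum ratev_mult A B)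
 then have "ratev (cw M) (\<Sum>c\<in>C. A c * B c) = 0" using z by blast
 moreover have "ratev (cw M) (B c) = cnj (ratev (cw M) (A c))" for c
  unfolding A B by (simp add: power_mult cw_cnj[OF M, simplified])
 ultimately have "(\<Sum>c\<in>C. ratev (cw M) (A c) * cnj (ratev (cw M) (A c))) = 0" by (simp add: ratev_sum ratev_mult)
 then have "(\<Sum>c\<in>C. complex_of_real ((cmod (ratev (cw M) (A c)))\<^sup>2)) = 0" by (simp only: complex_norm_square)
 then have "(\<Sum>c\<in>C. (cmod (ratev (cw M) (A c)))\<^sup>2) = 0" by (metis of_real_sum of_real_eq_0_iff)
 then have "\<forall>c\<in>C. ratev (cw M) (A c) = 0" using fin by (simp add: sum_nonneg_eq_0_iff)
 then have "\<forall>c\<in>C. ratev z (A c) = 0" using z by blast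
 then show False using nz by (simp add: A)
qed

lemma linf_bij_rep:
 fixes be :: "'k::field^'n::finite \<Rightarrow> 'k^'n \<Rightarrow> 'k"
 assumes b: "blin be" and nd: "\<And>y. (\<And>x. be x y = 0) \<Longrightarrow> y = 0" and F: "linf F"
 shows "\<exists>y. \<forall>x. F x = be x y"
proof -
 define \<Phi> where "\<Phi> y = repf (\<lambda>x. be x y)" for y
 have d: "dot (\<Phi> y) x = be x y" for x y unfolding \<Phi>_def by (rule dot_repf[OF blinD(2)[OF b]])
 have "lin \<Phi>" unfolding lin_def
  by (intro conjI allI; rule dot_eqI; subst (1 2) dot_sym; simp add: d linfD(1)[OF blinD(1)[OF b]] linfD(2)[OF blinD(1)[OF b]] dot_sym[of _ "\<Phi> _"])
 moreover have "y = 0" if "\<Phi> y = 0" for y using nd[of y] d[of y] that by simp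
 ultimately have "bij \<Phi>" by (rule lin_inj_surj)
 then obtain y where "\<Phi> y = repf F" by (metis bij_pointE)
 then have "F x = be x y" for x using d[of y x] dot_repf[OF F, of x] by simp
 then show ?thesis by blast
qed

section \<open>Grouplike elements\<close>

context hopf begin

definition gl :: "'k^'n \<Rightarrow> bool" where
 "gl g \<longleftrightarrow> (\<forall>f h. dot (cm f h) g = dot f g * dot h g) \<and> dot eps g = 1"

lemma gl_one: "gl one" by (simp add: gl_def one_cm)
lemma sw_gl: assumes "gl g" "blin F" shows "sw cm g F = F g g"
proof -
 obtain c where c: "F = (\<lambda>a b. \<Sum>i\<in>UNIV. \<Sum>j\<in>UNIV. c i j * (dot (ax i) a * dot (ax j) b))"
  using blin_ex[OF assms(2)] by blast
 show ?thesis using assms(1) by (simp only: c sw_sum sw_mult sw_cm gl_def)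
qed
lemma gl_mul: assumes "gl g" "gl h" shows "gl (mul g h)"
 unfolding gl_def
proof (intro conjI allI)
 fix f k
 have "dot (cm f k) (mul g h) = sw cm g (\<lambda>a b. dot f (mul a h) * dot k (mul b h))"
  unfolding compat by (subst sw_gl[OF assms(2)]) (intro lins, rule refl)
 also have "\<dots> = dot f (mul g h) * dot k (mul g h)" by (rule sw_gl[OF assms(1)]) (intro lins)
 finally show "dot (cm f k) (mul g h) = dot f (mul g h) * dot k (mul g h)" .
 show "dot eps (mul g h) = 1" using assms by (simp add: eps_mul gl_def)
qed
lemma gl_S: assumes "gl g" shows "gl (S g)"
 using assms by (simp add: gl_def S_cm dot_adjS)
lemma gl_inv: assumes "gl g" shows "mul (S g) g = one" "mul g (S g) = one"
proof -
 have "dot f (mul (S g) g) = dot f one" for f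
  using antil[of g f] sw_gl[OF assms, of "\<lambda>a b. dot f (mul (S a) b)"] assms by (simp add: lins gl_def)
 then show "mul (S g) g = one" by (rule dot_eqI)
 have "dot f (mul g (S g)) = dot f one" for f
  using antir[of g f] sw_gl[OF assms, of "\<lambda>a b. dot f (mul a (S b))"] assms by (simp add: lins gl_def)
 then show "mul g (S g) = one" by (rule dot_eqI)
qed
lemma gl_cancel: "gl g \<Longrightarrow> mul g x = mul g y \<Longrightarrow> x = y" "gl g \<Longrightarrow> mul x g = mul y g \<Longrightarrow> x = y"
 by (metis gl_inv mul_assoc mul_one)+
text \<open>Grouplike elements are multiplicative functionals on the dual algebra, so functions that
  separate g from single elements of B can be multiplied. This is the linear independence of
  characters.\<close>

lemma gl_sep:
 assumes "finite B" "\<forall>b\<in>B. gl b" "gl g" "g \<notin> B"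
 shows "\<exists>f. dot f g = 1 \<and> (\<forall>b\<in>B. dot f b = 0)"
 using assms
proof (induction B rule: finite_induct)
 case empty then show ?case by (intro exI[of _ eps]) (simp add: gl_def)
next
 case (insert b B)
 then obtain f where f: "dot f g = 1" "\<forall>b\<in>B. dot f b = 0" by auto
 obtain h where h: "dot h g \<noteq> dot h b" using insert.prems by (metis dot_eqI insert_iff)
 define k where "k = (1 / (dot h g - dot h b)) *s (h - dot h b *s eps)"
 have k: "dot k g = 1" "dot k b = 0" using h insert.prems by (auto simp: k_def gl_def)
 have "dot (cm f k) x = dot f x * dot k x" if "gl x" for x using that by (simp add: gl_def)
 then show ?case using insert.prems f k by (intro exI[of _ "cm f k"]) auto
qed

lemma gl_card: assumes "finite B" "\<forall>b\<in>B. gl b" shows "card B \<le> CARD('n)"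
proof -
 obtain e where e: "bij_betw e {..<card B} B" using ex_bij_betw_nat_finite[OF assms(1)] by (auto simp: atLeast0LessThan)
 have "\<exists>f. dot f (e i) = 1 \<and> (\<forall>b\<in>B - {e i}. dot f b = 0)" if "i < card B" for i
  by (rule gl_sep) (use assms e that in \<open>auto dest: bij_betw_apply\<close>)
 then obtain f where f: "\<And>i. i < card B \<Longrightarrow> dot (f i) (e i) = 1 \<and> (\<forall>b\<in>B - {e i}. dot (f i) b = 0)" by metis
 have "dot (f i) (e j) = (if i = j then 1 else 0)" if "i < card B" "j < card B" for i j
 proof (cases "i = j")
  case False
  then have "e j \<in> B - {e i}" using e that by (auto simp: bij_betw_def inj_on_def)
  then show ?thesis using f[OF that(1)] False by auto
 qed (use f that in auto)
 then show ?thesis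
  using biorth_bound[of "card B" f e] by (simp add: dot_def)
qed

lemma gl_finite: "finite {g. gl g}"
proof (rule ccontr)
 assume "infinite {g. gl g}"
 then obtain B where "finite B" "card B = Suc CARD('n)" "B \<subseteq> {g. gl g}" using infinite_arbitrarily_large by blast
 then show False using gl_card[of B] by auto
qed

definition pw :: "'k^'n \<Rightarrow> nat \<Rightarrow> 'k^'n" where "pw x k = ((mul x) ^^ k) one"
lemma pw_0 [simp]: "pw x 0 = one" by (simp add: pw_def)
lemma pw_Suc: "pw x (Suc k) = mul x (pw x k)" by (simp add: pw_def)
lemma pw_add: "pw x (j + k) = mul (pw x j) (pw x k)"
 by (induction j) (simp_all add: pw_Suc mul_assoc)
lemma pw_one [simp]: "pw one k = one" by (induction k) (simp_all add: pw_Suc)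
lemma gl_pw: "gl g \<Longrightarrow> gl (pw g k)" by (induction k) (simp_all add: gl_one pw_Suc gl_mul)
lemma gl_order: assumes "gl g" shows "\<exists>k>0. pw g k = one"
proof -
 have "\<not> inj_on (pw g) UNIV"
 proof
  assume i: "inj_on (pw g) UNIV"
  have "finite (range (pw g))" by (rule finite_subset[OF _ gl_finite]) (use gl_pw[OF assms] in auto)
  then show False using i finite_imageD by blast
 qed
 then obtain i j where ij: "i < j" "pw g i = pw g j" unfolding inj_on_def by (metis linorder_neqE_nat)
 then have "mul (pw g i) one = mul (pw g i) (pw g (j - i))" using pw_add[of g i "j - i"] by simp
 then have "pw g (j - i) = one" using gl_cancel(1)[OF gl_pw[OF assms]] by metis
 then show ?thesis using ij by (intro exI[of _ "j - i"]) simp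
qed

end

section \<open>The Frobenius form of the integral and the fourth power of the antipode\<close>

context hopf_int begin

lemma left_int: assumes mu: "\<And>f. cm f mu = dot f one *s mu"
 shows "linf F \<Longrightarrow> sw cm h (\<lambda>a b. F a * dot mu b) = F one * dot mu h"
 using sw_cm[of h "repf F" mu] mu[of "repf F"] by (simp add: dot_repf)

text \<open>Since mu is an integral, g(S(x_1)) mu(x_2 y) expands to g(S(x_1) x_2 y_1) mu(x_3 y_2),
  where the antipode law cancels S(x_1) x_2.\<close>

lemma int_swap: assumes mu: "\<And>f. cm f mu = dot f one *s mu"
 shows "sw cm y (\<lambda>a b. dot g a * dot mu (mul x b)) = sw cm x (\<lambda>a b. dot g (S a) * dot mu (mul b y))"
proof -
 have "sw cm x (\<lambda>a b. dot g (S a) * dot mu (mul b y)) = sw cm x (\<lambda>a b. sw cm (mul b y) (\<lambda>u v. dot g (mul (S a) u) * dot mu v))"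
  by (subst left_int[OF mu]) (intro lins, simp)
 also have "\<dots> = sw cm x (\<lambda>a b. sw cm b (\<lambda>b1 b2. sw cm y (\<lambda>y1 y2. dot g (mul (S a) (mul b1 y1)) * dot mu (mul b2 y2))))"
  by (subst sw_mul) (intro lins, rule refl)
 also have "\<dots> = sw cm x (\<lambda>u b2. sw cm u (\<lambda>a b1. sw cm y (\<lambda>y1 y2. dot g (mul (S a) (mul b1 y1)) * dot mu (mul b2 y2))))"
  by (rule sw_coassoc[symmetric]) (intro lins)
 also have "\<dots> = sw cm x (\<lambda>u b2. dot eps u * sw cm y (\<lambda>y1 y2. dot g y1 * dot mu (mul b2 y2)))"
 proof -
  have "sw cm u (\<lambda>a b1. sw cm y (\<lambda>y1 y2. dot g (mul (mul (S a) b1) y1) * dot mu (mul b2 y2))) =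
   dot eps u * sw cm y (\<lambda>y1 y2. dot g (mul one y1) * dot mu (mul b2 y2))" for u b2
   by (rule sw_antil[where f="\<lambda>t. sw cm y (\<lambda>y1 y2. dot g (mul t y1) * dot mu (mul b2 y2))"]) (intro lins)
  then show ?thesis by (simp add: mul_assoc)
 qed
 also have "\<dots> = sw cm y (\<lambda>a b. dot g a * dot mu (mul x b))"
  by (rule sw_counitl) (intro lins)
 finally show ?thesis by simp
qed

text \<open>The case x = \<open>Lam\<close> of \<open>int_swap\<close>. For mu = \<open>lam\<close>
  it says that S(L_1) and L_2, with L = \<open>Lam\<close>, are dual bases for the form lam(xy),
  which is therefore nondegenerate.\<close>

lemma dual_basis_mu: assumes mu: "\<And>f. cm f mu = dot f one *s mu"
 shows "sw cm Lam (\<lambda>a b. dot g (S a) * dot mu (mul b y)) = dot g y * dot mu Lam"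
proof -
 have "sw cm y (\<lambda>a b. dot g a * dot mu (mul Lam b)) = sw cm y (\<lambda>a b. (dot eps b * dot g a) * dot mu Lam)"
  by (simp add: Lam_r mult_ac)
 also have "\<dots> = dot g y * dot mu Lam"
  unfolding sw_mult by (subst sw_counitr) (intro lins, rule refl)
 finally show ?thesis by (simp only: int_swap[OF mu])
qed

lemma dual_basis: "linf F \<Longrightarrow> sw cm Lam (\<lambda>a b. F (S a) * dot lam (mul b y)) = F y"
 using dual_basis_mu[of lam "repf F" y] cm_lam by (simp add: dot_repf)

lemma lam_nd: assumes "\<And>x. dot lam (mul x y) = 0" shows "y = 0"
proof (rule dot_eqI)
 fix f show "dot f y = dot f 0" using dual_basis[of "dot f" y] by (simp add: assms lins sw_def)
qed

lemma lam_rep: "linf F \<Longrightarrow> \<exists>y. \<forall>x. F x = dot lam (mul x y)"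
proof (rule linf_bij_rep[of "\<lambda>x y. dot lam (mul x y)"])
 show "blin (\<lambda>x y. dot lam (mul x y))" by (intro lins)
qed (auto intro: lam_nd)

text \<open>S^2 is the Nakayama automorphism of the Frobenius form lam(xy). The defect
  \<open>phi\<close> is represented by a vector c, and \<open>Lam_S\<close> with the dual bases
  shows that every functional vanishes on c.\<close>

lemma lam_nak: "dot lam (mul x z) = dot lam (mul z (S (S x)))"
proof -
 define phi where "phi b = dot lam (mul x b) - dot lam (mul b (S (S x)))" for b
 have lphi: "linf phi" unfolding phi_def by (intro lins)
 obtain c where c: "\<And>b. phi b = dot lam (mul b c)" using lam_rep[OF lphi] by blast
 have "dot g c = 0" for g
 proof -
  have "sw cm Lam (\<lambda>a b. dot g (S a) * dot lam (mul x b)) = sw cm Lam (\<lambda>p q. dot g (S p) * dot lam (mul (mul x q) one))" by simp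
  also have "\<dots> = sw cm Lam (\<lambda>p q. dot g (S (mul (S x) p)) * dot lam (mul q one))"
   using Lam_S[of "\<lambda>p q. dot g (S p) * dot lam (mul q one)" x] by (simp add: lins)
  also have "\<dots> = dot g (S (S x))"
   unfolding S_mul using dual_basis[of "\<lambda>t. dot g (mul t (S (S x)))" one] by (simp add: lins)
  also have "\<dots> = sw cm Lam (\<lambda>a b. dot g (S a) * dot lam (mul b (S (S x))))"
   by (rule dual_basis[symmetric]) (intro lins)
  finally have "sw cm Lam (\<lambda>a b. dot g (S a) * phi b) = 0"
   by (simp add: phi_def right_diff_distrib sw_diff)
  then show ?thesis unfolding c using dual_basis[of "dot g" c] by (simp add: lins)
 qed
 then have "c = 0" by (intro dot_eqI) simp
 then show ?thesis using c[of z] by (simp add: phi_def mdist)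
qed

lemma lamS_int: "linf F \<Longrightarrow> sw cm h (\<lambda>a b. F b * dot lam (S a)) = F one * dot lam (S h)"
proof -
 assume F: "linf F"
 have l: "linf (\<lambda>x. F (Si x))" by (rule linf_comp[OF F]) (intro lins)
 have "sw cm (S h) (\<lambda>a b. F (Si a) * dot lam b) = F one * dot lam (S h)"
  using left_int[OF cm_lam l, of "S h"] by simp
 moreover have "blin (\<lambda>a b. F (Si a) * dot lam b)" by (intro lins l)
 ultimately show ?thesis by (simp add: sw_S)
qed

text \<open>One sum over dual bases is evaluated twice: by \<open>dual_basis_mu\<close> with g =
  \<open>lam\<close>, and by the fact that lam composed with S is an integral on the other
  side.\<close>

lemma lam_unique: assumes mu: "\<And>f. cm f mu = dot f one *s mu" shows "mu = dot mu Lam *s lam"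
proof (rule dot_eqI, subst (1 2) dot_sym)
 fix y
 have "dot lam y * dot mu Lam = sw cm Lam (\<lambda>a b. dot lam (S a) * dot mu (mul b y))"
  by (rule dual_basis_mu[OF mu, symmetric])
 also have "\<dots> = dot mu y" using lamS_int[of "\<lambda>b. dot mu (mul b y)" Lam] by (simp add: lins mult.commute)
 finally show "dot mu y = dot (dot mu Lam *s lam) y" by (simp add: mult.commute)
qed

text \<open>The distinguished grouplike element, which measures how far the left integral
  \<open>lam\<close> is from being a right integral.\<close>

definition aa where "aa = T lam Lam"
lemma lam_cm: "cm lam f = dot f aa *s lam"
proof -
 have "cm lam f = dot (cm lam f) Lam *s lam"
  by (rule lam_unique) (simp add: cm_assoc[symmetric] cm_lam cdist)
 then show ?thesis by (simp add: aa_def dot_T)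
qed
lemma gl_aa: "gl aa"
 unfolding gl_def
proof (intro conjI allI)
 fix f h
 have "dot (cm f h) aa *s lam = cm (cm lam f) h" by (simp add: lam_cm[symmetric] cm_assoc)
 also have "\<dots> = (dot f aa * dot h aa) *s lam" by (simp add: lam_cm cdist)
 finally have "dot (dot (cm f h) aa *s lam) Lam = dot ((dot f aa * dot h aa) *s lam) Lam"
  by (rule arg_cong[of _ _ "\<lambda>t. dot t Lam"])
 then show "dot (cm f h) aa = dot f aa * dot h aa" by simp
 show "dot eps aa = 1" using lam_cm[of eps] by (metis cm_eps(2) dot_scale(1) lam_Lam mult.right_neutral)
qed

text \<open>The functional h |-> lam(S^-1(h) a) with a = \<open>aa\<close> is a left integral with
  value 1 at \<open>Lam\<close>, so uniqueness identifies it with \<open>lam\<close>.\<close>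

lemma lam_S: "dot lam (S k) = dot lam (mul k aa)"
proof -
 have right: "sw cm h (\<lambda>x y. dot lam (mul x aa) * F y) = F one * dot lam (mul h aa)" if F: "linf F" for F h
 proof -
  have l: "linf (\<lambda>t. F (mul t (S aa)))" by (rule linf_comp[OF F]) (intro lins)
  have "sw cm (mul h aa) (\<lambda>x y. dot lam x * F (mul y (S aa))) = sw cm h (\<lambda>x y. dot lam (mul x aa) * F (mul (mul y aa) (S aa)))"
   by (subst sw_mul, intro lins l, subst sw_gl[OF gl_aa]) (intro lins linf_comp[OF F], rule refl)
  also have "\<dots> = sw cm h (\<lambda>x y. dot lam (mul x aa) * F y)" by (simp add: mul_assoc gl_inv[OF gl_aa])
  finally have "sw cm h (\<lambda>x y. dot lam (mul x aa) * F y) = sw cm (mul h aa) (\<lambda>x y. dot lam x * F (mul y (S aa)))" by simp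
  also have "\<dots> = dot (cm lam (repf (\<lambda>t. F (mul t (S aa))))) (mul h aa)"
   unfolding sw_cm[symmetric] by (simp only: dot_repf[OF l])
  also have "\<dots> = F one * dot lam (mul h aa)" by (simp add: lam_cm dot_repf[OF l] gl_inv[OF gl_aa])
  finally show ?thesis .
 qed
 define mu where "mu = repf (\<lambda>h. dot lam (mul (Si h) aa))"
 have mu: "dot mu h = dot lam (mul (Si h) aa)" for h unfolding mu_def by (rule dot_repf) (intro lins)
 have "cm f mu = dot f one *s mu" for f
 proof (rule dot_eqI, subst (1 2) dot_sym)
  fix h
  have "dot (cm f mu) h = sw cm (S (Si h)) (\<lambda>x y. dot f x * dot lam (mul (Si y) aa))"
   unfolding sw_cm[symmetric] by (simp add: mu)
  also have "\<dots> = sw cm (Si h) (\<lambda>x y. dot f (S y) * dot lam (mul x aa))"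
   by (subst sw_S) (intro lins, simp)
  also have "\<dots> = dot f one * dot mu h" using right[of "\<lambda>y. dot f (S y)" "Si h"] by (simp add: lins mult.commute mu)
  finally show "dot (cm f mu) h = dot (dot f one *s mu) h" by simp
 qed
 then have "mu = dot mu Lam *s lam" by (rule lam_unique)
 moreover have "dot mu Lam = 1"
 proof -
  have "Si Lam = Lam" by (metis S_Lam Si(2))
  then show ?thesis using gl_aa by (simp add: mu Lam_r gl_def)
 qed
 ultimately have "mu = lam" by simp
 then show ?thesis using mu[of "S k"] by simp
qed

text \<open>Radford's formula in the unimodular case: y is carried once around the form lam(xy),
  alternating \<open>lam_S\<close> and \<open>lam_nak\<close>.\<close>

lemma S4: "mul aa (S (S (S (S y)))) = mul y aa"
proof -
 have "dot lam (mul x (mul y aa - mul aa (S (S (S (S y)))))) = 0" for x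
 proof -
  have "dot lam (mul x (mul y aa)) = dot lam (S (mul x y))" by (simp add: lam_S mul_assoc)
  also have "\<dots> = dot lam (mul (S x) (S (S (S y))))" by (simp add: S_mul lam_nak[of "S y"])
  also have "\<dots> = dot lam (mul (S (S y)) (mul x aa))" by (simp add: S_mul[symmetric] lam_S mul_assoc)
  also have "\<dots> = dot lam (mul x (mul aa (S (S (S (S y))))))" by (simp add: lam_nak[of "S (S y)"] mul_assoc)
  finally show ?thesis by (simp add: mdist)
 qed
 then show ?thesis using lam_nd by fastforce
qed

text \<open>S^4 is conjugation by a grouplike element, which has finite order k. Counted in powers
  of S^2 this gives the exponent 2 k.\<close>

lemma S_order: "\<exists>M>1. \<forall>x. ((\<lambda>x. S (S x)) ^^ M) x = x"
proof -
 obtain k where k: "k > 0" "pw aa k = one" using gl_order[OF gl_aa] by blast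
 have "mul (pw aa j) (((\<lambda>x. S (S x)) ^^ (2 * j)) y) = mul y (pw aa j)" for j y
 proof (induction j arbitrary: y)
  case (Suc j)
  have c: "mul (pw aa j) aa = mul aa (pw aa j)" using pw_add[of aa j 1] pw_add[of aa 1 j] by (simp add: pw_Suc)
  have "((\<lambda>x. S (S x)) ^^ (2 * Suc j)) y = ((\<lambda>x. S (S x)) ^^ (2 * j)) (S (S (S (S y))))"
   using funpow_add[of "2 * j" 2 "\<lambda>x. S (S x)"] by (simp add: numeral_2_eq_2)
  then have "mul (pw aa (Suc j)) (((\<lambda>x. S (S x)) ^^ (2 * Suc j)) y) = mul aa (mul (S (S (S (S y)))) (pw aa j))"
   by (simp only: pw_Suc mul_assoc Suc)
  also have "\<dots> = mul y (mul aa (pw aa j))" by (simp only: mul_assoc[symmetric] S4)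
  finally show ?case by (simp add: pw_Suc)
 qed simp
 from this[of k] have "((\<lambda>x. S (S x)) ^^ (2 * k)) y = y" for y using k by simp
 then show ?thesis using k by (intro exI[of _ "2 * k"]) auto
qed

end

lemma geom_root:
 fixes x :: "'k::field"
 assumes "x ^ M = 1" shows "x \<noteq> 1 \<Longrightarrow> (\<Sum>j<M. x ^ j) = 0" "x = 1 \<Longrightarrow> (\<Sum>j<M. x ^ j) = of_nat M"
 using assms geometric_sum[of x M] by auto

section \<open>The square of the antipode\<close>

locale hopf_wed = hopf_int mul cm one eps S Lam + wed mul one m r E p
 for mul cm :: "'k::{alg_closed_field,field_char_0}^'n::finite \<Rightarrow> 'k^'n \<Rightarrow> 'k^'n" and one eps S Lam m r E p
begin

lemma dot_chi: "dot (chi c) x = (\<Sum>i\<in>blk c. dot (p i i) x)" by (simp add: chi_def dot_sum)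
lemma blk_PP: "i \<in> blk c \<Longrightarrow> j \<in> blk c \<Longrightarrow> (i,j) \<in> PP" by (simp add: blk_iff PP_iff)
lemma chi_mul: "dot (chi c) (mul x y) = (\<Sum>i\<in>blk c. \<Sum>k\<in>blk c. dot (p i k) x * dot (p k i) y)"
 unfolding dot_chi
proof (rule sum.cong[OF refl])
 fix i assume "i \<in> blk c"
 then have "(i,i) \<in> PP" "r i = c" by (simp_all add: blk_iff PP_iff)
 then show "dot (p i i) (mul x y) = (\<Sum>k\<in>blk c. dot (p i k) x * dot (p k i) y)" by (simp add: p_mul)
qed
lemma chi_trace: "dot (chi c) (mul x y) = dot (chi c) (mul y x)"
 unfolding chi_mul by (subst sum.swap) (simp add: mult.commute)

lemma idem_chi: assumes "mul x x = x"
 shows "\<exists>k\<le>d c. dot (chi c) x = of_nat k \<and> (k = 0 \<longrightarrow> (\<forall>i\<in>blk c. \<forall>j\<in>blk c. dot (p i j) x = 0))"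
 unfolding dot_chi d_def
proof (rule idem_trace)
 fix i j assume ij: "i \<in> blk c" "j \<in> blk c"
 then have "dot (p i j) (mul x x) = (\<Sum>k\<in>blk c. dot (p i k) x * dot (p k j) x)"
  using p_mul[OF blk_PP[OF ij]] by (simp add: blk_iff)
 then show "(\<Sum>k\<in>blk c. dot (p i k) x * dot (p k j) x) = dot (p i j) x" by (simp add: assms)
qed simp

lemma chi_one: "dot (chi c) one = of_nat (d c)"
proof -
 have "dot (p i i) one = 1" if "i \<in> blk c" for i using p_one[OF blk_PP[OF that that]] by simp
 then show ?thesis by (simp add: dot_chi d_def)
qed
lemma d_pos: "c \<in> Irr \<Longrightarrow> d c > 0"
 unfolding d_def Irr_def by (auto simp: card_gt_0_iff blk_def)

lemma PP_D: "(i,j) \<in> PP \<Longrightarrow> (j,i) \<in> PP" "(i,j) \<in> PP \<Longrightarrow> (i,i) \<in> PP" "(i,j) \<in> PP \<Longrightarrow> (j,j) \<in> PP"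
 "(i,j) \<in> PP \<Longrightarrow> i \<in> blk (r i)" "(i,j) \<in> PP \<Longrightarrow> j \<in> blk (r i)" "(i,j) \<in> PP \<Longrightarrow> r i \<in> Irr" "(i,j) \<in> PP \<Longrightarrow> r j = r i"
 by (auto simp: PP_iff blk_iff Irr_def)

lemma chi_E: assumes kl: "(k,l) \<in> PP" and c: "c \<in> Irr"
 shows "dot (chi c) (mul (E k l) y) = (if r k = c then dot (p l k) y else 0)"
proof (cases "r k = c")
 case True
 have kb: "k \<in> blk c" "l \<in> blk c" using PP_D[OF kl] True by auto
 have "dot (chi c) (mul (E k l) y) = (\<Sum>i\<in>blk c. if i = k then \<Sum>j\<in>blk c. if j = l then dot (p l k) y else 0 else 0)"
  unfolding chi_mul
 proof (rule sum.cong[OF refl])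
  fix i assume i: "i \<in> blk c"
  have "(\<Sum>j\<in>blk c. dot (p i j) (E k l) * dot (p j i) y) = (\<Sum>j\<in>blk c. if j = l then (if i = k then dot (p l k) y else 0) else 0)"
  proof (rule sum.cong[OF refl])
   fix j assume j: "j \<in> blk c"
   show "dot (p i j) (E k l) * dot (p j i) y = (if j = l then (if i = k then dot (p l k) y else 0) else 0)"
    using pE'[OF blk_PP[OF i j] kl] by auto
  qed
  then show "(\<Sum>j\<in>blk c. dot (p i j) (E k l) * dot (p j i) y) = (if i = k then \<Sum>j\<in>blk c. if j = l then dot (p l k) y else 0 else 0)"
   by (cases "i = k") simp_all
 qed
 then show ?thesis using kb True by simp
next
 case False
 have "dot (p i j) (E k l) = 0" if "i \<in> blk c" "j \<in> blk c" for i j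
  using pE'[OF blk_PP[OF that] kl] that False by (auto simp: blk_iff)
 then show ?thesis using False unfolding chi_mul by simp
qed

definition Chi where "Chi = (\<Sum>c\<in>Irr. chi c)"
lemma Chi_trace: "dot Chi (mul x y) = dot Chi (mul y x)"
 unfolding Chi_def dot_sum by (intro sum.cong refl chi_trace)
lemma Chi_E: "(k,l) \<in> PP \<Longrightarrow> dot Chi (mul (E k l) y) = dot (p l k) y"
 unfolding Chi_def dot_sum using PP_D(6)[of k l] by (simp add: chi_E)
lemma Chi_nd: assumes "\<And>x. dot Chi (mul x y) = 0" shows "y = 0"
 by (rule p_eqI) (metis Chi_E PP_D(1) assms dot_0(2))
lemma Chi_rep: "linf F \<Longrightarrow> \<exists>y. \<forall>x. F x = dot Chi (mul x y)"
proof (rule linf_bij_rep[of "\<lambda>x y. dot Chi (mul x y)"])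
 show "blin (\<lambda>x y. dot Chi (mul x y))" by (intro lins)
qed (auto intro: Chi_nd)

text \<open>A trace vanishes on off-diagonal matrix units and takes one value on all diagonal units
  of a block.\<close>

lemma tracelike_expand:
 assumes f: "\<And>x y. dot f (mul x y) = dot f (mul y x)"
 shows "\<exists>k. f = (\<Sum>c\<in>Irr. k c *s chi c)"
proof -
 define k where "k c = dot f (E (SOME i. i \<in> blk c) (SOME i. i \<in> blk c))" for c
 have diag: "dot f (E i j) = (if i = j then k (r i) else 0)" if ij: "(i,j) \<in> PP" for i j
 proof (cases "i = j")
  case False
  have "mul (E i i) (E i j) = E i j" "mul (E i j) (E i i) = 0"
   using E_mul'[OF PP_D(2)[OF ij] ij] E_mul'[OF ij PP_D(2)[OF ij]] False by auto
  then show ?thesis using f[of "E i i" "E i j"] False by simp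
 next
  case True
  define s where "s = (SOME t. t \<in> blk (r i))"
  have "s \<in> blk (r i)" unfolding s_def by (rule someI[of _ i]) (rule PP_D(4)[OF ij])
  then have si: "(s,i) \<in> PP" "(i,s) \<in> PP" "(s,s) \<in> PP" using blk_PP PP_D(4)[OF ij] by auto
  have "mul (E i s) (E s i) = E i i" "mul (E s i) (E i s) = E s s"
   using E_mul'[OF si(2,1)] E_mul'[OF si(1,2)] by auto
  then have "dot f (E i i) = dot f (E s s)" using f by metis
  then show ?thesis using True by (simp add: k_def s_def)
 qed
 have "f = (\<Sum>c\<in>Irr. k c *s chi c)"
 proof (rule f_eqI)
  fix i j assume ij: "(i,j) \<in> PP"
  have "dot (chi c) (E i j) = (if r i = c then (if i = j then 1 else 0) else 0)" if "c \<in> Irr" for c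
   using chi_E[OF ij that, of one] p_one[OF PP_D(1)[OF ij]] by auto
  then have "dot (\<Sum>c\<in>Irr. k c *s chi c) (E i j) = (\<Sum>c\<in>Irr. if r i = c then k c * (if i = j then 1 else 0) else 0)"
   unfolding dot_sum by (intro sum.cong refl) simp
  also have "\<dots> = k (r i) * (if i = j then 1 else 0)" using PP_D(6)[OF ij] by simp
  finally show "dot f (E i j) = dot (\<Sum>c\<in>Irr. k c *s chi c) (E i j)" using diag[OF ij] by simp
 qed
 then show ?thesis by blast
qed

text \<open>The coefficient of v E_ij w at E_ij is v_ii w_jj, so the double sum over each block
  factors.\<close>

lemma tr_conj: "tr (\<lambda>x. mul v (mul x w)) = (\<Sum>c\<in>Irr. dot (chi c) v * dot (chi c) w)"
proof -
 have "tr (\<lambda>x. mul v (mul x w)) = (\<Sum>a\<in>PP. dot (case_prod p a) (mul v (mul (case_prod E a) w)))"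
  by (rule tr_expand) (intro lins, rule expP)
 also have "\<dots> = (\<Sum>(i,j)\<in>PP. dot (p i i) v * dot (p j j) w)"
 proof (rule sum.cong[OF refl], clarify)
  fix i j assume ij: "(i,j) \<in> PP"
  have "dot (p i j) (mul (mul v (E i j)) w) = dot (p i i) v * dot (p j j) w"
  proof -
   have c1: "dot (p i k) (mul v (E i j)) = (if k = j then dot (p i i) v else 0)" if k: "k \<in> blk (r i)" for k
   proof -
    have ik: "(i,k) \<in> PP" using blk_PP[OF PP_D(4)[OF ij] k] .
    have "dot (p i k) (mul v (E i j)) = (\<Sum>l\<in>blk (r i). if l = i then (if k = j then dot (p i i) v else 0) else 0)"
     unfolding p_mul[OF ik]
    proof (rule sum.cong[OF refl])
     fix l assume "l \<in> blk (r i)"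
     then have "(l,k) \<in> PP" using blk_PP k by auto
     then show "dot (p i l) v * dot (p l k) (E i j) = (if l = i then (if k = j then dot (p i i) v else 0) else 0)"
      using pE'[of l k i j] ij by auto
    qed
    then show ?thesis using PP_D(4)[OF ij] by simp
   qed
   have "dot (p i j) (mul (mul v (E i j)) w) = (\<Sum>k\<in>blk (r i). if k = j then dot (p i i) v * dot (p j j) w else 0)"
    unfolding p_mul[OF ij] by (rule sum.cong[OF refl]) (simp add: c1)
   then show ?thesis using PP_D(5)[OF ij] by simp
  qed
  then show "dot (p i j) (mul v (mul (E i j) w)) = dot (p i i) v * dot (p j j) w" by (simp add: mul_assoc)
 qed
 also have "\<dots> = (\<Sum>c\<in>Irr. dot (chi c) v * dot (chi c) w)"
  unfolding sumP by (simp add: dot_chi sum_product)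
 finally show ?thesis .
qed

lemma rho_chi: "dot rho h = (\<Sum>c\<in>Irr. of_nat (d c) * dot (chi c) h)"
 using tr_conj[of h one] by (simp add: dot_rho chi_one mult.commute)

text \<open>The forms of \<open>lam\<close> and of \<open>Chi\<close> are both nondegenerate, so
  lam(x) = Chi(x u) for a unit u. Comparing Nakayama automorphisms, S^2 for the first and the
  identity for the second, shows that u implements S^2.\<close>

lemma ex_u: obtains u u' where "\<And>x. mul u x = mul (S (S x)) u" "mul u u' = one" "mul u' u = one"
proof -
 obtain u where u: "\<And>x. dot lam x = dot Chi (mul x u)" using Chi_rep[OF linf_dot(1)[of lam]] by blast
 have uc: "mul u x = mul (S (S x)) u" for x
 proof -
  have "dot Chi (mul z (mul u x - mul (S (S x)) u)) = 0" for z
  proof -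
   have "dot Chi (mul z (mul u x)) = dot lam (mul x z)" by (metis u Chi_trace mul_assoc)
   also have "\<dots> = dot lam (mul z (S (S x)))" by (rule lam_nak)
   also have "\<dots> = dot Chi (mul z (mul (S (S x)) u))" by (metis u mul_assoc)
   finally show ?thesis by (simp add: mdist)
  qed
  then show ?thesis using Chi_nd by fastforce
 qed
 have inj: "z = 0" if "mul z u = 0" for z
 proof -
  have "dot lam (mul x z) = 0" for x using that by (simp add: u mul_assoc mdist)
  then show ?thesis by (rule lam_nd)
 qed
 obtain b where b: "mul (mul u b) u = u" using vn_regular by blast
 then have "mul (mul u b - one) u = 0" by (simp add: mdist)
 then have 1: "mul u b = one" using inj by fastforce
 have "S (S one) = one" by simp
 have "mul (mul b u - one) (mul b u) = 0" using 1 by (simp add: mdist mul_assoc) (metis 1 mul_assoc mul_one(1))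
 have "bij (\<lambda>z. mul z u)" by (rule lin_inj_surj) (intro lins, rule inj)
 then obtain z where z: "mul z u = one" by (metis bij_pointE)
 have "z = b" by (metis z 1 mul_assoc mul_one)
 then show ?thesis using that uc 1 z by blast
qed

lemma central_p: assumes c: "\<And>x. mul z x = mul x z" and ij: "(i,j) \<in> PP"
 shows "i \<noteq> j \<Longrightarrow> dot (p i j) z = 0" "dot (p i i) z = dot (p j j) z"
proof -
 have e: "mul (E i i) (mul z (E j j)) = dot (p i j) z *s E i j"
  using E_mul_x[OF PP_D(2)[OF ij] PP_D(3)[OF ij], of z] PP_D(7)[OF ij] by (simp add: mul_assoc)
 show "dot (p i j) z = 0" if n: "i \<noteq> j"
 proof -
  have "mul (E i i) (mul z (E j j)) = 0" using E_mul'[OF PP_D(2)[OF ij] PP_D(3)[OF ij]] n by (simp add: c mul_assoc[symmetric]) (simp add: c mul_assoc mdist)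
  then show ?thesis using e pE'[OF ij ij] by (metis dot_scale(2) dot_0(2) mult.right_neutral)
 qed
 have "dot (p i i) z *s E i j = mul (mul (E i i) z) (E i j)" using E_mul_x[OF PP_D(2)[OF ij] ij, of z] by simp
 also have "\<dots> = mul (mul (E i i) (E i j)) z" by (metis c mul_assoc)
 also have "\<dots> = mul (mul (E i j) (E j j)) z" using E_mul'[OF PP_D(2)[OF ij] ij] E_mul'[OF ij PP_D(3)[OF ij]] by simp
 also have "\<dots> = mul (mul (E i j) z) (E j j)" by (metis c mul_assoc)
 also have "\<dots> = dot (p j j) z *s E i j" using E_mul_x[OF ij PP_D(3)[OF ij], of z] PP_D(7)[OF ij] by simp
 finally have "dot (p i i) z *s E i j = dot (p j j) z *s E i j" .
 then have "dot (p i j) (dot (p i i) z *s E i j) = dot (p i j) (dot (p j j) z *s E i j)" by (rule arg_cong)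
 then show "dot (p i i) z = dot (p j j) z" using pE'[OF ij ij] by simp
qed

lemma block_scalar: "dot (p i j) (\<Sum>c\<in>Irr. k c *s ce c) = (if i = j then k (r i) else 0)" if ij: "(i,j) \<in> PP"
proof -
 have "dot (p i j) (\<Sum>c\<in>Irr. k c *s ce c) = (\<Sum>c\<in>Irr. if r i = c then k c * (if i = j then 1 else 0) else 0)"
  unfolding dot_sum by (rule sum.cong[OF refl]) (simp add: p_ce[OF ij])
 then show ?thesis using PP_D(6)[OF ij] by simp
qed
lemma block_scalar_central: "mul (\<Sum>c\<in>Irr. k c *s ce c) x = mul x (\<Sum>c\<in>Irr. k c *s ce c)"
 unfolding msum mdist by (intro sum.cong refl arg_cong[of _ _ "\<lambda>t. _ *s t"] ce_central)
lemma block_scalar_mul: "mul (\<Sum>c\<in>Irr. k c *s ce c) (\<Sum>c\<in>Irr. l c *s ce c) = (\<Sum>c\<in>Irr. (k c * l c) *s ce c)"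
proof (rule p_eqI)
 fix i j assume ij: "(i,j) \<in> PP"
 have "dot (p i j) (mul (\<Sum>c\<in>Irr. k c *s ce c) (\<Sum>c\<in>Irr. l c *s ce c)) =
   (\<Sum>t\<in>blk (r i). if t = i then (if i = j then k (r i) * l (r i) else 0) else 0)"
  unfolding p_mul[OF ij]
 proof (rule sum.cong[OF refl])
  fix t assume t: "t \<in> blk (r i)"
  have "(i,t) \<in> PP" "(t,j) \<in> PP" using t PP_D(4,5)[OF ij] blk_PP by auto
  then show "dot (p i t) (\<Sum>c\<in>Irr. k c *s ce c) * dot (p t j) (\<Sum>c\<in>Irr. l c *s ce c) = (if t = i then (if i = j then k (r i) * l (r i) else 0) else 0)"
   by (simp add: block_scalar)
 qed
 then show "dot (p i j) (mul (\<Sum>c\<in>Irr. k c *s ce c) (\<Sum>c\<in>Irr. l c *s ce c)) = dot (p i j) (\<Sum>c\<in>Irr. (k c * l c) *s ce c)"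
  using PP_D(4)[OF ij] by (simp add: block_scalar[OF ij])
qed
lemma one_ce: "one = (\<Sum>c\<in>Irr. 1 *s ce c)"
 by (rule p_eqI, subst block_scalar) (simp_all add: p_one)
lemma block_scalar_pw: "pw (\<Sum>c\<in>Irr. k c *s ce c) n = (\<Sum>c\<in>Irr. k c ^ n *s ce c)"
 by (induction n) (simp_all add: pw_Suc block_scalar_mul one_ce[symmetric], metis (no_types, lifting) one_ce power_0 sum.cong vec.scale_one)

text \<open>Each matrix block of an implementing element is rescaled by a root so that the element itself has finite order.\<close>

lemma ex_v: assumes M: "\<forall>x. ((\<lambda>x. S (S x)) ^^ M) x = x" "M > 0"
 obtains v where "pw v M = one" "\<And>x. mul v x = mul (S (S x)) v"
proof -
 obtain u u' where u: "\<And>x. mul u x = mul (S (S x)) u" "mul u u' = one" "mul u' u = one" using ex_u by blast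
 have "mul (pw u k) x = mul (((\<lambda>x. S (S x)) ^^ k) x) (pw u k)" for k x
 proof (induction k arbitrary: x)
  case (Suc k)
  have "mul (pw u (Suc k)) x = mul u (mul (pw u k) x)" by (simp add: pw_Suc mul_assoc)
  also have "\<dots> = mul (mul u (((\<lambda>x. S (S x)) ^^ k) x)) (pw u k)" by (simp add: Suc mul_assoc)
  also have "\<dots> = mul (mul (S (S (((\<lambda>x. S (S x)) ^^ k) x))) u) (pw u k)" by (simp only: u(1))
  finally show ?case by (simp add: pw_Suc mul_assoc)
 qed simp
 from this[of M] have c: "mul (pw u M) x = mul x (pw u M)" for x using M by simp
 define s where "s c = dot (p (SOME i. i \<in> blk c) (SOME i. i \<in> blk c)) (pw u M)" for c
 have ps: "dot (p i j) (pw u M) = (if i = j then s (r i) else 0)" if ij: "(i,j) \<in> PP" for i j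
 proof -
  define t where "t = (SOME t. t \<in> blk (r i))"
  have "t \<in> blk (r i)" unfolding t_def by (rule someI[of _ i]) (rule PP_D(4)[OF ij])
  then have "(i,t) \<in> PP" using blk_PP PP_D(4)[OF ij] by auto
  from central_p(2)[OF c this] central_p(1)[OF c ij] show ?thesis by (auto simp: s_def t_def)
 qed
 have us: "pw u M = (\<Sum>c\<in>Irr. s c *s ce c)" by (rule p_eqI) (simp add: ps block_scalar)
 have s0: "s c \<noteq> 0" if cI: "c \<in> Irr" for c
 proof
  assume s: "s c = 0"
  have "mul (pw u k) (pw u' k) = one" for k
  proof (induction k)
   case (Suc k)
   have "pw u' (Suc k) = mul (pw u' k) u'" using pw_add[of u' k 1] by (simp add: pw_Suc)
   then have "mul (pw u (Suc k)) (pw u' (Suc k)) = mul u (mul (mul (pw u k) (pw u' k)) u')" by (simp add: pw_Suc mul_assoc)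
   then show ?case using Suc u by simp
  qed simp
  from this[of M] have inv: "mul (pw u M) (pw u' M) = one" .
  obtain i where "i \<in> blk c" using cI by (auto simp: Irr_def blk_iff)
  then have ii: "(i,i) \<in> PP" "r i = c" by (auto simp: PP_iff blk_iff)
  have "dot (p i i) (mul (pw u M) (pw u' M)) = 0" unfolding p_mul[OF ii(1)]
   by (rule sum.neutral) (use ii s in \<open>auto simp: ps blk_iff PP_iff\<close>)
  then show False using inv p_one[OF ii(1)] by simp
 qed
 have "\<exists>q. q ^ M = s c" for c using nth_root_exists[OF M(2)] by metis
 then obtain q where q: "\<And>c. q c ^ M = s c" by metis
 define k where "k c = 1 / q c" for c
 define \<kappa> where "\<kappa> = (\<Sum>c\<in>Irr. k c *s ce c)"
 have kc: "mul \<kappa> x = mul x \<kappa>" for x unfolding \<kappa>_def by (rule block_scalar_central)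
 define v where "v = mul \<kappa> u"
 have pv: "pw v n = mul (pw \<kappa> n) (pw u n)" for n
 proof (induction n)
  case (Suc n)
  have kcn: "mul (pw \<kappa> n) x = mul x (pw \<kappa> n)" for x
   unfolding \<kappa>_def block_scalar_pw by (rule block_scalar_central)
  have "pw v (Suc n) = mul v (mul (pw \<kappa> n) (pw u n))" by (simp only: pw_Suc Suc)
  also have "\<dots> = mul \<kappa> (mul (mul u (pw \<kappa> n)) (pw u n))" by (simp add: v_def mul_assoc)
  also have "\<dots> = mul \<kappa> (mul (mul (pw \<kappa> n) u) (pw u n))" by (simp only: kcn)
  finally show ?case by (simp add: pw_Suc mul_assoc)
 qed simp
 have "pw v M = (\<Sum>c\<in>Irr. (k c ^ M * s c) *s ce c)"
  unfolding pv us by (simp add: \<kappa>_def block_scalar_pw block_scalar_mul)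
 also have "\<dots> = (\<Sum>c\<in>Irr. 1 *s ce c)"
 proof (rule sum.cong[OF refl])
  fix c assume "c \<in> Irr"
  then have "q c ^ M \<noteq> 0" using s0 q by simp
  then have "k c ^ M * s c = 1" by (simp add: k_def power_divide flip: q)
  then show "(k c ^ M * s c) *s ce c = 1 *s ce c" by simp
 qed
 finally have "pw v M = one" by (simp only: one_ce[symmetric])
 moreover have "mul v x = mul (S (S x)) v" for x
 proof -
  have "mul v x = mul \<kappa> (mul (S (S x)) u)" by (simp add: v_def mul_assoc u(1))
  also have "\<dots> = mul (mul (S (S x)) \<kappa>) u" by (simp add: mul_assoc[symmetric] kc)
  finally show ?thesis by (simp add: v_def mul_assoc)
 qed
 ultimately show ?thesis using that by blast
qed

text \<open>Spectral projections of an element of finite order by finite Fourier inversion; y is the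
  inverse of z.\<close>

lemma root_decomp:
 assumes v: "pw v M = one" and M: "M > 1" and z: "z ^ M = 1" "\<And>j. 0 < j \<Longrightarrow> j < M \<Longrightarrow> z ^ j \<noteq> (1::'k)"
 obtains P where "\<And>j. mul (P j) (P j) = P j" "\<And>l. l < M \<Longrightarrow> pw v l = (\<Sum>j<M. z ^ (l * j) *s P j)"
  "\<And>j x. mul x v = mul v x \<Longrightarrow> mul x (P j) = mul (P j) x"
proof -
 define y where "y = z ^ (M - 1)"
 have zy: "z * y = 1" using z(1) M unfolding y_def by (metis power_Suc Suc_diff_1 less_trans zero_less_one)
 have z0: "z \<noteq> 0" using zy by auto
 have yM: "y ^ M = 1" unfolding y_def by (metis power_mult mult.commute power_one z(1))
 define P where "P j = (1 / of_nat M) *s (\<Sum>k<M. y ^ (j * k) *s pw v k)" for j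
 have M0: "(of_nat M :: 'k) \<noteq> 0" using M by simp
 have vP: "mul v (P j) = z ^ j *s P j" for j
 proof -
  define f where "f k = y ^ (j * k) *s pw v k" for k
  have fM: "f M = f 0" using yM v by (simp add: f_def mult.commute[of j] power_mult)
  have s: "(\<Sum>k<M. f (Suc k)) = (\<Sum>k<M. f k)"
   using sum.lessThan_Suc_shift[of f M] sum.lessThan_Suc[of f M] fM by simp
  have "mul v (f k) = z ^ j *s f (Suc k)" for k
  proof -
   have "z ^ j * y ^ (j * Suc k) = (z * y) ^ j * y ^ (j * k)" by (simp add: power_mult_distrib power_add)
   then show ?thesis by (simp add: f_def mdist pw_Suc zy)
  qed
  then have "mul v (\<Sum>k<M. f k) = z ^ j *s (\<Sum>k<M. f k)"
   by (simp add: msum vec.scale_sum_right[symmetric] s)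
  then show ?thesis by (simp add: P_def f_def mdist vec.scale_left_commute)
 qed
 have vkP: "mul (pw v k) (P j) = z ^ (j * k) *s P j" for k j
  by (induction k) (simp_all add: pw_Suc mul_assoc mdist vP power_add mult.commute)
 have idem: "mul (P j) (P j) = P j" for j
 proof -
  have "y ^ (j * k) * z ^ (j * k) = 1" for k by (metis zy mult.commute power_mult_distrib power_one)
  then have "mul (\<Sum>k<M. y ^ (j * k) *s pw v k) (P j) = of_nat M *s P j" by (simp add: msum mdist vkP sum_const_vec del: sum_constant)
  then show ?thesis using M0 by (subst P_def) (simp add: mdist)
 qed
 have rec: "pw v l = (\<Sum>j<M. z ^ (l * j) *s P j)" if l: "l < M" for l
 proof -
  have "(\<Sum>j<M. z ^ (l * j) *s P j) = (1 / of_nat M) *s (\<Sum>j<M. \<Sum>k<M. (z ^ l * y ^ k) ^ j *s pw v k)"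
   by (simp add: P_def vec.scale_sum_right vec.scale_left_commute power_mult_distrib mult.commute[of _ "_::nat"] flip: power_mult)
  also have "(\<Sum>j<M. \<Sum>k<M. (z ^ l * y ^ k) ^ j *s pw v k) = (\<Sum>k<M. (\<Sum>j<M. (z ^ l * y ^ k) ^ j) *s pw v k)"
   by (subst sum.swap) (simp add: vec.scale_sum_left)
  also have "\<dots> = (\<Sum>k<M. if k = l then of_nat M *s pw v l else 0)"
  proof (rule sum.cong[OF refl])
   fix k assume k: "k \<in> {..<M}"
   have w1: "(z ^ l * y ^ k) ^ M = 1" by (metis (no_types) mult_1 power_mult_distrib power_mult mult.commute power_one z(1) yM)
   show "(\<Sum>j<M. (z ^ l * y ^ k) ^ j) *s pw v k = (if k = l then of_nat M *s pw v l else 0)"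
   proof (cases "k = l")
    case True
    then have "z ^ l * y ^ k = 1" by (metis zy power_mult_distrib power_one)
    then show ?thesis using geom_root(2)[OF w1] True by simp
   next
    case False
    have "z ^ l * y ^ k \<noteq> 1"
    proof
     assume a: "z ^ l * y ^ k = 1"
     have "z ^ l = z ^ l * (z * y) ^ k" by (simp add: zy)
     also have "\<dots> = (z ^ l * y ^ k) * z ^ k" by (simp add: power_mult_distrib)
     finally have e: "z ^ l = z ^ k" using a by simp
     show False
     proof (cases "l < k")
      case True
      then have "z ^ k = z ^ l * z ^ (k - l)" by (simp flip: power_add)
      then have "z ^ (k - l) = 1" using e z0 by simp
      then show False using z(2)[of "k - l"] True k by (auto simp: less_imp_diff_less)
     next
      case F: False
      then have "z ^ l = z ^ k * z ^ (l - k)" by (simp flip: power_add)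
      then have "z ^ (l - k) = 1" using e z0 by simp
      then show False using z(2)[of "l - k"] F False l by (auto simp: less_imp_diff_less)
     qed
    qed
    then show ?thesis using geom_root(1)[OF w1] False by simp
   qed
  qed
  also have "\<dots> = of_nat M *s pw v l" using l by simp
  finally show ?thesis using M0 by simp
 qed
 show ?thesis
 proof (rule that[of P])
  show "mul x (P j) = mul (P j) x" if x: "mul x v = mul v x" for j x
  proof -
   have "mul x (pw v k) = mul (pw v k) x" for k
    by (induction k) (simp_all add: pw_Suc mul_assoc, metis mul_assoc x)
   then show ?thesis by (simp add: P_def mdist msum)
  qed
 qed (rule idem rec)+
qed

text \<open>Larson and Radford: in characteristic zero a semisimple Hopf algebra is cosemisimple.\<close>

lemma tr_SS_nz: "dot lam one \<noteq> 0"
proof -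
 obtain M where M: "M > 1" "\<forall>x. ((\<lambda>x. S (S x)) ^^ M) x = x" using S_order by blast
 then have Mp: "M > 0" by simp
 obtain v where v: "pw v M = one" "\<And>x. mul v x = mul (S (S x)) v" using ex_v[OF M(2) Mp] by blast
 obtain z :: 'k where z: "\<And>q. ratev z q = 0 \<longleftrightarrow> ratev (cw M) q = 0" using ex_root[OF Mp] by blast
 note zr = root_pow[OF Mp z]
 have "\<exists>P. (\<forall>j. mul (P j) (P j) = P j) \<and> (\<forall>l<M. pw v l = (\<Sum>j<M. z ^ (l * j) *s P j))"
 proof (rule root_decomp[OF v(1) M(1) zr])
  fix P assume "\<And>j. mul (P j) (P j) = P j" "\<And>l. l < M \<Longrightarrow> pw v l = (\<Sum>j<M. z ^ (l * j) *s P j)"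
  then show ?thesis by (intro exI[of _ P]) simp
 qed
 then obtain P where P0: "\<And>j. mul (P j) (P j) = P j" "\<And>l. l < M \<Longrightarrow> pw v l = (\<Sum>j<M. z ^ (l * j) *s P j)" by metis
 have P: "\<And>j. mul (P j) (P j) = P j" "v = (\<Sum>j<M. z ^ j *s P j)" "pw v (M - 1) = (\<Sum>j<M. z ^ ((M - 1) * j) *s P j)"
  using P0(1) P0(2)[of 1] P0(2)[of "M - 1"] M(1) by (simp_all add: pw_Suc)
 have "\<exists>k. dot (chi c) (P j) = of_nat k" for c j using idem_chi[OF P(1)] by blast
 then obtain a where a: "\<And>c j. dot (chi c) (P j) = of_nat (a c j)" by metis
 have cv: "dot (chi c) v = (\<Sum>j<M. of_nat (a c j) * z ^ j)" for c
  by (subst P(2)) (simp add: dot_sum a mult.commute)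
 have cv': "dot (chi c) (pw v (M - 1)) = (\<Sum>j<M. of_nat (a c j) * z ^ ((M - 1) * j))" for c
  by (subst P(3)) (simp add: dot_sum a mult.commute)
 have vv: "mul v (pw v (M - 1)) = one" using v(1) Mp pw_Suc[of v "M - 1"] by simp
 have "S (S x) = mul v (mul x (pw v (M - 1)))" for x
 proof -
  have "mul v (mul x (pw v (M - 1))) = mul (S (S x)) (mul v (pw v (M - 1)))" by (metis mul_assoc v(2))
  then show ?thesis by (simp only: vv mul_one)
 qed
 \<comment> \<open>The value chi(v) is a combination of powers of z with natural coefficients, and
   chi(v^(M-1)) has the same coefficients at the inverse powers; formally this is a sum of squared
   moduli.\<close>
 then have "dot lam one = (\<Sum>c\<in>Irr. dot (chi c) v * dot (chi c) (pw v (M - 1)))"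
  using tr_conj[of v "pw v (M - 1)"] by (simp add: dot_lam)
 also have "\<dots> \<noteq> 0" unfolding cv cv'
 proof (rule norm_sum_nz[OF Mp z finP(3)])
  \<comment> \<open>The trivial character is a combination of irreducible ones. If all chi(v) were
    zero, then eps(v) would be zero, although v is invertible.\<close>
  show "\<exists>c\<in>Irr. (\<Sum>j<M. of_nat (a c j) * z ^ j) \<noteq> 0"
  proof (rule ccontr)
   assume "\<not> ?thesis"
   then have "\<And>c. c \<in> Irr \<Longrightarrow> dot (chi c) v = 0" using cv by auto
   moreover have "\<And>x y. dot eps (mul x y) = dot eps (mul y x)" by (simp add: eps_mul)
   from tracelike_expand[OF this] obtain k where "eps = (\<Sum>c\<in>Irr. k c *s chi c)" by blast
   ultimately have "dot eps v = 0" by (simp add: dot_sum)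
   moreover have "dot eps v * dot eps (pw v (M - 1)) = 1" using vv eps_mul[of v "pw v (M - 1)"] by simp
   ultimately show False by simp
  qed
 qed
 finally show ?thesis .
qed

end

context hopf_wed begin

lemma chi_zero: assumes "mul x x = x" "dot (chi c) x = 0" "i \<in> blk c" "j \<in> blk c" shows "dot (p i j) x = 0"
 using idem_chi[OF assms(1), of c] assms(2-4) by auto

lemma chi_full: assumes "mul x x = x" "dot (chi c) x = of_nat (d c)" "i \<in> blk c" "j \<in> blk c"
 shows "dot (p i j) x = (if i = j then 1 else 0)"
proof -
 have "mul (one - x) (one - x) = one - x" by (simp add: mdist assms(1))
 moreover have "dot (chi c) (one - x) = 0" by (simp add: assms(2) chi_one)
 ultimately have "dot (p i j) (one - x) = 0" by (rule chi_zero) fact+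
 then show ?thesis using p_one[OF blk_PP[OF assms(3,4)]] by simp
qed

lemma central_if_scalar:
 assumes "\<And>c i j. c \<in> Irr \<Longrightarrow> i \<in> blk c \<Longrightarrow> j \<in> blk c \<Longrightarrow> dot (p i j) x = (if i = j then k c else 0)"
 shows "x = (\<Sum>c\<in>Irr. k c *s ce c)" "mul x y = mul y x"
proof -
 show *: "x = (\<Sum>c\<in>Irr. k c *s ce c)"
  by (rule p_eqI, subst block_scalar, assumption, rule assms) (auto dest: PP_D)
 show "mul x y = mul y x" by (subst (1 2) *) (rule block_scalar_central)
qed

lemma sum_d2: "(\<Sum>c\<in>Irr. (d c)^2) = CARD('n)"
proof -
 have "(of_nat (\<Sum>c\<in>Irr. (d c)^2) :: 'k) = of_nat CARD('n)"
  using rho_chi[of one] by (simp add: chi_one power2_eq_square)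
 then show ?thesis by (simp only: of_nat_eq_iff)
qed

text \<open>Larson and Radford: the square of the antipode is the identity. Here \<open>D = Tr S\<^sup>2\<close> is a sum of squares
 bounded by the dimension \<open>N\<close>, and \<open>D / N\<close> is an integer since it is the trace of \<open>S\<^sup>2\<close> on
 the right ideal of the dual generated by the regular character.\<close>

lemma SS_id: "S (S x) = x"
proof -
 define D where "D = dot lam one"
 have D0: "D \<noteq> 0" using tr_SS_nz by (simp add: D_def)
 interpret H: hopf cm mul eps one "adj S" by (rule hopf_dual)
 \<comment> \<open>As Tr S^2 is nonzero, lam / D is a normalised integral of the dual. Such an
   integral is two-sided, which makes the grouplike \<open>aa\<close> trivial and S^4 the
   identity.\<close>
 interpret H: hopf_int cm mul eps one "adj S" "(1 / D) *s lam"
 proof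
  show "cm h ((1 / D) *s lam) = dot one h *s ((1 / D) *s lam)" for h
   by (simp add: cdist cm_lam dot_sym vec.scale_left_commute)
  show "dot one ((1 / D) *s lam) = 1" using D0 by (simp add: D_def dot_sym)
 qed
 have "cm lam f = dot f one *s lam" for f
 proof -
  have "(1 / D) *s cm lam f = (1 / D) *s (dot f one *s lam)"
   using H.Lam_r[of f] by (simp add: cdist dot_sym vec.scale_left_commute)
  then have "D *s ((1 / D) *s cm lam f) = D *s ((1 / D) *s (dot f one *s lam))" by (rule arg_cong)
  then show ?thesis using D0 by simp
 qed
 then have "dot f aa *s lam = dot f one *s lam" for f by (simp flip: lam_cm)
 then have "dot (dot f aa *s lam) Lam = dot (dot f one *s lam) Lam" for f by (rule arg_cong)
 then have "aa = one" by (intro dot_eqI) simp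
 then have S4': "S (S (S (S y))) = y" for y using S4[of y] by simp
 have "\<forall>x. ((\<lambda>x. S (S x)) ^^ 2) x = x" by (simp add: S4' numeral_2_eq_2)
 from ex_v[OF this] obtain v where v2: "mul v v = one" and vS: "\<And>x. mul v x = mul (S (S x)) v"
  by (auto simp: numeral_2_eq_2 pw_Suc)
 have SS: "S (S x) = mul v (mul x v)" for x
 proof -
  have "mul v (mul x v) = mul (mul (S (S x)) v) v" by (metis vS mul_assoc)
  then show ?thesis by (simp add: mul_assoc v2)
 qed
 have n2: "(2::'k) \<noteq> 0" by simp
 define P where "P = (1/2) *s (one + v)"
 define Q where "Q = (1/2) *s (one - v)"
 have half: "(1/2) *s (x + x) = (x::'k^'n)" for x by (simp add: vec_eq_iff)
 have PP: "mul P P = P"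
 proof -
  have "mul (one + v) (one + v) = (one + v) + (one + v)" by (simp add: mdist v2 add_ac)
  then show ?thesis by (simp only: P_def mdist(5,6) half)
 qed
 have QQ: "mul Q Q = Q"
 proof -
  have "mul (one - v) (one - v) = (one - v) + (one - v)" by (simp add: mdist v2)
  then show ?thesis by (simp only: Q_def mdist(5,6) half)
 qed
 have Pv: "v = P - Q" "one = P + Q" by (simp_all add: P_def Q_def vec_eq_iff field_simps)
 have "\<exists>a b. dot (chi c) P = of_nat a \<and> dot (chi c) Q = of_nat b" for c
  using idem_chi[OF PP, of c] idem_chi[OF QQ, of c] by auto
 then obtain a b where ab: "\<And>c. dot (chi c) P = of_nat (a c)" "\<And>c. dot (chi c) Q = of_nat (b c)" by metis
 have dab: "d c = a c + b c" for c
 proof -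
  have "(of_nat (d c) :: 'k) = dot (chi c) (P + Q)" by (simp only: Pv(2)[symmetric] chi_one)
  then have "(of_nat (d c) :: 'k) = of_nat (a c + b c)" by (simp add: ab)
  then show ?thesis by (simp only: of_nat_eq_iff)
 qed
 \<comment> \<open>The value of chi_c at the involution v: dimension of its +1 eigenspace minus
   dimension of its -1 eigenspace in block c.\<close>
 define e where "e c = int (a c) - int (b c)" for c
 have cv: "dot (chi c) v = of_int (e c)" for c by (subst Pv(1)) (simp add: ab e_def)
 have Dsum: "D = of_int (\<Sum>c\<in>Irr. (e c)^2)"
  unfolding D_def dot_lam SS using tr_conj[of v v] by (simp add: cv power2_eq_square)
 define \<sigma> where "\<sigma> f = adj S (adj S f)" for f
 have l\<sigma>: "lin \<sigma>" unfolding \<sigma>_def by (intro lins lin_S)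
 have ls [lins]: "lin F \<Longrightarrow> lin (\<lambda>x. \<sigma> (F x))" for F by (rule lin_comp[OF l\<sigma>])
 have d\<sigma>: "dot (\<sigma> f) x = dot f (S (S x))" for f x by (simp add: \<sigma>_def dot_adjS)
 have \<sigma>\<sigma>: "\<sigma> (\<sigma> f) = f" for f by (rule dot_eqI, subst (1 2) dot_sym) (simp add: d\<sigma> S4')
 have \<sigma>cm: "\<sigma> (cm f g) = cm (\<sigma> f) (\<sigma> g)" for f g by (simp add: \<sigma>_def H.S_mul)
 have \<sigma>rho: "\<sigma> rho = rho"
  by (rule dot_eqI, subst (1 2) dot_sym) (simp add: d\<sigma> SS rho_trace[of v] mul_assoc v2)
 \<comment> \<open>The functional f |-> Tr(L_f sigma) is an integral, hence a multiple of
   \<open>Lam\<close>. The factor is its value at \<open>eps\<close>, which is Tr S^2 = D, and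
   rho(Lam) = 1.\<close>
 have trr: "tr (\<lambda>x. cm rho (\<sigma> x)) = D"
 proof -
  have "H.lam = dot eps H.lam *s Lam"
   by (rule Lam_unique) (simp add: H.cm_lam dot_sym)
  moreover have "dot eps H.lam = D"
  proof -
   have "dot H.lam eps = tr \<sigma>" by (simp add: H.dot_lam \<sigma>_def[abs_def])
   also have "\<sigma> = adj (\<lambda>x. S (S x))"
   proof (rule ext, rule dot_eqI, subst (1 2) dot_sym)
    have "lin (\<lambda>x. S (S x))" by (intro lins)
    then show "dot (\<sigma> f) x = dot (adj (\<lambda>x. S (S x)) f) x" for f x by (simp add: d\<sigma> dot_adj)
   qed
   also have "tr \<dots> = tr (\<lambda>x. S (S x))" by (rule tr_adj) (intro lins)
   finally show ?thesis by (simp add: D_def dot_lam dot_sym[of eps])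
  qed
  ultimately have "dot H.lam rho = dot (D *s Lam) rho" by simp
  moreover have "dot H.lam rho = tr (\<lambda>x. cm rho (\<sigma> x))" by (simp add: H.dot_lam \<sigma>_def)
  ultimately show ?thesis by (simp add: dot_sym[of Lam])
 qed
 define N :: 'k where "N = of_nat CARD('n)"
 have N0: "N \<noteq> 0" by (simp add: N_def)
 \<comment> \<open>F projects the dual onto the right ideal generated by \<open>rho\<close> and
   commutes with sigma. F1 and F2 project onto the eigenspaces of sigma in its image, so D / N is
   the difference of their ranks.\<close>
 define F where "F x = (1/N) *s cm rho x" for x
 have lF [lins]: "lin G \<Longrightarrow> lin (\<lambda>x. F (G x))" for G unfolding F_def by (intro lins)
 have FF: "F (F x) = F x" for x
 proof -
  have "cm rho rho = N *s rho" using cm_rho[OF rho_trace] by (simp add: N_def)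
  then show ?thesis using N0 by (simp add: F_def cdist cm_assoc[symmetric])
 qed
 have F\<sigma>: "F (\<sigma> x) = \<sigma> (F x)" for x by (simp add: F_def linD(2)[OF l\<sigma>] \<sigma>cm \<sigma>rho)
 have Flin: "F (x + y) = F x + F y" "F (x - y) = F x - F y" "F (c *s x) = c *s F x" for x y c
  by (simp_all add: F_def cdist vec.scale_right_distrib vec.scale_right_diff_distrib vec.scale_left_commute)
 have slin: "\<sigma> (x + y) = \<sigma> x + \<sigma> y" "\<sigma> (x - y) = \<sigma> x - \<sigma> y" "\<sigma> (c *s x) = c *s \<sigma> x" for x y c
  using l\<sigma> by (simp_all add: linD lin_diff)
 define F1 where "F1 x = (1/2) *s (F x + \<sigma> (F x))" for x
 define F2 where "F2 x = (1/2) *s (F x - \<sigma> (F x))" for x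
 have "F1 (F1 x) = F1 x" for x
 proof -
  have "F (F x + \<sigma> (F x)) + \<sigma> (F (F x + \<sigma> (F x))) = (F x + \<sigma> (F x)) + (F x + \<sigma> (F x))"
   by (simp add: Flin slin F\<sigma> FF \<sigma>\<sigma> add_ac)
  then have "(1/2) *s ((1/2) *s (F (F x + \<sigma> (F x)) + \<sigma> (F (F x + \<sigma> (F x))))) = F1 x" by (simp only: half F1_def)
  then show ?thesis by (simp only: F1_def Flin slin vec.scale_right_distrib vec.scale_right_diff_distrib)
 qed
 moreover have "F2 (F2 x) = F2 x" for x
 proof -
  have "F (F x - \<sigma> (F x)) - \<sigma> (F (F x - \<sigma> (F x))) = (F x - \<sigma> (F x)) + (F x - \<sigma> (F x))"
   by (simp add: Flin slin F\<sigma> FF \<sigma>\<sigma> add_ac)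
  then have "(1/2) *s ((1/2) *s (F (F x - \<sigma> (F x)) - \<sigma> (F (F x - \<sigma> (F x))))) = F2 x" by (simp only: half F2_def)
  then show ?thesis by (simp only: F2_def Flin slin vec.scale_right_distrib vec.scale_right_diff_distrib)
 qed
 moreover have "lin F1" "lin F2" unfolding F1_def F2_def by (intro lins)+
 ultimately obtain r1 r2 where r: "tr F1 = of_nat r1" "tr F2 = of_nat r2" using tr_idem by meson
 have "tr (\<lambda>x. \<sigma> (F x)) = tr (\<lambda>x. F1 x + (-1) *s F2 x)"
  by (rule arg_cong[of _ _ tr], rule ext) (simp add: F1_def F2_def vec_eq_iff field_simps)
 also have "\<dots> = of_int (int r1 - int r2)" by (simp only: tr_add tr_scale r) simp
 finally have "tr (\<lambda>x. \<sigma> (F x)) = of_int (int r1 - int r2)" .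
 moreover have "tr (\<lambda>x. \<sigma> (F x)) = (1/N) * D"
  by (simp only: F\<sigma>[symmetric], simp only: F_def tr_scale trr)
 ultimately have "D = N * of_int (int r1 - int r2)" using N0 by (simp add: field_simps)
 then have "(of_int (\<Sum>c\<in>Irr. (e c)^2) :: 'k) = of_int (int CARD('n) * (int r1 - int r2))"
  by (simp add: Dsum N_def)
 then have De: "(\<Sum>c\<in>Irr. (e c)^2) = int CARD('n) * (int r1 - int r2)" by (simp only: of_int_eq_iff)
 have ed: "(e c)^2 \<le> int (d c)^2" for c
  by (rule power2_le_iff_abs_le[THEN iffD2]) (auto simp: e_def dab)
 have nn: "0 \<le> (\<Sum>c\<in>Irr. (e c)^2)" by (simp add: sum_nonneg)
 moreover have "(\<Sum>c\<in>Irr. (e c)^2) \<noteq> 0"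
 proof
  assume "(\<Sum>c\<in>Irr. (e c)^2) = 0"
  then have "D = 0" by (simp only: Dsum of_int_0)
  then show False using D0 by simp
 qed
 \<comment> \<open>D is a positive multiple of N and at most the sum N of the squared degrees. Hence
   |e c| = d c for every c, so v acts as a sign on each block and is central.\<close>
 ultimately have "int CARD('n) * (int r1 - int r2) > 0" unfolding De by (rule order_le_neq_trans[OF _ not_sym])
 then have pos: "int r1 - int r2 > 0" by (simp add: zero_less_mult_iff)
 have "(\<Sum>c\<in>Irr. int (d c)^2) = int CARD('n)" by (simp flip: sum_d2)
 moreover have "int CARD('n) \<le> int CARD('n) * (int r1 - int r2)" using pos by simp
 ultimately have "(\<Sum>c\<in>Irr. int (d c)^2 - (e c)^2) \<le> 0" using De by (simp add: sum_subtractf)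
 then have "\<forall>c\<in>Irr. int (d c)^2 - (e c)^2 = 0"
  using sum_nonneg_eq_0_iff[of Irr "\<lambda>c. int (d c)^2 - (e c)^2"] ed sum_nonneg[of Irr "\<lambda>c. int (d c)^2 - (e c)^2"]
  by (simp add: order_antisym)
 then have ab0: "a c = 0 \<or> b c = 0" if "c \<in> Irr" for c
 proof -
  have "int (d c)^2 - (e c)^2 = 4 * int (a c) * int (b c)" by (simp add: e_def dab power2_eq_square algebra_simps)
  then show ?thesis using \<open>\<forall>c\<in>Irr. int (d c)^2 - (e c)^2 = 0\<close> that by auto
 qed
 have vc: "mul v y = mul y v" for y
 proof (rule central_if_scalar(2)[where k="\<lambda>c. if b c = 0 then 1 else -1"])
  fix c i j assume c: "c \<in> Irr" "i \<in> blk c" "j \<in> blk c"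
  show "dot (p i j) v = (if i = j then (if b c = 0 then 1 else -1) else 0)"
  proof (cases "b c = 0")
   case True
   then have "dot (chi c) P = of_nat (d c)" "dot (chi c) Q = 0" by (simp_all add: ab dab)
   then show ?thesis using True chi_full[OF PP _ c(2,3)] chi_zero[OF QQ _ c(2,3)] by (subst Pv(1)) simp
  next
   case False
   then have "a c = 0" using ab0[OF c(1)] by auto
   then have "dot (chi c) Q = of_nat (d c)" "dot (chi c) P = 0" by (simp_all add: ab dab)
   then show ?thesis using False chi_full[OF QQ _ c(2,3)] chi_zero[OF PP _ c(2,3)] by (subst Pv(1)) simp
  qed
 qed
 show ?thesis by (simp only: SS vc[of x, symmetric] mul_assoc[symmetric] v2 mul_one)
qed

end

section \<open>Characters and one-dimensional representations\<close>

context hopf_int begin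

lemma SS [simp]: "S (S x) = x"
proof -
 obtain m r E p where "wed mul one m r E p" using ex_wed by blast
 then interpret w: wed mul one m r E p .
 interpret hopf_wed mul cm one eps S Lam m r E p ..
 show ?thesis by (rule SS_id)
qed
lemma adjSS [simp]: "adj S (adj S f) = f"
 by (rule dot_eqI, subst (1 2) dot_sym) (simp add: dot_adjS)
lemma lin_adjS [lins]: "lin H \<Longrightarrow> lin (\<lambda>x. adj S (H x))" by (intro lins lin_S)

lemma lam_rho: "lam = rho"
 by (rule dot_eqI, subst (1 2) dot_sym) (simp add: dot_lam dot_rho)
lemma cm_rho_l: "cm f rho = dot f one *s rho" using cm_lam by (simp add: lam_rho)
definition Lm where "Lm = (1 / of_nat CARD('n)) *s rho"
lemma Lm_l: "cm f Lm = dot f one *s Lm" by (simp add: Lm_def cdist cm_rho_l vec.scale_left_commute)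
lemma Lm_one [simp]: "dot Lm one = 1" by (simp add: Lm_def)

text \<open>Semisimplicity of the dual: for S^2 = id the integral \<open>lam\<close> is the regular
  character, whose value n at \<open>one\<close> can be normalised.\<close>

lemma hopf_int_dual: "hopf_int cm mul eps one (adj S) Lm"
proof -
 interpret H: hopf cm mul eps one "adj S" by (rule hopf_dual)
 show ?thesis by unfold_locales (simp_all add: Lm_l dot_sym[of one])
qed

lemma adjS_mul: "adj S (cm f g) = cm (adj S g) (adj S f)"
 by (rule hopf.S_mul[OF hopf_dual])
lemma adjS_eps [simp]: "adj S eps = eps"
 by (rule hopf.S_one[OF hopf_dual])
lemma dual_rho: "hopf_int.rho cm = of_nat CARD('n) *s Lam"
proof -
 interpret D: hopf_int cm mul eps one "adj S" Lm by (rule hopf_int_dual)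
 have "D.rho = dot eps D.rho *s Lam" by (rule Lam_unique) (use D.cm_rho_l in \<open>simp add: dot_sym\<close>)
 then show ?thesis using D.rho_one by (simp add: dot_sym)
qed
lemma tr_cm: "tr (\<lambda>x. cm f x) = of_nat CARD('n) * dot f Lam"
 using hopf_int.dot_rho[OF hopf_int_dual, of f] by (simp add: dual_rho dot_sym[of Lam])
text \<open>Up to the factor n, \<open>Lam\<close> is the regular character of the dual, hence a
  trace on it.\<close>

lemma Lam_trace: "dot (cm f g) Lam = dot (cm g f) Lam"
proof -
 have "tr (\<lambda>x. cm f (cm g x)) = tr (\<lambda>x. cm g (cm f x))" by (rule tr_comm) (intro lins)+
 then have "(of_nat CARD('n) :: 'k) * dot (cm f g) Lam = of_nat CARD('n) * dot (cm g f) Lam"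
  by (simp flip: tr_cm add: cm_assoc)
 then show ?thesis by simp
qed
lemma sw_Lam_comm: assumes "blin F" shows "sw cm Lam F = sw cm Lam (\<lambda>a b. F b a)"
proof -
 obtain c where c: "F = (\<lambda>a b. \<Sum>i\<in>UNIV. \<Sum>j\<in>UNIV. c i j * (dot (ax i) a * dot (ax j) b))"
  using blin_ex[OF assms] by blast
 have "sw cm Lam (\<lambda>a b. dot f a * dot g b) = sw cm Lam (\<lambda>a b. dot f b * dot g a)" for f g
  unfolding sw_cm by (simp only: mult.commute[of "dot f _"] sw_cm Lam_trace)
 then show ?thesis by (simp only: c sw_sum sw_mult)
qed
lemma dual_basis': "linf F \<Longrightarrow> sw cm Lam (\<lambda>a b. dot rho (mul a y) * F (S b)) = F y"
proof -
 assume F: "linf F"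
 have "sw cm Lam (\<lambda>a b. F (S a) * dot rho (mul b y)) = sw cm Lam (\<lambda>a b. F (S b) * dot rho (mul a y))"
  by (rule sw_Lam_comm) (intro lins linf_comp[OF F])
 then show ?thesis using dual_basis[OF F, of y] by (simp add: lam_rho mult.commute)
qed
text \<open>Expansion of the trace in the dual bases L_1 and S(L_2), with L = \<open>Lam\<close>, of
  the form rho(xy).\<close>

lemma tr_Lam: assumes "lin F" shows "tr F = sw cm Lam (\<lambda>a b. dot rho (mul a (F (S b))))"
proof -
 have lF: "lin H \<Longrightarrow> lin (\<lambda>x. F (H x))" for H by (rule lin_comp[OF assms])
 have "tr F = (\<Sum>i\<in>UNIV. sw cm Lam (\<lambda>a b. dot rho (mul a (F (ax i))) * dot (ax i) (S b)))"
  unfolding tr_def by (subst dual_basis') (intro lins, simp)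
 also have "\<dots> = sw cm Lam (\<lambda>a b. \<Sum>i\<in>UNIV. dot rho (mul a (F (ax i))) * dot (ax i) (S b))"
  by (simp add: sw_sum)
 also have "\<dots> = sw cm Lam (\<lambda>a b. dot rho (mul a (F (S b))))"
  by (subst (2) lin_expand[OF assms]) (simp add: msum mdist dot_sum mult.commute)
 finally show ?thesis .
qed

lemma gl_rho: "gl g \<Longrightarrow> g \<noteq> one \<Longrightarrow> dot rho g = 0"
proof (rule ccontr)
 assume g: "gl g" "g \<noteq> one" "dot rho g \<noteq> 0"
 have "dot f g = dot f one" for f
 proof -
  have "dot f g * dot rho g = dot f one * dot rho g" using g(1) cm_rho_l[of f] unfolding gl_def by (metis dot_scale(1))
  then show ?thesis using g(3) by simp
 qed
 then show False using g(2) dot_eqI by blast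
qed

text \<open>These are the grouplike elements of the dual (\<open>gd_gl\<close>), so results on
  \<open>gl\<close> apply to them.\<close>

definition gd :: "'k^'n \<Rightarrow> bool" where "gd al \<longleftrightarrow> (\<forall>x y. dot al (mul x y) = dot al x * dot al y) \<and> dot al one = 1"
lemma gd_gl: "gd al \<longleftrightarrow> hopf.gl mul one al"
 by (auto simp: gd_def hopf.gl_def[OF hopf_dual] dot_sym)
lemma gd_mult: "gd al \<Longrightarrow> dot al (mul x y) = dot al x * dot al y" by (simp add: gd_def)
lemma gd_inv: assumes "gd al" shows "cm (adj S al) al = eps" "cm al (adj S al) = eps" "gd (adj S al)"
 using hopf.gl_inv[OF hopf_dual, of al] hopf.gl_S[OF hopf_dual, of al] assms by (simp_all add: gd_gl)
lemma gd_cm: "gd al \<Longrightarrow> gd be \<Longrightarrow> gd (cm al be)"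
 using hopf.gl_mul[OF hopf_dual] by (simp add: gd_gl)
lemma gd_eps: "gd eps" by (simp add: gd_def eps_mul)
lemma gd_finite: "finite {al. gd al}"
 using hopf.gl_finite[OF hopf_dual] by (simp add: gd_gl)
lemma gd_Lam: "gd al \<Longrightarrow> al \<noteq> eps \<Longrightarrow> dot al Lam = 0"
 using hopf_int.gl_rho[OF hopf_int_dual, of al] by (simp add: gd_gl dual_rho dot_sym)

lemma TT: "T f (T g x) = T (cm g f) x" "T' f (T' g x) = T' (cm f g) x" "T f (T' g x) = T' g (T f x)"
 by (rule dot_eqI, simp add: dot_T dot_T' cm_assoc)+
lemma T_eps [simp]: "T eps x = x" "T' eps x = x" by (rule dot_eqI, simp add: dot_T dot_T')+
lemma T_S: "T al (S x) = S (T' (adj S al) x)"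
proof (rule dot_eqI)
 fix f
 have "dot f (T al (S x)) = dot (cm al f) (S x)" by (rule dot_T)
 also have "\<dots> = dot (cm (adj S f) (adj S al)) x" by (rule S_cm)
 also have "\<dots> = dot (adj S f) (T' (adj S al) x)" by (simp add: dot_T')
 finally show "dot f (T al (S x)) = dot f (S (T' (adj S al) x))" by (simp add: dot_adjS)
qed
lemma T_mul: assumes "gd al" shows "T al (mul x y) = mul (T al x) (T al y)"
proof (rule dot_eqI)
 fix f
 have l: "linf (\<lambda>t. dot f (mul t (T al y)))" by (intro lins)
 have l2: "linf (\<lambda>t. dot f (mul z t))" for z by (intro lins)
 have "dot f (T al (mul x y)) = sw cm x (\<lambda>a b. sw cm y (\<lambda>c d. dot al (mul a c) * dot f (mul b d)))"
  unfolding dot_T compat ..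
 also have "\<dots> = sw cm x (\<lambda>a b. dot al a * sw cm y (\<lambda>c d. dot al c * dot f (mul b d)))"
  by (simp add: gd_mult[OF assms] sw_mult mult.assoc)
 also have "\<dots> = dot f (mul (T al x) (T al y))"
  by (simp only: linf_T[OF l2, symmetric] linf_T[OF l, symmetric])
 finally show "dot f (T al (mul x y)) = dot f (mul (T al x) (T al y))" .
qed
lemma T'_mul: assumes "gd al" shows "T' al (mul x y) = mul (T' al x) (T' al y)"
proof (rule dot_eqI)
 fix f
 have l: "linf (\<lambda>t. dot f (mul t (T' al y)))" by (intro lins)
 have l2: "linf (\<lambda>t. dot f (mul z t))" for z by (intro lins)
 have "dot f (T' al (mul x y)) = sw cm x (\<lambda>a b. sw cm y (\<lambda>c d. dot f (mul a c) * dot al (mul b d)))"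
  unfolding dot_T' compat ..
 also have "\<dots> = sw cm x (\<lambda>a b. sw cm y (\<lambda>c d. dot f (mul a c) * dot al d) * dot al b)"
  by (simp add: gd_mult[OF assms] sw_mult(2)[symmetric] mult.assoc mult.commute[of "dot al _" "dot al _"])
 also have "\<dots> = dot f (mul (T' al x) (T' al y))"
  by (simp only: linf_T'[OF l2, symmetric] linf_T'[OF l, symmetric])
 finally show "dot f (T' al (mul x y)) = dot f (mul (T' al x) (T' al y))" .
qed
lemma T_one: "gd al \<Longrightarrow> T al one = one" "gd al \<Longrightarrow> T' al one = one"
 by (rule dot_eqI, simp add: dot_T dot_T' one_cm gd_def)+

text \<open>Expanded by \<open>tr_Lam\<close>, the trace is rho(y) times the value at
  \<open>Lam\<close> of the inverse character, and a nontrivial one-dimensional character vanishes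
  at the integral.\<close>

lemma tr_T: assumes a: "gd al" "al \<noteq> eps" shows "tr (\<lambda>x. mul (T al x) y) = 0"
proof -
 let ?b = "adj S al"
 have gb: "gd ?b" and b: "?b \<noteq> eps" using gd_inv[OF a(1)] a(2) by (auto, metis adjSS adjS_eps)
 have l: "linf (\<lambda>t. dot rho (mul z (mul (S t) y)))" for z by (intro lins)
 have "tr (\<lambda>x. mul (T al x) y) = sw cm Lam (\<lambda>a b. dot rho (mul a (mul (T al (S b)) y)))"
  by (rule tr_Lam) (intro lins)
 also have "\<dots> = sw cm Lam (\<lambda>a u. sw cm u (\<lambda>b c. dot rho (mul a (mul (S b) y)) * dot ?b c))"
  by (simp only: T_S linf_T'[OF l])
 also have "\<dots> = sw cm Lam (\<lambda>u c. sw cm u (\<lambda>a b. dot rho (mul a (mul (S b) y)) * dot ?b c))"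
  by (rule sw_coassoc[symmetric]) (intro lins)
 also have "\<dots> = sw cm Lam (\<lambda>u c. dot eps u * (dot rho y * dot ?b c))"
 proof -
  have "sw cm u (\<lambda>a b. dot rho (mul a (mul (S b) y))) = dot eps u * dot rho y" for u
   using sw_antir[of "\<lambda>t. dot rho (mul t y)" u] by (simp add: lins mul_assoc)
  then show ?thesis by (simp add: sw_mult mult.assoc)
 qed
 also have "\<dots> = dot rho y * dot ?b Lam" by (rule sw_counitl) (intro lins)
 also have "\<dots> = 0" using gd_Lam[OF gb b] by simp
 finally show ?thesis .
qed

definition tracelike where "tracelike f \<longleftrightarrow> (\<forall>x y. dot f (mul x y) = dot f (mul y x))"

text \<open>A matrix representation given by its coefficients. The index set is arbitrary, so that a
  tensor product can be indexed by pairs.\<close>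

definition rep :: "'a set \<Rightarrow> ('a \<Rightarrow> 'a \<Rightarrow> 'k^'n) \<Rightarrow> bool" where
 "rep A q \<longleftrightarrow> finite A \<and> (\<forall>a\<in>A. \<forall>b\<in>A. dot (q a b) one = (if a = b then 1 else 0) \<and>
   (\<forall>x y. dot (q a b) (mul x y) = (\<Sum>c\<in>A. dot (q a c) x * dot (q c b) y)))"

definition ischar :: "'k^'n \<Rightarrow> bool" where
 "ischar f \<longleftrightarrow> (\<exists>(A::nat set) q. rep A q \<and> f = (\<Sum>a\<in>A. q a a))"

lemma rep_reindex: assumes "rep A q" "bij_betw h B A" shows "rep B (\<lambda>a b. q (h a) (h b))"
proof -
 have i: "inj_on h B" "h ` B = A" using assms(2) by (auto simp: bij_betw_def)
 have "(\<Sum>c\<in>A. g c) = (\<Sum>c\<in>B. g (h c))" for g :: "'a \<Rightarrow> 'k" using sum.reindex[OF i(1), of g] i(2) by simp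
 moreover have "finite B" using assms bij_betw_finite by (auto simp: rep_def)
 ultimately show ?thesis using assms i unfolding rep_def by (auto simp: inj_on_eq_iff)
qed
lemma ischarI: assumes "rep A q" shows "ischar (\<Sum>a\<in>A. q a a)"
proof -
 obtain h where h: "bij_betw h {..<card A} A" using ex_bij_betw_nat_finite[of A] assms by (auto simp: rep_def atLeast0LessThan)
 have "(\<Sum>a\<in>A. q a a) = (\<Sum>i\<in>{..<card A}. q (h i) (h i))"
  using sum.reindex_bij_betw[OF h, of "\<lambda>a. q a a"] by simp
 then show ?thesis using rep_reindex[OF assms h] unfolding ischar_def by blast
qed

lemma rep_prod: assumes A: "rep A q" and B: "rep B q'"
 shows "rep (A \<times> B) (\<lambda>a b. cm (q (fst a) (fst b)) (q' (snd a) (snd b)))"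
 unfolding rep_def
proof (intro conjI ballI allI)
 show "finite (A \<times> B)" using A B by (simp add: rep_def)
 fix a b assume a: "a \<in> A \<times> B" and b: "b \<in> A \<times> B"
 show "dot (cm (q (fst a) (fst b)) (q' (snd a) (snd b))) one = (if a = b then 1 else 0)"
 proof -
  have 1: "dot (q a b) one = (if a = b then 1 else 0)" if "a \<in> A" "b \<in> A" for a b using A that by (simp add: rep_def)
  have 2: "dot (q' a b) one = (if a = b then 1 else 0)" if "a \<in> B" "b \<in> B" for a b using B that by (simp add: rep_def)
  show ?thesis using a b by (simp add: one_cm 1 2 mem_Times_iff prod_eq_iff)
 qed
 fix x y
 have "dot (cm (q (fst a) (fst b)) (q' (snd a) (snd b))) (mul x y) =
   sw cm x (\<lambda>x1 x2. sw cm y (\<lambda>y1 y2. (\<Sum>c\<in>A. dot (q (fst a) c) x1 * dot (q c (fst b)) y1) * (\<Sum>e\<in>B. dot (q' (snd a) e) x2 * dot (q' e (snd b)) y2)))"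
  unfolding compat using a b A B by (simp add: rep_def mem_Times_iff)
 also have "\<dots> = sw cm x (\<lambda>x1 x2. sw cm y (\<lambda>y1 y2. \<Sum>c\<in>A. \<Sum>e\<in>B. (dot (q (fst a) c) x1 * dot (q' (snd a) e) x2) * (dot (q c (fst b)) y1 * dot (q' e (snd b)) y2)))"
  by (simp add: sum_product mult_ac)
 also have "\<dots> = (\<Sum>c\<in>A. \<Sum>e\<in>B. dot (cm (q (fst a) c) (q' (snd a) e)) x * dot (cm (q c (fst b)) (q' e (snd b))) y)"
  by (simp only: sw_sum sw_mult sw_cm)
 also have "\<dots> = (\<Sum>c\<in>A \<times> B. dot (cm (q (fst a) (fst c)) (q' (snd a) (snd c))) x * dot (cm (q (fst c) (fst b)) (q' (snd c) (snd b))) y)"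
  by (simp add: sum.cartesian_product case_prod_beta)
 finally show "dot (cm (q (fst a) (fst b)) (q' (snd a) (snd b))) (mul x y) = \<dots>" .
qed
lemma ischar_cm: assumes "ischar f" "ischar g" shows "ischar (cm f g)"
proof -
 obtain A B :: "nat set" and q q' where "rep A q" "f = (\<Sum>a\<in>A. q a a)" "rep B q'" "g = (\<Sum>b\<in>B. q' b b)"
  using assms unfolding ischar_def by blast
 then have "cm f g = (\<Sum>a\<in>A\<times>B. cm (q (fst a) (fst a)) (q' (snd a) (snd a)))"
  by (simp only: csum(1), simp only: csum(2), simp add: sum.cartesian_product case_prod_beta)
 with ischarI[OF rep_prod[OF \<open>rep A q\<close> \<open>rep B q'\<close>]] show ?thesis by simp
qed
lemma ischar_adj: assumes "ischar f" shows "ischar (adj S f)"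
proof -
 obtain A :: "nat set" and q where q: "rep A q" "f = (\<Sum>a\<in>A. q a a)" using assms unfolding ischar_def by blast
 have "rep A (\<lambda>a b. adj S (q b a))"
  using q(1) by (auto simp: rep_def dot_adjS S_mul mult.commute)
 moreover have "adj S f = (\<Sum>a\<in>A. adj S (q a a))" unfolding q(2) by (rule lin_sum[OF lin_adjS[OF lin_id]])
 ultimately show ?thesis unfolding ischar_def by blast
qed
lemma ischar_gd: assumes "gd al" shows "ischar al"
proof -
 have "rep {0::nat} (\<lambda>_ _. al)" using assms by (simp add: rep_def gd_def)
 from ischarI[OF this] show ?thesis by simp
qed
lemma ischar_trace: "ischar f \<Longrightarrow> tracelike f"
 unfolding ischar_def tracelike_def
proof (elim exE conjE, intro allI)
 fix A :: "nat set" and q x y assume q: "rep A q" "f = (\<Sum>a\<in>A. q a a)"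
 have "dot f (mul x y) = (\<Sum>a\<in>A. \<Sum>c\<in>A. dot (q a c) x * dot (q c a) y)" for x y
  using q by (simp add: dot_sum rep_def)
 note e = this
 have "dot f (mul x y) = (\<Sum>a\<in>A. \<Sum>c\<in>A. dot (q c a) x * dot (q a c) y)" unfolding e by (rule sum.swap)
 then show "dot f (mul x y) = dot f (mul y x)" by (simp add: e mult.commute)
qed
lemma ischar_idem: assumes "ischar f" "mul x x = x" shows "\<exists>k. dot f x = of_nat k"
proof -
 obtain A :: "nat set" and q where q: "rep A q" "f = (\<Sum>a\<in>A. q a a)" using assms unfolding ischar_def by blast
 have "(\<Sum>c\<in>A. dot (q a c) x * dot (q c b) x) = dot (q a b) x" if "a \<in> A" "b \<in> A" for a b
 proof -
  have "dot (q a b) (mul x x) = (\<Sum>c\<in>A. dot (q a c) x * dot (q c b) x)" using q(1) that by (simp add: rep_def)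
  then show ?thesis by (simp add: assms(2))
 qed
 from idem_trace[OF _ this] q(1) show ?thesis unfolding q(2) dot_sum rep_def by blast
qed

text \<open>The multiplicity pairing: the product of f with the dual character of g, evaluated at
  the projection \<open>Lam\<close> onto invariants.\<close>

definition B where "B f g = dot (cm f (adj S g)) Lam"
lemma B_sym: "B f g = B g f"
proof -
 have "dot (cm f (adj S g)) Lam = dot (cm f (adj S g)) (S Lam)" by simp
 also have "\<dots> = dot (cm g (adj S f)) Lam" by (simp only: S_cm) simp
 finally show ?thesis by (simp add: B_def)
qed
lemma B_frob: "B (cm f g) h = B f (cm h (adj S g))" "B (cm f g) h = B g (cm (adj S f) h)"
 by (simp_all add: B_def adjS_mul cm_assoc Lam_trace[of f])
lemma B_lin: "B (x + y) z = B x z + B y z" "B (c *s x) z = c * B x z" "B z (x + y) = B z x + B z y" "B z (c *s x) = c * B z x"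
 "B (\<Sum>i\<in>I. h i) z = (\<Sum>i\<in>I. B (h i) z)" "B z (\<Sum>i\<in>I. h i) = (\<Sum>i\<in>I. B z (h i))"
 using lin_adjS[OF lin_id] by (simp_all add: B_def cdist linD lin_sum csum dot_sum)
lemma Lam_idem: "mul Lam Lam = Lam" using Lam_l[of Lam] by simp
lemma B_nat: assumes "ischar f" "ischar g" shows "\<exists>k. B f g = of_nat k"
 unfolding B_def by (rule ischar_idem[OF ischar_cm[OF assms(1) ischar_adj[OF assms(2)]] Lam_idem])

text \<open>R / c is an idempotent of the dual. Left multiplication by f there has trace n f(Lam),
  so n / c is the trace of a projection.\<close>

lemma quasi_idem_div: assumes "cm R R = of_nat c *s R" "dot R Lam = 1" "c > 0"
 shows "c dvd CARD('n)"
proof -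
 define e where "e = (1 / of_nat c) *s R"
 have c0: "(of_nat c :: 'k) \<noteq> 0" using assms(3) by simp
 have "cm e e = e" using c0 by (simp add: e_def cdist assms(1))
 then have "cm e (cm e x) = cm e x" for x by (simp flip: cm_assoc)
 moreover have "lin (\<lambda>x. cm e x)" by (intro lins)
 ultimately obtain k where "tr (\<lambda>x. cm e x) = of_nat k" using tr_idem[of "\<lambda>x. cm e x"] by blast
 then have "of_nat CARD('n) * (1 / of_nat c) = (of_nat k :: 'k)" by (simp add: tr_cm e_def assms(2))
 then have "(of_nat CARD('n) :: 'k) = of_nat (k * c)" using c0 by (simp add: field_simps)
 then have "CARD('n) = k * c" by (simp only: of_nat_eq_iff)
 then show ?thesis by simp
qed

end

section \<open>Orthogonality of irreducible characters\<close>

context hopf_wed begin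

lemma rep_chi: "rep (blk c) p"
 unfolding rep_def using p_one p_mul blk_PP by (auto simp: blk_iff)
lemma ischar_chi: "ischar (chi c)" unfolding chi_def by (rule ischarI[OF rep_chi])

lemma rho_E: assumes kl: "(k,l) \<in> PP" shows "dot rho (mul a (E k l)) = of_nat (d (r k)) * dot (p l k) a"
proof -
 have "dot rho (mul a (E k l)) = dot rho (mul (E k l) a)" by (rule rho_trace)
 also have "\<dots> = (\<Sum>c\<in>Irr. if r k = c then of_nat (d c) * dot (p l k) a else 0)"
  unfolding rho_chi by (rule sum.cong[OF refl]) (simp add: chi_E[OF kl])
 also have "\<dots> = of_nat (d (r k)) * dot (p l k) a" using PP_D(6)[OF kl] by simp
 finally show ?thesis .
qed
text \<open>Schur orthogonality: rho(a E_kl) is the degree times one matrix coefficient of a, so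
  \<open>dual_basis'\<close> at y = E_kl isolates that coefficient.\<close>

lemma Lam_p: assumes kl: "(k,l) \<in> PP" and F: "linf F"
 shows "sw cm Lam (\<lambda>a b. dot (p l k) a * F (S b)) = F (E k l) / of_nat (d (r k))"
proof -
 have "of_nat (d (r k)) * sw cm Lam (\<lambda>a b. dot (p l k) a * F (S b)) = F (E k l)"
  using dual_basis'[OF F, of "E k l"] by (simp add: rho_E[OF kl] sw_mult mult.assoc)
 moreover have "d (r k) > 0" using d_pos PP_D(6)[OF kl] by simp
 ultimately show ?thesis by (simp add: field_simps)
qed
lemma chi_B: assumes c: "c \<in> Irr" "c' \<in> Irr" shows "B (chi c) (chi c') = (if c = c' then 1 else 0)"
proof -
 have "B (chi c) (chi c') = sw cm Lam (\<lambda>a b. dot (chi c) a * dot (chi c') (S b))"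
  unfolding B_def sw_cm[symmetric] by (simp add: dot_adjS)
 also have "\<dots> = (\<Sum>i\<in>blk c. sw cm Lam (\<lambda>a b. dot (p i i) a * dot (chi c') (S b)))"
  by (simp add: dot_chi[of c] sum_distrib_right sw_sum)
 also have "\<dots> = (\<Sum>i\<in>blk c. (if c = c' then 1 / of_nat (d c) else 0))"
 proof (rule sum.cong[OF refl])
  fix i assume i: "i \<in> blk c"
  then have ii: "(i,i) \<in> PP" "r i = c" using blk_PP by (auto simp: blk_iff)
  have "dot (chi c') (E i i) = (if c = c' then 1 else 0)"
   using chi_E[OF ii(1) c(2), of one] ii p_one[OF ii(1)] by auto
  then show "sw cm Lam (\<lambda>a b. dot (p i i) a * dot (chi c') (S b)) = (if c = c' then 1 / of_nat (d c) else 0)"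
   using Lam_p[OF ii(1) linf_dot(1)[of "chi c'"]] ii by auto
 qed
 also have "\<dots> = (if c = c' then 1 else 0)" using d_pos[OF c(1)] by (auto simp: d_def)
 finally show ?thesis .
qed
lemma trace_expand: assumes "tracelike f" shows "f = (\<Sum>c\<in>Irr. B f (chi c) *s chi c)"
proof -
 obtain k where k: "f = (\<Sum>c\<in>Irr. k c *s chi c)" using tracelike_expand[of f] assms by (auto simp: tracelike_def)
 have "B f (chi c') = k c'" if "c' \<in> Irr" for c'
 proof -
  have "B f (chi c') = (\<Sum>c\<in>Irr. if c = c' then k c else 0)"
   unfolding k B_lin by (rule sum.cong[OF refl]) (simp add: chi_B that)
  then show ?thesis using that by simp
 qed
 then show ?thesis by (subst k) (rule sum.cong, auto)
qed
text \<open>Expresses the central idempotent through the integral, which makes the effect on it of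
  translation by one-dimensional characters visible.\<close>

lemma ce_Lam: assumes c: "c \<in> Irr" shows "ce c = of_nat (d c) *s T (adj S (chi c)) Lam"
proof (rule dot_eqI)
 fix f
 have "dot f (T (adj S (chi c)) Lam) = dot (cm (adj S (chi c)) f) (S Lam)" by (simp add: dot_T)
 also have "\<dots> = dot (cm (adj S f) (chi c)) Lam" by (simp only: S_cm) simp
 also have "\<dots> = dot (cm (chi c) (adj S f)) Lam" by (rule Lam_trace)
 also have "\<dots> = (\<Sum>i\<in>blk c. sw cm Lam (\<lambda>a b. dot (p i i) a * dot f (S b)))"
  unfolding sw_cm[symmetric] by (simp add: dot_adjS dot_chi[of c] sum_distrib_right sw_sum)
 also have "\<dots> = (\<Sum>i\<in>blk c. dot f (E i i) / of_nat (d c))"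
 proof (rule sum.cong[OF refl])
  fix i assume i: "i \<in> blk c"
  then have ii: "(i,i) \<in> PP" "r i = c" using blk_PP by (auto simp: blk_iff)
  show "sw cm Lam (\<lambda>a b. dot (p i i) a * dot f (S b)) = dot f (E i i) / of_nat (d c)"
   using Lam_p[OF ii(1) linf_dot(1)[of f]] ii by simp
 qed
 finally show "dot f (ce c) = dot f (of_nat (d c) *s T (adj S (chi c)) Lam)"
  using d_pos[OF c] by (simp add: ce_def dot_sum sum_divide_distrib[symmetric])
qed

end

section \<open>Groups of one-dimensional characters\<close>

context hopf_int begin

definition sgd :: "('k^'n) set \<Rightarrow> bool" where
 "sgd A \<longleftrightarrow> A \<subseteq> {al. gd al} \<and> eps \<in> A \<and> (\<forall>al\<in>A. \<forall>be\<in>A. cm al be \<in> A) \<and> (\<forall>al\<in>A. adj S al \<in> A)"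
definition avg :: "('k^'n) set \<Rightarrow> 'k^'n" where "avg A = (1 / of_nat (card A)) *s (\<Sum>al\<in>A. al)"

lemma sgd_finite: "sgd A \<Longrightarrow> finite A" using gd_finite by (auto simp: sgd_def intro: finite_subset)
lemma sgd_card: "sgd A \<Longrightarrow> card A > 0" using sgd_finite by (auto simp: card_gt_0_iff sgd_def)
lemma T_avg: "T (avg A) x = (1 / of_nat (card A)) *s (\<Sum>al\<in>A. T al x)" "T' (avg A) x = (1 / of_nat (card A)) *s (\<Sum>al\<in>A. T' al x)"
 by (rule dot_eqI, simp add: dot_T dot_T' avg_def cdist csum dot_sum)+
lemma T_avg_fixed: assumes "sgd A" shows "(\<And>al. al \<in> A \<Longrightarrow> T al x = x) \<Longrightarrow> T (avg A) x = x"
 "(\<And>al. al \<in> A \<Longrightarrow> T' al x = x) \<Longrightarrow> T' (avg A) x = x"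
 using sgd_card[OF assms] by (simp_all add: T_avg sum_const_vec del: sum_constant)
lemma sgd_all: "sgd {al. gd al}" by (auto simp: sgd_def gd_eps gd_cm gd_inv)
lemma gd_cancel: "gd al \<Longrightarrow> cm al x = cm al y \<Longrightarrow> x = y" "gd al \<Longrightarrow> cm x al = cm y al \<Longrightarrow> x = y"
 by (metis gd_inv(1,2) cm_assoc cm_eps)+

lemma sgd_shift: assumes "sgd A" "al \<in> A" shows "cm al (\<Sum>A) = \<Sum>A" "cm (\<Sum>A) al = \<Sum>A"
proof -
 have g: "gd al" and i: "adj S al \<in> A" and c: "\<And>be. be \<in> A \<Longrightarrow> cm al be \<in> A" "\<And>be. be \<in> A \<Longrightarrow> cm be al \<in> A"
  "\<And>be. be \<in> A \<Longrightarrow> cm (adj S al) be \<in> A" "\<And>be. be \<in> A \<Longrightarrow> cm be (adj S al) \<in> A"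
  using assms by (auto simp: sgd_def)
 have "bij_betw (cm al) A A"
  by (rule bij_betw_byWitness[where f'="cm (adj S al)"]) (use c g in \<open>auto simp: cm_assoc[symmetric] gd_inv\<close>)
 from sum.reindex_bij_betw[OF this, of "\<lambda>x. x"] show "cm al (\<Sum>A) = \<Sum>A" by (simp add: csum)
 have "bij_betw (\<lambda>x. cm x al) A A"
  by (rule bij_betw_byWitness[where f'="\<lambda>x. cm x (adj S al)"]) (use c g in \<open>auto simp: cm_assoc gd_inv\<close>)
 from sum.reindex_bij_betw[OF this, of "\<lambda>x. x"] show "cm (\<Sum>A) al = \<Sum>A" by (simp add: csum)
qed
lemma avg_shift: "sgd A \<Longrightarrow> al \<in> A \<Longrightarrow> cm al (avg A) = avg A" "sgd A \<Longrightarrow> al \<in> A \<Longrightarrow> cm (avg A) al = avg A"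
 by (simp_all add: avg_def cdist sgd_shift)
lemma sum_sgd_idem: assumes "sgd A" shows "cm (\<Sum>A) (\<Sum>A) = of_nat (card A) *s \<Sum>A"
proof -
 have "cm (\<Sum>A) (\<Sum>A) = (\<Sum>al\<in>A. cm al (\<Sum>A))" by (simp add: csum(1))
 also have "\<dots> = (\<Sum>al\<in>A. 1 *s \<Sum>A)" by (rule sum.cong) (simp_all add: sgd_shift[OF assms])
 also have "\<dots> = of_nat (card A) *s \<Sum>A" by (simp only: vec.scale_sum_left[symmetric] sum_constant mult_1_right)
 finally show ?thesis .
qed
lemma avg_idem: assumes "sgd A" shows "cm (avg A) (avg A) = avg A"
proof -
 have "(of_nat (card A) :: 'k) \<noteq> 0" using sgd_card[OF assms] by simp
 then show ?thesis by (simp add: avg_def cdist sum_sgd_idem[OF assms])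
qed
lemma sgd_Lam: assumes "sgd A" shows "dot (\<Sum>A) Lam = 1"
proof -
 have "dot (\<Sum>A) Lam = (\<Sum>al\<in>A. if al = eps then 1 else 0)"
  unfolding dot_sum by (rule sum.cong) (use assms gd_Lam in \<open>auto simp: sgd_def\<close>)
 then show ?thesis using assms sgd_finite by (simp add: sgd_def)
qed
lemma sgd_dvd: "sgd A \<Longrightarrow> card A dvd CARD('n)"
 by (rule quasi_idem_div[of "\<Sum>A"]) (auto simp: sum_sgd_idem sgd_Lam sgd_card)

text \<open>Only the identity of \<open>A\<close> contributes to the trace of the averaged twist.\<close>

lemma avg_rho: assumes A: "sgd A" and z: "mul z z = z" "\<And>al. al \<in> A \<Longrightarrow> T al z = z"
 shows "\<exists>k. dot rho z = of_nat (card A * k)"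
proof -
 let ?n = "of_nat (card A) :: 'k"
 have n0: "?n \<noteq> 0" using sgd_card[OF A] by simp
 \<comment> \<open>A projection: the translations are multiplicative and fix z, so averaging
   commutes with right multiplication by z.\<close>
 define F where "F x = mul (T (avg A) x) z" for x
 have FF: "F (F x) = F x" for x
 proof -
  have "T al (mul y z) = mul (T al y) z" if "al \<in> A" for al y
   using that A T_mul[of al y z] z(2) by (auto simp: sgd_def)
  then have "T (avg A) (mul y z) = mul (T (avg A) y) z" for y by (simp add: T_avg mdist msum)
  then show ?thesis by (simp add: F_def mul_assoc z TT avg_idem[OF A])
 qed
 have "lin F" unfolding F_def by (intro lins)
 then obtain k where k: "tr F = of_nat k" using tr_idem FF by blast
 have "tr F = (1 / ?n) * (\<Sum>al\<in>A. tr (\<lambda>x. mul (T al x) z))"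
  unfolding F_def T_avg by (simp add: mdist msum tr_scale tr_sum)
 also have "(\<Sum>al\<in>A. tr (\<lambda>x. mul (T al x) z)) = (\<Sum>al\<in>A. if al = eps then tr (\<lambda>x. mul x z) else 0)"
  by (rule sum.cong) (use A tr_T in \<open>auto simp: sgd_def\<close>)
 also have "\<dots> = tr (\<lambda>x. mul x z)" using A sgd_finite[OF A] by (simp add: sgd_def)
 also have "\<dots> = dot rho z"
 proof -
  have "tr (\<lambda>x. mul x z) = sw cm Lam (\<lambda>a b. dot rho (mul (mul z a) (S b)))"
   unfolding tr_Lam[of "\<lambda>x. mul x z", OF lin_mul1[OF lin_id]] by (simp add: mul_assoc[symmetric] rho_trace[of _ z])
  also have "\<dots> = dot rho z" using sw_antir[of "\<lambda>t. dot rho (mul z t)" Lam] by (simp add: lins mul_assoc)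
  finally show ?thesis .
 qed
 finally have "dot rho z = ?n * of_nat k" using k n0 by (simp add: field_simps)
 then show ?thesis by (intro exI[of _ k]) simp
qed

end

section \<open>Irreducible characters and multiplicities\<close>

context hopf_wed begin

definition IX where "IX = chi ` Irr"
text \<open>Degrees and multiplicities are natural numbers recovered from their images in k; the
  descriptions are known to be met for characters (\<open>deg_char\<close>,
  \<open>mu_char\<close>).\<close>

definition deg :: "'k^'n \<Rightarrow> nat" where "deg f = (THE k. of_nat k = dot f one)"
definition mu :: "'k^'n \<Rightarrow> 'k^'n \<Rightarrow> nat" where "mu f g = (THE k. of_nat k = B f g)"

lemma deg_char: assumes "ischar f" shows "dot f one = of_nat (deg f)"
proof -
 obtain k where "dot f one = of_nat k" using ischar_idem[OF assms, of one] by auto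
 then have "(THE k. of_nat k = dot f one) = k" by (intro the_equality) simp_all
 then show ?thesis using \<open>dot f one = of_nat k\<close> by (simp add: deg_def)
qed
lemma mu_char: assumes "ischar f" "ischar g" shows "B f g = of_nat (mu f g)"
proof -
 obtain k where "B f g = of_nat k" using B_nat[OF assms] by auto
 then have "(THE k. of_nat k = B f g) = k" by (intro the_equality) simp_all
 then show ?thesis using \<open>B f g = of_nat k\<close> by (simp add: mu_def)
qed

lemma chi_inj: "inj_on chi Irr"
 by (rule inj_onI) (metis chi_B zero_neq_one)
lemma IX_fin [simp]: "finite IX" by (simp add: IX_def)
lemma IX_char: "x \<in> IX \<Longrightarrow> ischar x" by (auto simp: IX_def ischar_chi)
lemma IX_mu: "x \<in> IX \<Longrightarrow> y \<in> IX \<Longrightarrow> mu x y = (if x = y then 1 else 0)"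
proof -
 assume a: "x \<in> IX" "y \<in> IX"
 then have "(of_nat (mu x y) :: 'k) = (if x = y then 1 else 0)"
  unfolding mu_char[OF IX_char[OF a(1)] IX_char[OF a(2)], symmetric]
  by (auto simp: IX_def chi_B dest: inj_onD[OF chi_inj])
 then show ?thesis by (auto split: if_splits)
qed
lemma IX_deg: "x \<in> IX \<Longrightarrow> deg x > 0"
proof -
 assume x: "x \<in> IX"
 then obtain c where c: "c \<in> Irr" "x = chi c" by (auto simp: IX_def)
 have "of_nat (deg x) = (of_nat (d c) :: 'k)" using deg_char[OF IX_char[OF x]] chi_one[of c] c by simp
 then show ?thesis using d_pos[OF c(1)] by (simp only: of_nat_eq_iff)
qed
lemma deg_chi: "c \<in> Irr \<Longrightarrow> deg (chi c) = d c"
 using deg_char[OF ischar_chi[of c]] chi_one[of c] by (simp only: of_nat_eq_iff)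
lemma sum_IX: "(\<Sum>x\<in>IX. f x) = (\<Sum>c\<in>Irr. f (chi c))" unfolding IX_def by (simp add: sum.reindex[OF chi_inj])
lemma sum_deg2: "(\<Sum>x\<in>IX. (deg x)^2) = CARD('n)"
 using sum_d2 by (simp add: sum_IX deg_chi)
lemma rho_IX: "dot rho h = (\<Sum>x\<in>IX. of_nat (deg x) * dot x h)"
 by (simp add: sum_IX deg_chi rho_chi)

lemma char_expand: assumes "ischar f" shows "f = (\<Sum>x\<in>IX. of_nat (mu f x) *s x)"
proof -
 have "f = (\<Sum>c\<in>Irr. B f (chi c) *s chi c)" by (rule trace_expand[OF ischar_trace[OF assms]])
 also have "\<dots> = (\<Sum>c\<in>Irr. of_nat (mu f (chi c)) *s chi c)"
  using mu_char[OF assms ischar_chi] by simp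
 finally show ?thesis by (simp add: sum_IX)
qed
lemma char_dot: assumes "ischar f" shows "dot f h = (\<Sum>x\<in>IX. of_nat (mu f x) * dot x h)"
 by (subst char_expand[OF assms]) (simp add: dot_sum)
lemma deg_expand: assumes "ischar f" shows "deg f = (\<Sum>x\<in>IX. mu f x * deg x)"
proof -
 have "(of_nat (deg f) :: 'k) = (\<Sum>x\<in>IX. of_nat (mu f x) * dot x one)"
  using char_dot[OF assms, of one] deg_char[OF assms] by simp
 also have "\<dots> = of_nat (\<Sum>x\<in>IX. mu f x * deg x)" by (simp add: deg_char IX_char)
 finally show ?thesis by (simp only: of_nat_eq_iff)
qed
lemma deg_cm: assumes "ischar f" "ischar g" shows "deg (cm f g) = deg f * deg g"
proof -
 have "(of_nat (deg (cm f g)) :: 'k) = of_nat (deg f * deg g)"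
  using deg_char[OF ischar_cm[OF assms]] deg_char[OF assms(1)] deg_char[OF assms(2)] by (simp add: one_cm)
 then show ?thesis by (simp only: of_nat_eq_iff)
qed
lemma deg_adj: assumes "ischar f" shows "deg (adj S f) = deg f"
proof -
 have "(of_nat (deg (adj S f)) :: 'k) = of_nat (deg f)"
  using deg_char[OF ischar_adj[OF assms]] deg_char[OF assms] by (simp add: dot_adjS)
 then show ?thesis by (simp only: of_nat_eq_iff)
qed
lemma mu_sym: "mu f g = mu g f" by (simp add: mu_def B_sym[of f])
lemma mu_frob: "mu (cm f g) h = mu f (cm h (adj S g))" "mu (cm f g) h = mu g (cm (adj S f) h)"
 unfolding mu_def B_frob(1)[of f g h] by (simp, simp add: B_frob[symmetric])
lemma mu_prod: assumes "ischar f" "ischar g" shows "mu f g = (\<Sum>x\<in>IX. mu f x * mu g x)"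
proof -
 have "(of_nat (mu f g) :: 'k) = B (\<Sum>x\<in>IX. of_nat (mu f x) *s x) g"
  unfolding mu_char[OF assms, symmetric] using char_expand[OF assms(1)] by simp
 also have "\<dots> = (\<Sum>x\<in>IX. of_nat (mu f x) * of_nat (mu g x))"
  by (simp add: B_lin mu_char IX_char assms mu_sym[of g])
 also have "\<dots> = of_nat (\<Sum>x\<in>IX. mu f x * mu g x)" by simp
 finally show ?thesis by (simp only: of_nat_eq_iff)
qed
text \<open>The multiplicities are natural numbers whose squares add up to 1.\<close>

lemma norm_one: assumes "ischar f" "mu f f = 1" shows "f \<in> IX"
proof -
 have s: "(\<Sum>x\<in>IX. mu f x * mu f x) = 1" using mu_prod[OF assms(1,1)] assms(2) by simp
 have "\<exists>x\<in>IX. mu f x * mu f x \<noteq> 0"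
 proof (rule ccontr)
  assume "\<not> ?thesis"
  then have "(\<Sum>x\<in>IX. mu f x * mu f x) = 0" by (intro sum.neutral) blast
  then show False using s by linarith
 qed
 then obtain x where x: "x \<in> IX" "mu f x * mu f x \<noteq> 0" by blast
 have "mu f x * mu f x + (\<Sum>y\<in>IX - {x}. mu f y * mu f y) = 1" using s x by (simp add: sum.remove)
 moreover have "mu f x * mu f x \<ge> 1" using x by simp
 ultimately have r: "mu f x * mu f x = 1" "(\<Sum>y\<in>IX - {x}. mu f y * mu f y) = 0" by linarith+
 then have m: "mu f x = 1" "\<And>y. y \<in> IX \<Longrightarrow> y \<noteq> x \<Longrightarrow> mu f y = 0" by auto
 have "f = (\<Sum>y\<in>IX. if y = x then x else 0)"
  by (subst char_expand[OF assms(1)]) (rule sum.cong, auto simp: m)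
 then show ?thesis using x by simp
qed

lemma gd_IX: assumes "gd al" shows "al \<in> IX" "deg al = 1"
proof -
 have c: "ischar al" by (rule ischar_gd[OF assms])
 have "(of_nat (mu al al) :: 'k) = 1" unfolding mu_char[OF c c, symmetric] B_def by (simp add: gd_inv[OF assms])
 then show "al \<in> IX" using norm_one[OF c] by simp
 have "(of_nat (deg al) :: 'k) = 1" using deg_char[OF c] assms by (simp add: gd_def)
 then show "deg al = 1" by simp
qed
lemma deg1_gd: assumes "x \<in> IX" "deg x = 1" shows "gd x"
proof -
 obtain c where c: "c \<in> Irr" "x = chi c" using assms by (auto simp: IX_def)
 then have "card (blk c) = 1" using assms deg_chi by (simp add: d_def)
 then obtain i where i: "blk c = {i}" by (auto simp: card_1_singleton_iff)
 then have ii: "(i,i) \<in> PP" "r i = c" using blk_PP[of i c i] by (auto simp: blk_iff)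
 have "x = p i i" by (simp add: c chi_def i)
 then show ?thesis using p_mul[OF ii(1)] p_one[OF ii(1)] ii i by (simp add: gd_def)
qed
lemma gd_iff: "gd x \<longleftrightarrow> x \<in> IX \<and> deg x = 1" using gd_IX deg1_gd by blast
lemma gd_char: "gd al \<Longrightarrow> ischar al" by (rule ischar_gd)
lemma adj_IX: "x \<in> IX \<Longrightarrow> adj S x \<in> IX"
proof -
 assume x: "x \<in> IX"
 have c: "ischar x" "ischar (adj S x)" using IX_char[OF x] ischar_adj by auto
 have "mu (adj S x) (adj S x) = mu (cm eps (adj S x)) (adj S x)" by simp
 also have "\<dots> = mu eps (cm (adj S x) x)" by (simp only: mu_frob(1) adjSS)
 also have "\<dots> = mu (cm (adj S x) x) eps" by (rule mu_sym)
 also have "\<dots> = mu x x" by (simp only: mu_frob(2) adjSS cm_eps)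
 finally show ?thesis using norm_one[OF c(2)] IX_mu[OF x x] by simp
qed
lemma gd_act: assumes "gd al" "x \<in> IX" shows "cm al x \<in> IX" "deg (cm al x) = deg x"
 "cm x al \<in> IX" "deg (cm x al) = deg x"
proof -
 have c: "ischar al" "ischar x" using assms gd_char IX_char by auto
 have "mu (cm al x) (cm al x) = mu x x" by (simp add: mu_frob(2) cm_assoc[symmetric] gd_inv[OF assms(1)])
 then show "cm al x \<in> IX" using norm_one ischar_cm c IX_mu assms by simp
 have "mu (cm x al) (cm x al) = mu x x" by (simp add: mu_frob(1) cm_assoc gd_inv[OF assms(1)])
 then show "cm x al \<in> IX" using norm_one ischar_cm c IX_mu assms by simp
 show "deg (cm al x) = deg x" "deg (cm x al) = deg x" using deg_cm c gd_IX(2)[OF assms(1)] by simp_all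
qed
text \<open>Reciprocity moves one factor across and leaves a comparison of two irreducible
  characters.\<close>

lemma mu_gd: assumes "gd al" "x \<in> IX" "y \<in> IX"
 shows "mu (cm x y) al = (if x = cm al (adj S y) then 1 else 0)"
  "mu (cm x y) al = (if y = cm (adj S x) al then 1 else 0)"
proof -
 have m: "mu (cm x y) al = mu x (cm al (adj S y))" "mu (cm x y) al = mu y (cm (adj S x) al)" by (rule mu_frob)+
 show "mu (cm x y) al = (if x = cm al (adj S y) then 1 else 0)"
  unfolding m(1) by (rule IX_mu[OF assms(2) gd_act(1)[OF assms(1) adj_IX[OF assms(3)]]])
 show "mu (cm x y) al = (if y = cm (adj S x) al then 1 else 0)"
  unfolding m(2) by (rule IX_mu[OF assms(3) gd_act(3)[OF assms(1) adj_IX[OF assms(2)]]])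
qed
lemma mu_gd_self: assumes "gd al" "x \<in> IX" shows "mu (cm x (adj S x)) al = (if cm al x = x then 1 else 0)"
 using mu_gd(1)[OF assms adj_IX[OF assms(2)]] by auto

text \<open>Translations by A fix the central idempotent of the block of x, and rho takes the value
  (deg x)^2 there; \<open>avg_rho\<close> gives the divisibility.\<close>

lemma stab_dvd: assumes A: "sgd A" and x: "x \<in> IX" and st: "\<And>al. al \<in> A \<Longrightarrow> cm al x = x"
 shows "card A dvd (deg x)^2"
proof -
 obtain c where c: "c \<in> Irr" "x = chi c" using x by (auto simp: IX_def)
 have "T al (ce c) = ce c" if "al \<in> A" for al
 proof -
  have g: "gd al" "adj S al \<in> A" using A that by (auto simp: sgd_def)
  have "cm (adj S x) al = adj S (cm (adj S al) x)" by (simp add: adjS_mul)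
  then have "cm (adj S x) al = adj S x" using st[OF g(2)] by simp
  then show ?thesis unfolding ce_Lam[OF c(1)] using c by (simp add: linD(2)[OF lin_T(1)[OF lin_id]] TT)
 qed
 moreover have "mul (ce c) (ce c) = ce c"
 proof (rule p_eqI)
  fix i j assume ij: "(i,j) \<in> PP"
  have "dot (p i j) (mul (ce c) (ce c)) = (\<Sum>k\<in>blk (r i). if k = i then (if i = j \<and> r i = c then 1 else 0) else 0)"
   unfolding p_mul[OF ij]
  proof (rule sum.cong[OF refl])
   fix k assume "k \<in> blk (r i)"
   then have "(i,k) \<in> PP" "(k,j) \<in> PP" using blk_PP PP_D(4,5)[OF ij] by auto
   then show "dot (p i k) (ce c) * dot (p k j) (ce c) = (if k = i then (if i = j \<and> r i = c then 1 else 0) else 0)"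
    using p_ce[OF _ c(1)] by auto
  qed
  then show "dot (p i j) (mul (ce c) (ce c)) = dot (p i j) (ce c)" using p_ce[OF ij c(1)] PP_D(4)[OF ij] by auto
 qed
 ultimately obtain k where k: "dot rho (ce c) = of_nat (card A * k)" using avg_rho[OF A] by blast
 have "dot rho (ce c) = of_nat ((d c)^2)"
 proof -
  have "dot (chi c') (ce c) = (if c' = c then of_nat (d c) else 0)" if "c' \<in> Irr" for c'
  proof -
   have "dot (p i i) (ce c) = (if c' = c then 1 else 0)" if "i \<in> blk c'" for i
    using p_ce[OF blk_PP[OF that that] c(1)] that by (auto simp: blk_iff)
   then show ?thesis by (simp add: dot_chi d_def)
  qed
  then have "dot rho (ce c) = (\<Sum>c'\<in>Irr. if c' = c then of_nat (d c) * of_nat (d c) else 0)"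
   unfolding rho_chi by (intro sum.cong refl) auto
  then show ?thesis using c by (simp add: power2_eq_square)
 qed
 then have "card A * k = (deg x)^2" using k c deg_chi by (metis of_nat_eq_iff)
 then show ?thesis by (metis dvd_triv_left)
qed

definition St where "St x = {al. gd al \<and> cm al x = x}"
lemma sgd_St: "sgd (St x)"
 unfolding sgd_def St_def
proof (intro conjI ballI; clarsimp)
 fix al assume a: "gd al" "cm al x = x"
 have "cm (adj S al) (cm al x) = x" by (simp add: cm_assoc[symmetric] gd_inv[OF a(1)])
 then show "gd (adj S al) \<and> cm (adj S al) x = x" using a gd_inv[OF a(1)] by simp
qed (auto simp: gd_eps gd_cm cm_assoc)
lemma St_dvd: "x \<in> IX \<Longrightarrow> card (St x) dvd (deg x)^2"
 by (rule stab_dvd[OF sgd_St]) (auto simp: St_def)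

lemma free_dvd: assumes A: "sgd A" and X: "finite X" "\<And>al x. al \<in> A \<Longrightarrow> x \<in> X \<Longrightarrow> cm al x \<in> X"
 and free: "\<And>al x. al \<in> A \<Longrightarrow> x \<in> X \<Longrightarrow> cm al x = x \<Longrightarrow> al = eps"
 shows "card A dvd card X"
proof (rule equiv_imp_dvd_card)
 define R where "R = {(x,y). x \<in> X \<and> y \<in> X \<and> (\<exists>al\<in>A. y = cm al x)}"
 have inv: "\<And>al. al \<in> A \<Longrightarrow> adj S al \<in> A \<and> cm (adj S al) al = eps" and cl: "\<And>al be. al \<in> A \<Longrightarrow> be \<in> A \<Longrightarrow> cm al be \<in> A" and e: "eps \<in> A"
  and gA: "\<And>al. al \<in> A \<Longrightarrow> gd al"
  using A by (auto simp: sgd_def gd_inv)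
 show "equiv X R"
 proof (rule equivI)
  show "R \<subseteq> X \<times> X" by (auto simp: R_def)
  show "refl_on X R" using e by (auto simp: refl_on_def R_def intro!: bexI[of _ eps])
  show "sym R"
   by (rule symI) (auto simp: R_def cm_assoc[symmetric] inv intro!: bexI[of _ "adj S _"] dest: inv)
  show "trans R"
   by (rule transI) (auto simp: R_def cm_assoc[symmetric] cl)
 qed
 show "finite X" by fact
 fix O' assume "O' \<in> X // R"
 then obtain x where x: "x \<in> X" "O' = R `` {x}" by (auto elim: quotientE)
 then have O: "O' = (\<lambda>al. cm al x) ` A" using X(2) by (auto simp: R_def)
 have "inj_on (\<lambda>al. cm al x) A"
 proof (rule inj_onI)
  fix al be assume ab: "al \<in> A" "be \<in> A" "cm al x = cm be x"
  have "cm (cm (adj S be) al) x = x" using ab inv[OF ab(2)] by (simp add: cm_assoc) (simp add: cm_assoc[symmetric])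
  then have "cm (adj S be) al = eps" using free[OF cl] inv ab x by blast
  then have "cm be (cm (adj S be) al) = be" by simp
  then show "al = be" using gd_inv(2)[OF gA[OF ab(2)]] by (simp add: cm_assoc[symmetric])
 qed
 then show "card A dvd card O'" by (simp add: O card_image)
qed

lemma lagrange: assumes "sgd A" "sgd C" "A \<subseteq> C" shows "card A dvd card C"
proof (rule free_dvd[OF assms(1) sgd_finite[OF assms(2)]])
 show "cm al x \<in> C" if "al \<in> A" "x \<in> C" for al x using assms that by (auto simp: sgd_def)
 show "al = eps" if "al \<in> A" "x \<in> C" "cm al x = x" for al x
  using gd_cancel(2)[of x al eps] that assms(2) by (auto simp: sgd_def)
qed

text \<open>A character as a list of irreducible ones with repetition: the degrees of the list form
  a partition of its degree, which can be enumerated.\<close>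

lemma dec: assumes "ischar f" obtains xs where "set xs \<subseteq> IX" "f = sum_list xs" "\<And>y. y \<in> IX \<Longrightarrow> count_list xs y = mu f y"
proof -
 obtain ys where ys: "set ys = IX" "distinct ys" using finite_distinct_list[OF IX_fin] by blast
 define xs where "xs = concat (map (\<lambda>x. replicate (mu f x) x) ys)"
 have rep: "sum_list (replicate k x) = of_nat k *s x" for k and x :: "'k^'n"
  by (induction k) (simp_all add: vec.scale_left_distrib add.commute)
 have "sum_list (concat (map (\<lambda>x. replicate (mu f x) x) zs)) = sum_list (map (\<lambda>x. of_nat (mu f x) *s x) zs)" for zs
  by (induction zs) (simp_all add: rep)
 note sl = this
 have "sum_list xs = (\<Sum>x\<in>IX. of_nat (mu f x) *s x)"
  unfolding xs_def sl sum_list_distinct_conv_sum_set[OF ys(2)] ys(1) ..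
 moreover have "set (concat (map (\<lambda>x. replicate (mu f x) x) zs)) \<subseteq> set zs" for zs
  by (induction zs) auto
 then have "set xs \<subseteq> IX" unfolding xs_def ys(1)[symmetric] .
 moreover have "count_list (concat (map (\<lambda>x. replicate (mu f x) x) zs)) y = (if y \<in> set zs then mu f y else 0)" if "distinct zs" for zs y
 proof -
  have cr: "count_list (replicate k x) y = (if x = y then k else 0)" for k x by (induction k) auto
  show ?thesis using that by (induction zs) (auto simp: cr)
 qed
 then have "count_list xs y = mu f y" if "y \<in> IX" for y using ys that by (simp add: xs_def)
 ultimately show ?thesis using that[of xs] char_expand[OF assms] by simp
qed

lemma ischar_sum_list: "set xs \<subseteq> IX \<Longrightarrow> ischar f \<Longrightarrow> f = sum_list xs \<Longrightarrow> deg f = sum_list (map deg xs)"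
proof -
 assume a: "set xs \<subseteq> IX" "ischar f" "f = sum_list xs"
 have "dot (sum_list ys) one = of_nat (sum_list (map deg ys))" if "set ys \<subseteq> IX" for ys
  using that by (induction ys) (auto simp: deg_char IX_char)
 then have "(of_nat (deg f) :: 'k) = of_nat (sum_list (map deg xs))" using a deg_char[OF a(2)] by simp
 then show ?thesis by (simp only: of_nat_eq_iff)
qed

lemma char_dec: assumes "ischar f" "set ws \<subseteq> IX" "\<And>y. y \<in> IX \<Longrightarrow> count_list ws y \<le> mu f y"
 obtains xs where "set xs \<subseteq> IX" "f = sum_list ws + sum_list xs" "\<And>y. y \<in> IX \<Longrightarrow> mu f y = count_list ws y + count_list xs y"
  "deg f = sum_list (map deg ws) + sum_list (map deg xs)"
proof -
 obtain zs where zs: "set zs \<subseteq> IX" "f = sum_list zs" "\<And>y. y \<in> IX \<Longrightarrow> count_list zs y = mu f y" using dec[OF assms(1)] by blast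
 have "\<exists>xs. set xs \<subseteq> IX \<and> sum_list zs = sum_list ws + sum_list xs \<and> (\<forall>y. count_list zs y = count_list ws y + count_list xs y) \<and> sum_list (map deg zs) = sum_list (map deg ws) + sum_list (map deg xs)"
  if "\<And>y. count_list ws y \<le> count_list zs y" "set zs \<subseteq> IX" for zs
  using that
 proof (induction ws arbitrary: zs)
  case Nil then show ?case by (intro exI[of _ zs]) simp
 next
  case (Cons w ws)
  have wz: "w \<in> set zs" using Cons.prems(1)[of w] by (metis count_list_0_iff count_list.simps(2) le_zero_eq nat.simps(3) add_is_0 zero_neq_one)
  then obtain as bs where s: "zs = as @ w # bs" by (meson split_list)
  have c: "count_list zs y = (if w = y then 1 else 0) + count_list (as @ bs) y" for y by (simp add: s)
  have "\<exists>xs. set xs \<subseteq> IX \<and> sum_list (as @ bs) = sum_list ws + sum_list xs \<and> (\<forall>y. count_list (as @ bs) y = count_list ws y + count_list xs y) \<and> sum_list (map deg (as @ bs)) = sum_list (map deg ws) + sum_list (map deg xs)"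
  proof (rule Cons.IH)
   show "count_list ws y \<le> count_list (as @ bs) y" for y using Cons.prems(1)[of y] c[of y] by (auto split: if_splits)
   show "set (as @ bs) \<subseteq> IX" using Cons.prems(2) s by auto
  qed
  then show ?case using c by (auto simp: s add_ac)
 qed
 note main = this
 have "count_list ws y \<le> count_list zs y" for y
 proof (cases "y \<in> IX")
  case True then show ?thesis using zs(3) assms(3) by simp
 next
  case False
  then have "y \<notin> set ws" using assms(2) by blast
  then have "count_list ws y = 0" by (rule count_notin)
  then show ?thesis by simp
 qed
 from main[OF this zs(1)] obtain xs where xs: "set xs \<subseteq> IX" "sum_list zs = sum_list ws + sum_list xs" "\<And>y. count_list zs y = count_list ws y + count_list xs y" "sum_list (map deg zs) = sum_list (map deg ws) + sum_list (map deg xs)"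
  by blast
 have "deg f = sum_list (map deg zs)" by (rule ischar_sum_list[OF zs(1) assms(1) zs(2)])
 show ?thesis
 proof (rule that[of xs])
  show "f = sum_list ws + sum_list xs" by (simp only: zs(2) xs(2))
  show "mu f y = count_list ws y + count_list xs y" if "y \<in> IX" for y using zs(3)[OF that] xs(3)[of y] by simp
  show "deg f = sum_list (map deg ws) + sum_list (map deg xs)" using \<open>deg f = _\<close> xs(4) by simp
 qed (rule xs)
qed

end

section \<open>Fusion rules\<close>

lemma parts_ge2:
 fixes ns :: "nat list"
 assumes "\<And>n. n \<in> set ns \<Longrightarrow> 2 \<le> n"
 shows "sum_list ns = 2 \<Longrightarrow> ns = [2]" "sum_list ns = 3 \<Longrightarrow> ns = [3]" "sum_list ns = 4 \<Longrightarrow> ns = [4] \<or> ns = [2,2]"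
  "sum_list ns = 5 \<Longrightarrow> ns = [5] \<or> ns = [2,3] \<or> ns = [3,2]"
proof -
 have e: "ns = [] \<or> (\<exists>a. ns = [a] \<and> 2 \<le> a) \<or> (\<exists>a b. ns = [a,b] \<and> 2 \<le> a \<and> 2 \<le> b) \<or> sum_list ns \<ge> 6"
 proof (cases ns)
  case (Cons a l)
  show ?thesis
  proof (cases l)
   case (Cons b k)
   show ?thesis
   proof (cases k)
    case (Cons c j)
    have "2 \<le> a" "2 \<le> b" "2 \<le> c" using assms by (auto simp: \<open>ns = _\<close> \<open>l = _\<close> Cons)
    then show ?thesis by (simp add: \<open>ns = _\<close> \<open>l = _\<close> Cons)
   qed (use assms \<open>ns = _\<close> \<open>l = _\<close> in auto)
  qed (use assms \<open>ns = _\<close> in auto)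
 qed simp
 show "sum_list ns = 2 \<Longrightarrow> ns = [2]" "sum_list ns = 3 \<Longrightarrow> ns = [3]" "sum_list ns = 4 \<Longrightarrow> ns = [4] \<or> ns = [2,2]"
  "sum_list ns = 5 \<Longrightarrow> ns = [5] \<or> ns = [2,3] \<or> ns = [3,2]"
  using e by auto
qed

context hopf_wed begin

lemma B_IX: "x \<in> IX \<Longrightarrow> y \<in> IX \<Longrightarrow> B x y = (if x = y then 1 else 0)"
 by (simp add: mu_char IX_char IX_mu)
lemma tracelike_lin: "tracelike f \<Longrightarrow> tracelike g \<Longrightarrow> tracelike (f + g)" "tracelike f \<Longrightarrow> tracelike (c *s f)"
 "(\<And>i. i \<in> A \<Longrightarrow> tracelike (h i)) \<Longrightarrow> tracelike (\<Sum>i\<in>A. h i)"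
 by (simp_all add: tracelike_def dot_sum)
lemma IX_eqI: assumes "tracelike f" "tracelike g" "\<And>z. z \<in> IX \<Longrightarrow> B f z = B g z" shows "f = g"
 using trace_expand[OF assms(1)] trace_expand[OF assms(2)] assms(3) by (simp add: IX_def)
lemma IX_trace: "x \<in> IX \<Longrightarrow> tracelike x" by (simp add: IX_char ischar_trace)
lemma IX_Lam: assumes "x \<in> IX" shows "dot x Lam = (if x = eps then 1 else 0)"
proof -
 have "dot x Lam = B x eps" by (simp add: B_def)
 then show ?thesis using B_IX[OF assms gd_IX(1)[OF gd_eps]] by simp
qed

text \<open>R, the sum of the (deg x) x over K, acts as a regular character: R y = (deg y) R for y
  in K, since all constituents of z times the dual of y lie in K and their degrees add up to deg z
  deg y. Then \<open>quasi_idem_div\<close> applies.\<close>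

lemma closed_dvd:
 assumes K: "K \<subseteq> IX" "eps \<in> K" "\<And>x. x \<in> K \<Longrightarrow> adj S x \<in> K"
  and cl: "\<And>x y z. x \<in> K \<Longrightarrow> y \<in> K \<Longrightarrow> z \<in> IX \<Longrightarrow> z \<notin> K \<Longrightarrow> B (cm x y) z = 0"
 shows "(\<Sum>x\<in>K. (deg x)^2) dvd CARD('n)"
proof (rule quasi_idem_div)
 define R where "R = (\<Sum>x\<in>K. of_nat (deg x) *s x)"
 have fK: "finite K" by (rule finite_subset[OF K(1) IX_fin])
 have chK: "x \<in> K \<Longrightarrow> ischar x" and IK: "x \<in> K \<Longrightarrow> x \<in> IX" for x using K(1) IX_char[of x] by blast+
 have tR: "tracelike R" unfolding R_def by (intro tracelike_lin IX_trace IK)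
 have Ry: "cm R y = of_nat (deg y) *s R" if y: "y \<in> K" for y
 proof (rule IX_eqI)
  have e: "cm R y = (\<Sum>x\<in>K. of_nat (deg x) *s cm x y)" by (simp add: R_def csum cdist)
  show "tracelike (cm R y)" unfolding e by (intro tracelike_lin ischar_trace ischar_cm chK y)
  show "tracelike (of_nat (deg y) *s R)" by (intro tracelike_lin tR)
  fix z assume z: "z \<in> IX"
  have BR: "B R z = (if z \<in> K then of_nat (deg z) else 0)"
  proof -
   have "B R z = (\<Sum>x\<in>K. if x = z then of_nat (deg z) else 0)"
    unfolding R_def B_lin by (rule sum.cong[OF refl]) (use IK z in \<open>auto simp: B_IX\<close>)
   then show ?thesis using fK by simp
  qed
  show "B (cm R y) z = B (of_nat (deg y) *s R) z"
  proof (cases "z \<in> K")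
   case False
   then show ?thesis using cl y z BR by (simp add: e B_lin)
  next
   case True
   let ?w = "cm z (adj S y)"
   have w: "ischar ?w" using ischar_cm[OF chK[OF True] chK[OF K(3)[OF y]]] .
   have nz: "mu ?w x = 0" if "x \<in> IX" "x \<notin> K" for x
    using cl[OF True K(3)[OF y] that] mu_char[OF w IX_char[OF that(1)]] by simp
   have "B (cm R y) z = (\<Sum>x\<in>K. of_nat (deg x) * B x ?w)"
    by (simp add: e B_lin B_frob(1)[of _ y z])
   also have "\<dots> = (\<Sum>x\<in>K. of_nat (deg x) * of_nat (mu ?w x))"
    by (rule sum.cong[OF refl]) (simp add: mu_char[OF w chK, symmetric] B_sym[of ?w])
   also have "\<dots> = of_nat (\<Sum>x\<in>K. mu ?w x * deg x)" by (simp add: mult.commute)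
   also have "(\<Sum>x\<in>K. mu ?w x * deg x) = (\<Sum>x\<in>IX. mu ?w x * deg x)"
    by (rule sum.mono_neutral_left) (use K nz in auto)
   also have "\<dots> = deg z * deg y" unfolding deg_expand[OF w, symmetric]
    using deg_cm[OF chK[OF True] chK[OF K(3)[OF y]]] deg_adj[OF chK[OF y]] by simp
   finally show ?thesis using True by (simp add: B_lin BR)
  qed
 qed
 have "cm R R = (\<Sum>y\<in>K. of_nat (deg y) *s cm R y)" by (subst (2) R_def) (simp add: csum cdist)
 also have "\<dots> = (\<Sum>y\<in>K. of_nat ((deg y)^2) *s R)" by (rule sum.cong[OF refl]) (simp add: Ry power2_eq_square)
 also have "\<dots> = of_nat (\<Sum>y\<in>K. (deg y)^2) *s R" by (simp add: vec.scale_sum_left)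
 finally show "cm R R = of_nat (\<Sum>y\<in>K. (deg y)^2) *s R" .
 have "dot R Lam = (\<Sum>x\<in>K. if x = eps then of_nat (deg eps) else 0)"
  unfolding R_def dot_sum by (rule sum.cong[OF refl]) (use IK in \<open>auto simp: IX_Lam\<close>)
 then show "dot R Lam = 1" using fK K(2) gd_IX(2)[OF gd_eps] by simp
 have "1 \<le> (\<Sum>x\<in>K. (deg x)^2)"
  using member_le_sum[of eps K "\<lambda>x. (deg x)^2"] K(2) fK gd_IX(2)[OF gd_eps] by simp
 then show "(\<Sum>x\<in>K. (deg x)^2) > 0" by simp
qed

definition freeact where "freeact x \<longleftrightarrow> (\<forall>al. gd al \<longrightarrow> cm al x = x \<longrightarrow> al = eps)"

text \<open>The order of the stabiliser divides (deg x)^2 as well as the order of the whole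
  group.\<close>

lemma freeact_coprime: assumes x: "x \<in> IX" and c: "coprime (deg x) (card {al. gd al})" shows "freeact x"
proof -
 have "card (St x) dvd card {al. gd al}" by (rule lagrange[OF sgd_St sgd_all]) (auto simp: St_def)
 then have "coprime (card (St x)) (card (St x))"
  using St_dvd[OF x] c by (meson coprime_divisors coprime_power_left_iff)
 then have "card (St x) = 1" by simp
 then obtain be where "St x = {be}" by (auto simp: card_1_singleton_iff)
 moreover have "eps \<in> St x" by (simp add: St_def gd_eps)
 ultimately have "St x = {eps}" by auto
 then show ?thesis unfolding freeact_def St_def by blast
qed

lemma free_deg_dvd: assumes "\<And>x. x \<in> IX \<Longrightarrow> deg x = j \<Longrightarrow> freeact x" shows "card {al. gd al} dvd card {x\<in>IX. deg x = j}"
 proof (rule free_dvd[OF sgd_all])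
 show "al = eps" if "al \<in> {al. gd al}" "x \<in> {x\<in>IX. deg x = j}" "cm al x = x" for al x
  using assms[of x] that unfolding freeact_def by blast
qed (auto simp: gd_act)

lemma deg_list: "map deg xs = [i] \<Longrightarrow> \<exists>a. xs = [a] \<and> deg a = i" "map deg xs = [i,j] \<Longrightarrow> \<exists>a b. xs = [a,b] \<and> deg a = i \<and> deg b = j"
 by auto
lemma deg_ge2: assumes "x \<in> IX" "\<not> gd x" shows "2 \<le> deg x"
 using IX_deg[OF assms(1)] deg1_gd[OF assms(1)] assms(2) by (cases "deg x = 1") auto
lemma cIX: "x \<in> IX \<Longrightarrow> y \<in> IX \<Longrightarrow> ischar (cm x y)" by (simp add: IX_char ischar_cm)
lemma dIX: "x \<in> IX \<Longrightarrow> y \<in> IX \<Longrightarrow> deg (cm x y) = deg x * deg y" by (simp add: IX_char deg_cm)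
lemma aIX: "x \<in> IX \<Longrightarrow> deg (adj S x) = deg x" by (simp add: IX_char deg_adj)
lemma mu_gd_zero: "gd al \<Longrightarrow> x \<in> IX \<Longrightarrow> y \<in> IX \<Longrightarrow> deg x \<noteq> deg y \<Longrightarrow> mu (cm x y) al = 0"
 using mu_gd(1)[of al x y] gd_act(2)[of al "adj S y"] by (auto simp: adj_IX aIX)
lemma mu_mult_le: assumes f: "ischar f" and X: "X \<subseteq> IX" shows "(\<Sum>x\<in>X. mu f x * deg x) \<le> deg f"
 unfolding deg_expand[OF f] by (rule sum_mono2) (use X in auto)

lemma count_one: "mu f x > 0 \<Longrightarrow> count_list [x] y \<le> mu f y"
 by (cases "x = y") simp_all

lemma prod_dec:
 assumes I: "x \<in> IX" "y \<in> IX" and ws: "set ws \<subseteq> IX" "\<And>z. z \<in> IX \<Longrightarrow> count_list ws z \<le> mu (cm x y) z"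
  and g: "\<And>z. gd z \<Longrightarrow> mu (cm x y) z \<le> count_list ws z"
 obtains xs where "set xs \<subseteq> IX" "cm x y = sum_list ws + sum_list xs"
  "\<And>z. z \<in> IX \<Longrightarrow> mu (cm x y) z = count_list ws z + count_list xs z"
  "deg x * deg y = sum_list (map deg ws) + sum_list (map deg xs)"
  "\<And>z. z \<in> set xs \<Longrightarrow> \<not> gd z" "\<And>n. n \<in> set (map deg xs) \<Longrightarrow> 2 \<le> n"
proof -
 obtain xs where xs: "set xs \<subseteq> IX" "cm x y = sum_list ws + sum_list xs"
  "\<And>z. z \<in> IX \<Longrightarrow> mu (cm x y) z = count_list ws z + count_list xs z"
  "deg (cm x y) = sum_list (map deg ws) + sum_list (map deg xs)"
  using char_dec[OF cIX[OF I] ws] by blast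
 have ng: "\<not> gd z" if "z \<in> set xs" for z
 proof
  assume "gd z"
  then have "count_list xs z = 0" using g[of z] xs(3) gd_IX(1)[of z] by simp
  then show False using that by (simp add: count_list_0_iff)
 qed
 show ?thesis by (rule that[OF xs(1-3) _ ng]) (use xs ng dIX[OF I] deg_ge2 in auto)
qed

lemma square_dec: assumes x: "x \<in> IX" "freeact x"
 obtains xs where "set xs \<subseteq> IX" "cm x (adj S x) = eps + sum_list xs"
  "\<And>y. y \<in> IX \<Longrightarrow> mu (cm x (adj S x)) y = count_list [eps] y + count_list xs y"
  "deg x * deg x = 1 + sum_list (map deg xs)" "\<And>y. y \<in> set xs \<Longrightarrow> \<not> gd y" "\<And>n. n \<in> set (map deg xs) \<Longrightarrow> 2 \<le> n"
proof -
 have "mu (cm x (adj S x)) al = (if al = eps then 1 else 0)" if "gd al" for al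
 proof (cases "cm al x = x")
  case True then show ?thesis using mu_gd_self[OF that x(1)] x(2) that unfolding freeact_def by metis
 next
  case False then show ?thesis using mu_gd_self[OF that x(1)] by auto
 qed
 then have m: "mu (cm x (adj S x)) al = count_list [eps] al" if "gd al" for al using that by (cases "al = eps") simp_all
 have "count_list [eps] y \<le> mu (cm x (adj S x)) y" for y by (rule count_one) (simp add: m[OF gd_eps])
 then show ?thesis
  by (rule_tac prod_dec[OF x(1) adj_IX[OF x(1)], of "[eps]"]) (use that m gd_IX[OF gd_eps] aIX[OF x(1)] in auto)
qed

text \<open>By freeness \<open>eps\<close> is the only one-dimensional constituent, and the
  remaining degree 3 is no sum of two numbers above 1.\<close>

lemma psi_square: assumes p: "psi \<in> IX" "deg psi = 2" "freeact psi"
 obtains xi where "xi \<in> IX" "deg xi = 3" "cm psi (adj S psi) = eps + xi"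
proof -
 obtain xs where xs: "set xs \<subseteq> IX" "cm psi (adj S psi) = eps + sum_list xs"
  "deg psi * deg psi = 1 + sum_list (map deg xs)" "\<And>n. n \<in> set (map deg xs) \<Longrightarrow> 2 \<le> n"
  using square_dec[OF p(1,3)] by metis
 have "map deg xs = [3]" by (rule parts_ge2(2)[OF xs(4)]) (use xs(3) p(2) in auto)
 then obtain xi where "xs = [xi]" "deg xi = 3" using deg_list(1) by blast
 then show ?thesis using that xs(1,2) by simp
qed

text \<open>The product has degree 4, so beside xi' there is exactly one constituent, of degree 1;
  by reciprocity it carries psi to psi'.\<close>

lemma two_in_square: assumes p: "psi \<in> IX" "deg psi = 2" and c: "xi \<in> IX" "deg xi = 3" "cm psi (adj S psi) = eps + xi"
  and p': "psi' \<in> IX" "deg psi' = 2" and c': "xi' \<in> IX" "deg xi' = 3" and m: "mu (cm psi' (adj S psi)) xi' > 0"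
 shows "\<exists>h. gd h \<and> psi' = cm h psi \<and> xi' = cm h xi"
proof -
 let ?f = "cm psi' (adj S psi)"
 have a: "adj S psi \<in> IX" using p adj_IX by simp
 have "count_list [xi'] y \<le> mu ?f y" for y using m by (rule count_one)
 then obtain xs where xs: "set xs \<subseteq> IX" "?f = sum_list [xi'] + sum_list xs" "\<And>y. y \<in> IX \<Longrightarrow> mu ?f y = count_list [xi'] y + count_list xs y"
  "deg ?f = sum_list (map deg [xi']) + sum_list (map deg xs)"
  using char_dec[OF cIX[OF p'(1) a], of "[xi']"] c'(1) by auto
 have s: "sum_list (map deg xs) = 1" using xs(4) dIX[OF p'(1) a] p(1,2) p' c' by (simp add: aIX)
 obtain h zs where h: "xs = h # zs" using s by (cases xs) auto
 have hI: "h \<in> IX" using h xs by simp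
 have "deg h = 1" using s h IX_deg[OF hI] by simp
 then have g: "gd h" using deg1_gd hI by blast
 have "zs = []"
 proof (cases zs)
  case (Cons b l)
  then have "deg b > 0" using xs(1) h IX_deg by simp
  then show ?thesis using s h Cons \<open>deg h = 1\<close> by simp
 qed
 then have f: "?f = xi' + h" using xs(2) h by simp
 have "mu ?f h \<noteq> 0" using xs(3)[OF hI] h by simp
 then have e: "psi' = cm h psi" using mu_gd(1)[OF g p'(1) a] by (simp split: if_splits)
 have "?f = h + cm h xi" by (simp add: e cm_assoc c(3) cdist)
 then have "xi' = cm h xi" using f by (simp add: add.commute)
 then show ?thesis using g e by blast
qed

lemma square_adj: assumes "cm psi (adj S psi) = eps + xi" shows "adj S xi = xi"
proof -
 have "adj S (eps + xi) = eps + xi" unfolding assms[symmetric] by (simp add: adjS_mul)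
 then show ?thesis using linD(1)[OF lin_adjS[OF lin_id]] by simp
qed

text \<open>Of the degree 6, psi takes 2. If the rest were 2 + 2, \<open>two_in_square\<close> and
  the free action on xi would produce psi once more, but its multiplicity is 1.\<close>

lemma chi_psi: assumes p: "psi \<in> IX" "deg psi = 2" and c: "xi \<in> IX" "deg xi = 3" "cm psi (adj S psi) = eps + xi" "freeact xi"
 obtains phi where "phi \<in> IX" "deg phi = 4" "cm xi psi = psi + phi"
proof -
 let ?f = "cm xi psi"
 have a: "adj S psi \<in> IX" using p adj_IX by simp
 have mp: "mu ?f (cm h psi) = (if h = eps then 1 else 0)" if h: "gd h" for h
 proof -
  have hc: "cm h xi \<in> IX" "deg (cm h xi) = 3" using gd_act[OF h c(1)] c by auto
  have hI: "h \<in> IX" "deg h = 1" using gd_IX[OF h] by auto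
  have "mu ?f (cm h psi) = mu xi (cm (cm h psi) (adj S psi))" by (rule mu_frob)
  also have "cm (cm h psi) (adj S psi) = h + cm h xi" by (simp add: cm_assoc c(3) cdist)
  also have "mu xi (h + cm h xi) = (if h = eps then 1 else 0)"
  proof -
   have s: "cm h xi = xi \<longleftrightarrow> h = eps" using c(4) h unfolding freeact_def by (metis cm_eps(1))
   have "h \<noteq> xi" using hI c(2) by auto
   then have b: "B xi (h + cm h xi) = (if h = eps then 1 else 0)"
    using s by (auto simp: B_lin B_IX c(1) hI hc)
   show ?thesis unfolding mu_def b by (rule the_equality) auto
  qed
  finally show ?thesis .
 qed
 have "mu ?f psi = 1" using mp[OF gd_eps] by simp
 then have "count_list [psi] y \<le> mu ?f y" for y by (intro count_one) simp
 moreover have "mu ?f g \<le> count_list [psi] g" if "gd g" for g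
  using mu_gd_zero[OF that c(1) p(1)] c p by simp
 ultimately obtain xs where xs: "set xs \<subseteq> IX" "?f = psi + sum_list xs" "\<And>y. y \<in> IX \<Longrightarrow> mu ?f y = count_list [psi] y + count_list xs y"
  "sum_list (map deg xs) = 4" "\<And>n. n \<in> set (map deg xs) \<Longrightarrow> 2 \<le> n"
  using p c by (rule_tac prod_dec[OF c(1) p(1), of "[psi]"]) auto
 have "map deg xs = [4] \<or> map deg xs = [2,2]" using parts_ge2(3) xs(4,5) by blast
 moreover have False if two: "map deg xs = [2,2]"
 proof -
  obtain b b' where b: "xs = [b,b']" "deg b = 2" using deg_list(2)[OF two] by blast
  have bI: "b \<in> IX" using b xs by simp
  have mb: "mu ?f b > 0" using xs(3)[OF bI] b by simp
  have "mu ?f b = mu xi (cm b (adj S psi))" by (rule mu_frob)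
  then have "mu (cm b (adj S psi)) xi > 0" using mb mu_sym[of xi] by simp
  from two_in_square[OF p c(1,2,3) bI b(2) c(1,2) this] obtain h where h: "gd h" "b = cm h psi" by blast
  then have "h = eps" using mb mp by (simp split: if_splits)
  then have "b = psi" using h by simp
  then have "mu ?f psi \<ge> 2" using xs(3)[OF p(1)] b by simp
  then show False using \<open>mu ?f psi = 1\<close> by simp
 qed
 ultimately have "map deg xs = [4]" by metis
 then obtain phi where "xs = [phi]" "deg phi = 4" using deg_list(1) by blast
 then show ?thesis using that[of phi] xs(1,2) by simp
qed

text \<open>Of the degree 8, xi takes 3. The rest 5 is irreducible or splits as 2 + 3; then the new
  cubic constituent is a translate h xi with h nontrivial, and two decompositions of its product
  with psi show that h fixes phi.\<close>

lemma phi_psi: assumes p: "psi \<in> IX" "deg psi = 2" and c: "xi \<in> IX" "deg xi = 3" "cm psi (adj S psi) = eps + xi"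
  and f: "phi \<in> IX" "deg phi = 4" "cm xi psi = psi + phi"
 shows "(\<exists>\<kappa>\<in>IX. deg \<kappa> = 5) \<or> (\<exists>h \<eta>. gd h \<and> h \<noteq> eps \<and> \<eta> \<in> IX \<and> deg \<eta> = 2 \<and> cm phi (adj S psi) = xi + cm h xi + \<eta> \<and> cm h phi = phi)"
proof -
 let ?f = "cm phi (adj S psi)"
 have a: "adj S psi \<in> IX" using p adj_IX by simp
 have mf: "mu ?f y = mu phi (cm y psi)" for y using mu_frob(1)[of phi "adj S psi" y] by simp
 have pf: "phi \<noteq> psi" using p f by auto
 have m1: "mu ?f xi = 1"
 proof -
  have "B phi (psi + phi) = 1" using pf by (simp add: B_lin B_IX f p)
  then have "mu phi (psi + phi) = 1" unfolding mu_def by (intro the_equality) auto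
  then show ?thesis unfolding mf f(3) .
 qed
 then have "count_list [xi] y \<le> mu ?f y" for y by (intro count_one) simp
 moreover have "mu ?f g \<le> count_list [xi] g" if "gd g" for g
  using mu_gd_zero[OF that f(1) a] f p by (simp add: aIX)
 ultimately obtain xs where xs: "set xs \<subseteq> IX" "?f = xi + sum_list xs" "\<And>y. y \<in> IX \<Longrightarrow> mu ?f y = count_list [xi] y + count_list xs y"
  "sum_list (map deg xs) = 5" "\<And>n. n \<in> set (map deg xs) \<Longrightarrow> 2 \<le> n"
  using p c f by (rule_tac prod_dec[OF f(1) a, of "[xi]"]) (auto simp: aIX)
 have "map deg xs = [5] \<or> map deg xs = [2,3] \<or> map deg xs = [3,2]" using parts_ge2(4) xs(4,5) by blast
 moreover have ?thesis if "map deg xs = [5]"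
  using deg_list(1)[OF that] xs(1) by auto
 moreover have ?thesis if five: "map deg xs = [2,3] \<or> map deg xs = [3,2]"
 proof -
  obtain \<eta> xi' where x: "xs = [\<eta>,xi'] \<or> xs = [xi',\<eta>]" "deg \<eta> = 2" "deg xi' = 3" using five deg_list(2)[of xs] by blast
  have I: "\<eta> \<in> IX" "xi' \<in> IX" and fe: "?f = xi + xi' + \<eta>" using x(1) xs by (auto simp: add_ac)
  have mc: "mu ?f xi' > 0" using xs(3)[OF I(2)] x(1) by auto
  have cc: "xi' \<noteq> xi" using xs(3)[OF c(1)] m1 x(1) by (auto split: if_splits)
  have mm: "mu (cm xi' psi) phi > 0" using mc mf[of xi'] mu_sym[of phi] by simp
  then have "count_list [phi] y \<le> mu (cm xi' psi) y" for y by (rule count_one)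
  moreover have "mu (cm xi' psi) g \<le> count_list [phi] g" if "gd g" for g
   using mu_gd_zero[OF that I(2) p(1)] x p by simp
  ultimately obtain ys where ys: "set ys \<subseteq> IX" "cm xi' psi = phi + sum_list ys" "\<And>y. y \<in> IX \<Longrightarrow> mu (cm xi' psi) y = count_list [phi] y + count_list ys y"
   "sum_list (map deg ys) = 2" "\<And>n. n \<in> set (map deg ys) \<Longrightarrow> 2 \<le> n"
   using p x f by (rule_tac prod_dec[OF I(2) p(1), of "[phi]"]) auto
  then have "map deg ys = [2]" using parts_ge2(1) by blast
  then obtain psi' where q: "ys = [psi']" "deg psi' = 2" using deg_list(1) by blast
  have qI: "psi' \<in> IX" using ys q by simp
  have "mu (cm xi' psi) psi' > 0" using ys(3)[OF qI] q by simp
  then have "mu (cm psi' (adj S psi)) xi' > 0" using mu_frob(1)[of xi' psi psi'] mu_sym[of xi'] by simp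
  from two_in_square[OF p c qI q(2) I(2) x(3) this] obtain h where h: "gd h" "psi' = cm h psi" "xi' = cm h xi" by blast
  have "cm xi' psi = cm h psi + cm h phi" unfolding h(3) by (simp add: cm_assoc f(3) cdist)
  moreover have "cm xi' psi = phi + cm h psi" using ys(2) q h by simp
  ultimately have "cm h phi = phi" by (simp add: add.commute)
  moreover have "h \<noteq> eps" using cc h by auto
  ultimately show ?thesis using h I x fe by blast
 qed
 ultimately show ?thesis by metis
qed

end

section \<open>Degrees in dimension 56\<close>

lemma sum_list_34: assumes "\<And>n. n \<in> set ns \<Longrightarrow> n = 3 \<or> n = (4::nat)" shows "sum_list ns = 8 \<Longrightarrow> ns = [4,4]" "sum_list ns = 6 \<Longrightarrow> 3 \<in> set ns"
proof -
 have e: "ns = [] \<or> (\<exists>a. ns = [a]) \<or> (\<exists>a b. ns = [a,b]) \<or> sum_list ns \<ge> 9"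
 proof (cases ns)
  case (Cons a l)
  show ?thesis
  proof (cases l)
   case (Cons b k)
   show ?thesis
   proof (cases k)
    case (Cons c j)
    have "a = 3 \<or> a = 4" "b = 3 \<or> b = 4" "c = 3 \<or> c = 4" using assms by (auto simp: \<open>ns = _\<close> \<open>l = _\<close> Cons)
    then show ?thesis by (auto simp: \<open>ns = _\<close> \<open>l = _\<close> Cons)
   qed (use \<open>ns = _\<close> \<open>l = _\<close> in auto)
  qed (use \<open>ns = _\<close> in auto)
 qed simp
 show "ns = [4,4]" if s: "sum_list ns = 8"
 proof -
  obtain a b where ab: "ns = [a,b]" using e s assms by auto
  then show ?thesis using assms[of a] assms[of b] s by auto
 qed
 show "3 \<in> set ns" if s: "sum_list ns = 6"
 proof -
  obtain a b where ab: "ns = [a,b]" using e s assms by auto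
  then show ?thesis using assms[of a] assms[of b] s by auto
 qed
qed

lemma dvd56: assumes "(g::nat) dvd 56" shows "g \<in> {1,2,4,7,8,14,28,56}"
proof -
 have "\<forall>g\<in>set [0..<57]. g dvd 56 \<longrightarrow> g \<in> {1,2,4,7,8,14,28,56::nat}" by code_simp
 moreover have "g < 57" using dvd_imp_le[OF assms] by simp
 ultimately show ?thesis using assms by simp
qed

text \<open>In this lemma and the next two, 55 and 54 are 56 minus the number of one-dimensional
  characters, and the coefficients are squared degrees. The parity conditions express that a group
  of order 2 acts freely on characters of odd degree.\<close>

lemma arith1: "(55::nat) \<noteq> 9 * a + 16 * b + 25 * c + 36 * d + 49 * e"
proof
 assume h: "55 = 9 * a + 16 * b + 25 * c + 36 * d + 49 * e"
 have "\<forall>b\<in>set [0..<4]. \<forall>c\<in>set [0..<3]. \<forall>d\<in>set [0..<2]. \<forall>e\<in>set [0..<2]. \<forall>a\<in>set [0..<7]. 55 \<noteq> 9 * a + 16 * b + 25 * c + 36 * d + 49 * (e::nat)"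
  by code_simp
 note A = this
 have "a < 7" "b < 4" "c < 3" "d < 2" "e < 2" using h by linarith+
 then show False using A[rule_format, of b c d e a] h by simp
qed
lemma arith2: assumes h: "(54::nat) = 9 * a + 16 * b + 25 * c + 36 * d" and ev: "even a" "even c"
 shows "b = 0 \<and> c = 0 \<and> a > 0"
proof -
 have "\<forall>b\<in>set [0..<4]. \<forall>c\<in>set [0..<3]. \<forall>d\<in>set [0..<2]. \<forall>a\<in>set [0..<7]. even a \<longrightarrow> even c \<longrightarrow> 54 = 9 * a + 16 * b + 25 * c + 36 * (d::nat) \<longrightarrow> b = 0 \<and> c = 0 \<and> a > 0"
  by code_simp
 note A = this
 have "a < 7" "b < 4" "c < 3" "d < 2" using h by linarith+
 then show ?thesis using A[rule_format, of b c d a] h ev by simp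
qed
lemma arith3: assumes h: "(54::nat) = 4 * x + 9 * a + 16 * b + 25 * c + 36 * d" and ev: "even a" "even c" "x > 0"
 shows "(x = 1 \<or> x \<ge> 5 \<and> a = 2 \<and> d = 0) \<and> (a > 0 \<longrightarrow> c = 0)"
proof -
 have "\<forall>x\<in>set [0..<14]. \<forall>b\<in>set [0..<4]. \<forall>c\<in>set [0..<3]. \<forall>d\<in>set [0..<2]. \<forall>a\<in>set [0..<7]. even a \<longrightarrow> even c \<longrightarrow> x > 0 \<longrightarrow> 54 = 4 * x + 9 * a + 16 * b + 25 * c + 36 * (d::nat) \<longrightarrow> (x = 1 \<or> x \<ge> 5 \<and> a = 2 \<and> d = 0) \<and> (a > 0 \<longrightarrow> c = 0)"
  by code_simp
 note A = this
 have "x < 14" "a < 7" "b < 4" "c < 3" "d < 2" using h by linarith+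
 then show ?thesis using A[rule_format, of x b c d a] h ev by simp
qed

context hopf_wed begin

definition nd :: "nat \<Rightarrow> nat" where "nd j = card {x\<in>IX. deg x = j}"
abbreviation "Gd \<equiv> {al. gd al}"

lemma nd1: "nd 1 = card Gd" by (simp add: nd_def gd_iff)
lemma nd_pos: "x \<in> IX \<Longrightarrow> nd (deg x) > 0" by (auto simp: nd_def card_gt_0_iff)
lemma nd_zero: "nd j = 0 \<Longrightarrow> x \<in> IX \<Longrightarrow> deg x \<noteq> j" using nd_pos[of x] by auto
lemma nd_ex: "nd j > 0 \<Longrightarrow> \<exists>x\<in>IX. deg x = j" by (auto simp: nd_def card_gt_0_iff)
lemma nd_one: "nd j = 1 \<Longrightarrow> x \<in> IX \<Longrightarrow> deg x = j \<Longrightarrow> y \<in> IX \<Longrightarrow> deg y = j \<Longrightarrow> x = y"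
proof -
 assume a: "nd j = 1" "x \<in> IX" "deg x = j" "y \<in> IX" "deg y = j"
 obtain s where s: "{x\<in>IX. deg x = j} = {s}" using a(1) unfolding nd_def by (rule card_1_singletonE)
 have "x \<in> {x\<in>IX. deg x = j}" "y \<in> {x\<in>IX. deg x = j}" using a by auto
 then show "x = y" unfolding s by blast
qed

lemma gd_pair: assumes "card Gd = 2" obtains g where "gd g" "g \<noteq> eps" "cm g g = eps" "adj S g = g" "\<And>h. gd h \<Longrightarrow> h = eps \<or> h = g"
proof -
 obtain x y where xy: "Gd = {x,y}" "x \<noteq> y" using assms by (auto simp: card_2_iff)
 obtain g where g: "Gd = {eps,g}" "g \<noteq> eps" using xy gd_eps by (metis doubleton_eq_iff insert_iff mem_Collect_eq singletonD insertE)
 have gg: "gd g" and o: "gd h \<Longrightarrow> h = eps \<or> h = g" for h using g by auto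
 have "cm g g \<noteq> g" using gd_cancel(1)[OF gg, of g eps] g by auto
 then have "cm g g = eps" using o[OF gd_cm[OF gg gg]] by blast
 moreover have "adj S g = g" using o[OF gd_inv(3)[OF gg]] g(2) by (metis adjSS adjS_eps)
 ultimately show ?thesis using that gg g(2) o by blast
qed

lemma gd_shift_mu: "gd g \<Longrightarrow> mu (cm g f) (cm g h) = mu f h"
 by (simp add: mu_frob(2) cm_assoc[symmetric] gd_inv)
text \<open>Together with xi the character f contains the different translate g xi equally often,
  which uses degree 6.\<close>

lemma fixed_no_cubic: assumes f: "ischar f" and g: "gd g" "g \<noteq> eps" "cm g f = f" and c: "xi \<in> IX" "deg xi = 3" "freeact xi" "mu f xi > 0"
 shows "6 \<le> deg f"
proof -
 have n: "cm g xi \<noteq> xi" using c(3) g(1,2) unfolding freeact_def by blast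
 have "mu f (cm g xi) = mu f xi" using gd_shift_mu[OF g(1), of f xi] g(3) by simp
 then have "(\<Sum>x\<in>{xi, cm g xi}. mu f x * deg x) = 6 * mu f xi" using n gd_act(2)[OF g(1) c(1)] c(2) by simp
 then show ?thesis using mu_mult_le[OF f, of "{xi, cm g xi}"] c(1,4) gd_act(1)[OF g(1) c(1)] by simp
qed

text \<open>The second alternative of \<open>phi_psi\<close> for an involution g. Associativity
  determines all products of \<open>eps\<close>, g, X, g X and Y: they are the fusion rules of the
  symmetric group S_4, closed with 1 + 1 + 9 + 9 + 4 = 24.\<close>

lemma closed24:
 assumes G: "gd g" "g \<noteq> eps" "cm g g = eps" "adj S g = g"
  and p: "psi \<in> IX" "deg psi = 2" and c: "X \<in> IX" "deg X = 3" "cm psi (adj S psi) = eps + X" "freeact X"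
  and f: "phi \<in> IX" "deg phi = 4" "cm X psi = psi + phi"
  and Y: "Y \<in> IX" "deg Y = 2" "cm phi (adj S psi) = X + cm g X + Y" "cm g phi = phi"
 shows "24 dvd CARD('n)"
proof -
 have adjp: "adj S (x + y) = adj S x + adj S y" for x y using linD(1)[OF lin_adjS[OF lin_id]] by simp
 have gX: "cm g X \<in> IX" "deg (cm g X) = 3" "cm g X \<noteq> X" using gd_act[OF G(1) c(1)] c(2,4) G unfolding freeact_def by auto
 have Xg: "cm X g \<in> IX" "deg (cm X g) = 3" using gd_act[OF G(1) c(1)] c(2) by auto
 have I: "eps \<in> IX" "g \<in> IX" "deg eps = 1" "deg g = 1" using gd_IX[OF gd_eps] gd_IX[OF G(1)] by auto
 have Xa: "adj S X = X" by (rule square_adj[OF c(3)])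
 \<comment> \<open>X psi psi' with psi' the dual of psi is computed in two ways, through psi psi' =
   \<open>eps\<close> + X and through X psi = psi + phi.\<close>
 have XX: "cm X X = eps + X + cm g X + Y"
 proof -
  have "cm X (cm psi (adj S psi)) = cm (cm X psi) (adj S psi)" by (simp add: cm_assoc)
  then have "X + cm X X = eps + X + (X + cm g X + Y)" by (simp add: c(3) f(3) cdist Y(3))
  then show ?thesis by (simp add: algebra_simps)
 qed
 have s: "cm g X + Y = cm X g + adj S Y"
 proof -
  have "adj S (cm X X) = cm X X" by (simp add: adjS_mul Xa)
  then have "eps + X + cm X g + adj S Y = eps + X + cm g X + Y" by (simp add: XX adjp adjS_mul Xa G)
  then show ?thesis by (simp add: algebra_simps)
 qed
 have Ya: "adj S Y \<in> IX" "deg (adj S Y) = 2" using adj_IX[OF Y(1)] aIX[OF Y(1)] Y(2) by auto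
 have XG: "cm X g = cm g X"
 proof (rule ccontr)
  assume n: "cm X g \<noteq> cm g X"
  have "B (cm g X + Y) (cm g X) = 1" using Y(2) gX by (auto simp: B_lin B_IX Y(1) gX(1))
  moreover have "B (cm X g + adj S Y) (cm g X) = 0" using n Ya gX by (auto simp: B_lin B_IX Xg(1))
  ultimately show False using s by simp
 qed
 have Yad: "adj S Y = Y" using s XG by simp
 have gY: "cm g Y = Y"
 proof -
  have "cm g (cm phi (adj S psi)) = cm phi (adj S psi)" by (simp add: cm_assoc[symmetric] Y(4))
  then have "cm g X + X + cm g Y = X + cm g X + Y" by (simp add: Y(3) cdist cm_assoc[symmetric] G(3))
  then show ?thesis by (simp add: algebra_simps)
 qed
 have Yg: "cm Y g = Y"
 proof -
  have "adj S (cm g Y) = adj S Y" by (simp add: gY)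
  then show ?thesis by (simp add: adjS_mul Yad G)
 qed
 have mb: "mu a b = 1" if "B a b = 1" for a b unfolding mu_def that by (rule the_equality) auto
 have Yne: "Y \<noteq> eps" "Y \<noteq> g" "Y \<noteq> X" "Y \<noteq> cm g X" using Y(2) c(2) gX(2) I by auto
 have YX: "cm Y X = X + cm g X"
 proof -
  have "B (cm Y X) X = B Y (cm X X)" by (simp add: B_frob(1) Xa)
  also have "\<dots> = 1" unfolding XX using Yne by (simp add: B_lin B_IX I Y(1) gX(1) c(1))
  finally have m1: "mu (cm Y X) X = 1" by (rule mb)
  have "B (cm Y X) (cm g X) = B Y (cm g (cm X X))" by (simp add: B_frob(1) Xa cm_assoc)
  also have "\<dots> = 1" unfolding XX using Yne by (simp add: B_lin B_IX I Y(1) gX(1) c(1) cdist gY cm_assoc[symmetric] G(3))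
  finally have m2: "mu (cm Y X) (cm g X) = 1" by (rule mb)
  have "count_list [X, cm g X] y \<le> mu (cm Y X) y" for y
   using m1 m2 gX(3) by (cases "y = X"; cases "y = cm g X") simp_all
  then obtain xs where xs: "set xs \<subseteq> IX" "cm Y X = sum_list [X, cm g X] + sum_list xs" "\<And>y. y \<in> IX \<Longrightarrow> mu (cm Y X) y = count_list [X, cm g X] y + count_list xs y"
   "deg (cm Y X) = sum_list (map deg [X, cm g X]) + sum_list (map deg xs)"
   using char_dec[OF cIX[OF Y(1) c(1)], of "[X, cm g X]"] c(1) gX(1) by auto
  have "sum_list (map deg xs) = 0" using xs(4) dIX[OF Y(1) c(1)] by (simp add: gX c(2) Y(2))
  then have "xs = []" using xs(1) IX_deg[of "hd xs"] by (cases xs) auto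
  then show ?thesis using xs(2) by simp
 qed
 have XY: "cm X Y = X + cm g X"
 proof -
  have "adj S (cm Y X) = X + cm X g" by (simp add: YX adjp adjS_mul Xa G)
  then show ?thesis by (simp add: adjS_mul Xa Yad XG)
 qed
 have YY: "cm Y Y = eps + g + Y"
 proof -
  have gg: "cm g (cm g z) = z" for z by (simp add: cm_assoc[symmetric] G)
  have XgX: "cm X (cm g X) = cm g (cm X X)" using XG by (simp add: cm_assoc[symmetric])
  have "cm X (cm X Y) = cm (cm X X) Y" by (simp add: cm_assoc)
  moreover have "cm X (cm X Y) = cm X X + cm g (cm X X)" unfolding XY by (simp add: cdist XgX)
  moreover have "cm g (cm X X) = g + cm g X + X + Y" unfolding XX by (simp add: cdist gg gY)
  moreover have "cm (cm X X) Y = Y + (X + cm g X) + (cm g X + X) + cm Y Y"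
   unfolding XX by (simp add: cdist XY cm_assoc gg)
  ultimately have "Y + (X + cm g X) + (cm g X + X) + cm Y Y = (eps + X + cm g X + Y) + (g + cm g X + X + Y)"
   using XX by simp
  then show ?thesis by (simp add: algebra_simps)
 qed
 have gg: "cm g (cm g z) = z" for z by (simp add: cm_assoc[symmetric] G)
 have Xgz: "cm X (cm g z) = cm g (cm X z)" for z by (simp add: cm_assoc[symmetric] XG)
 have Ygz: "cm Y (cm g z) = cm Y z" for z by (simp add: cm_assoc[symmetric] Yg)
 let ?K = "{eps, g, X, cm g X, Y}"
 have "(\<Sum>x\<in>?K. (deg x)^2) dvd CARD('n)"
 proof (rule closed_dvd)
  show "?K \<subseteq> IX" "eps \<in> ?K" using I Y gX c by auto
  show "adj S x \<in> ?K" if "x \<in> ?K" for x using that by (auto simp: Xa Yad G adjS_mul XG)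
  fix x y z assume z: "z \<in> IX" "z \<notin> ?K" and xy: "x \<in> ?K" "y \<in> ?K"
  have b: "B eps z = 0" "B g z = 0" "B X z = 0" "B (cm g X) z = 0" "B Y z = 0" using z by (auto simp: B_IX I c gX Y)
  note R = cm_assoc G(3) gg XX XG Xgz gY Yg Ygz YX XY YY cdist B_lin b
  from xy(1) consider "x = eps" | "x = g" | "x = X" | "x = cm g X" | "x = Y" by blast
  then show "B (cm x y) z = 0"
  proof cases
   case 1 then show ?thesis using xy(2) b by auto
  next
   case 2 then show ?thesis using xy(2) by (elim insertE emptyE) (simp_all add: R)
  next
   case 3 then show ?thesis using xy(2) by (elim insertE emptyE) (simp_all add: R)
  next
   case 4 then show ?thesis using xy(2) by (elim insertE emptyE) (simp_all add: R)
  next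
   case 5 then show ?thesis using xy(2) by (elim insertE emptyE) (simp_all add: R)
  qed
 qed
 moreover have "(\<Sum>x\<in>?K. (deg x)^2) = 24"
 proof -
  have "eps \<noteq> g" "eps \<noteq> X" "eps \<noteq> cm g X" "eps \<noteq> Y" "g \<noteq> X" "g \<noteq> cm g X" "g \<noteq> Y" "X \<noteq> cm g X" "X \<noteq> Y" "cm g X \<noteq> Y"
   using G(2) Yne gX I c(2) by auto
  then show ?thesis by (simp add: I c(2) gX(2) Y(2) power2_eq_square)
 qed
 ultimately show ?thesis by simp
qed

text \<open>Uniqueness makes psi self-dual and fixed by g, so psi psi = \<open>eps\<close> + g + psi
  as for the symmetric group S_3, with 1 + 1 + 4 = 6.\<close>

lemma closed6: assumes G: "gd g" "g \<noteq> eps" "cm g g = eps" "adj S g = g" "\<And>h. gd h \<Longrightarrow> h = eps \<or> h = g"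
  and p: "psi \<in> IX" "deg psi = 2" "nd 2 = 1"
 shows "6 dvd CARD('n)"
proof -
 have u: "y = psi" if "y \<in> IX" "deg y = 2" for y by (rule nd_one[OF p(3) that p(1,2)])
 have a: "adj S psi = psi" by (rule u) (simp_all only: adj_IX p aIX)
 have gp: "cm g psi = psi" "cm psi g = psi" by (rule u; simp only: gd_act[OF G(1) p(1)] p)+
 have I: "eps \<in> IX" "g \<in> IX" "deg eps = 1" "deg g = 1" using gd_IX[OF gd_eps] gd_IX[OF G(1)] by auto
 let ?f = "cm psi psi"
 have m: "mu ?f h = 1" if "gd h" for h using mu_gd_self[OF that p(1)] G(5)[OF that] a gp by auto
 have "count_list [eps,g] y \<le> mu ?f y" for y
  using m[OF gd_eps] m[OF G(1)] G(2) by (cases "y = eps"; cases "y = g") simp_all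
 moreover have "mu ?f h \<le> count_list [eps,g] h" if "gd h" for h using m[OF that] G(2) G(5)[OF that] by auto
 ultimately obtain xs where xs: "set xs \<subseteq> IX" "?f = eps + g + sum_list xs"
  "sum_list (map deg xs) = 2" "\<And>n. n \<in> set (map deg xs) \<Longrightarrow> 2 \<le> n"
  using p I by (rule_tac prod_dec[OF p(1) p(1), of "[eps,g]"]) (auto simp: add_ac)
 then have "map deg xs = [2]" using parts_ge2(1) by blast
 then obtain z where z: "xs = [z]" "deg z = 2" using deg_list(1) by blast
 then have "z = psi" by (intro u) (use xs(1) in simp_all)
 then have pp: "?f = eps + g + psi" using xs(2) z by simp
 let ?K = "{eps, g, psi}"
 have "(\<Sum>x\<in>?K. (deg x)^2) dvd CARD('n)"
 proof (rule closed_dvd)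
  show "?K \<subseteq> IX" "eps \<in> ?K" using I p by auto
  show "adj S x \<in> ?K" if "x \<in> ?K" for x using that by (auto simp: a G)
  fix x y z assume z: "z \<in> IX" "z \<notin> ?K" and xy: "x \<in> ?K" "y \<in> ?K"
  have b: "B eps z = 0" "B g z = 0" "B psi z = 0" using z by (auto simp: B_IX I p)
  show "B (cm x y) z = 0" using xy by (elim insertE emptyE) (simp_all add: b B_lin pp gp G(3))
 qed
 moreover have "(\<Sum>x\<in>?K. (deg x)^2) = 6"
 proof -
  have "eps \<noteq> psi" "g \<noteq> psi" using p I by auto
  then show ?thesis using G(2) by (auto simp: I p(2) power2_eq_square)
 qed
 ultimately show ?thesis by simp
qed

text \<open>A character of degree 2 exists by \<open>arith1\<close> and produces characters of
  degrees 3, 4 and 5. One of each degree from 1 to 5 already sums to 55, and the missing 1 cannot be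
  filled.\<close>

lemma kill1: assumes N: "CARD('n) = 56" and c: "card Gd = 1" and s: "56 = 1 + 4 * nd 2 + 9 * nd 3 + 16 * nd 4 + 25 * nd 5 + 36 * nd 6 + 49 * nd 7"
 shows False
proof -
 have fr: "freeact x" if "x \<in> IX" for x using freeact_coprime[OF that] c by simp
 have e: "h = eps" if "gd h" for h
 proof -
  obtain z where "Gd = {z}" using c by (auto simp: card_1_singleton_iff)
  then have "h \<in> {z}" "eps \<in> {z}" using gd_eps that by blast+
  then show ?thesis by simp
 qed
 have "nd 2 > 0"
 proof (rule ccontr)
  assume "\<not> ?thesis" then show False using s arith1[of "nd 3" "nd 4" "nd 5" "nd 6" "nd 7"] by simp
 qed
 then obtain psi where p: "psi \<in> IX" "deg psi = 2" using nd_ex by blast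
 obtain xi where x: "xi \<in> IX" "deg xi = 3" "cm psi (adj S psi) = eps + xi" using psi_square[OF p fr[OF p(1)]] by blast
 obtain phi where f: "phi \<in> IX" "deg phi = 4" "cm xi psi = psi + phi" using chi_psi[OF p x fr[OF x(1)]] by blast
 have "\<exists>\<kappa>\<in>IX. deg \<kappa> = 5" using phi_psi[OF p x f] e by blast
 then have "nd 5 > 0" using nd_pos by metis
 moreover have "nd 3 > 0" "nd 4 > 0" using nd_pos[OF x(1)] nd_pos[OF f(1)] x f by auto
 ultimately have "nd 2 = 1" "nd 3 = 1" "nd 4 = 1" "nd 5 = 1" "nd 6 = 0" "nd 7 = 0" using s \<open>nd 2 > 0\<close> by linarith+
 then show False using s by linarith
qed

text \<open>Without degree 2 all nonlinear degrees are 3 or 6, but 9 - 1 = 8 is not a multiple of 3.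
  A character of degree 2 moved by g leads to \<open>closed24\<close>, a single fixed one to
  \<open>closed6\<close>. If there are at least five, all fixed, each occurs in xi times its dual
  for a cubic xi, and 1 + 2 * 5 exceeds 9.\<close>

lemma kill2: assumes N: "CARD('n) = 56" and c: "card Gd = 2" and s: "54 = 4 * nd 2 + 9 * nd 3 + 16 * nd 4 + 25 * nd 5 + 36 * nd 6" "nd 7 = 0"
  and le: "\<And>x. x \<in> IX \<Longrightarrow> deg x \<le> 7"
  and ev: "even (nd 3)" "even (nd 5)"
 shows False
proof -
 obtain g where G: "gd g" "g \<noteq> eps" "cm g g = eps" "adj S g = g" "\<And>h. gd h \<Longrightarrow> h = eps \<or> h = g" using gd_pair[OF c] by blast
 have fr: "freeact x" if "x \<in> IX" "deg x = 3" for x using freeact_coprime[OF that(1)] c that(2) by simp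
 show False
 proof (cases "nd 2 = 0")
  case True
  have z: "nd 4 = 0" "nd 5 = 0" "nd 3 > 0" using arith2[OF _ ev, of "nd 4" "nd 6"] s True by auto
  then obtain xi where x: "xi \<in> IX" "deg xi = 3" using nd_ex by blast
  obtain xs where xs: "set xs \<subseteq> IX" "deg xi * deg xi = 1 + sum_list (map deg xs)" "\<And>y. y \<in> set xs \<Longrightarrow> \<not> gd y"
   using square_dec[OF x(1) fr[OF x]] by metis
  have "3 dvd deg y" if "y \<in> set xs" for y
  proof -
   have y: "y \<in> IX" "\<not> gd y" using that xs by auto
   then have "2 \<le> deg y" "deg y \<le> 7" using deg_ge2 le by auto
   moreover have "deg y \<noteq> 2" "deg y \<noteq> 4" "deg y \<noteq> 5" "deg y \<noteq> 7" using nd_zero y(1) z True s(2) by auto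
   ultimately have "deg y = 3 \<or> deg y = 6" by linarith
   then show ?thesis by auto
  qed
  then have "3 dvd sum_list (map deg xs)" by (induction xs) auto
  moreover have "sum_list (map deg xs) = 8" using xs(2) x(2) by simp
  ultimately show False by simp
 next
  case False
  show False
  proof (cases "\<forall>psi\<in>IX. deg psi = 2 \<longrightarrow> cm g psi = psi")
   case fx: False
   then obtain psi where p: "psi \<in> IX" "deg psi = 2" "cm g psi \<noteq> psi" by blast
   then have pf: "freeact psi" unfolding freeact_def using G(5) by blast
   obtain xi where x: "xi \<in> IX" "deg xi = 3" "cm psi (adj S psi) = eps + xi" using psi_square[OF p(1,2) pf] by blast
   obtain phi where f: "phi \<in> IX" "deg phi = 4" "cm xi psi = psi + phi" using chi_psi[OF p(1,2) x fr[OF x(1,2)]] by blast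
   have "nd 3 > 0" using nd_pos[OF x(1)] x by simp
   then have "nd 5 = 0" using arith3[OF s(1) ev] False by auto
   then have "\<not> (\<exists>\<kappa>\<in>IX. deg \<kappa> = 5)" using nd_zero by blast
   then obtain h \<eta> where h: "gd h" "h \<noteq> eps" "\<eta> \<in> IX" "deg \<eta> = 2" "cm phi (adj S psi) = xi + cm h xi + \<eta>" "cm h phi = phi"
    using phi_psi[OF p(1,2) x f] by blast
   have "h = g" using G(5) h by blast
   then have "24 dvd CARD('n)" using closed24[OF G(1-4) p(1,2) x fr[OF x(1,2)] f h(3,4)] h by blast
   then show False using N by simp
  next
   case fx: True
   show False
   proof (cases "nd 2 = 1")
    case True
    obtain psi where p: "psi \<in> IX" "deg psi = 2" using nd_ex[of 2] True by auto
    have "6 dvd CARD('n)" by (rule closed6[OF G p True])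
    then show False using N by simp
   next
    case n1: False
    then have a: "nd 2 \<ge> 5" "nd 3 = 2" "nd 6 = 0" "nd 5 = 0" using arith3[OF s(1) ev] False by auto
    obtain xi where x: "xi \<in> IX" "deg xi = 3" using nd_ex[of 3] a by auto
    have gx: "cm g xi \<in> IX" "deg (cm g xi) = 3" "cm g xi \<noteq> xi" using gd_act[OF G(1) x(1)] x fr[OF x] G unfolding freeact_def by auto
    have three: "y = xi \<or> y = cm g xi" if "y \<in> IX" "deg y = 3" for y
    proof -
     have "{xi, cm g xi} = {y\<in>IX. deg y = 3}"
      by (rule card_subset_eq) (use x gx a(2) in \<open>auto simp: nd_def\<close>)
     then show ?thesis using that by blast
    qed
    \<comment> \<open>psi xi has degree 6 and constituents of degrees 3 and 4 only, so a cubic one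
      occurs. It is xi or g xi, and these occur equally often because g fixes psi.\<close>
    have key: "mu (cm xi (adj S xi)) psi > 0" if p: "psi \<in> IX" "deg psi = 2" for psi
    proof -
     have gp: "cm g psi = psi" using fx p by blast
     have pa: "adj S psi \<in> IX" "deg (adj S psi) = 2" using adj_IX[OF p(1)] aIX[OF p(1)] p by auto
     have gpa: "cm g (adj S psi) = adj S psi" using fx pa by blast
     let ?f = "cm psi xi"
     obtain xs where xs: "set xs \<subseteq> IX" "?f = sum_list xs" "\<And>y. y \<in> IX \<Longrightarrow> count_list xs y = mu ?f y"
      using dec[OF cIX[OF p(1) x(1)]] by metis
     have sm: "sum_list (map deg xs) = 6" using ischar_sum_list[OF xs(1) cIX[OF p(1) x(1)] xs(2)] dIX[OF p(1) x(1)] p x by simp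
     have pos: "mu ?f y > 0" if "y \<in> set xs" for y using xs(1,3) that count_list_0_iff[of xs y] by (metis gr0I subsetD)
     have m34: "deg y = 3 \<or> deg y = 4" if "y \<in> set xs" for y
     proof -
      have y: "y \<in> IX" using that xs by auto
      have "\<not> gd y" using mu_gd_zero[OF _ p(1) x(1), of y] pos[OF that] p x by auto
      then have "2 \<le> deg y" "deg y \<le> 7" using deg_ge2 le y by auto
      moreover have "deg y \<noteq> 6" "deg y \<noteq> 5" "deg y \<noteq> 7" using nd_zero y(1) a s(2) by auto
      moreover have "deg y \<noteq> 2"
      proof
       assume d: "deg y = 2"
       have "mu (cm (adj S psi) y) xi = mu y ?f" using mu_frob(2)[of "adj S psi" y xi] by simp
       then have "mu (cm (adj S psi) y) xi > 0" using pos[OF that] mu_sym[of y] by simp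
       moreover have "cm g (cm (adj S psi) y) = cm (adj S psi) y" using gpa by (simp add: cm_assoc[symmetric])
       ultimately have "6 \<le> deg (cm (adj S psi) y)" using fixed_no_cubic[OF cIX[OF pa(1) y] G(1,2) _ x fr[OF x]] by blast
       then show False using dIX[OF pa(1) y] pa d by simp
      qed
      ultimately show ?thesis by linarith
     qed
     have "3 \<in> set (map deg xs)" by (rule sum_list_34(2)[OF _ sm]) (use m34 in auto)
     then obtain y where y: "y \<in> set xs" "deg y = 3" by auto
     then have "y = xi \<or> y = cm g xi" using three xs(1) by blast
     moreover have "mu ?f (cm g xi) = mu ?f xi" using gd_shift_mu[OF G(1), of ?f xi] gp by (simp add: cm_assoc[symmetric])
     ultimately have "mu ?f xi > 0" using pos[OF y(1)] by auto
     moreover have "mu ?f xi = mu psi (cm xi (adj S xi))" by (rule mu_frob)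
     ultimately show ?thesis using mu_sym[of psi] by simp
    qed
    let ?q = "cm xi (adj S xi)"
    let ?X = "insert eps {y\<in>IX. deg y = 2}"
    have q: "ischar ?q" "deg ?q = 9" using cIX[OF x(1) adj_IX[OF x(1)]] dIX[OF x(1) adj_IX[OF x(1)]] aIX[OF x(1)] x by auto
    have m1: "mu ?q eps = 1" using mu_gd_self[OF gd_eps x(1)] by simp
    have "(\<Sum>y\<in>?X. mu ?q y * deg y) = 1 + (\<Sum>y\<in>{y\<in>IX. deg y = 2}. mu ?q y * deg y)"
     using m1 gd_IX[OF gd_eps] by simp
    moreover have "(\<Sum>y\<in>{y\<in>IX. deg y = 2}. 2) \<le> (\<Sum>y\<in>{y\<in>IX. deg y = 2}. mu ?q y * deg y)"
     by (rule sum_mono) (use key in \<open>auto simp: Suc_le_eq\<close>)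
    moreover have "(\<Sum>y\<in>{y\<in>IX. deg y = 2}. 2) = 2 * nd 2" by (simp add: nd_def)
    moreover have "(\<Sum>y\<in>?X. mu ?q y * deg y) \<le> 9" using mu_mult_le[OF q(1), of ?X] q(2) gd_IX(1)[OF gd_eps] by auto
    ultimately show False using a(1) by linarith
   qed
  qed
 qed
qed

text \<open>Either there are four characters of degree 2; then degrees at most 2 form a closed set
  with 4 + 16 = 20. Or there is one phi of degree 4; then a cubic xi times its dual is
  \<open>eps\<close> + 2 phi, so phi xi contains each of the four translates of xi twice, which is
  degree 24 instead of 12.\<close>

lemma kill4: assumes N: "CARD('n) = 56" and c: "card Gd = 4" and s: "16 = 4 * nd 2 + 16 * nd 4" "nd 3 = 4" "nd 5 = 0" "nd 6 = 0" "nd 7 = 0"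
  and le: "\<And>x. x \<in> IX \<Longrightarrow> deg x \<le> 7"
 shows False
proof -
 have fr: "freeact x" if "x \<in> IX" "deg x = 3" for x
 proof -
  have "coprime (3::nat) 4" by (simp add: coprime_iff_gcd_eq_1 gcd_non_0_nat)
  then show ?thesis using freeact_coprime[OF that(1)] c that(2) by simp
 qed
 show False
 proof (cases "nd 4 = 0")
  case True
  then have n2: "nd 2 = 4" using s by simp
  have st: "\<exists>h. gd h \<and> h \<noteq> eps \<and> cm h psi = psi" if p: "psi \<in> IX" "deg psi = 2" for psi
  proof (rule ccontr)
   assume "\<not> ?thesis"
   then have pf: "freeact psi" unfolding freeact_def by blast
   obtain xi where x: "xi \<in> IX" "deg xi = 3" "cm psi (adj S psi) = eps + xi" using psi_square[OF p(1,2) pf] by blast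
   obtain phi where f: "phi \<in> IX" "deg phi = 4" using chi_psi[OF p(1,2) x fr[OF x(1,2)]] by blast
   then show False using nd_zero[OF True] by blast
  qed
  let ?K = "{x\<in>IX. deg x \<le> 2}"
  have "(\<Sum>x\<in>?K. (deg x)^2) dvd CARD('n)"
  proof (rule closed_dvd)
   show "?K \<subseteq> IX" "eps \<in> ?K" using gd_IX[OF gd_eps] by auto
   show "adj S x \<in> ?K" if "x \<in> ?K" for x using that adj_IX aIX by auto
   fix x y z assume xy: "x \<in> ?K" "y \<in> ?K" and z: "z \<in> IX" "z \<notin> ?K"
   have I: "x \<in> IX" "y \<in> IX" "deg x \<le> 2" "deg y \<le> 2" using xy by auto
   have "deg z \<noteq> 4" "deg z \<noteq> 5" "deg z \<noteq> 6" "deg z \<noteq> 7" using nd_zero z(1) True s by auto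
   then have z3: "deg z = 3" using z le[OF z(1)] by (simp add: not_le)
   have "deg x > 0" "deg y > 0" using IX_deg I by auto
   then consider "deg x = 1" | "deg y = 1" | "deg x = 2" "deg y = 2" using I by linarith
   then show "B (cm x y) z = 0"
   proof cases
    case 1
    then have "cm x y \<in> IX" "deg (cm x y) = deg y" using gd_act[OF deg1_gd[OF I(1)] I(2)] by auto
    then show ?thesis using B_IX z z3 I by auto
   next
    case 2
    then have "cm x y \<in> IX" "deg (cm x y) = deg x" using gd_act[OF deg1_gd[OF I(2)] I(1)] by auto
    then show ?thesis using B_IX z z3 I by auto
   next
    case 3
    obtain h where h: "gd h" "h \<noteq> eps" "cm h x = x" using st[OF I(1) 3(1)] by blast
    have "cm h (cm x y) = cm x y" using h(3) by (simp add: cm_assoc[symmetric])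
    then have "\<not> mu (cm x y) z > 0"
     using fixed_no_cubic[OF cIX[OF I(1,2)] h(1,2) _ z(1) z3 fr[OF z(1) z3]] dIX[OF I(1,2)] 3 by auto
    then show ?thesis using mu_char[OF cIX[OF I(1,2)] IX_char[OF z(1)]] by simp
   qed
  qed
  moreover have "(\<Sum>x\<in>?K. (deg x)^2) = 20"
  proof -
   have "?K = {x\<in>IX. deg x = 1} \<union> {x\<in>IX. deg x = 2}" using IX_deg by force
   then have "(\<Sum>x\<in>?K. (deg x)^2) = (\<Sum>x\<in>{x\<in>IX. deg x = 1}. (deg x)^2) + (\<Sum>x\<in>{x\<in>IX. deg x = 2}. (deg x)^2)"
    by (simp only:) (rule sum.union_disjoint, auto)
   also have "\<dots> = nd 1 * 1 + nd 2 * 4" by (simp add: nd_def power2_eq_square)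
   finally show ?thesis using nd1 c n2 by simp
  qed
  ultimately show False using N by simp
 next
  case False
  then have n: "nd 4 = 1" "nd 2 = 0" using s(1) by auto
  obtain phi where f: "phi \<in> IX" "deg phi = 4" using nd_ex[of 4] n by auto
  obtain xi where x: "xi \<in> IX" "deg xi = 3" using nd_ex[of 3] s by auto
  let ?q = "cm xi (adj S xi)"
  obtain xs where xs: "set xs \<subseteq> IX" "\<And>y. y \<in> IX \<Longrightarrow> mu ?q y = count_list [eps] y + count_list xs y" "deg xi * deg xi = 1 + sum_list (map deg xs)" "\<And>y. y \<in> set xs \<Longrightarrow> \<not> gd y"
   using square_dec[OF x(1) fr[OF x]] by metis
  have m34: "deg y = 3 \<or> deg y = 4" if "y \<in> set xs" for y
  proof -
   have y: "y \<in> IX" "\<not> gd y" using that xs by auto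
   then have "2 \<le> deg y" "deg y \<le> 7" using deg_ge2 le by auto
   moreover have "deg y \<noteq> 2" "deg y \<noteq> 6" "deg y \<noteq> 5" "deg y \<noteq> 7" using nd_zero y(1) n s by auto
   ultimately show ?thesis by linarith
  qed
  have "map deg xs = [4,4]" by (rule sum_list_34(1)) (use m34 xs(3) x in auto)
  then obtain u v where uv: "xs = [u,v]" "deg u = 4" "deg v = 4" using deg_list(2) by blast
  have "u = phi" "v = phi" by (rule nd_one[OF n(1) _ _ f]; use uv xs(1) in simp)+
  then have mq: "mu ?q phi = 2" using xs(2)[OF f(1)] uv f gd_IX(2)[OF gd_eps] by auto
  have m2: "mu (cm phi xi) (cm al xi) = 2" if a: "gd al" for al
  proof -
   have "cm al phi = phi" by (rule nd_one[OF n(1) _ _ f]) (use gd_act[OF a f(1)] f in simp_all)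
   then have "mu phi (cm al ?q) = mu phi ?q" using gd_shift_mu[OF a, of phi ?q] by simp
   moreover have "mu (cm phi xi) (cm al xi) = mu phi (cm (cm al xi) (adj S xi))" by (rule mu_frob)
   ultimately show ?thesis using mq mu_sym[of phi] by (simp add: cm_assoc)
  qed
  have inj: "inj_on (\<lambda>al. cm al xi) Gd"
  proof (rule inj_onI)
   fix al be assume ab: "al \<in> Gd" "be \<in> Gd" "cm al xi = cm be xi"
   have i: "cm (adj S be) be = eps" "cm be (adj S be) = eps" "gd (adj S be)" using gd_inv ab by auto
   have "cm (cm (adj S be) al) xi = xi" using ab(3) i by (simp add: cm_assoc) (simp add: cm_assoc[symmetric])
   then have "cm (adj S be) al = eps" using fr[OF x] gd_cm[OF i(3)] ab unfolding freeact_def by blast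
   then have "cm be (cm (adj S be) al) = be" by simp
   then show "al = be" using i by (simp add: cm_assoc[symmetric])
  qed
  let ?X = "(\<lambda>al. cm al xi) ` Gd"
  have "(\<Sum>y\<in>?X. mu (cm phi xi) y * deg y) = (\<Sum>al\<in>Gd. 2 * 3)"
   unfolding sum.reindex[OF inj] by (rule sum.cong[OF refl]) (use m2 gd_act[OF _ x(1)] x in auto)
  then have "(\<Sum>y\<in>?X. mu (cm phi xi) y * deg y) = 24" using c by simp
  moreover have "(\<Sum>y\<in>?X. mu (cm phi xi) y * deg y) \<le> deg (cm phi xi)"
   by (rule mu_mult_le[OF cIX[OF f(1) x(1)]]) (use gd_act[OF _ x(1)] in auto)
  ultimately show False using dIX[OF f(1) x(1)] f x by simp
 qed
qed

lemma deg_le7: assumes N: "CARD('n) = 56" and x: "x \<in> IX" shows "deg x \<le> 7"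
proof (rule ccontr)
 assume "\<not> ?thesis"
 then have "8 \<le> deg x" by simp
 then have "8 ^ 2 \<le> (deg x)^2" by (rule power_mono) simp
 moreover have "(deg x)^2 \<le> (\<Sum>x\<in>IX. (deg x)^2)" by (rule member_le_sum) (use x in auto)
 ultimately show False using sum_deg2 N by simp
qed
lemma count56: assumes N: "CARD('n) = 56"
 shows "56 = card Gd + 4 * nd 2 + 9 * nd 3 + 16 * nd 4 + 25 * nd 5 + 36 * nd 6 + 49 * nd 7"
proof -
 have "deg ` IX \<subseteq> {1,2,3,4,5,6,7}"
 proof (rule image_subsetI)
  fix x assume x: "x \<in> IX"
  then have "deg x \<le> 7" "deg x > 0" using deg_le7[OF N] IX_deg by auto
  then have "deg x = 1 \<or> deg x = 2 \<or> deg x = 3 \<or> deg x = 4 \<or> deg x = 5 \<or> deg x = 6 \<or> deg x = 7" by linarith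
  then show "deg x \<in> {1,2,3,4,5,6,7}" by blast
 qed
 then have "(\<Sum>x\<in>IX. (deg x)^2) = (\<Sum>j\<in>{1,2,3,4,5,6,7}. \<Sum>x\<in>{x\<in>IX. deg x = j}. (deg x)^2)"
  by (intro sum.group[symmetric]) auto
 also have "\<dots> = (\<Sum>j\<in>{1,2,3,4,5,6,7}. nd j * j^2)" by (intro sum.cong refl) (simp add: nd_def)
 finally show ?thesis using N sum_deg2 nd1 by (simp add: power2_eq_square)
qed

text \<open>Freeness makes the order of the group divide the number of characters of degree 3 and of
  degree 5, and of degree 7 if the order divides 8. With the degree equation this leaves few cases;
  order 7 needs a character of degree 7 since 49 is odd, and order 14 fails since 42 / 2 is
  odd.\<close>

lemma type56: assumes N: "CARD('n) = 56"
 shows "(card Gd \<in> {4,8} \<and> (\<forall>x\<in>IX. \<not> gd x \<longrightarrow> even (deg x))) \<or> (card Gd = 7 \<and> (\<exists>v. deg v = 7 \<and> IX = insert v Gd)) \<or> card Gd = 28 \<or> card Gd = 56"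
proof -
 let ?g = "card Gd"
 have gd56: "?g dvd 56" using sgd_dvd[OF sgd_all] N by simp
 note s = count56[OF N]
 have dj: "?g dvd nd j" if "coprime j ?g" for j
  using free_deg_dvd[of j] freeact_coprime that by (auto simp: nd_def)
 have d3: "?g dvd nd 3" by (rule dj, rule coprime_divisors[OF dvd_refl gd56]) (simp add: coprime_iff_gcd_eq_1 gcd_non_0_nat)
 have d5: "?g dvd nd 5" by (rule dj, rule coprime_divisors[OF dvd_refl gd56]) (simp add: coprime_iff_gcd_eq_1 gcd_non_0_nat)
 have d7: "?g dvd nd 7" if "?g dvd 8" by (rule dj, rule coprime_divisors[OF dvd_refl that]) (simp add: coprime_iff_gcd_eq_1 gcd_non_0_nat)
 have le: "\<And>x. x \<in> IX \<Longrightarrow> deg x \<le> 7" by (rule deg_le7[OF N])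
 have evens: "\<forall>x\<in>IX. \<not> gd x \<longrightarrow> even (deg x)" if z: "nd 3 = 0" "nd 5 = 0" "nd 7 = 0"
 proof (intro ballI impI)
  fix x assume x: "x \<in> IX" "\<not> gd x"
  have "2 \<le> deg x" "deg x \<le> 7" using deg_ge2[OF x] le x by auto
  moreover have "deg x \<noteq> 3" "deg x \<noteq> 5" "deg x \<noteq> 7" using nd_zero x(1) z by auto
  ultimately have "deg x = 2 \<or> deg x = 4 \<or> deg x = 6" by linarith
  then show "even (deg x)" by auto
 qed
 from dvd56[OF gd56] consider "?g = 1" | "?g = 2" | "?g = 4" | "?g = 7" | "?g = 8" | "?g = 14" | "?g = 28" | "?g = 56" by blast
 then show ?thesis
 proof cases
  case 1 then show ?thesis using kill1[OF N 1] s by simp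
 next
  case 2
  have "even (nd 7)" using d7 2 by simp
  then have "nd 7 = 0" using s by (cases "nd 7 = 1") auto
  then show ?thesis using kill2[OF N 2] s 2 d3 d5 le by simp
 next
  case 3
  obtain k where k: "nd 3 = 4 * k" using d3 3 by (auto elim: dvdE)
  obtain l where l: "nd 5 = 4 * l" using d5 3 by (auto elim: dvdE)
  obtain m where m: "nd 7 = 4 * m" using d7 3 by (auto elim: dvdE)
  have lm: "l = 0" "m = 0" "k = 0 \<or> k = 1" using s k l m 3 by linarith+
  have "k \<noteq> 1"
  proof
   assume k1: "k = 1"
   then have "nd 6 = 0" using s k l m 3 lm by linarith
   then show False using kill4[OF N 3] s k l m 3 lm k1 le by simp
  qed
  then show ?thesis using 3 evens k l m lm by simp
 next
  case 4
  obtain k where k: "nd 3 = 7 * k" using d3 4 by (auto elim: dvdE)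
  obtain l where l: "nd 5 = 7 * l" using d5 4 by (auto elim: dvdE)
  have lm: "k = 0" "l = 0" "nd 7 \<le> 1" using s k l 4 by linarith+
  have "nd 7 \<noteq> 0"
  proof
   assume "nd 7 = 0"
   then have "(49::nat) = 2 * (2 * nd 2 + 8 * nd 4 + 18 * nd 6)" using s k l lm 4 by simp
   then have "even (49::nat)" by (metis dvd_triv_left)
   then show False by simp
  qed
  then have n7: "nd 7 = 1" using lm(3) by simp
  then have z: "nd 2 = 0" "nd 3 = 0" "nd 4 = 0" "nd 5 = 0" "nd 6 = 0" using s 4 by linarith+
  obtain v where v: "v \<in> IX" "deg v = 7" using nd_ex[of 7] n7 by auto
  have "x = v" if x: "x \<in> IX" "\<not> gd x" for x
  proof -
   have "2 \<le> deg x" "deg x \<le> 7" using deg_ge2[OF x] le x by auto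
   moreover have "deg x \<noteq> 2" "deg x \<noteq> 3" "deg x \<noteq> 4" "deg x \<noteq> 5" "deg x \<noteq> 6" using nd_zero x(1) z by auto
   ultimately have "deg x = 7" by linarith
   then show ?thesis using nd_one[OF n7] v x(1) by blast
  qed
  then have "IX = insert v Gd" using v gd_iff by blast
  then show ?thesis using 4 v by blast
 next
  case 5
  obtain k where k: "nd 3 = 8 * k" using d3 5 by (auto elim: dvdE)
  obtain l where l: "nd 5 = 8 * l" using d5 5 by (auto elim: dvdE)
  obtain m where m: "nd 7 = 8 * m" using d7 5 by (auto elim: dvdE)
  have "k = 0" "l = 0" "m = 0" using s k l m 5 by linarith+
  then show ?thesis using 5 evens k l m by simp
 next
  case 6
  obtain k where k: "nd 3 = 14 * k" using d3 6 by (auto elim: dvdE)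
  obtain l where l: "nd 5 = 14 * l" using d5 6 by (auto elim: dvdE)
  have "k = 0" "l = 0" "nd 7 = 0" using s k l 6 by linarith+
  then have "42 = 4 * nd 2 + 16 * nd 4 + 36 * nd 6" using s k l 6 by linarith
  then have "(21::nat) = 2 * (nd 2 + 4 * nd 4 + 9 * nd 6)" by simp
  then have "even (21::nat)" by (metis dvd_triv_left)
  then show ?thesis by simp
 next
  case 7 then show ?thesis by simp
 next
  case 8 then show ?thesis by simp
 qed
qed

end

section \<open>Idempotents and automorphisms of matrix blocks\<close>

lemma tr_idem_zero:
 fixes F :: "'k::field_char_0^'n::finite \<Rightarrow> 'k^'n"
 assumes F: "lin F" "\<And>x. F (F x) = F x" and t: "tr F = 0"
 shows "F x = 0"
proof -
 have m: "(\<Sum>c\<in>UNIV. F (ax c) $ a * F (ax b) $ c) = F (ax b) $ a" for a b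
 proof -
  have "F (F (ax b)) $ a = (\<Sum>c\<in>UNIV. F (ax b) $ c * F (ax c) $ a)"
   by (subst lin_expand[OF F(1)]) (simp add: sum_component)
  then show ?thesis by (simp add: F(2) mult.commute)
 qed
 obtain r where r: "(\<Sum>a\<in>UNIV. F (ax a) $ a) = of_nat r" "r = 0 \<longrightarrow> (\<forall>a\<in>UNIV. \<forall>b\<in>UNIV. F (ax b) $ a = 0)"
  using idem_trace[of "UNIV::'n set" "\<lambda>a b. F (ax b) $ a", OF finite m] by blast
 have "(\<Sum>a\<in>UNIV. F (ax a) $ a) = 0" using t by (simp add: tr_def)
 then have "r = 0" using r(1) by simp
 then have "F (ax b) = 0" for b using r(2) by (simp add: vec_eq_iff)
 then show ?thesis by (subst lin_expand[OF F(1)]) simp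
qed

text \<open>Subtracting the rank-one projection x |-> f(x) p leaves a projection of trace
  zero.\<close>

lemma tr_idem_one:
 fixes F :: "'k::field_char_0^'n::finite \<Rightarrow> 'k^'n"
 assumes F: "lin F" "\<And>x. F (F x) = F x" and t: "tr F = 1"
  and f: "linf f" "\<And>x. f (F x) = f x" "f p = 1" "F p = p"
 shows "F x = f x *s p"
proof -
 define G where "G x = F x - f x *s p" for x
 have lG: "lin G" unfolding G_def by (intro lins F(1) f(1) lin_comp[OF F(1)] lin_id)
 note fd = linf_diff[OF f(1)] linfD(2)[OF f(1)] and Fd = lin_diff[OF F(1)] linD(2)[OF F(1)]
 have "G (G x) = G x" for x by (simp add: G_def fd Fd F f)
 moreover have "tr G = 0"
 proof -
  have "tr G = tr F - tr (\<lambda>x. f x *s p)" by (simp add: G_def tr_def sum_subtractf)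
  also have "tr (\<lambda>x. f x *s p) = f p"
  proof -
   have "tr (\<lambda>x. f x *s p) = (\<Sum>i\<in>UNIV. p $ i * f (ax i))" by (simp add: tr_def mult.commute)
   then show ?thesis using linf_expand[OF f(1), of p] by simp
  qed
  finally show ?thesis using t f(3) by simp
 qed
 ultimately have "G x = 0" using tr_idem_zero[OF lG] by blast
 then show ?thesis by (simp add: G_def)
qed

context hopf_wed begin

lemma IX_ex: "x \<in> IX \<Longrightarrow> \<exists>c\<in>Irr. x = chi c \<and> deg x = d c" using deg_chi by (auto simp: IX_def)

lemma idem_nat: assumes "mul e e = e" "x \<in> IX" shows "\<exists>n\<le>deg x. dot x e = of_nat n"
 using idem_chi[OF assms(1)] IX_ex[OF assms(2)] by metis

text \<open>Under this condition on the ranks, e is 0 or the identity in each block.\<close>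

lemma idem_central: assumes e: "mul e e = e" and f: "\<And>x. x \<in> IX \<Longrightarrow> dot x e = 0 \<or> dot x e = of_nat (deg x)"
 shows "mul e y = mul y e"
proof (rule central_if_scalar(2))
 fix c i j assume c: "c \<in> Irr" and ij: "i \<in> blk c" "j \<in> blk c"
 have "chi c \<in> IX" using c by (simp add: IX_def)
 from f[OF this] show "dot (p i j) e = (if i = j then (if dot (chi c) e = 0 then 0 else 1) else 0)"
  using chi_zero[OF e _ ij] chi_full[OF e _ ij] deg_chi[OF c] by auto
qed

lemma idem_unique: assumes e: "mul e e = e" "mul e' e' = e'" and s: "\<And>x. x \<in> IX \<Longrightarrow> dot x e = dot x e'"
  and f: "\<And>x. x \<in> IX \<Longrightarrow> dot x e = 0 \<or> dot x e = of_nat (deg x)"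
 shows "e = e'"
proof (rule p_eqI)
 fix i j assume ij: "(i,j) \<in> PP"
 let ?c = "r i"
 have c: "?c \<in> Irr" and b: "i \<in> blk ?c" "j \<in> blk ?c" using PP_D[OF ij] by auto
 have I: "chi ?c \<in> IX" using c by (simp add: IX_def)
 from f[OF I] show "dot (p i j) e = dot (p i j) e'"
 proof
  assume "dot (chi ?c) e = 0"
  then show ?thesis using chi_zero[OF e(1) _ b] chi_zero[OF e(2) _ b] s[OF I] by simp
 next
  assume "dot (chi ?c) e = of_nat (deg (chi ?c))"
  then show ?thesis using chi_full[OF e(1) _ b] chi_full[OF e(2) _ b] s[OF I] deg_chi[OF c] by simp
 qed
qed

lemma full_mul: assumes e: "mul e e = e" and x: "x \<in> IX" "dot x e = of_nat (deg x)" shows "dot x (mul e y) = dot x y"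
proof -
 obtain c where c: "c \<in> Irr" "x = chi c" "deg x = d c" using IX_ex[OF x(1)] by blast
 have "dot x (mul e y) = (\<Sum>i\<in>blk c. \<Sum>k\<in>blk c. dot (p i k) e * dot (p k i) y)" unfolding c(2) by (rule chi_mul)
 also have "\<dots> = (\<Sum>i\<in>blk c. \<Sum>k\<in>blk c. if i = k then dot (p i i) y else 0)"
  by (intro sum.cong refl) (use chi_full[OF e] x(2) c in auto)
 also have "\<dots> = dot x y" by (simp add: c(2) dot_chi)
 finally show ?thesis .
qed

lemma commutative_if_linear: assumes "\<And>x. x \<in> IX \<Longrightarrow> gd x" shows "mul x y = mul y x"
proof (rule p_eqI)
 fix i j assume ij: "(i,j) \<in> PP"
 let ?c = "r i"
 have c: "?c \<in> Irr" and b: "i \<in> blk ?c" "j \<in> blk ?c" using PP_D[OF ij] by auto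
 have "chi ?c \<in> IX" using c by (simp add: IX_def)
 then have "card (blk ?c) = 1" using assms gd_IX(2) deg_chi[OF c] by (simp add: d_def)
 then obtain k where "blk ?c = {k}" by (auto simp: card_1_singleton_iff)
 then have k: "i = k" "j = k" "blk (r i) = {k}" using b by auto
 show "dot (p i j) (mul x y) = dot (p i j) (mul y x)" unfolding p_mul[OF ij] using k by (simp add: mult.commute)
qed

lemma E_span: assumes W: "c \<in> Irr" shows "mul (ce c) x = (\<Sum>k\<in>blk c. \<Sum>l\<in>blk c. dot (p k l) x *s E k l)"
proof (rule p_eqI)
 fix i j assume ij: "(i,j) \<in> PP"
 have b: "i \<in> blk (r i)" "j \<in> blk (r i)" using PP_D[OF ij] by auto
 have "dot (p i j) (mul (ce c) x) = (\<Sum>k\<in>blk (r i). if k = i then (if r i = c then dot (p i j) x else 0) else 0)"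
  unfolding p_mul[OF ij] by (rule sum.cong[OF refl]) (use p_ce[OF blk_PP[OF b(1)] W] in auto)
 also have "\<dots> = (if r i = c then dot (p i j) x else 0)" using b by simp
 also have "\<dots> = dot (p i j) (\<Sum>k\<in>blk c. \<Sum>l\<in>blk c. dot (p k l) x *s E k l)"
 proof -
  have "dot (p i j) (\<Sum>k\<in>blk c. \<Sum>l\<in>blk c. dot (p k l) x *s E k l) = (\<Sum>k\<in>blk c. \<Sum>l\<in>blk c. if k = i then (if l = j then dot (p i j) x else 0) else 0)"
   unfolding dot_sum by (intro sum.cong refl) (use pE'[OF ij blk_PP] in auto)
  also have "\<dots> = (\<Sum>k\<in>blk c. if k = i then (\<Sum>l\<in>blk c. if l = j then dot (p i j) x else 0) else 0)"
   by (intro sum.cong refl) simp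
  also have "\<dots> = (if r i = c then dot (p i j) x else 0)" using b by (auto simp: blk_iff)
  finally show ?thesis by simp
 qed
 finally show "dot (p i j) (mul (ce c) x) = dot (p i j) (\<Sum>k\<in>blk c. \<Sum>l\<in>blk c. dot (p k l) x *s E k l)" .
qed

lemma block_nz: assumes c: "c \<in> Irr" and x: "mul (ce c) x = x" "x \<noteq> 0" obtains a b where "a \<in> blk c" "b \<in> blk c" "dot (p a b) x \<noteq> 0"
proof -
 have "\<exists>a\<in>blk c. \<exists>b\<in>blk c. dot (p a b) x \<noteq> 0"
 proof (rule ccontr)
  assume n: "\<not> ?thesis"
  have "mul (ce c) x = 0" unfolding E_span[OF c] by (intro sum.neutral ballI) (use n in auto)
  then show False using x by simp
 qed
 then show ?thesis using that by blast
qed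

lemma ce_idem: assumes c: "c \<in> Irr" shows "mul (ce c) (ce c) = ce c"
 unfolding E_span[OF c, of "ce c"]
proof -
 have "(\<Sum>k\<in>blk c. \<Sum>l\<in>blk c. dot (p k l) (ce c) *s E k l) = (\<Sum>k\<in>blk c. \<Sum>l\<in>blk c. if l = k then E k k else 0)"
  by (intro sum.cong refl) (use p_ce[OF blk_PP c] in \<open>auto simp: blk_iff\<close>)
 then show "(\<Sum>k\<in>blk c. \<Sum>l\<in>blk c. dot (p k l) (ce c) *s E k l) = ce c" by (simp add: ce_def)
qed
lemma chi_ce: assumes c: "c \<in> Irr" "c' \<in> Irr" shows "dot (chi c') (ce c) = (if c' = c then of_nat (d c) else 0)"
proof -
 have "dot (p i i) (ce c) = (if c' = c then 1 else 0)" if "i \<in> blk c'" for i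
  using p_ce[OF blk_PP[OF that that] c(1)] that by (auto simp: blk_iff)
 then show ?thesis by (simp add: dot_chi d_def)
qed

text \<open>The intertwiner is the sum over i of tau(E_{i,i0}) E_{b,i}. Here i0 is chosen so that
  tau(E_{i0,i0}) is nonzero, and b is one of its nonzero columns, which keeps u from
  vanishing.\<close>

lemma skolem_noether:
 assumes c: "c \<in> Irr" and \<tau>: "lin \<tau>" "\<And>x y. \<tau> (mul x y) = mul (\<tau> x) (\<tau> y)" "\<tau> (ce c) = ce c"
 obtains u where "u \<noteq> 0" "mul u (ce c) = u" "mul (ce c) u = u" "\<And>x. mul (\<tau> (mul (ce c) x)) u = mul u x"
proof -
 let ?W = "ce c"
 have tsum: "\<tau> (\<Sum>i\<in>I. f i) = (\<Sum>i\<in>I. \<tau> (f i))" for f and I :: "nat set" by (rule lin_sum[OF \<tau>(1)])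
 have tsc: "\<tau> (k *s x) = k *s \<tau> x" for k x using linD[OF \<tau>(1)] by simp
 have Wn: "?W \<noteq> 0" using chi_ce[OF c c] d_pos[OF c] by auto
 have EP: "mul (E i j) (E k l) = (if j = k then E i l else 0)" if "i \<in> blk c" "j \<in> blk c" "k \<in> blk c" "l \<in> blk c" for i j k l
  by (rule E_mul'[OF blk_PP blk_PP]) (use that in auto)
 have "\<exists>i\<in>blk c. \<tau> (E i i) \<noteq> 0"
 proof (rule ccontr)
  assume "\<not> ?thesis"
  then have "\<tau> ?W = 0" unfolding ce_def tsum by (intro sum.neutral) auto
  then show False using \<tau>(3) Wn by simp
 qed
 then obtain i0 where i0: "i0 \<in> blk c" "\<tau> (E i0 i0) \<noteq> 0" by blast
 let ?y = "\<tau> (E i0 i0)"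
 have WE: "mul ?W (E i j) = E i j" "mul (E i j) ?W = E i j" if "i \<in> blk c" "j \<in> blk c" for i j
 proof -
  have "mul ?W (E i j) = (\<Sum>k\<in>blk c. if k = i then E i j else 0)"
   unfolding ce_def msum by (intro sum.cong refl) (use EP that in auto)
  then show "mul ?W (E i j) = E i j" using that by simp
  then show "mul (E i j) ?W = E i j" using ce_central[OF c] by simp
 qed
 have "mul ?W ?y = ?y" using \<tau>(2)[of ?W "E i0 i0"] \<tau>(3) WE i0 by simp
 then obtain a b where ab: "a \<in> blk c" "b \<in> blk c" "dot (p a b) ?y \<noteq> 0" using block_nz[OF c _ i0(2)] by blast
 define u where "u = (\<Sum>i\<in>blk c. mul (\<tau> (E i i0)) (E b i))"
 have uE: "mul u (E k l) = mul (\<tau> (E k i0)) (E b l)" if "k \<in> blk c" "l \<in> blk c" for k l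
 proof -
  have "mul u (E k l) = (\<Sum>i\<in>blk c. if i = k then mul (\<tau> (E k i0)) (E b l) else 0)"
   unfolding u_def msum by (intro sum.cong refl) (use EP ab that in \<open>auto simp: mul_assoc mdist\<close>)
  then show ?thesis using that by simp
 qed
 have tu: "mul (\<tau> (E k l)) u = mul (\<tau> (E k i0)) (E b l)" if "k \<in> blk c" "l \<in> blk c" for k l
 proof -
  have "mul (\<tau> (E k l)) (mul (\<tau> (E i i0)) (E b i)) = (if i = l then mul (\<tau> (E k i0)) (E b l) else 0)" if "i \<in> blk c" for i
   using EP[OF \<open>k \<in> blk c\<close> \<open>l \<in> blk c\<close> that i0(1)] linD(2)[OF \<tau>(1), of 0 0]
   by (auto simp: mul_assoc[symmetric] \<tau>(2)[symmetric] mdist)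
  then have "mul (\<tau> (E k l)) u = (\<Sum>i\<in>blk c. if i = l then mul (\<tau> (E k i0)) (E b l) else 0)"
   unfolding u_def msum by (intro sum.cong refl) auto
  then show ?thesis using that by simp
 qed
 have uW: "mul u ?W = u"
  unfolding u_def msum by (intro sum.cong refl) (use WE ab in \<open>simp add: mul_assoc\<close>)
 have Wu: "mul ?W u = u" using ce_central[OF c] uW by simp
 have ct: "mul (\<tau> (mul ?W x)) u = mul u x" for x
 proof -
  have "mul (\<tau> (mul ?W x)) u = (\<Sum>k\<in>blk c. \<Sum>l\<in>blk c. dot (p k l) x *s mul (\<tau> (E k l)) u)"
   unfolding E_span[OF c] tsum tsc msum mdist ..
  also have "\<dots> = (\<Sum>k\<in>blk c. \<Sum>l\<in>blk c. dot (p k l) x *s mul u (E k l))"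
   by (intro sum.cong refl) (simp add: tu uE)
  also have "\<dots> = mul u (mul ?W x)" unfolding E_span[OF c] msum mdist ..
  finally show ?thesis by (simp add: mul_assoc[symmetric] uW)
 qed
 have "u \<noteq> 0"
 proof
  assume "u = 0"
  then have "mul ?y (E b i0) = 0" using uE[OF i0(1) i0(1)] by (simp add: mdist)
  then have "0 = dot (p a i0) (mul ?y (E b i0))" by simp
  also have "\<dots> = (\<Sum>k\<in>blk c. dot (p a k) ?y * dot (p k i0) (E b i0))"
   using p_mul[OF blk_PP[OF ab(1) i0(1)]] ab(1) by (simp add: blk_iff)
  also have "\<dots> = (\<Sum>k\<in>blk c. if k = b then dot (p a b) ?y else 0)"
   by (intro sum.cong refl) (use pE'[OF blk_PP[OF _ i0(1)] blk_PP[OF ab(2) i0(1)]] in auto)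
  finally show False using ab by simp
 qed
 then show ?thesis using that uW Wu ct by blast
qed

text \<open>A matrix block is a prime ring: a nonzero x can be moved to every diagonal matrix unit,
  and u would annihilate all of them.\<close>

lemma block_regular: assumes c: "c \<in> Irr" and u: "mul u (ce c) = u" "u \<noteq> 0" and x: "mul (ce c) x = x" "\<And>y. mul u (mul y x) = 0" shows "x = 0"
proof (rule ccontr)
 assume "x \<noteq> 0"
 then obtain a b where ab: "a \<in> blk c" "b \<in> blk c" "dot (p a b) x \<noteq> 0" using block_nz[OF c x(1)] by blast
 have "mul u (E i i) = 0" if i: "i \<in> blk c" for i
 proof -
  have r: "r i = c" "r a = c" "r b = c" using i ab by (auto simp: blk_iff)
  have "mul (mul (E i a) x) (E b i) = dot (p a b) x *s E i i"
   by (rule E_mul_x[OF blk_PP[OF i ab(1)] blk_PP[OF ab(2) i]]) (simp add: r)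
  then have "dot (p a b) x *s mul u (E i i) = mul (mul u (mul (E i a) x)) (E b i)" by (simp add: mul_assoc mdist)
  also have "\<dots> = 0" using x(2) by (simp add: mdist)
  finally show ?thesis using ab(3) by simp
 qed
 then have "mul u (ce c) = 0" unfolding ce_def msum by (intro sum.neutral) auto
 then show False using u by simp
qed

end

section \<open>Seven one-dimensional representations\<close>

text \<open>The equality case of Cauchy-Schwarz: the squares of n j - 1 add up to 0.\<close>

lemma sum_sq_one: assumes "finite J" "(\<Sum>j\<in>J. n j) = card J" "(\<Sum>j\<in>J. n j * n j) = card J" "j \<in> J" shows "n j = (1::nat)"
proof -
 have "(\<Sum>j\<in>J. (int (n j) - 1)^2) = (\<Sum>j\<in>J. int (n j * n j) - 2 * int (n j) + 1)"
  by (rule sum.cong) (simp_all add: power2_eq_square algebra_simps)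
 also have "\<dots> = int (\<Sum>j\<in>J. n j * n j) - 2 * int (\<Sum>j\<in>J. n j) + int (card J)"
  by (simp add: sum.distrib sum_subtractf sum_distrib_left)
 also have "\<dots> = 0" using assms by simp
 finally have "(int (n j) - 1)^2 = 0" using assms(1,4) by (simp add: sum_nonneg_eq_0_iff)
 then show ?thesis by simp
qed

context hopf_int begin

definition cpw :: "'k^'n \<Rightarrow> nat \<Rightarrow> 'k^'n" where "cpw al k = (cm al ^^ k) eps"
lemma cpw_0 [simp]: "cpw al 0 = eps" by (simp add: cpw_def)
lemma cpw_Suc: "cpw al (Suc k) = cm al (cpw al k)" by (simp add: cpw_def)
lemma cpw_1 [simp]: "cpw al (Suc 0) = al" by (simp add: cpw_Suc)
lemma cpw_add: "cpw al (j + k) = cm (cpw al j) (cpw al k)" by (induction j) (simp_all add: cpw_Suc cm_assoc)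
lemma gd_cpw: "gd al \<Longrightarrow> gd (cpw al k)" by (induction k) (simp_all add: cpw_Suc gd_eps gd_cm)
lemma T_cpw: "T (cpw al k) x = (T al ^^ k) x"
proof (induction k arbitrary: x)
 case (Suc k)
 have "T (cpw al (Suc k)) x = T (cpw al k) (T al x)" by (simp add: cpw_Suc TT)
 also have "\<dots> = (T al ^^ k) (T al x)" by (rule Suc)
 finally show ?case by (simp add: funpow_swap1)
qed simp

end

context hopf_wed begin

lemma prime_generator: assumes p: "prime q" and c: "card Gd = q"
 obtains al where "gd al" "\<And>be. gd be \<Longrightarrow> \<exists>k<q. be = cpw al k" "cpw al q = eps" "\<And>k. 0 < k \<Longrightarrow> k < q \<Longrightarrow> cpw al k \<noteq> eps"
proof -
 have q2: "q \<ge> 2" using p prime_ge_2_nat by blast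
 have "\<not> Gd \<subseteq> {eps}"
 proof
  assume "Gd \<subseteq> {eps}"
  then have "card Gd \<le> card {eps}" by (rule card_mono[rotated]) simp
  then show False using c q2 by simp
 qed
 then obtain al where a: "gd al" "al \<noteq> eps" by blast
 have "\<not> inj_on (cpw al) {0..q}"
 proof
  assume "inj_on (cpw al) {0..q}"
  then have "card (cpw al ` {0..q}) = q + 1" by (simp add: card_image)
  moreover have "card (cpw al ` {0..q}) \<le> card Gd" by (rule card_mono[OF gd_finite]) (use gd_cpw a in auto)
  ultimately show False using c by simp
 qed
 then obtain i j where ij: "i < j" "j \<le> q" "cpw al i = cpw al j"
  unfolding inj_on_def by (metis atLeastAtMost_iff nat_neq_iff)
 define m where "m = j - i"
 have m: "0 < m" "m \<le> q" using ij by (auto simp: m_def)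
 have "cm (cpw al i) (cpw al m) = cm (cpw al i) eps" proof -
  have "cpw al (i + m) = cpw al i" using ij by (simp add: m_def)
  then show ?thesis by (simp add: cpw_add)
 qed
 then have pm: "cpw al m = eps" using gd_cancel(1)[OF gd_cpw[OF a(1)]] by blast
 have pmk: "cpw al (k * m) = eps" for k by (induction k) (simp_all add: cpw_add pm)
 have pmod: "cpw al k = cpw al (k mod m)" for k
 proof -
  have "cpw al (k div m * m + k mod m) = cpw al (k mod m)" unfolding cpw_add pmk by simp
  then show ?thesis by simp
 qed
 let ?A = "cpw al ` {..<m}"
 have inA: "cpw al k \<in> ?A" for k using pmod[of k] m by auto
 have sA: "sgd ?A"
  unfolding sgd_def
 proof (intro conjI ballI)
  show "?A \<subseteq> Gd" using gd_cpw a by auto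
  show "eps \<in> ?A" using inA[of 0] by simp
  show "cm x y \<in> ?A" if "x \<in> ?A" "y \<in> ?A" for x y
   using that by (auto simp: cpw_add[symmetric] simp del: image_iff intro!: inA)
  show "adj S x \<in> ?A" if "x \<in> ?A" for x
  proof -
   obtain k where k: "x = cpw al k" using \<open>x \<in> ?A\<close> by blast
   have g: "gd x" using k gd_cpw a by simp
   have "k + k * (m - 1) = k * m" using m by (cases m) auto
   then have "cm x (cpw al (k * (m - 1))) = cm x (adj S x)" using pmk gd_inv(2)[OF g] k by (simp add: cpw_add[symmetric])
   then have "adj S x = cpw al (k * (m - 1))" using gd_cancel(1)[OF g] by metis
   then show ?thesis using inA by simp
  qed
 qed
 have "card ?A dvd q" using lagrange[OF sA sgd_all] c sA by (simp add: sgd_def)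
 moreover have "card ?A \<noteq> 1"
 proof
  assume "card ?A = 1"
  then obtain w where "?A = {w}" by (auto simp: card_1_singleton_iff)
  then have "cpw al 0 = w" "cpw al (Suc 0) = w" using inA[of 0] inA[of "Suc 0"] by blast+
  then have "cpw al 0 = cpw al (Suc 0)" by metis
  then show False using a(2) by simp
 qed
 ultimately have cA: "card ?A = q" using p by (auto simp: prime_nat_iff)
 have cle: "card ?A \<le> m" using card_image_le[of "{..<m}" "cpw al"] by simp
 then have mq: "m = q" using cA m by simp
 have AG: "?A = Gd" by (rule card_subset_eq[OF gd_finite]) (use sA cA c in \<open>auto simp: sgd_def\<close>)
 have inj: "inj_on (cpw al) {..<q}" using eq_card_imp_inj_on[of "{..<q}" "cpw al"] cA mq by simp
 show ?thesis
 proof (rule that[OF a(1)])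
  show "\<exists>k<q. be = cpw al k" if "gd be" for be using AG that mq by auto
  show "cpw al q = eps" using pm mq by simp
  show "cpw al k \<noteq> eps" if "0 < k" "k < q" for k
   using inj_onD[OF inj, of k 0] that by auto
 qed
qed

end

locale seven = hopf_wed mul cm one eps S Lam m r E p
 for mul cm :: "'k::{alg_closed_field,field_char_0}^'n::finite \<Rightarrow> 'k^'n \<Rightarrow> 'k^'n" and one eps S Lam m r E p +
 fixes v
 assumes N: "CARD('n) = 56" and G7: "card Gd = 7" and dv: "deg v = 7" and IXv: "IX = insert v Gd"
begin

lemma vI: "v \<in> IX" and vng: "\<not> gd v" using IXv dv gd_IX(2)[of v] by auto
lemma av: "gd al \<Longrightarrow> cm al v = v" "gd al \<Longrightarrow> cm v al = v"
proof -
 assume a: "gd al"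
 show "cm al v = v" using gd_act(1,2)[OF a vI] dv IXv gd_IX(2)[of "cm al v"] by auto
 show "cm v al = v" using gd_act(3,4)[OF a vI] dv IXv gd_IX(2)[of "cm v al"] by auto
qed

definition c0 where "c0 = (SOME c. c \<in> Irr \<and> v = chi c)"
lemma c0: "c0 \<in> Irr" "chi c0 = v" "d c0 = 7"
proof -
 have "\<exists>c. c \<in> Irr \<and> v = chi c" using vI by (auto simp: IX_def)
 from someI_ex[OF this, folded c0_def] show c: "c0 \<in> Irr" "chi c0 = v" by simp_all
 show "d c0 = 7" using deg_chi[OF c(1)] dv unfolding c(2) by simp
qed
definition W where "W = ce c0"
lemma W_idem: "mul W W = W" unfolding W_def by (rule ce_idem[OF c0(1)])
lemma W_central: "mul W x = mul x W" unfolding W_def by (rule ce_central[OF c0(1)])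
lemma vW: "dot v W = 7" using chi_ce[OF c0(1) c0(1)] by (simp add: W_def c0)
lemma gW: assumes "gd al" shows "dot al W = 0"
proof -
 obtain c where c: "c \<in> Irr" "al = chi c" using gd_IX(1)[OF assms] by (auto simp: IX_def)
 have "c \<noteq> c0"
 proof
  assume "c = c0"
  then have "al = v" using c(2) c0(2) by simp
  then show False using assms vng by simp
 qed
 then show ?thesis unfolding c(2) W_def using chi_ce[OF c0(1) c(1)] by simp
qed
lemma gWx: "gd al \<Longrightarrow> dot al (mul W x) = 0" by (simp add: gd_mult gW)
lemma T_W: assumes a: "gd al" shows "T al W = W" "T' al W = W"
proof -
 have f: "dot x W = 0 \<or> dot x W = of_nat (deg x)" if "x \<in> IX" for x using that IXv gW vW dv by auto
 have "W = T al W"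
  by (rule idem_unique[OF W_idem _ _ f])
   (use IXv in \<open>auto simp: T_mul[OF a, symmetric] W_idem dot_T av[OF a] gW gd_cm[OF a]\<close>)
 then show "T al W = W" by simp
 have "W = T' al W"
  by (rule idem_unique[OF W_idem _ _ f])
   (use IXv a in \<open>auto simp: T'_mul[OF a, symmetric] W_idem dot_T' av[OF a] gW gd_cm\<close>)
 then show "T' al W = W" by simp
qed
lemma idem_W_zero: assumes "mul x x = x" "mul W x = x" "dot v x = 0" shows "x = 0"
proof (rule idem_unique[OF assms(1)])
 show "mul 0 0 = 0" by (simp add: mdist)
 fix y assume "y \<in> IX"
 then show "dot y x = dot y 0" "dot y x = 0 \<or> dot y x = of_nat (deg y)"
  using IXv assms(3) gWx[of y x] assms(2) by auto
qed

definition al0 where "al0 = (SOME al. gd al \<and> (\<forall>be. gd be \<longrightarrow> (\<exists>k<7. be = cpw al k)) \<and> cpw al 7 = eps \<and> (\<forall>k. 0 < k \<longrightarrow> k < 7 \<longrightarrow> cpw al k \<noteq> eps))"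
lemma al0: "gd al0" "gd be \<Longrightarrow> \<exists>k<7. be = cpw al0 k" "cpw al0 7 = eps" "0 < k \<Longrightarrow> k < 7 \<Longrightarrow> cpw al0 k \<noteq> eps"
proof -
 have "prime (7::nat)" by (simp add: prime_nat_numeral_eq)
 from prime_generator[OF this G7] have "\<exists>al. gd al \<and> (\<forall>be. gd be \<longrightarrow> (\<exists>k<7. be = cpw al k)) \<and> cpw al 7 = eps \<and> (\<forall>k. 0 < k \<longrightarrow> k < 7 \<longrightarrow> cpw al k \<noteq> eps)"
  by metis
 from someI_ex[OF this, folded al0_def]
 show "gd al0" "gd be \<Longrightarrow> \<exists>k<7. be = cpw al0 k" "cpw al0 7 = eps" "0 < k \<Longrightarrow> k < 7 \<Longrightarrow> cpw al0 k \<noteq> eps" by blast+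
qed

text \<open>Translation by \<open>al0\<close> is an algebra automorphism fixing W, hence inner on
  the block of v.\<close>

lemma ex_u0: "\<exists>u. u \<noteq> 0 \<and> mul u W = u \<and> mul W u = u \<and> (\<forall>x. mul (T al0 (mul W x)) u = mul u x)"
 unfolding W_def
 by (rule skolem_noether[OF c0(1), of "T al0"]) (use T_mul[OF al0(1)] T_W[OF al0(1)] lin_T(1)[OF lin_id] in \<open>auto simp: W_def\<close>)
definition u where "u = (SOME u. u \<noteq> 0 \<and> mul u W = u \<and> mul W u = u \<and> (\<forall>x. mul (T al0 (mul W x)) u = mul u x))"
lemma u: "u \<noteq> 0" "mul u W = u" "mul W u = u" "mul (T al0 (mul W x)) u = mul u x"
 using someI_ex[OF ex_u0, folded u_def] by blast+

lemma pwu_W: "0 < k \<Longrightarrow> mul W (pw u k) = pw u k" "0 < k \<Longrightarrow> mul (pw u k) W = pw u k"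
proof -
 assume "0 < k"
 then obtain j where "k = Suc j" by (cases k) auto
 then show "mul W (pw u k) = pw u k" by (simp add: pw_Suc mul_assoc[symmetric] u)
 then show "mul (pw u k) W = pw u k" by (simp add: W_central)
qed
lemma TW: "T (cpw al0 k) (mul W x) = mul W (T (cpw al0 k) x)"
 by (simp add: T_mul[OF gd_cpw[OF al0(1)]] T_W[OF gd_cpw[OF al0(1)]])
lemma pwu: "mul (T (cpw al0 k) (mul W x)) (pw u k) = mul (pw u k) (mul W x)"
proof (induction k)
 case (Suc k)
 have "T (cpw al0 (Suc k)) (mul W x) = T al0 (T (cpw al0 k) (mul W x))" by (simp add: T_cpw)
 also have "\<dots> = T al0 (mul W (T (cpw al0 k) (mul W x)))" by (simp add: TW) (simp add: mul_assoc[symmetric] W_idem)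
 finally have "mul (T (cpw al0 (Suc k)) (mul W x)) (pw u (Suc k)) = mul (mul u (T (cpw al0 k) (mul W x))) (pw u k)"
  by (simp add: pw_Suc mul_assoc[symmetric] u(4))
 also have "\<dots> = mul (pw u (Suc k)) (mul W x)" using Suc by (simp add: pw_Suc mul_assoc)
 finally show ?case .
qed simp
lemma u7_central: "mul (pw u 7) x = mul x (pw u 7)"
proof -
 have "mul (mul W x) (pw u 7) = mul (pw u 7) (mul W x)" using pwu[of 7 x] by (simp add: al0)
 moreover have "mul (mul W x) (pw u 7) = mul x (pw u 7)" by (simp add: W_central[of x] mul_assoc pwu_W)
 moreover have "mul (pw u 7) (mul W x) = mul (pw u 7) x" by (simp add: mul_assoc[symmetric] pwu_W)
 ultimately show ?thesis by simp
qed
lemma pwu_nz: "pw u (Suc k) \<noteq> 0"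
proof (induction k)
 case 0 then show ?case by (simp add: pw_Suc u)
next
 case (Suc k)
 show ?case
 proof
  assume z: "pw u (Suc (Suc k)) = 0"
  have "mul u (mul y (pw u (Suc k))) = 0" for y
  proof -
   have "mul u (mul y (pw u (Suc k))) = mul (mul (T al0 (mul W y)) u) (pw u (Suc k))" by (simp add: u(4) mul_assoc)
   also have "\<dots> = mul (T al0 (mul W y)) (pw u (Suc (Suc k)))" by (simp add: pw_Suc mul_assoc)
   also have "\<dots> = 0" unfolding z by (simp add: mdist)
   finally show ?thesis .
  qed
  then have "pw u (Suc k) = 0"
   using block_regular[OF c0(1), of u "pw u (Suc k)"] u pwu_W(1)[of "Suc k"] by (simp add: W_def)
  then show False using Suc by simp
 qed
qed
lemma u7: "\<exists>s. s \<noteq> 0 \<and> pw u 7 = s *s W"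
proof -
 obtain i where i: "i \<in> blk c0" using c0(3) by (metis card.empty d_def equals0I zero_neq_numeral)
 let ?s = "dot (p i i) (pw u 7)"
 have "pw u 7 = mul (ce c0) (pw u 7)" using pwu_W(1)[of 7] by (simp add: W_def)
 also have "\<dots> = (\<Sum>k\<in>blk c0. \<Sum>l\<in>blk c0. if l = k then ?s *s E k k else 0)"
  unfolding E_span[OF c0(1)]
 proof (intro sum.cong refl)
  fix k l assume kl: "k \<in> blk c0" "l \<in> blk c0"
  show "dot (p k l) (pw u 7) *s E k l = (if l = k then ?s *s E k k else 0)"
   using central_p(1)[OF u7_central blk_PP[OF kl]] central_p(2)[OF u7_central blk_PP[OF kl(1) i]] by auto
 qed
 also have "\<dots> = ?s *s W" by (simp add: W_def ce_def vec.scale_sum_right)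
 finally have e: "pw u 7 = ?s *s W" .
 moreover have "?s \<noteq> 0"
 proof
  assume "?s = 0"
  then have "pw u (Suc 6) = 0" using e by simp
  then show False using pwu_nz by blast
 qed
 ultimately show ?thesis by blast
qed

lemma chi_W: assumes "c \<in> Irr" "c \<noteq> c0" shows "dot (chi c) (mul W x) = 0"
proof -
 have "chi c \<in> IX" using assms by (simp add: IX_def)
 moreover have "chi c \<noteq> v" using assms c0 chi_inj unfolding inj_on_def by metis
 ultimately have "gd (chi c)" using IXv by blast
 then show ?thesis by (rule gWx)
qed
lemma tr_W: "tr (\<lambda>x. mul (mul W a) (mul x (mul W b))) = dot v (mul W a) * dot v (mul W b)"
proof -
 have "tr (\<lambda>x. mul (mul W a) (mul x (mul W b))) = (\<Sum>c\<in>Irr. if c = c0 then dot v (mul W a) * dot v (mul W b) else 0)"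
  unfolding tr_conj by (rule sum.cong[OF refl]) (auto simp: chi_W c0(2))
 then show ?thesis using c0(1) by simp
qed
text \<open>The product is the trace of x |-> u^k x u^(7-k) on the block. Up to a scalar this map is
  translation by a nontrivial character followed by multiplication with W, which has trace zero by
  \<open>tr_T\<close>.\<close>

lemma v_pwu: assumes "0 < k" "k < 7" shows "dot v (pw u k) * dot v (pw u (7 - k)) = 0"
proof -
 obtain s where s: "s \<noteq> 0" "pw u 7 = s *s W" using u7 by blast
 have e: "mul (mul W (pw u k)) (mul x (mul W (pw u (7 - k)))) = s *s mul (T (cpw al0 k) x) W" for x
 proof -
  have "mul (mul W (pw u k)) (mul x (mul W (pw u (7 - k)))) = mul (mul (pw u k) (mul W x)) (pw u (7 - k))"
   using assms by (simp add: pwu_W mul_assoc[symmetric])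
  also have "\<dots> = mul (T (cpw al0 k) (mul W x)) (mul (pw u k) (pw u (7 - k)))"
   unfolding pwu[symmetric] by (simp add: mul_assoc)
  also have "mul (pw u k) (pw u (7 - k)) = s *s W" using assms s by (simp add: pw_add[symmetric])
  also have "mul (T (cpw al0 k) (mul W x)) (s *s W) = s *s mul (T (cpw al0 k) x) W"
   by (simp add: TW mdist) (metis W_central mul_assoc W_idem)
  finally show ?thesis .
 qed
 have "dot v (mul W (pw u k)) * dot v (mul W (pw u (7 - k))) = s * tr (\<lambda>x. mul (T (cpw al0 k) x) W)"
  unfolding tr_W[symmetric] e by (rule tr_scale)
 also have "\<dots> = 0" using tr_T[OF gd_cpw[OF al0(1)] al0(4)[OF assms]] by simp
 finally show ?thesis using assms by (simp add: pwu_W)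
qed

text \<open>After rescaling, u has order 7 on the block, and n j is the multiplicity of the
  eigenvalue z^j. Since character values at u^l and u^(7-l) have product 0, Parseval's identity
  gives 7 for the sum of the squares of the n j; their sum is 7 too, so every eigenvalue is
  simple.\<close>

lemma ex_P: "\<exists>P. (\<forall>j<(7::nat). mul (P j) (P j) = P j \<and> mul W (P j) = P j \<and> dot v (P j) = 1 \<and> (\<forall>x. mul x u = mul u x \<longrightarrow> mul x (P j) = mul (P j) x)) \<and> (\<Sum>j<7. P j) = W"
proof -
 obtain s where s: "s \<noteq> 0" "pw u 7 = s *s W" using u7 by blast
 obtain t where t: "t ^ 7 = 1 / s" using nth_root_exists[of 7 "1 / s"] by auto
 \<comment> \<open>The summand one - W extends the rescaled u to an element of H with seventh power
   \<open>one\<close>.\<close>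
 define U where "U = t *s u + (one - W)"
 have Uk: "pw U k = t ^ k *s pw u k + (one - W)" if "0 < k" for k
  using that
 proof (induction k)
  case (Suc k)
  show ?case
  proof (cases "k = 0")
   case True then show ?thesis by (simp add: pw_Suc U_def)
  next
   case False
   then have "pw U (Suc k) = mul U (t ^ k *s pw u k + (one - W))" using Suc by (simp add: pw_Suc)
   also have "\<dots> = t ^ Suc k *s pw u (Suc k) + (one - W)"
    using False by (simp add: U_def mdist pw_Suc u W_idem pwu_W mult.commute vec.scale_right_diff_distrib)
   finally show ?thesis .
  qed
 qed simp
 have U7: "pw U 7 = one" using Uk[of 7] s t by simp
 obtain z :: 'k where z: "\<And>q. ratev z q = 0 \<longleftrightarrow> ratev (cw 7) q = 0" using ex_root[of 7] by auto
 note zr = root_pow[OF _ z]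
 have z7: "z ^ 7 = 1" using zr(1) by simp
 have zj: "z ^ j \<noteq> 1" if "0 < j" "j < 7" for j using zr(2)[of j] that by simp
 have z0: "z \<noteq> 0" using z7 by auto
 have "\<exists>Q. (\<forall>j. mul (Q j) (Q j) = Q j) \<and> (\<forall>l<7. pw U l = (\<Sum>j<7. z ^ (l * j) *s Q j)) \<and> (\<forall>j x. mul x U = mul U x \<longrightarrow> mul x (Q j) = mul (Q j) x)"
 proof (rule root_decomp[OF U7 _ z7 zj])
  fix Q assume "\<And>j. mul (Q j) (Q j) = Q j" "\<And>l. l < 7 \<Longrightarrow> pw U l = (\<Sum>j<7. z ^ (l * j) *s Q j)"
   "\<And>j x. mul x U = mul U x \<Longrightarrow> mul x (Q j) = mul (Q j) x"
  then show ?thesis by (intro exI[of _ Q] conjI allI impI)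
 qed simp_all
 then obtain Q where QQ: "(\<forall>j. mul (Q j) (Q j) = Q j) \<and> (\<forall>l<7. pw U l = (\<Sum>j<7. z ^ (l * j) *s Q j)) \<and> (\<forall>j x. mul x U = mul U x \<longrightarrow> mul x (Q j) = mul (Q j) x)" ..
 note Q = QQ[THEN conjunct1, rule_format] QQ[THEN conjunct2, THEN conjunct1, rule_format] QQ[THEN conjunct2, THEN conjunct2, rule_format]
 define P where "P j = mul W (Q j)" for j
 have PP: "mul (P j) (P j) = P j" for j
 proof -
  have "mul (Q j) (mul W y) = mul W (mul (Q j) y)" for y by (metis W_central mul_assoc)
  moreover have "mul W (mul W y) = mul W y" for y by (simp add: mul_assoc[symmetric] W_idem)
  ultimately show ?thesis by (simp add: P_def mul_assoc Q)
 qed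
 have WP: "mul W (P j) = P j" for j by (simp add: P_def mul_assoc[symmetric] W_idem)
 have cP: "mul x (P j) = mul (P j) x" if x: "mul x u = mul u x" for x j
 proof -
  have "mul x U = mul U x" by (simp add: U_def mdist x W_central)
  then have "mul x (Q j) = mul (Q j) x" by (rule Q(3))
  then show ?thesis unfolding P_def by (metis W_central mul_assoc)
 qed
 have "\<forall>j. \<exists>k. dot v (P j) = of_nat k" using idem_nat[OF PP vI] by blast
 then obtain n where n: "\<And>j. dot v (P j) = of_nat (n j)" by metis
 have vU: "dot v (mul W (pw U l)) = (\<Sum>j<7. z ^ (l * j) * of_nat (n j))" if "l < 7" for l
  using Q(2)[OF that] by (simp add: msum mdist dot_sum P_def[symmetric] n)
 have vU': "dot v (mul W (pw U l)) = t ^ l * dot v (pw u l)" if "0 < l" for l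
  using Uk[OF that] that by (simp add: mdist pwu_W W_idem)
 have s1: "(\<Sum>j<7. P j) = W" proof -
  have "(\<Sum>j<7. P j) = mul W (\<Sum>j<7. Q j)" by (simp add: P_def msum)
  also have "(\<Sum>j<7. Q j) = one" using Q(2)[of 0] by simp
  finally show ?thesis by simp
 qed
 then have "dot v (\<Sum>j<7. P j) = 7" by (simp add: vW)
 then have "(of_nat (\<Sum>j<7. n j) :: 'k) = of_nat 7" by (simp add: dot_sum n)
 then have sn: "(\<Sum>j<7. n j) = 7" by (simp only: of_nat_eq_iff)
 define a where "a l = dot v (mul W (pw U l))" for l
 have a0: "a 0 = 7" by (simp add: a_def vW)
 have aa: "a l * a (7 - l) = 0" if "0 < l" "l < 7" for l
  using v_pwu[OF that] vU'[of l] vU'[of "7 - l"] that by (auto simp: a_def)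
 have az: "(\<Sum>j<7. z ^ (6 * l * j) * of_nat (n j)) = (if l = 0 then 7 else a (7 - l))" if "l < 7" for l
 proof (cases "l = 0")
  case True then show ?thesis using vU[of 0] by (simp add: vW)
 next
  case False
  have "z ^ (6 * l * j) = z ^ ((7 - l) * j)" for j
  proof -
   have "6 * l * j = (7 - l) * j + 7 * ((l - 1) * j)" using False that by (simp add: algebra_simps diff_mult_distrib diff_mult_distrib2)
   then have "z ^ (6 * l * j) = z ^ ((7 - l) * j) * (z ^ 7) ^ ((l - 1) * j)" by (simp only: power_add power_mult)
   then show ?thesis by (simp add: z7)
  qed
  then show ?thesis using False that vU[of "7 - l"] by (simp add: a_def)
 qed
 have al: "(\<Sum>j<7. z ^ (l * j) * of_nat (n j)) = a l" if "l < 7" for l using vU[OF that] by (simp add: a_def)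
 have "(\<Sum>l<7. (\<Sum>i<7. z ^ (l * i) * of_nat (n i)) * (\<Sum>j<7. z ^ (6 * l * j) * of_nat (n j))) = (\<Sum>l<(7::nat). if l = 0 then 49 else 0)"
  by (rule sum.cong[OF refl]) (use al az aa a0 in auto)
 also have "\<dots> = 49" by simp
 finally have S49: "(\<Sum>l<7. (\<Sum>i<7. z ^ (l * i) * of_nat (n i)) * (\<Sum>j<7. z ^ (6 * l * j) * of_nat (n j))) = 49" .
 have "(\<Sum>l<7. (\<Sum>i<7. z ^ (l * i) * of_nat (n i)) * (\<Sum>j<7. z ^ (6 * l * j) * of_nat (n j)))
  = (\<Sum>l<7. \<Sum>i<7. \<Sum>j<7. (z ^ (i + 6 * j)) ^ l * (of_nat (n i) * of_nat (n j)))"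
  unfolding sum_product by (intro sum.cong refl) (simp add: power_add power_mult[symmetric] power_mult_distrib mult_ac)
 also have "\<dots> = (\<Sum>i<7. \<Sum>j<7. (\<Sum>l<7. (z ^ (i + 6 * j)) ^ l) * (of_nat (n i) * of_nat (n j)))"
  by (subst sum.swap, rule sum.cong[OF refl], subst sum.swap) (simp add: sum_distrib_right)
 also have "\<dots> = (\<Sum>i<7. \<Sum>j<7. if j = i then 7 * (of_nat (n i) * of_nat (n i)) else 0)"
 proof (intro sum.cong refl)
  fix i j :: nat assume ij: "i \<in> {..<7}" "j \<in> {..<7}"
  have w7: "(z ^ (i + 6 * j)) ^ 7 = 1" by (metis z7 mult.commute power_mult power_one)
  show "(\<Sum>l<7. (z ^ (i + 6 * j)) ^ l) * (of_nat (n i) * of_nat (n j)) = (if j = i then 7 * (of_nat (n i) * of_nat (n i)) else 0)"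
  proof (cases "j = i")
   case True
   have "z ^ (i + 6 * j) = (z ^ 7) ^ i" using True by (simp add: power_mult[symmetric])
   then have "z ^ (i + 6 * j) = 1" by (simp add: z7)
   then show ?thesis using True by simp
  next
   case False
   have "z ^ (i + 6 * j) \<noteq> 1"
   proof
    assume h: "z ^ (i + 6 * j) = 1"
    have "z ^ i * (z ^ 7) ^ j = z ^ (i + 6 * j) * z ^ j" by (simp add: power_add[symmetric] power_mult[symmetric] add.commute)
    then have e: "z ^ i = z ^ j" by (simp add: z7 h)
    show False
    proof (cases "i < j")
     case True
     then have "z ^ j = z ^ i * z ^ (j - i)" by (simp add: power_add[symmetric])
     then have "z ^ (j - i) = 1" using e z0 by simp
     then show False using zj[of "j - i"] True ij by (auto simp: less_imp_diff_less)
    next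
     case F: False
     then have "z ^ i = z ^ j * z ^ (i - j)" by (simp add: power_add[symmetric])
     then have "z ^ (i - j) = 1" using e z0 by simp
     then show False using zj[of "i - j"] F False ij by (auto simp: less_imp_diff_less)
    qed
   qed
   then show ?thesis using geom_root(1)[OF w7] False by simp
  qed
 qed
 also have "\<dots> = of_nat (7 * (\<Sum>i<7. n i * n i))" by (simp add: sum_distrib_left)
 finally have "(of_nat (7 * (\<Sum>i<7. n i * n i)) :: 'k) = of_nat 49" using S49 by simp
 then have "7 * (\<Sum>i<7. n i * n i) = 49" by (simp only: of_nat_eq_iff)
 then have "(\<Sum>i<7. n i * n i) = 7" by simp
 then have n1: "n j = 1" if "j < 7" for j using sum_sq_one[of "{..<7}" n j] sn that by simp
 show ?thesis
  by (intro exI[of _ P] conjI allI impI) (simp_all add: PP WP n n1 s1 cP)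
qed

text \<open>The algebra fixed by all translations \<open>T be\<close> (\<open>R_all\<close>); within
  the block of v it is the commutant of u.\<close>

definition R where "R x \<longleftrightarrow> T al0 x = x"
lemma R_u: assumes "R x" shows "mul x u = mul u x"
proof -
 have "T al0 (mul W x) = mul W x" using assms TW[of "Suc 0" x] by (simp add: R_def)
 then have "mul (mul W x) u = mul u x" using u(4)[of x] by simp
 then show ?thesis by (metis W_central mul_assoc u(3))
qed
lemma u_R: assumes x: "mul W x = x" "mul x u = mul u x" shows "R x"
proof -
 obtain s where s: "s \<noteq> 0" "pw u 7 = s *s W" using u7 by blast
 let ?y = "T al0 x - x"
 have y: "mul W ?y = ?y" using TW[of "Suc 0" x] x(1) by (simp add: mdist)
 have "mul ?y u = 0" using u(4)[of x] x by (simp add: mdist)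
 then have "mul ?y (mul u (pw u 6)) = 0" by (simp only: mul_assoc[symmetric] mdist(7))
 then have "mul ?y (pw u 7) = 0" using pw_Suc[of u 6] by simp
 then have "s *s mul ?y W = 0" using s(2) by (simp add: mdist)
 then have "?y = 0" using s(1) y W_central by simp
 then show ?thesis by (simp add: R_def)
qed
lemma R_all: assumes "R x" "gd be" shows "T be x = x"
proof -
 obtain k where "be = cpw al0 k" using al0(2)[OF assms(2)] by blast
 moreover have "(T al0 ^^ k) x = x" using assms(1) by (induction k) (simp_all add: R_def)
 ultimately show ?thesis by (simp add: T_cpw)
qed
lemma R_avg: "R (T (avg Gd) x)"
 unfolding R_def by (simp add: TT avg_shift(2)[OF sgd_all] al0(1))
lemma R_T': "R x \<Longrightarrow> R (T' be x)" by (simp add: R_def TT(3))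

context
 fixes P assumes P: "mul P P = P" "mul W P = P" "dot v P = 1" "\<And>x. mul x u = mul u x \<Longrightarrow> mul x P = mul P x"
begin

lemma R_P: "R P" using u_R[OF P(2)] P(4)[of u] by simp
lemma gP: "gd be \<Longrightarrow> dot be P = 0" using gWx[of be P] P(2) by simp
lemma rank1: "mul P (mul x P) = dot v (mul P x) *s P"
proof -
 have "tr (\<lambda>x. mul P (mul x P)) = 1" using tr_W[of P P] by (simp add: P)
 have v: "dot v (mul P (mul P (mul x P))) = dot v (mul P x)" for x
  by (metis P(1) IX_trace[OF vI] mul_assoc tracelike_def)
 have "mul P (mul x P) = dot v (mul P x) *s P"
 proof (rule tr_idem_one[of "\<lambda>x. mul P (mul x P)" "\<lambda>x. dot v (mul P x)"])
  show "lin (\<lambda>x. mul P (mul x P))" "linf (\<lambda>x. dot v (mul P x))" by (intro lins)+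
  show "mul P (mul (mul P (mul x P)) P) = mul P (mul x P)" for x by (metis P(1) mul_assoc)
 qed (simp_all add: v P, fact)
 then show ?thesis .
qed
lemma R_rank1: assumes "R x" shows "mul P x = dot v (mul P x) *s P"
proof -
 have a: "mul x P = mul P x" by (rule P(4)[OF R_u[OF assms]])
 have "mul P (mul x P) = mul P x" unfolding a by (simp add: mul_assoc[symmetric] P)
 then show ?thesis by (simp only: rank1)
qed
lemma f_mult: assumes "R x" "R y" shows "dot v (mul P (mul x y)) = dot v (mul P x) * dot v (mul P y)"
proof -
 have "mul P (mul x y) = mul (dot v (mul P x) *s P) y" by (simp only: R_rank1[OF assms(1), symmetric] mul_assoc)
 then show ?thesis by (simp add: mdist)
qed

lemma T'_P: assumes g: "gd be" shows "mul (T' be P) (T' be P) = T' be P" "mul W (T' be P) = T' be P" "dot v (T' be P) = 1" "R (T' be P)"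
 using T'_mul[OF g, of P P] T'_mul[OF g, of W P] T_W(2)[OF g] R_T'[OF R_P] by (simp_all add: P dot_T' av[OF g])
text \<open>P has rank one and commutes with the fixed algebra, so v(P x) is multiplicative in x
  there and takes the value 0 or 1 at an idempotent.\<close>

lemma T'_P_dich: assumes g: "gd be" shows "T' be P = P \<or> mul P (T' be P) = 0"
proof -
 let ?Q = "T' be P"
 note Q = T'_P[OF g]
 let ?f = "dot v (mul P ?Q)"
 have "?f * ?f = ?f" using f_mult[OF Q(4) Q(4)] Q(1) by simp
 then have "?f = 0 \<or> ?f = 1" by simp
 then show ?thesis
 proof
  assume "?f = 0" then show ?thesis using R_rank1[OF Q(4)] by simp
 next
  assume "?f = 1"
  then have a: "mul P ?Q = P" using R_rank1[OF Q(4)] by simp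
  then have b: "mul ?Q P = P" using P(4)[OF R_u[OF Q(4)]] by simp
  have "?Q - P = 0"
   by (rule idem_W_zero) (simp_all add: mdist P Q a b)
  then show ?thesis by simp
 qed
qed
text \<open>The stabiliser of P is a nontrivial subgroup of a group of prime order.\<close>

lemma T'_P_all: assumes g: "gd be" "be \<noteq> eps" "T' be P = P" and h: "gd \<gamma>" shows "T' \<gamma> P = P"
proof -
 let ?A = "{\<gamma>. gd \<gamma> \<and> T' \<gamma> P = P}"
 have inv: "T' (adj S \<gamma>) P = P" if "gd \<gamma>" "T' \<gamma> P = P" for \<gamma>
 proof -
  have "T' (adj S \<gamma>) (T' \<gamma> P) = P" by (simp add: TT gd_inv[OF that(1)])
  then show ?thesis using that by simp
 qed
 have s: "sgd ?A" using inv by (auto simp: sgd_def gd_eps gd_cm gd_inv TT(2)[symmetric])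
 have "card ?A dvd 7" using lagrange[OF s sgd_all] G7 by auto
 moreover have "card ?A \<noteq> 1"
 proof
  assume "card ?A = 1"
  then obtain w where w: "?A = {w}" by (auto simp: card_1_singleton_iff)
  have "eps \<in> ?A" "be \<in> ?A" using g gd_eps by auto
  then show False using g(2) unfolding w by simp
 qed
 moreover have "prime (7::nat)" by (simp add: prime_nat_numeral_eq)
 ultimately have "card ?A = 7" by (auto simp: prime_nat_iff)
 then have "?A = Gd" using card_subset_eq[OF gd_finite, of ?A] G7 by auto
 then show ?thesis using h by blast
qed

text \<open>The convolution \<open>r \<mapsto> f(r\<^sub>1) r\<^sub>2\<close> is multiplicative on \<open>R\<close> because the first leg of \<open>R\<close> stays in \<open>R\<close>.\<close>

definition f where "f = repf (\<lambda>x. dot v (mul P x))"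
lemma dot_f: "dot f x = dot v (mul P x)"
 unfolding f_def by (rule dot_repf) (intro lins)
text \<open>x equals its own average, and coassociativity transfers the averaging to the first
  leg.\<close>

lemma sw_R: assumes "R x" "blin F" shows "sw cm x F = sw cm x (\<lambda>a b. F (T (avg Gd) a) b)"
proof -
 let ?a = "avg Gd"
 have "T ?a x = x" by (rule T_avg_fixed(1)[OF sgd_all]) (simp add: R_all[OF assms(1)])
 then have "sw cm x F = sw cm (T ?a x) F" by simp
 also have "\<dots> = sw cm x (\<lambda>a b. dot ?a a * sw cm b F)" by (rule sw_T[OF assms(2)])
 also have "\<dots> = sw cm x (\<lambda>a b. F (T ?a a) b)"
 proof -
  have t: "tlin (\<lambda>a b c. dot ?a a * F b c)" using assms(2) by (intro lins) (auto intro!: lins linf_comp[OF blinD(1)[OF assms(2)]] linf_comp[OF blinD(2)[OF assms(2)]] lin_id)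
  have "sw cm x (\<lambda>a b. dot ?a a * sw cm b F) = sw cm x (\<lambda>a b. sw cm b (\<lambda>c e. dot ?a a * F c e))" by (simp add: sw_mult)
  also have "\<dots> = sw cm x (\<lambda>a e. sw cm a (\<lambda>b c. dot ?a b * F c e))" using sw_coassoc[OF t] by simp
  also have "\<dots> = sw cm x (\<lambda>a b. F (T ?a a) b)" by (simp only: linf_T[OF blinD(2)[OF assms(2)]])
  finally show ?thesis .
 qed
 finally show ?thesis .
qed
lemma theta_mult: assumes "R x" "R y" shows "T f (mul x y) = mul (T f x) (T f y)"
proof (rule dot_eqI)
 fix g
 have l: "linf (\<lambda>t. dot g (mul t (T f y)))" by (intro lins)
 have l2: "linf (\<lambda>t. dot g (mul z t))" for z by (intro lins)
 let ?t = "T (avg Gd)"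
 have "dot g (T f (mul x y)) = sw cm x (\<lambda>a b. sw cm y (\<lambda>c d. dot f (mul a c) * dot g (mul b d)))"
  unfolding dot_T compat ..
 also have "\<dots> = sw cm x (\<lambda>a b. sw cm y (\<lambda>c d. dot f (mul (?t a) c) * dot g (mul b d)))"
  by (rule sw_R[OF assms(1)]) (intro lins)
 also have "\<dots> = sw cm x (\<lambda>a b. sw cm y (\<lambda>c d. dot f (mul (?t a) (?t c)) * dot g (mul b d)))"
  by (subst sw_R[OF assms(2)]) (intro lins, simp)
 also have "\<dots> = sw cm x (\<lambda>a b. sw cm y (\<lambda>c d. dot f (?t a) * (dot f (?t c) * dot g (mul b d))))"
  by (simp add: dot_f f_mult[OF R_avg R_avg] mult.assoc)
 also have "\<dots> = sw cm x (\<lambda>a b. dot f (?t a) * sw cm y (\<lambda>c d. dot f (?t c) * dot g (mul b d)))"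
  by (simp add: sw_mult)
 also have "\<dots> = sw cm x (\<lambda>a b. dot f a * sw cm y (\<lambda>c d. dot f (?t c) * dot g (mul b d)))"
  by (rule sw_R[OF assms(1), symmetric]) (intro lins)
 also have "\<dots> = sw cm x (\<lambda>a b. dot f a * sw cm y (\<lambda>c d. dot f c * dot g (mul b d)))"
  by (subst (2) sw_R[OF assms(2)]) (intro lins, simp)
 also have "\<dots> = dot g (mul (T f x) (T f y))"
  by (simp only: linf_T[OF l2, symmetric] linf_T[OF l, symmetric])
 finally show "dot g (T f (mul x y)) = dot g (mul (T f x) (T f y))" .
qed

lemma rho_v: "rho = (\<Sum>be\<in>Gd. be) + 7 *s v"
proof (rule dot_eqI, subst (1 2) dot_sym)
 fix h
 have "dot rho h = of_nat (deg v) * dot v h + (\<Sum>x\<in>Gd. of_nat (deg x) * dot x h)"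
  unfolding rho_IX IXv using vng gd_finite by simp
 also have "(\<Sum>x\<in>Gd. of_nat (deg x) * dot x h) = (\<Sum>x\<in>Gd. dot x h)" by (rule sum.cong) (simp_all add: gd_IX)
 finally show "dot rho h = dot ((\<Sum>be\<in>Gd. be) + 7 *s v) h" by (simp add: dv dot_sum)
qed

text \<open>In a free orbit the seven translates of P are orthogonal and add up to W. Now rho is the
  sum of the seven one-dimensional characters and 7 v; evaluating f rho at W gives 49 = 7 + 49 c,
  where c is the natural number v(f(P_1) P_2).\<close>

lemma no_free_orbit: assumes g: "gd be" "T' be P \<noteq> P" shows False
proof -
 have be: "be \<noteq> eps" using g by auto
 have orth0: "mul P (T' \<gamma> P) = 0" if "gd \<gamma>" "\<gamma> \<noteq> eps" for \<gamma>
  using T'_P_dich[OF that(1)] T'_P_all[OF that(1,2) _ g(1)] g(2) by blast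
 have orth: "mul (T' \<gamma> P) (T' \<delta> P) = (if \<gamma> = \<delta> then T' \<gamma> P else 0)" if "gd \<gamma>" "gd \<delta>" for \<gamma> \<delta>
 proof (cases "\<gamma> = \<delta>")
  case True then show ?thesis using T'_P[OF that(1)] by simp
 next
  case False
  let ?e = "cm (adj S \<gamma>) \<delta>"
  have ge: "gd ?e" using gd_cm gd_inv that by blast
  have ge2: "cm \<gamma> ?e = \<delta>" by (simp add: cm_assoc[symmetric] gd_inv[OF that(1)])
  have "?e \<noteq> eps"
  proof
   assume a: "?e = eps"
   show False using ge2 False unfolding a by simp
  qed
  then have "T' \<gamma> (mul P (T' ?e P)) = 0" using orth0[OF ge] lin_0[OF lin_T(2)[OF lin_id]] by simp
  then show ?thesis using False T'_mul[OF that(1), of P "T' ?e P"] by (simp add: TT ge2)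
 qed
 let ?Z = "\<Sum>\<gamma>\<in>Gd. T' \<gamma> P"
 have ZW: "?Z = W"
 proof (rule idem_unique)
  show "mul ?Z ?Z = ?Z"
  proof -
   have "mul ?Z ?Z = (\<Sum>\<gamma>\<in>Gd. \<Sum>\<delta>\<in>Gd. if \<gamma> = \<delta> then T' \<gamma> P else 0)"
    by (simp only: msum(1), simp only: msum(2)) (intro sum.cong refl, use orth in auto)
   then show ?thesis using gd_finite by simp
  qed
  show "mul W W = W" by (rule W_idem)
  have zv: "dot v ?Z = 7" using T'_P(3) G7 by (simp add: dot_sum)
  have zg: "dot \<delta> ?Z = 0" if "gd \<delta>" for \<delta>
   unfolding dot_sum by (rule sum.neutral) (use that gP gd_cm in \<open>auto simp: dot_T'\<close>)
  fix x assume "x \<in> IX"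
  then show "dot x ?Z = dot x W" "dot x ?Z = 0 \<or> dot x ?Z = of_nat (deg x)"
   using IXv zv zg vW gW dv by auto
 qed
 have "mul (T f P) (T f P) = T f P" using theta_mult[OF R_P R_P] P(1) by simp
 then obtain c where c: "dot v (T f P) = of_nat c" using idem_nat[OF _ vI] by blast
 have "dot v (T f W) = (\<Sum>\<gamma>\<in>Gd. dot v (T f (T' \<gamma> P)))"
  unfolding ZW[symmetric] by (simp add: lin_sum[OF lin_T(1)[OF lin_id]] dot_sum)
 also have "\<dots> = (\<Sum>\<gamma>\<in>Gd. of_nat c)"
  by (rule sum.cong[OF refl]) (simp add: TT(3) dot_T'[of v] av c)
 finally have fW: "dot (cm f v) W = 7 * of_nat c" using G7 by (simp add: dot_T)
 have f1: "dot f one = 1" "dot f W = 1" using P(2,3) W_central[of P] by (simp_all add: dot_f)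
 have "dot (cm f rho) W = 49"
 proof -
  have "dot rho W = 49" unfolding rho_v by (simp add: dot_sum vW gW)
  then show ?thesis by (simp add: cm_rho_l f1)
 qed
 moreover have "dot (cm f rho) W = (\<Sum>\<gamma>\<in>Gd. dot (cm f \<gamma>) W) + 7 * dot (cm f v) W"
  unfolding rho_v by (simp add: cdist csum dot_sum)
 moreover have "(\<Sum>\<gamma>\<in>Gd. dot (cm f \<gamma>) W) = 7"
 proof -
  have "(\<Sum>\<gamma>\<in>Gd. dot (cm f \<gamma>) W) = (\<Sum>\<gamma>\<in>Gd. 1)"
   by (rule sum.cong[OF refl]) (simp add: dot_T'[symmetric] T_W f1)
  then show ?thesis using G7 by simp
 qed
 ultimately have "(of_nat 49 :: 'k) = of_nat (7 + 49 * c)" using fW by simp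
 then have "49 = 7 + 49 * c" by (simp only: of_nat_eq_iff)
 then show False by presburger
qed

end

text \<open>On the block of v a fixed element is a combination of the P j, which are fixed on the
  other side as well. On the complement the matrix coefficients are one-dimensional characters, and
  these all agree with \<open>eps\<close> on x.\<close>

lemma R_fixed: assumes x: "R x" and g: "gd be" shows "T' be x = x"
proof -
 obtain P where P: "\<And>j. j < (7::nat) \<Longrightarrow> mul (P j) (P j) = P j" "\<And>j. j < 7 \<Longrightarrow> mul W (P j) = P j" "\<And>j. j < 7 \<Longrightarrow> dot v (P j) = 1"
  "\<And>j x. j < 7 \<Longrightarrow> mul x u = mul u x \<Longrightarrow> mul x (P j) = mul (P j) x" "(\<Sum>j<7. P j) = W" using ex_P by metis
 have fx: "T' be (P j) = P j" if j: "j < 7" for j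
 proof (rule ccontr)
  assume n: "T' be (P j) \<noteq> P j"
  show False by (rule no_free_orbit[OF P(1)[OF j] P(2)[OF j] P(3)[OF j] _ g n]) (rule P(4)[OF j])
 qed
 have r1: "mul (P j) x = dot v (mul (P j) x) *s P j" if j: "j < 7" for j
  by (rule R_rank1[OF P(1)[OF j] P(2)[OF j] P(3)[OF j] _ x]) (rule P(4)[OF j])
 have e1: "T' be (mul W x) = mul W x"
 proof -
  have "mul W x = (\<Sum>j<7. dot v (mul (P j) x) *s P j)"
   unfolding P(5)[symmetric] msum by (rule sum.cong[OF refl]) (use r1 in simp)
  moreover have "T' be (\<Sum>j<7. dot v (mul (P j) x) *s P j) = (\<Sum>j<7. dot v (mul (P j) x) *s P j)"
   unfolding lin_sum[OF lin_T(2)[OF lin_id]] linD(2)[OF lin_T(2)[OF lin_id]] using fx by simp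
  ultimately show ?thesis by simp
 qed
 have lin: "dot \<gamma> x = dot eps x" if "gd \<gamma>" for \<gamma>
  using R_all[OF x that] dot_T[of eps \<gamma> x] by simp
 have "mul (one - W) (T' be x) = mul (one - W) x"
 proof (rule p_eqI)
  fix i j assume ij: "(i,j) \<in> PP"
  have W0: "dot (p i j) (mul (one - W) y) = (if r i = c0 then 0 else dot (p i j) y)" for y
  proof -
   have b: "i \<in> blk (r i)" "j \<in> blk (r i)" using PP_D[OF ij] by auto
   have "dot (p i j) (mul W y) = (\<Sum>k\<in>blk (r i). if k = i then (if r i = c0 then dot (p i j) y else 0) else 0)"
    unfolding p_mul[OF ij] W_def by (rule sum.cong[OF refl]) (use p_ce[OF blk_PP[OF b(1)] c0(1)] in auto)
   then show ?thesis using b by (simp add: mdist)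
  qed
  show "dot (p i j) (mul (one - W) (T' be x)) = dot (p i j) (mul (one - W) x)"
  proof (cases "r i = c0")
   case False
   have c: "r i \<in> Irr" and b: "i \<in> blk (r i)" "j \<in> blk (r i)" using PP_D[OF ij] by auto
   have "chi (r i) \<noteq> v" using False c c0 chi_inj unfolding inj_on_def by metis
   then have g': "gd (chi (r i))" using c IXv by (auto simp: IX_def)
   then have "card (blk (r i)) = 1" using deg_chi[OF c] gd_IX(2) by (simp add: d_def)
   then obtain k where k: "blk (r i) = {k}" by (auto simp: card_1_singleton_iff)
   then have "chi (r i) = p i j" using b by (simp add: chi_def)
   then have "gd (p i j)" using g' by simp
   then show ?thesis using False by (simp add: W0 dot_T' lin gd_cm g)
  qed (simp add: W0)
 qed
 then have "T' be x - mul W (T' be x) = x - mul W x" by (simp add: mdist)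
 moreover have "mul W (T' be x) = T' be (mul W x)" by (simp add: T'_mul[OF g] T_W[OF g])
 ultimately show ?thesis using e1 by simp
qed

text \<open>For the average a, \<open>R_fixed\<close> says a g a = a g in the dual. Applying the
  antipode gives a g a = g a.\<close>

lemma avg_central: "cm (avg Gd) h = cm h (avg Gd)"
proof -
 let ?a = "avg Gd"
 have Ta: "T' ?a x = x" if "R x" for x by (rule T_avg_fixed(2)[OF sgd_all]) (simp add: R_fixed[OF that])
 have e: "cm ?a (cm g ?a) = cm ?a g" for g
 proof (rule dot_eqI, subst (1 2) dot_sym)
  fix x
  have "dot (cm ?a (cm g ?a)) x = dot g (T' ?a (T ?a x))" by (simp add: dot_T' dot_T)
  also have "\<dots> = dot (cm ?a g) x" by (simp add: Ta[OF R_avg] dot_T)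
  finally show "dot (cm ?a (cm g ?a)) x = dot (cm ?a g) x" .
 qed
 have aS: "adj S ?a = ?a"
 proof -
  have l: "lin (adj S)" by (rule lin_adjS[OF lin_id])
  have "bij_betw (adj S) Gd Gd" by (rule bij_betw_byWitness[where f'="adj S"]) (auto simp: gd_inv)
  from sum.reindex_bij_betw[OF this, of "\<lambda>x. x"] show ?thesis by (simp add: avg_def linD(2)[OF l] lin_sum[OF l])
 qed
 have "adj S (cm ?a (cm (adj S h) ?a)) = adj S (cm ?a (adj S h))" by (simp only: e)
 then have "cm (cm ?a h) ?a = cm h ?a" by (simp add: adjS_mul aS)
 then show ?thesis using e[of h] by (simp add: cm_assoc)
qed

end

lemma (in hopf_wed) seven_central:
 assumes "CARD('n) = 56" "card Gd = 7" "deg v = 7" "IX = insert v Gd"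
 shows "cm (avg Gd) h = cm h (avg Gd)"
proof -
 interpret s: seven mul cm one eps S Lam m r E p v by unfold_locales (rule assms)+
 show ?thesis by (rule s.avg_central)
qed

section \<open>Central groups of grouplike elements\<close>

context hopf_int begin

text \<open>The input of \<open>centr_nsub\<close> and, for the dual, of \<open>centrD_nsub\<close>;
  the bounds on the order make the resulting normal Hopf subalgebra proper.\<close>

definition centr :: "('k^'n) set \<Rightarrow> bool" where
 "centr P \<longleftrightarrow> sgd P \<and> 1 < card P \<and> card P < CARD('n) \<and> (\<forall>h. cm (avg P) h = cm h (avg P))"

text \<open>Otherwise inversion would pair off the nontrivial elements.\<close>

lemma sgd_involution: assumes A: "sgd A" and ev: "even (card A)" shows "\<exists>al\<in>A. al \<noteq> eps \<and> cm al al = eps"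
proof (rule ccontr)
 assume n: "\<not> ?thesis"
 let ?X = "A - {eps}"
 have inv: "adj S al \<in> ?X" "adj S al \<noteq> al" if a: "al \<in> ?X" for al
 proof -
  have g: "gd al" "adj S al \<in> A" using A a by (auto simp: sgd_def)
  have "adj S al \<noteq> eps" using a adjSS[of al] by (metis DiffD2 adjS_eps insertI1)
  then show "adj S al \<in> ?X" using g by simp
  show "adj S al \<noteq> al" using n a gd_inv(2)[OF g(1)] by auto
 qed
 have "2 dvd card ?X"
 proof (rule equiv_imp_dvd_card)
  let ?R = "{(x,y). x \<in> ?X \<and> y \<in> ?X \<and> (y = x \<or> y = adj S x)}"
  show "equiv ?X ?R"
   by (rule equivI) (auto simp: refl_on_def intro!: symI transI)
  show "finite ?X" using sgd_finite[OF A] by simp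
  fix O' assume "O' \<in> ?X // ?R"
  then obtain x where x: "x \<in> ?X" "O' = ?R `` {x}" by (auto elim: quotientE)
  then have "O' = {x, adj S x}" using inv(1)[OF x(1)] by auto
  then show "2 dvd card O'" using inv(2)[OF x(1)] by simp
 qed
 moreover have "card A = card ?X + 1" using A sgd_finite[OF A] card_Suc_Diff1[of A eps] by (simp add: sgd_def)
 ultimately show False using ev by simp
qed

lemma sgd_pair: assumes "gd z" "z \<noteq> eps" "cm z z = eps" shows "sgd {eps,z}" "card {eps,z} = 2"
proof -
 have "adj S z = z" using gd_cancel(1)[OF assms(1), of "adj S z" z] gd_inv(2)[OF assms(1)] assms(3) by simp
 then show "sgd {eps,z}" using assms by (auto simp: sgd_def gd_eps)
 show "card {eps,z} = 2" using assms by simp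
qed

end

context hopf_wed begin

lemma sum_IX_Gd: "(\<Sum>x\<in>IX. f x) = (\<Sum>x\<in>IX - Gd. f x) + (\<Sum>x\<in>Gd. f x)"
 for f :: "'k^'n \<Rightarrow> 'b::comm_monoid_add"
 by (rule sum.subset_diff) (use gd_IX in auto)

lemma idem_ranks:
 assumes e: "mul e e = e" and k: "dot rho e = of_nat k"
 obtains n where "\<And>x. x \<in> IX \<Longrightarrow> n x \<le> deg x" "\<And>x. x \<in> IX \<Longrightarrow> dot x e = of_nat (n x)"
  "\<And>al j. gd al \<Longrightarrow> dot al e = of_nat j \<Longrightarrow> n al = j"
  "(\<Sum>x\<in>IX. deg x * n x) = k" "k = (\<Sum>x\<in>IX - Gd. deg x * n x) + (\<Sum>x\<in>Gd. n x)"
proof -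
 have "\<forall>x. x \<in> IX \<longrightarrow> (\<exists>n\<le>deg x. dot x e = of_nat n)" using idem_nat[OF e] by blast
 then obtain n where n: "\<And>x. x \<in> IX \<Longrightarrow> n x \<le> deg x" "\<And>x. x \<in> IX \<Longrightarrow> dot x e = of_nat (n x)" by metis
 have "(of_nat (\<Sum>x\<in>IX. deg x * n x) :: 'k) = of_nat k" using n(2) k by (simp add: rho_IX)
 then have s: "(\<Sum>x\<in>IX. deg x * n x) = k" by (simp only: of_nat_eq_iff)
 show ?thesis
  by (rule that[OF n _ s]) (use n(2) gd_IX s sum_IX_Gd[of "\<lambda>x. deg x * n x"] in auto)
qed

end

text \<open>H and its dual with a Wedderburn decomposition each. Grouplike elements of H appear as
  one-dimensional characters \<open>D.gd\<close> of the dual, and \<open>swap\<close> exchanges the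
  two sides.\<close>

locale pair = hopf_wed mul cm one eps S Lam m r E p + D: hopf_wed cm mul eps one "adj S" "hopf_int.Lm mul" m' r' E' p'
 for mul cm :: "'k::{alg_closed_field,field_char_0}^'n::finite \<Rightarrow> 'k^'n \<Rightarrow> 'k^'n" and one eps S Lam m r E p m' r' E' p'
begin

lemma swap: "pair cm mul eps one (adj S) Lm m' r' E' p' m r E p"
proof -
 have "hopf_int.Lm cm = Lam" using D.Lm_def dual_rho by simp
 then have w: "hopf_wed mul cm one eps (adj (adj S)) (hopf_int.Lm cm) m r E p"
  using hopf_wed_axioms by (simp add: adj_adjS)
 show ?thesis by (rule pair.intro[OF D.hopf_wed_axioms w])
qed

lemma gl_cm: "D.gd g \<Longrightarrow> dot (cm f h) g = dot f g * dot h g"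
 using D.gd_mult[of g f h] by (simp add: dot_sym[of g])
lemma gl_eps [simp]: "D.gd g \<Longrightarrow> dot eps g = 1" by (simp add: D.gd_def dot_sym[of eps])
lemma gl_rho0: "D.gd g \<Longrightarrow> g \<noteq> one \<Longrightarrow> dot rho g = 0"
 using D.gd_Lam[of g] by (simp add: Lm_def dot_sym[of rho])
lemma gl_S: "D.gd g \<Longrightarrow> mul (S g) g = one" "D.gd g \<Longrightarrow> mul g (S g) = one" "D.gd g \<Longrightarrow> D.gd (S g)"
 using D.gd_inv[of g] by (simp_all add: adj_adjS)
lemma gd_mulg: "gd al \<Longrightarrow> dot al (mul x y) = dot al x * dot al y" by (rule gd_mult)
lemma gd_one: "gd al \<Longrightarrow> dot al one = 1" by (simp add: gd_def)

lemma sum_char: assumes A: "sgd A" and g: "D.gd g" shows "(\<Sum>al\<in>A. dot al g) = (if \<forall>al\<in>A. dot al g = 1 then of_nat (card A) else 0)"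
proof (cases "\<forall>al\<in>A. dot al g = 1")
 case False
 then obtain be where b: "be \<in> A" "dot be g \<noteq> 1" by blast
 have "dot (\<Sum>A) g = dot (cm be (\<Sum>A)) g" by (simp only: sgd_shift[OF A b(1)])
 also have "\<dots> = dot be g * dot (\<Sum>A) g" by (rule gl_cm[OF g])
 finally have "(1 - dot be g) * dot (\<Sum>A) g = 0" by (simp add: algebra_simps)
 then have "dot (\<Sum>A) g = 0" using b(2) by simp
 then have "(\<Sum>al\<in>A. dot al g) = 0" by (simp add: dot_sum)
 then show ?thesis using False by (simp only: if_False)
qed simp

lemma rho_avg: assumes "D.sgd A" shows "dot rho (D.avg A) = of_nat CARD('n) / of_nat (card A)"
proof -
 have "dot rho (D.avg A) = (1 / of_nat (card A)) * (\<Sum>g\<in>A. dot rho g)" by (simp add: D.avg_def dot_sum)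
 also have "(\<Sum>g\<in>A. dot rho g) = (\<Sum>g\<in>A. if g = one then of_nat CARD('n) else 0)"
  by (rule sum.cong[OF refl]) (use assms gl_rho0 in \<open>auto simp: D.sgd_def\<close>)
 also have "\<dots> = of_nat CARD('n)" using assms D.sgd_finite[OF assms] by (simp add: D.sgd_def)
 finally show ?thesis by simp
qed
lemma eps_avg: assumes "D.sgd A" shows "dot eps (D.avg A) = 1"
proof -
 have "(\<Sum>g\<in>A. dot eps g) = of_nat (card A)" using assms by (simp add: D.sgd_def subset_iff)
 then show ?thesis using D.sgd_card[OF assms] by (simp add: D.avg_def dot_sum)
qed

text \<open>The average e has rho(e) = 56 / 28 = 2, of which the trivial character takes 1. The
  remaining 1 can only come from a one-dimensional character, so e is central.\<close>

lemma case28: assumes N: "CARD('n) = 56" and c: "card D.Gd = 28" shows "D.centr D.Gd"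
proof -
 let ?e = "D.avg D.Gd"
 have e: "mul ?e ?e = ?e" by (rule D.avg_idem[OF D.sgd_all])
 have "dot rho ?e = of_nat 2" using rho_avg[OF D.sgd_all] by (simp add: N c)
 then obtain n where n: "\<And>x. x \<in> IX \<Longrightarrow> n x \<le> deg x" "\<And>x. x \<in> IX \<Longrightarrow> dot x ?e = of_nat (n x)"
  and ng: "\<And>al j. gd al \<Longrightarrow> dot al ?e = of_nat j \<Longrightarrow> n al = j" and s: "(\<Sum>x\<in>IX. deg x * n x) = 2"
  by (rule idem_ranks[OF e]) blast
 have eI: "eps \<in> IX" "deg eps = 1" using gd_IX[OF gd_eps] by auto
 have ne: "n eps = 1" by (rule ng[OF gd_eps]) (simp add: eps_avg[OF D.sgd_all])
 have "(\<Sum>x\<in>IX - {eps}. deg x * n x) = 1" using s eI ne by (simp add: sum.remove[OF IX_fin eI(1)])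
 then have le: "deg x * n x \<le> 1" if "x \<in> IX" "x \<noteq> eps" for x
  using member_le_sum[of x "IX - {eps}" "\<lambda>x. deg x * n x"] that by simp
 have f: "dot x ?e = 0 \<or> dot x ?e = of_nat (deg x)" if x: "x \<in> IX" for x
 proof (cases "x = eps")
  case True then show ?thesis using n(2)[OF x] ne eI by simp
 next
  case False
  have "n x = 0 \<or> n x = deg x"
  proof (cases "n x")
   case (Suc k)
   then have "deg x * Suc k \<le> 1" using le[OF x False] by simp
   then have "deg x \<le> 1" by (cases k) auto
   then show ?thesis using n(1)[OF x] Suc by linarith
  qed simp
  then show ?thesis using n(2)[OF x] by auto
 qed
 show ?thesis unfolding D.centr_def using D.sgd_all c N idem_central[OF e f] by simp
qed

text \<open>H is commutative, so all averages are central. If all of H is spanned by grouplike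
  elements, a subgroup of order 2 is taken to stay proper.\<close>

lemma case56: assumes N: "CARD('n) = 56" and c: "card Gd = 56" shows "\<exists>P. D.centr P"
proof -
 have "(\<Sum>x\<in>Gd. (deg x)^2) = 56" using c gd_IX by simp
 then have "(\<Sum>x\<in>IX - Gd. (deg x)^2) = 0" using sum_deg2 N sum_IX_Gd[of "\<lambda>x. (deg x)^2"] by simp
 then have z0: "deg x = 0" if "x \<in> IX - Gd" for x using that by simp
 have "gd x" if x: "x \<in> IX" for x
 proof (rule ccontr)
  assume "\<not> gd x"
  then show False using z0[of x] x IX_deg[OF x] by simp
 qed
 then have com: "mul x y = mul y x" for x y by (rule commutative_if_linear)
 have le: "card D.Gd \<le> 56"
 proof -
  have "card D.Gd dvd 56" using D.sgd_dvd[OF D.sgd_all] N by simp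
  then show ?thesis by (rule dvd_imp_le) simp
 qed
 show ?thesis
 proof (cases "card D.Gd = 56")
  case True
  then obtain z where z: "D.gd z" "z \<noteq> one" "mul z z = one" using D.sgd_involution[OF D.sgd_all] by auto
  have "D.centr {one, z}" unfolding D.centr_def using D.sgd_pair[OF z] com N by simp
  then show ?thesis by blast
 next
  case False
  then have "card D.Gd < 56" using le by simp
  moreover have "1 < card D.Gd" using D.type56[OF N] by auto
  ultimately have "D.centr D.Gd" unfolding D.centr_def using D.sgd_all com N by simp
  then show ?thesis by blast
 qed
qed

text \<open>If n x is the rank of the idempotent (one + z) / 2 at x, then x(z) = 2 n x - deg
  x.\<close>

lemma involution_values: assumes z: "D.gd z" "mul z z = one"
 shows "\<exists>t. \<forall>x\<in>IX. dot x z = of_int (t x) \<and> \<bar>t x\<bar> \<le> int (deg x) \<and> even (t x + int (deg x))"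
proof -
 let ?e = "(1/2) *s (one + z)"
 have e: "mul ?e ?e = ?e" by (simp add: mdist z vec.scale_right_distrib vec.scale_left_distrib[symmetric] add_ac)
 have "\<forall>x. x \<in> IX \<longrightarrow> (\<exists>n\<le>deg x. dot x ?e = of_nat n)" using idem_nat[OF e] by blast
 then obtain n where n: "\<And>x. x \<in> IX \<Longrightarrow> n x \<le> deg x" "\<And>x. x \<in> IX \<Longrightarrow> dot x ?e = of_nat (n x)" by metis
 have "dot x z = of_int (2 * int (n x) - int (deg x))" if x: "x \<in> IX" for x
  using n(2)[OF x] deg_char[OF IX_char[OF x]] by (simp add: field_simps)
 moreover have "\<bar>2 * int (n x) - int (deg x)\<bar> \<le> int (deg x)" if x: "x \<in> IX" for x using n(1)[OF x] by linarith
 ultimately show ?thesis by (intro exI[of _ "\<lambda>x. 2 * int (n x) - int (deg x)"]) simp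
qed

context
 fixes z t c
 assumes N: "CARD('n) = 56" and z: "D.gd z" "z \<noteq> one" "mul z z = one"
  and t: "\<And>x. x \<in> IX \<Longrightarrow> dot x z = of_int (t x)" "\<And>x. x \<in> IX \<Longrightarrow> \<bar>t x\<bar> \<le> int (deg x)"
  and c: "int c = (\<Sum>x\<in>IX. t x * t x)"
begin

text \<open>A common eigenvector of the irreducible characters: f Rz = f(z) Rz
  (\<open>cm_Rz\<close>). Hence Rz Rz = c Rz, as \<open>quasi_idem_div\<close> requires.\<close>

definition "Rz = (\<Sum>x\<in>IX. dot x z *s x)"
lemma Sz: "S z = z"
 using D.gd_cancel(1)[OF z(1), of "S z" z] gl_S(2)[OF z(1)] z(3) by simp
lemma of_c: "(\<Sum>x\<in>IX. dot x z * dot x z) = of_nat c"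
proof -
 have "(of_nat c :: 'k) = of_int (\<Sum>x\<in>IX. t x * t x)" using c by (metis of_int_of_nat_eq)
 then show ?thesis by (simp add: t(1))
qed
lemma t_eps: "t eps = 1"
proof -
 have "(of_int (t eps) :: 'k) = of_int 1" using t(1)[OF gd_IX(1)[OF gd_eps]] z by simp
 then show ?thesis by (simp only: of_int_eq_iff)
qed
lemma c_pos: "c > 0"
proof -
 have "t eps * t eps \<le> (\<Sum>x\<in>IX. t x * t x)" by (rule member_le_sum) (use gd_IX[OF gd_eps] in auto)
 then show ?thesis using c t_eps by simp
qed
lemma B_Rz: "y \<in> IX \<Longrightarrow> B Rz y = dot y z"
proof -
 assume y: "y \<in> IX"
 have "B Rz y = (\<Sum>x\<in>IX. if x = y then dot y z else 0)"
  unfolding Rz_def B_lin by (rule sum.cong[OF refl]) (use y in \<open>auto simp: B_IX\<close>)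
 then show ?thesis using y by simp
qed
lemma B_Rz_char: assumes f: "ischar f" shows "B Rz f = dot f z"
proof -
 have "B Rz f = (\<Sum>x\<in>IX. of_nat (mu f x) * B Rz x)" by (subst char_expand[OF f]) (simp add: B_lin)
 then show ?thesis by (simp add: B_Rz char_dot[OF f])
qed
lemma cm_Rz: assumes f: "f \<in> IX" shows "cm f Rz = dot f z *s Rz"
proof (rule IX_eqI)
 have e: "cm f Rz = (\<Sum>x\<in>IX. dot x z *s cm f x)" by (simp add: Rz_def csum cdist)
 have tR: "tracelike Rz" unfolding Rz_def by (intro tracelike_lin IX_trace)
 show "tracelike (cm f Rz)" unfolding e by (intro tracelike_lin ischar_trace cIX f)
 show "tracelike (dot f z *s Rz)" by (intro tracelike_lin tR)
 fix y assume y: "y \<in> IX"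
 have ch: "ischar (cm (adj S f) y)" by (rule cIX[OF adj_IX[OF f] y])
 have "B (cm f Rz) y = B Rz (cm (adj S f) y)" by (rule B_frob)
 also have "\<dots> = dot (adj S f) z * dot y z" unfolding B_Rz_char[OF ch] by (rule gl_cm[OF z(1)])
 also have "dot (adj S f) z = dot f z" by (simp add: dot_adjS Sz)
 finally show "B (cm f Rz) y = B (dot f z *s Rz) y" by (simp add: B_lin B_Rz y)
qed
lemma Rz_Rz: "cm Rz Rz = of_nat c *s Rz"
proof -
 have "cm Rz Rz = (\<Sum>x\<in>IX. dot x z *s cm x Rz)" by (subst Rz_def) (simp add: csum cdist)
 also have "\<dots> = (\<Sum>x\<in>IX. (dot x z * dot x z) *s Rz)" by (rule sum.cong[OF refl]) (simp add: cm_Rz)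
 finally show ?thesis by (simp add: vec.scale_sum_left[symmetric] of_c)
qed
lemma Rz_Lam: "dot Rz Lam = 1"
proof -
 have "dot Rz Lam = (\<Sum>x\<in>IX. if x = eps then dot eps z else 0)"
  unfolding Rz_def dot_sum by (rule sum.cong[OF refl]) (auto simp: IX_Lam)
 then show ?thesis using gd_IX[OF gd_eps] z by simp
qed
lemma c_dvd: "c dvd 56" using quasi_idem_div[OF Rz_Rz Rz_Lam c_pos] N by simp

lemma c56_central: assumes "c = 56" shows "D.centr {one, z}"
proof -
 let ?e = "D.avg {one, z}"
 have sz: "D.sgd {one,z}" "card {one,z} = 2" using D.sgd_pair[OF z] by auto
 have e: "mul ?e ?e = ?e" by (rule D.avg_idem[OF sz(1)])
 have "(\<Sum>x\<in>IX. int (deg x) * int (deg x)) = 56"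
  using sum_deg2 N by (simp add: power2_eq_square flip: of_nat_mult of_nat_sum)
 then have s: "(\<Sum>x\<in>IX. int (deg x) * int (deg x) - t x * t x) = 0" using c assms by (simp add: sum_subtractf)
 have nn: "0 \<le> int (deg x) * int (deg x) - t x * t x" if "x \<in> IX" for x
 proof -
  have "\<bar>t x\<bar> * \<bar>t x\<bar> \<le> int (deg x) * int (deg x)" by (rule mult_mono) (use t(2)[OF that] in auto)
  then show ?thesis by simp
 qed
 have tt: "t x = int (deg x) \<or> t x = - int (deg x)" if "x \<in> IX" for x
 proof -
  have "int (deg x) * int (deg x) - t x * t x = 0"
   by (rule sum_nonneg_0[OF IX_fin _ s that]) (rule nn)
  then have "t x * t x = int (deg x) * int (deg x)" by simp
  then show ?thesis by (simp add: square_eq_iff)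
 qed
 have "dot x ?e = 0 \<or> dot x ?e = of_nat (deg x)" if x: "x \<in> IX" for x
 proof -
  have "dot x ?e = (of_nat (deg x) + of_int (t x)) / 2"
   using z(2) by (simp add: D.avg_def t(1)[OF x] deg_char[OF IX_char[OF x]] dot_sum)
  then show ?thesis using tt[OF x] by auto
 qed
 then show ?thesis unfolding D.centr_def using sz N idem_central[OF e] by simp
qed

text \<open>k = 56 / c is the value of the regular character of the dual at the idempotent Rz / c.
  There z contributes 1, the other grouplike elements 0 and the remaining characters even numbers,
  so k is 1 or 7.\<close>

lemma c_parity: assumes ev: "\<And>y. y \<in> D.IX \<Longrightarrow> \<not> D.gd y \<Longrightarrow> even (D.deg y)"
  and sep: "\<And>g. D.gd g \<Longrightarrow> g \<noteq> one \<Longrightarrow> g \<noteq> z \<Longrightarrow> \<exists>al. gd al \<and> dot al g \<noteq> dot al z"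
 shows "c = 8 \<or> c = 56"
proof -
 obtain k where k: "56 = c * k" using c_dvd unfolding dvd_def by blast
 have c0: "(of_nat c :: 'k) \<noteq> 0" using c_pos by simp
 define e where "e = (1 / of_nat c) *s Rz"
 have ee: "cm e e = e" using c0 by (simp add: e_def cdist Rz_Rz)
 have "dot D.rho e = of_nat k"
 proof -
  have "dot D.rho e = of_nat 56 * (1 / of_nat c)" using Rz_Lam by (simp add: dual_rho N e_def dot_sym[of Lam])
  also have "\<dots> = of_nat k" using c0 unfolding k by simp
  finally show ?thesis .
 qed
 then obtain n where n: "\<And>al j. D.gd al \<Longrightarrow> dot al e = of_nat j \<Longrightarrow> n al = j"
  and s: "k = (\<Sum>y\<in>D.IX - D.Gd. D.deg y * n y) + (\<Sum>y\<in>D.Gd. n y)"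
  by (rule D.idem_ranks[OF ee]) blast
 have eg: "dot g e = (if g = z then 1 else 0)" if g: "D.gd g" for g
 proof -
  consider "g = z" | "g = one" | "g \<noteq> one" "g \<noteq> z" by blast
  then show ?thesis
  proof cases
   case 1
   have "dot z Rz = of_nat c" unfolding dot_sym[of z] Rz_def by (simp add: dot_sum of_c)
   then show ?thesis using 1 c0 by (simp add: e_def)
  next
   \<comment> \<open>At \<open>one\<close> the element Rz evaluates to the regular character at z,
     which vanishes.\<close>
   case 2
   have "dot one Rz = (\<Sum>x\<in>IX. of_nat (deg x) * dot x z)" unfolding dot_sym[of one] Rz_def
    by (simp add: dot_sum deg_char IX_char mult.commute)
   also have "\<dots> = 0" unfolding rho_IX[symmetric] by (rule gl_rho0[OF z(1,2)])
   finally show ?thesis using 2 z(2) by (simp add: e_def)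
  next
   case 3
   then obtain al where a: "gd al" "dot al g \<noteq> dot al z" using sep g by blast
   have "dot al g * dot Rz g = dot (cm al Rz) g" by (simp add: gl_cm[OF g])
   also have "\<dots> = dot al z * dot Rz g" by (simp add: cm_Rz[OF gd_IX(1)[OF a(1)]])
   finally have "dot Rz g = 0" using a(2) by simp
   then show ?thesis using 3 by (simp add: e_def dot_sym[of g])
  qed
 qed
 have "(\<Sum>y\<in>D.Gd. n y) = (\<Sum>y\<in>D.Gd. if y = z then 1 else 0)"
  by (rule sum.cong[OF refl]) (use eg in \<open>auto intro!: n\<close>)
 moreover have "even (\<Sum>y\<in>D.IX - D.Gd. D.deg y * n y)" by (rule dvd_sum) (use ev in auto)
 ultimately have ok: "odd k" using s z(1) D.gd_finite by simp
 have "k dvd 56" unfolding k by (rule dvd_triv_right)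
 then have "k \<in> {1,2,4,7,8,14,28,56}" by (rule dvd56)
 then have "k = 1 \<or> k = 7" using ok by auto
 then show ?thesis using k by auto
qed

end

lemma involution_eight:
 assumes N: "CARD('n) = 56" and z: "D.gd z" "z \<noteq> one" "mul z z = one"
  and ev: "\<And>y. y \<in> D.IX \<Longrightarrow> \<not> D.gd y \<Longrightarrow> even (D.deg y)"
  and sep: "\<And>g. D.gd g \<Longrightarrow> g \<noteq> one \<Longrightarrow> g \<noteq> z \<Longrightarrow> \<exists>al. gd al \<and> dot al g \<noteq> dot al z"
  and nc: "\<not> D.centr {one, z}"
 obtains t where "\<And>x. x \<in> IX \<Longrightarrow> dot x z = of_int (t x)" "\<And>x. x \<in> IX \<Longrightarrow> even (t x + int (deg x))" "(\<Sum>x\<in>IX. t x * t x) = 8"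
proof -
 obtain t where t: "\<forall>x\<in>IX. dot x z = of_int (t x) \<and> \<bar>t x\<bar> \<le> int (deg x) \<and> even (t x + int (deg x))"
  using involution_values[OF z(1,3)] by blast
 then have t1: "\<And>x. x \<in> IX \<Longrightarrow> dot x z = of_int (t x)" and t2: "\<And>x. x \<in> IX \<Longrightarrow> \<bar>t x\<bar> \<le> int (deg x)" by blast+
 define c where "c = nat (\<Sum>x\<in>IX. t x * t x)"
 have c: "int c = (\<Sum>x\<in>IX. t x * t x)" by (simp add: c_def sum_nonneg)
 have "c \<noteq> 56" using c56_central[OF N z t1 t2 c] nc by blast
 then have "c = 8" using c_parity[OF N z t1 t2 c ev sep] by blast
 then show ?thesis using that[of t] t c by simp
qed

text \<open>\<open>ann\<close> and \<open>annD\<close> are the two radicals of the pairing between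
  one-dimensional characters and grouplike elements.\<close>

definition "ann = {al. gd al \<and> (\<forall>g. D.gd g \<longrightarrow> dot al g = 1)}"
definition "annD = {g. D.gd g \<and> (\<forall>al. gd al \<longrightarrow> dot al g = 1)}"

lemma sgd_ann: "sgd ann"
 unfolding sgd_def ann_def using gl_S(3) by (auto simp: gd_eps gd_cm gd_inv gl_cm dot_adjS)
text \<open>The average over all grouplike elements is fixed by translation by \<open>ann\<close>,
  so by \<open>avg_rho\<close> the quotient of 56 by their number is a multiple of the order of
  \<open>ann\<close>.\<close>

lemma ann_dvd: assumes N: "CARD('n) = 56" shows "card ann * card D.Gd dvd 56"
proof -
 let ?e = "D.avg D.Gd"
 have T: "T al ?e = ?e" if "al \<in> ann" for al
 proof (rule dot_eqI)
  fix f
  have "(\<Sum>g\<in>D.Gd. dot (cm al f) g) = (\<Sum>g\<in>D.Gd. dot f g)"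
   by (rule sum.cong[OF refl]) (use that in \<open>auto simp: gl_cm ann_def\<close>)
  then show "dot f (T al ?e) = dot f ?e" by (simp add: dot_T D.avg_def dot_sum)
 qed
 obtain k where "dot rho ?e = of_nat (card ann * k)"
  using avg_rho[OF sgd_ann D.avg_idem[OF D.sgd_all] T] by blast
 then have "(of_nat 56 :: 'k) / of_nat (card D.Gd) = of_nat (card ann * k)" using rho_avg[OF D.sgd_all] N by simp
 moreover have "(of_nat (card D.Gd) :: 'k) \<noteq> 0" using D.sgd_card[OF D.sgd_all] by simp
 ultimately have "(of_nat 56 :: 'k) = of_nat (card ann * k * card D.Gd)" by (simp add: field_simps)
 then have "56 = card ann * k * card D.Gd" by (simp only: of_nat_eq_iff)
 then have "56 = (card ann * card D.Gd) * k" by (simp add: mult_ac)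
 then show ?thesis unfolding dvd_def by blast
qed
lemma sum_char_G: assumes a: "gd al" shows "(\<Sum>g\<in>D.Gd. dot al g) = (if al \<in> ann then of_nat (card D.Gd) else 0)"
proof -
 interpret X: pair cm mul eps one "adj S" Lm m' r' E' p' m r E p by (rule swap)
 have "(\<Sum>g\<in>D.Gd. dot g al) = (if \<forall>g\<in>D.Gd. dot g al = 1 then of_nat (card D.Gd) else 0)"
  by (rule X.sum_char[OF D.sgd_all a])
 then show ?thesis using a by (simp add: ann_def dot_sym[of al])
qed
lemma ann_val: assumes a: "gd al" shows "dot al (D.avg D.Gd) = (if al \<in> ann then 1 else 0)"
proof -
 have "(of_nat (card D.Gd) :: 'k) \<noteq> 0" using D.sgd_card[OF D.sgd_all] by simp
 then show ?thesis using sum_char_G[OF a] by (simp add: D.avg_def dot_sum)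
qed
text \<open>k is the value of rho at the average over the grouplike elements. Characters of even
  degree contribute even numbers, and the one-dimensional ones contribute 1 exactly on
  \<open>ann\<close>.\<close>

lemma ann_parity: assumes N: "CARD('n) = 56" and ev: "\<And>x. x \<in> IX \<Longrightarrow> \<not> gd x \<Longrightarrow> even (deg x)" and k: "56 = card D.Gd * k"
 shows "even k \<longleftrightarrow> even (card ann)"
proof -
 let ?e = "D.avg D.Gd"
 have e: "mul ?e ?e = ?e" by (rule D.avg_idem[OF D.sgd_all])
 have c0: "(of_nat (card D.Gd) :: 'k) \<noteq> 0" using D.sgd_card[OF D.sgd_all] by simp
 have "dot rho ?e = of_nat 56 / of_nat (card D.Gd)" using rho_avg[OF D.sgd_all] N by simp
 also have "\<dots> = of_nat k" using c0 unfolding k by simp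
 finally obtain n where n: "\<And>al j. gd al \<Longrightarrow> dot al ?e = of_nat j \<Longrightarrow> n al = j"
  and s: "k = (\<Sum>x\<in>IX - Gd. deg x * n x) + (\<Sum>x\<in>Gd. n x)"
  by (rule idem_ranks[OF e]) blast
 have "(\<Sum>x\<in>Gd. n x) = (\<Sum>x\<in>Gd. if x \<in> ann then 1 else 0)"
  by (rule sum.cong[OF refl]) (use ann_val in \<open>auto intro!: n\<close>)
 moreover have "(\<Sum>x\<in>Gd. if x \<in> ann then 1 else 0) = card ann"
 proof -
  have "(\<Sum>x\<in>Gd. if x \<in> ann then 1 else 0) = card (Gd \<inter> ann)" using gd_finite by (simp add: sum.If_cases)
  also have "Gd \<inter> ann = ann" by (auto simp: ann_def)
  finally show ?thesis .
 qed
 moreover have "even (\<Sum>x\<in>IX - Gd. deg x * n x)" by (rule dvd_sum) (use ev in auto)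
 ultimately show ?thesis using s by simp
qed

text \<open>The order of \<open>ann\<close> divides 8 and also 56 / 8 = 7 or 56 / 4 = 14; in the
  second case it is even by \<open>ann_parity\<close>.\<close>

lemma ann_card:
 assumes N: "CARD('n) = 56" and ev: "\<And>x. x \<in> IX \<Longrightarrow> \<not> gd x \<Longrightarrow> even (deg x)" and h: "card Gd = 4 \<or> card Gd = 8"
 shows "card D.Gd = 8 \<Longrightarrow> ann = {eps}" "card D.Gd = 4 \<Longrightarrow> card ann = 2"
proof -
 have "card ann dvd card Gd" using lagrange[OF sgd_ann sgd_all] sgd_ann by (simp add: sgd_def)
 then have d8: "card ann dvd 8" using h dvd_trans[of "card ann" 4 8] by auto
 note d = ann_dvd[OF N]
 show "ann = {eps}" if c: "card D.Gd = 8"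
 proof -
  have "card ann * 8 dvd 7 * 8" using d c by simp
  then have "card ann dvd 7" by (subst (asm) dvd_times_right_cancel_iff) auto
  then have "card ann dvd gcd 7 8" using d8 by simp
  then have "card ann = 1" by (simp add: gcd_non_0_nat)
  then obtain w where "ann = {w}" by (auto simp: card_1_singleton_iff)
  then show ?thesis using sgd_ann by (auto simp: sgd_def)
 qed
 show "card ann = 2" if c: "card D.Gd = 4"
 proof -
  have "card ann * 4 dvd 14 * 4" using d c by simp
  then have "card ann dvd 14" by (subst (asm) dvd_times_right_cancel_iff) auto
  then have "card ann dvd gcd 14 8" using d8 by simp
  then have 2: "card ann dvd 2" by (simp add: gcd_non_0_nat)
  then have "card ann \<le> 2" by (rule dvd_imp_le) simp
  moreover have "even (card ann)" using ann_parity[OF N ev, of 14] c by simp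
  ultimately show ?thesis using 2 by (cases "card ann = 0") auto
 qed
qed

lemma nonlinear_ex: assumes N: "CARD('n) = 56" and c: "card Gd < 56" shows "\<exists>x\<in>IX. \<not> gd x"
proof (rule ccontr)
 assume "\<not> ?thesis"
 then have "IX = Gd" using gd_IX by auto
 then have "(\<Sum>x\<in>Gd. (deg x)^2) = 56" using sum_deg2 N by simp
 then show False using c gd_IX by simp
qed

text \<open>If g and z had the same values under all one-dimensional characters, then g z would lie
  in \<open>annD\<close>, since z is its own inverse.\<close>

lemma gl_separated: assumes a: "annD \<subseteq> {one,z}" and z: "D.gd z" "mul z z = one" and za: "annD = {one} \<or> z \<in> annD"
 and g: "D.gd g" "g \<noteq> one" "g \<noteq> z"
 shows "\<exists>al. gd al \<and> dot al g \<noteq> dot al z"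
proof (rule ccontr)
 assume "\<not> ?thesis"
 then have e: "dot al g = dot al z" if "gd al" for al using that by blast
 have "dot al (mul g z) = 1" if "gd al" for al
  using gd_mulg[OF that, of z z] z(2) gd_one[OF that] e[OF that] by (simp add: gd_mulg[OF that])
 then have gz: "mul g z \<in> annD" using D.gd_cm[OF g(1) z(1)] by (simp add: annD_def)
 show False
 proof (cases "annD = {one}")
  case True
  then have "mul g z = mul z z" using gz z by simp
  then show False using D.gd_cancel(2)[OF z(1)] g(3) by blast
 next
  case False
  then have "dot al z = 1" if "gd al" for al using za that by (auto simp: annD_def)
  then have "g \<in> annD" using e g by (simp add: annD_def)
  then show False using a g by blast
 qed
qed

text \<open>Without a central involution the sum for each involution is 8, which the eight
  one-dimensional characters use up, so all others vanish at involutions. For such a xi let P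
  consist of the grouplike elements trivial on its stabiliser. At an involution in P, xi times its
  dual would be 0 and also the order of the stabiliser; so P has odd order, hence is trivial. Then
  xi vanishes at all grouplike elements but \<open>one\<close>, and its rank at their average would
  be deg xi / 8, with deg xi at most 7.\<close>

lemma case88: assumes N: "CARD('n) = 56" and cc: "card Gd = 8" "card D.Gd = 8"
  and ev: "\<And>x. x \<in> IX \<Longrightarrow> \<not> gd x \<Longrightarrow> even (deg x)" and evD: "\<And>y. y \<in> D.IX \<Longrightarrow> \<not> D.gd y \<Longrightarrow> even (D.deg y)"
  and a: "annD = {one}"
 shows "\<exists>P. D.centr P"
proof (rule ccontr)
 assume nc: "\<not> ?thesis"
 have van: "dot x z = 0" if z: "D.gd z" "z \<noteq> one" "mul z z = one" and x: "x \<in> IX" "\<not> gd x" for x z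
 proof -
  have sep: "\<exists>al. gd al \<and> dot al g \<noteq> dot al z" if "D.gd g" "g \<noteq> one" "g \<noteq> z" for g
   by (rule gl_separated[OF _ z(1,3) _ that]) (use a in auto)
  obtain t where t: "\<And>x. x \<in> IX \<Longrightarrow> dot x z = of_int (t x)" "(\<Sum>x\<in>IX. t x * t x) = 8"
   by (rule involution_eight[OF N z evD sep]) (use nc in blast)+
  have "t al * t al = 1" if "gd al" for al
  proof -
   have "dot al z * dot al z = 1" using gd_mulg[OF that, of z z] z(3) gd_one[OF that] by simp
   then have "(of_int (t al * t al) :: 'k) = of_int 1" using t(1)[OF gd_IX(1)[OF that]] by simp
   then show ?thesis by (simp only: of_int_eq_iff)
  qed
  then have "(\<Sum>al\<in>Gd. t al * t al) = 8" using cc by simp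
  then have s0: "(\<Sum>x\<in>IX - Gd. t x * t x) = 0" using t(2) sum_IX_Gd[of "\<lambda>x. t x * t x"] by simp
  have "t x * t x = 0" by (rule sum_nonneg_0[OF _ _ s0]) (use x in auto)
  then show ?thesis using t(1)[OF x(1)] by simp
 qed
 obtain xi where x: "xi \<in> IX" "\<not> gd xi" using nonlinear_ex[OF N] cc by auto
 let ?P = "{g. D.gd g \<and> (\<forall>al\<in>St xi. dot al g = 1)}"
 have sP: "D.sgd ?P"
 proof -
  have "dot al (S g) = 1" if "al \<in> St xi" "D.gd g" "dot al g = 1" for al g
   using gd_mulg[of al "S g" g] gl_S(1)[OF that(2)] gd_one[of al] that by (simp add: St_def)
  then show ?thesis unfolding D.sgd_def
   using gl_S(3) by (auto simp: D.gd_eps D.gd_cm adj_adjS St_def gd_mulg gd_one)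
 qed
 have "odd (card ?P)"
 proof
  assume "even (card ?P)"
  then obtain z where z: "z \<in> ?P" "z \<noteq> one" "mul z z = one" using D.sgd_involution[OF sP] by blast
  then have zg: "D.gd z" by blast
  have ch: "ischar (cm xi (adj S xi))" by (rule cIX[OF x(1) adj_IX[OF x(1)]])
  have "0 = dot (cm xi (adj S xi)) z" using van[OF zg z(2,3) x] by (simp add: gl_cm[OF zg])
  also have "\<dots> = (\<Sum>y\<in>IX. if y \<in> St xi then 1 else 0)"
   unfolding char_dot[OF ch]
  proof (rule sum.cong[OF refl])
   fix y assume y: "y \<in> IX"
   show "of_nat (mu (cm xi (adj S xi)) y) * dot y z = (if y \<in> St xi then 1 else 0)"
   proof (cases "gd y")
    case True
    then show ?thesis using mu_gd_self[OF True x(1)] z(1) by (auto simp: St_def)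
   next
    case False then show ?thesis using van[OF zg z(2,3) y] by (simp add: St_def)
   qed
  qed
  also have "\<dots> = of_nat (card (IX \<inter> St xi))" by (simp add: sum.If_cases)
  also have "IX \<inter> St xi = St xi" using gd_IX by (auto simp: St_def)
  finally show False using sgd_card[OF sgd_St[of xi]] by simp
 qed
 moreover have "card ?P dvd 8" using D.lagrange[OF sP D.sgd_all] cc by auto
 ultimately have "card ?P = 1"
 proof -
  assume o: "odd (card ?P)" and d: "card ?P dvd 8"
  have "coprime (card ?P) (2 ^ 3)" using o by (simp only: coprime_power_right_iff coprime_right_2_iff_odd) blast
  moreover have "card ?P dvd 2 ^ 3" using d by simp
  ultimately have "is_unit (card ?P)" by (rule coprime_common_divisor[OF _ dvd_refl])
  then show "card ?P = 1" by simp
 qed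
 then obtain w where w: "?P = {w}" by (auto simp: card_1_singleton_iff)
 have "one \<in> ?P" using D.gd_eps gd_one by (auto simp: St_def)
 then have P1: "?P = {one}" using w by auto
 have v0: "dot xi g = 0" if g: "D.gd g" "g \<noteq> one" for g
 proof -
  have "g \<notin> ?P" using P1 g by auto
  then obtain al where al: "al \<in> St xi" "dot al g \<noteq> 1" using g by auto
  then have "dot xi g = dot al g * dot xi g" using gl_cm[OF g(1), of al xi] by (simp add: St_def)
  then show ?thesis using al(2) by simp
 qed
 have "(\<Sum>g\<in>D.Gd. dot xi g) = (\<Sum>g\<in>D.Gd. if g = one then of_nat (deg xi) else 0)"
  by (rule sum.cong[OF refl]) (use v0 deg_char[OF IX_char[OF x(1)]] in auto)
 also have "\<dots> = of_nat (deg xi)" using D.gd_finite D.gd_eps by simp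
 finally have "dot xi (D.avg D.Gd) = of_nat (deg xi) / 8" using cc by (simp add: D.avg_def dot_sum)
 moreover obtain n where "dot xi (D.avg D.Gd) = of_nat n" using idem_nat[OF D.avg_idem[OF D.sgd_all] x(1)] by blast
 ultimately have "(of_nat (deg xi) :: 'k) = of_nat (8 * n)" by (simp add: field_simps)
 then have "deg xi = 8 * n" by (simp only: of_nat_eq_iff)
 moreover have "deg xi \<le> 7" "deg xi > 0" using deg_le7[OF N x(1)] IX_deg[OF x(1)] by auto
 ultimately show False by (cases n) auto
qed

text \<open>The configuration forced by \<open>special_ex\<close> when no central group exists: the
  involution z of the radical is seen by a single nonlinear character xi.\<close>

definition special :: "'k^'n \<Rightarrow> 'k^'n \<Rightarrow> bool" where
 "special xi z \<longleftrightarrow> xi \<in> IX \<and> \<not> gd xi \<and> deg xi = 2 \<and> D.gd z \<and> z \<noteq> one \<and> mul z z = one \<and> annD = {one, z} \<and> dot xi z = -2 \<and>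
   (\<forall>x\<in>IX. \<not> gd x \<longrightarrow> x \<noteq> xi \<longrightarrow> dot x z = 0) \<and> cm xi xi = \<Sum>Gd \<and>
   (\<forall>g. D.gd g \<longrightarrow> g \<noteq> one \<longrightarrow> g \<noteq> z \<longrightarrow> dot xi g = 0) \<and> (\<forall>al. gd al \<longrightarrow> cm al xi = xi) \<and> adj S xi = xi"

text \<open>The four one-dimensional characters contribute 4 to the sum 8. The rest consists of
  squares of even numbers, so exactly one xi has a nonzero value +-2 at z. Since rho vanishes at z,
  deg xi times this value is -4. Being unique, xi is invariant under translation and
  duality.\<close>

lemma special_ex:
 assumes N: "CARD('n) = 56" and c4: "card Gd = 4" and cD: "card annD = 2"
  and ev: "\<And>x. x \<in> IX \<Longrightarrow> \<not> gd x \<Longrightarrow> even (deg x)" and evD: "\<And>y. y \<in> D.IX \<Longrightarrow> \<not> D.gd y \<Longrightarrow> even (D.deg y)"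
  and nc: "\<not> (\<exists>P. D.centr P)"
 shows "\<exists>xi z. special xi z"
proof -
 interpret X: pair cm mul eps one "adj S" Lm m' r' E' p' m r E p by (rule swap)
 have an: "X.ann = annD" by (auto simp: X.ann_def annD_def dot_sym)
 have sA: "D.sgd annD" using X.sgd_ann unfolding an .
 obtain z where z: "z \<in> annD" "z \<noteq> one" "mul z z = one" using D.sgd_involution[OF sA] cD by auto
 have zg: "D.gd z" using z by (simp add: annD_def)
 have z1: "dot al z = 1" if "gd al" for al using z that by (simp add: annD_def)
 have "one \<in> annD" using sA by (simp add: D.sgd_def)
 then have aeq: "annD = {one, z}" using cD z
  by (metis D.sgd_pair(2) card_subset_eq empty_subsetI insert_subset sA D.sgd_finite zg)
 have sep: "\<exists>al. gd al \<and> dot al g \<noteq> dot al z" if "D.gd g" "g \<noteq> one" "g \<noteq> z" for g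
  by (rule gl_separated[OF _ zg z(3) _ that]) (use aeq in auto)
 obtain t where t: "\<And>x. x \<in> IX \<Longrightarrow> dot x z = of_int (t x)" "\<And>x. x \<in> IX \<Longrightarrow> even (t x + int (deg x))" "(\<Sum>x\<in>IX. t x * t x) = 8"
  by (rule involution_eight[OF N zg z(2,3) evD sep]) (use nc in blast)+
 have tg: "t al = 1" if "gd al" for al
 proof -
  have "(of_int (t al) :: 'k) = of_int 1" using t(1)[OF gd_IX(1)[OF that]] z1[OF that] by simp
  then show ?thesis by (simp only: of_int_eq_iff)
 qed
 have s4: "(\<Sum>x\<in>IX - Gd. t x * t x) = 4" using sum_IX_Gd[of "\<lambda>x. t x * t x"] t(3) tg c4 by simp
 have "\<forall>x\<in>IX - Gd. \<exists>s. t x = 2 * s" using t(2) ev by auto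
 then obtain s where s: "\<And>x. x \<in> IX - Gd \<Longrightarrow> t x = 2 * s x" by metis
 have s1: "(\<Sum>x\<in>IX - Gd. s x * s x) = 1"
 proof -
  have "(\<Sum>x\<in>IX - Gd. t x * t x) = (\<Sum>x\<in>IX - Gd. 4 * (s x * s x))" by (rule sum.cong[OF refl]) (simp add: s)
  then show ?thesis using s4 by (simp add: sum_distrib_left[symmetric])
 qed
 have "\<exists>xi\<in>IX - Gd. s xi \<noteq> 0"
 proof (rule ccontr)
  assume "\<not> ?thesis"
  then have "(\<Sum>x\<in>IX - Gd. s x * s x) = 0" by (intro sum.neutral) auto
  then show False using s1 by simp
 qed
 then obtain xi where x: "xi \<in> IX - Gd" "s xi \<noteq> 0" by blast
 have r: "(\<Sum>x\<in>IX - Gd. s x * s x) = s xi * s xi + (\<Sum>x\<in>IX - Gd - {xi}. s x * s x)"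
  by (rule sum.remove) (use x in auto)
 have "s xi * s xi \<ge> 1" using x(2) by (metis linorder_not_le mult_eq_0_iff not_square_less_zero int_one_le_iff_zero_less less_le)
 moreover have "(\<Sum>x\<in>IX - Gd - {xi}. s x * s x) \<ge> 0" by (rule sum_nonneg) simp
 ultimately have r0: "(\<Sum>x\<in>IX - Gd - {xi}. s x * s x) = 0" "s xi * s xi = 1" using r s1 by linarith+
 have s0: "s y = 0" if "y \<in> IX - Gd" "y \<noteq> xi" for y
 proof -
  have "s y * s y = 0" by (rule sum_nonneg_0[OF _ _ r0(1)]) (use that in auto)
  then show ?thesis by simp
 qed
 have van: "dot y z = 0" if "y \<in> IX" "\<not> gd y" "y \<noteq> xi" for y
  using t(1)[OF that(1)] s0[of y] s[of y] that by simp
 have xI: "xi \<in> IX" "\<not> gd xi" using x by auto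
 have xz: "dot xi z \<noteq> 0" using t(1)[OF xI(1)] s[OF x(1)] x(2) by simp
 have "(\<Sum>x\<in>IX. of_nat (deg x) * dot x z) = 0" using gl_rho0[OF zg z(2)] by (simp add: rho_IX)
 then have "(of_int (\<Sum>x\<in>IX. int (deg x) * t x) :: 'k) = of_int 0" by (simp add: t(1))
 then have "(\<Sum>x\<in>IX. int (deg x) * t x) = 0" by (simp only: of_int_eq_iff)
 moreover have "(\<Sum>x\<in>IX - Gd. int (deg x) * t x) = int (deg xi) * t xi + (\<Sum>x\<in>IX - Gd - {xi}. int (deg x) * t x)"
  by (rule sum.remove) (use x in auto)
 moreover have "(\<Sum>x\<in>IX - Gd - {xi}. int (deg x) * t x) = 0"
  by (rule sum.neutral) (use s s0 in auto)
 ultimately have "int (deg xi) * t xi + 4 = 0" using sum_IX_Gd[of "\<lambda>x. int (deg x) * t x"] tg gd_IX(2) c4 by simp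
 then have ds: "int (deg xi) * s xi = -2" using s[OF x(1)] by simp
 have "s xi = 1 \<or> s xi = -1" using r0(2) by (metis abs_mult_self_eq abs_1 abs_eq_iff' zmult_eq_1_iff)
 then have sm: "s xi = -1" "deg xi = 2" using ds by auto
 have xm: "dot xi z = -2" using t(1)[OF xI(1)] s[OF x(1)] sm by simp
 have u: "y = xi" if "y \<in> IX" "\<not> gd y" "dot y z \<noteq> 0" for y using van that by blast
 have Sz: "S z = z" using D.gd_cancel(1)[OF zg, of "S z" z] gl_S(2)[OF zg] z(3) by simp
 have ac: "cm al xi = xi" if a: "gd al" for al
 proof (rule u)
  show "cm al xi \<in> IX" by (rule gd_act(1)[OF a xI(1)])
  show "\<not> gd (cm al xi)" using gd_act(2)[OF a xI(1)] gd_IX(2)[of "cm al xi"] sm by auto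
  show "dot (cm al xi) z \<noteq> 0" by (simp add: gl_cm[OF zg] z1[OF a] xm)
 qed
 have ad: "adj S xi = xi"
 proof (rule u)
  show "adj S xi \<in> IX" by (rule adj_IX[OF xI(1)])
  show "\<not> gd (adj S xi)" using aIX[OF xI(1)] gd_IX(2)[of "adj S xi"] sm by auto
  show "dot (adj S xi) z \<noteq> 0" by (simp add: dot_adjS Sz xm)
 qed
 have xx: "cm xi xi = \<Sum>Gd"
 proof -
  let ?f = "cm xi xi"
  have ch: "ischar ?f" by (rule cIX[OF xI(1) xI(1)])
  have mg: "mu ?f al = 1" if "gd al" for al using mu_gd_self[OF that xI(1)] ac[OF that] by (simp add: ad)
  have "deg ?f = (\<Sum>y\<in>IX - Gd. mu ?f y * deg y) + (\<Sum>y\<in>Gd. mu ?f y * deg y)"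
   unfolding deg_expand[OF ch] by (rule sum_IX_Gd)
  moreover have "(\<Sum>y\<in>Gd. mu ?f y * deg y) = 4" using mg gd_IX(2) c4 by simp
  moreover have "deg ?f = 4" using dIX[OF xI(1) xI(1)] sm by simp
  ultimately have z0: "(\<Sum>y\<in>IX - Gd. mu ?f y * deg y) = 0" by simp
  have m0: "mu ?f y = 0" if "y \<in> IX - Gd" for y
  proof -
   have "mu ?f y * deg y = 0" using z0 that by simp
   then show ?thesis using IX_deg[of y] that by simp
  qed
  have "?f = (\<Sum>y\<in>IX - Gd. of_nat (mu ?f y) *s y) + (\<Sum>y\<in>Gd. of_nat (mu ?f y) *s y)"
   by (subst (1) char_expand[OF ch], rule sum_IX_Gd)
  also have "(\<Sum>y\<in>IX - Gd. of_nat (mu ?f y) *s y) = 0" by (rule sum.neutral) (use m0 in auto)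
  also have "(\<Sum>y\<in>Gd. of_nat (mu ?f y) *s y) = \<Sum>Gd" by (rule sum.cong[OF refl]) (simp add: mg)
  finally show ?thesis by simp
 qed
 have v0: "dot xi g = 0" if g: "D.gd g" "g \<noteq> one" "g \<noteq> z" for g
 proof -
  have "g \<notin> annD" using aeq g by auto
  then have n: "\<not> (\<forall>al\<in>Gd. dot al g = 1)" using g by (simp add: annD_def)
  have "dot xi g * dot xi g = (\<Sum>al\<in>Gd. dot al g)" using xx gl_cm[OF g(1), of xi xi] by (simp add: dot_sum)
  also have "\<dots> = 0" unfolding sum_char[OF sgd_all g(1)] using n by (simp only: if_False)
  finally show ?thesis by simp
 qed
 have "special xi z"
  unfolding special_def using xI sm zg z aeq xm van xx v0 ac ad by blast
 then show ?thesis by blast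
qed

text \<open>Both remaining cases exhibit an idempotent \<open>L\<close> on which the regular character takes the value 7.\<close>

lemma special_contradiction:
 assumes N: "CARD('n) = 56" and ev: "\<And>x. x \<in> IX \<Longrightarrow> \<not> gd x \<Longrightarrow> even (deg x)" and sp: "special xi z"
  and L: "mul L L = L" "dot rho L = 7" "dot eps L = 1" "\<And>al. gd al \<Longrightarrow> al \<noteq> eps \<Longrightarrow> dot al L = 0"
  and v: "\<And>x. x \<in> IX \<Longrightarrow> 8 * dot (cm xi x) L = 2 * of_nat (deg x) - 2 * dot x z"
 shows False
proof -
 have x: "xi \<in> IX" "\<not> gd xi" "deg xi = 2" and zg: "D.gd z" and van: "\<And>x. x \<in> IX \<Longrightarrow> \<not> gd x \<Longrightarrow> x \<noteq> xi \<Longrightarrow> dot x z = 0"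
  using sp unfolding special_def by blast+
 obtain n where n: "\<And>x. x \<in> IX \<Longrightarrow> dot x L = of_nat (n x)" "\<And>al j. gd al \<Longrightarrow> dot al L = of_nat j \<Longrightarrow> n al = j"
  and s: "7 = (\<Sum>x\<in>IX - Gd. deg x * n x) + (\<Sum>x\<in>Gd. n x)"
  by (rule idem_ranks[OF L(1), of 7]) (use L(2) in \<open>simp, blast\<close>)
 have "8 * dot xi L = 0" using v[OF gd_IX(1)[OF gd_eps]] gd_IX(2)[OF gd_eps] zg by simp
 then have nx: "n xi = 0" using n(1)[OF x(1)] by simp
 \<comment> \<open>For y other than xi and nonlinear, y(z) = 0, so 8 k = 2 deg y with k the natural
   number (xi y)(L). Thus 4 divides deg y, and rho(L) = 7 would be 1 plus a multiple of 4.\<close>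
 have d4: "4 dvd deg y * n y" if y: "y \<in> IX - Gd" for y
 proof (cases "y = xi")
  case False
  obtain k where k: "dot (cm xi y) L = of_nat k" using ischar_idem[OF cIX[OF x(1)] L(1)] y by blast
  have "8 * of_nat k = 2 * (of_nat (deg y) :: 'k)" using v[of y] k van[of y] y False by simp
  then have "(of_nat (8 * k) :: 'k) = of_nat (2 * deg y)" by simp
  then have "8 * k = 2 * deg y" by (simp only: of_nat_eq_iff)
  then have "deg y = 4 * k" by simp
  then show ?thesis by simp
 qed (simp add: nx)
 have "(\<Sum>x\<in>Gd. n x) = (\<Sum>x\<in>Gd. if x = eps then 1 else 0)"
  by (rule sum.cong[OF refl]) (use L in \<open>auto intro!: n\<close>)
 moreover have "4 dvd (\<Sum>x\<in>IX - Gd. deg x * n x)" by (rule dvd_sum) (rule d4)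
 ultimately have "4 dvd (6::nat)" using s gd_finite gd_eps by simp
 then show False by simp
qed

lemma sum_special: assumes sp: "special xi z" and x: "x \<in> IX"
 shows "(\<Sum>g\<in>D.Gd. dot (cm xi x) g) = 2 * of_nat (deg x) - 2 * dot x z"
proof -
 have z: "D.gd z" "z \<noteq> one" "dot xi z = -2" and v0: "\<And>g. D.gd g \<Longrightarrow> g \<noteq> one \<Longrightarrow> g \<noteq> z \<Longrightarrow> dot xi g = 0" and d: "deg xi = 2" "xi \<in> IX"
  using sp unfolding special_def by blast+
 have "(\<Sum>g\<in>D.Gd. dot (cm xi x) g) = (\<Sum>g\<in>{one,z}. dot (cm xi x) g)"
  by (rule sum.mono_neutral_right) (use z v0 D.gd_eps D.gd_finite in \<open>auto simp: gl_cm\<close>)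
 also have "\<dots> = 2 * of_nat (deg x) - 2 * dot x z"
  using z(2) by (simp add: gl_cm[OF z(1)] gl_cm[OF D.gd_eps] z(3) deg_char[OF IX_char[OF x]] deg_char[OF IX_char[OF d(2)]] d(1))
 finally show ?thesis .
qed

text \<open>L is the average over the eight grouplike elements, for which rho(L) = 56 / 8.\<close>

lemma case84: assumes N: "CARD('n) = 56" and cc: "card Gd = 4" "card D.Gd = 8" and a: "ann = {eps}" "card annD = 2"
  and ev: "\<And>x. x \<in> IX \<Longrightarrow> \<not> gd x \<Longrightarrow> even (deg x)" and evD: "\<And>y. y \<in> D.IX \<Longrightarrow> \<not> D.gd y \<Longrightarrow> even (D.deg y)"
 shows "\<exists>P. D.centr P"
proof (rule ccontr)
 assume nc: "\<not> ?thesis"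
 obtain xi z where sp: "special xi z" using special_ex[OF N cc(1) a(2) ev evD nc] by blast
 show False
 proof (rule special_contradiction[OF N ev sp])
  show "mul (D.avg D.Gd) (D.avg D.Gd) = D.avg D.Gd" by (rule D.avg_idem[OF D.sgd_all])
  show "dot rho (D.avg D.Gd) = 7" using rho_avg[OF D.sgd_all] N cc by simp
  show "dot eps (D.avg D.Gd) = 1" by (rule eps_avg[OF D.sgd_all])
  show "dot al (D.avg D.Gd) = 0" if "gd al" "al \<noteq> eps" for al using ann_val[OF that(1)] a that by simp
  show "8 * dot (cm xi x) (D.avg D.Gd) = 2 * of_nat (deg x) - 2 * dot x z" if "x \<in> IX" for x
   using sum_special[OF sp that] cc by (simp add: D.avg_def dot_sum)
 qed
qed

text \<open>The average over four grouplike elements has rho = 14, twice too much. With G their sum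
  and psi the special character of the dual, L = (G + 2 psi) / 8 is idempotent because psi psi = G
  and g psi = psi = psi g; and rho(L) = 56 / 8.\<close>

lemma case44: assumes N: "CARD('n) = 56" and cc: "card Gd = 4" "card D.Gd = 4" and a: "card ann = 2" "card annD = 2"
  and ev: "\<And>x. x \<in> IX \<Longrightarrow> \<not> gd x \<Longrightarrow> even (deg x)" and evD: "\<And>y. y \<in> D.IX \<Longrightarrow> \<not> D.gd y \<Longrightarrow> even (D.deg y)"
 shows "(\<exists>P. D.centr P) \<or> (\<exists>P. centr P)"
proof (rule ccontr)
 assume "\<not> ?thesis"
 then have nc: "\<not> (\<exists>P. D.centr P)" "\<not> (\<exists>P. centr P)" by blast+
 interpret X: pair cm mul eps one "adj S" Lm m' r' E' p' m r E p by (rule swap)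
 have an: "X.annD = ann" by (auto simp: X.annD_def ann_def dot_sym)
 obtain xi z where sp: "special xi z" using special_ex[OF N cc(1) a(2) ev evD nc(1)] by blast
 have "\<not> (\<exists>P. X.D.centr P)" using nc(2) by (simp add: adj_adjS)
 then obtain psi \<zeta> where sq: "X.special psi \<zeta>" using X.special_ex[OF N cc(2) _ evD ev] a an by auto
 have q: "psi \<in> D.IX" "\<not> D.gd psi" "D.deg psi = 2" "gd \<zeta>" "\<zeta> \<noteq> eps" "cm \<zeta> \<zeta> = eps" "ann = {eps, \<zeta>}" "dot psi \<zeta> = -2"
  "mul psi psi = \<Sum>D.Gd" and qv: "\<And>al. gd al \<Longrightarrow> al \<noteq> eps \<Longrightarrow> al \<noteq> \<zeta> \<Longrightarrow> dot psi al = 0"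
  and qa: "\<And>g. D.gd g \<Longrightarrow> mul g psi = psi" and qs: "S psi = psi"
  using sq unfolding X.special_def an by (simp_all add: adj_adjS)
 have qa': "mul psi g = psi" if "D.gd g" for g
 proof -
  have "S (mul (S g) psi) = S psi" using qa[OF gl_S(3)[OF that]] by simp
  then show ?thesis by (simp add: S_mul qs)
 qed
 \<comment> \<open>psi(zeta) = -2 = -deg psi, so (eps - zeta) / 2 is the identity in the block of
   psi and zeta acts there as -1. As zeta fixes xi, psi vanishes on all products xi f.\<close>
 have half: "dot psi (cm \<zeta> f) = - dot psi f" for f
 proof -
  let ?q = "(1/2) *s (eps - \<zeta>)"
  have qq: "cm ?q ?q = ?q" by (simp add: cdist q vec.scale_right_diff_distrib) (simp add: vec_eq_iff)
  have "dot psi eps = 2" using D.deg_char[OF D.IX_char[OF q(1)]] q(3) by simp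
  then have "dot psi ?q = of_nat (D.deg psi)" by (simp add: q)
  from D.full_mul[OF qq q(1) this, of f] have "dot psi f - dot psi (cm \<zeta> f) = 2 * dot psi f" by (simp add: cdist)
  then have "- dot psi (cm \<zeta> f) = dot psi f" by simp
  then show ?thesis by (metis minus_minus)
 qed
 have psi0: "dot (cm xi f) psi = 0" for f
 proof -
  have "cm \<zeta> xi = xi" using sp q(4) unfolding special_def by blast
  then have "dot psi (cm xi f) = - dot psi (cm xi f)" using half[of "cm xi f"] by (simp add: cm_assoc[symmetric])
  then show ?thesis by (simp add: dot_sym[of _ psi])
 qed
 let ?G = "\<Sum>D.Gd"
 define L where "L = (1/8) *s (?G + 2 *s psi)"
 have LL: "mul L L = L"
 proof -
  have g1: "mul ?G ?G = 4 *s ?G" using D.sum_sgd_idem[OF D.sgd_all] cc by simp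
  have "mul ?G psi = (\<Sum>g\<in>D.Gd. psi)" unfolding msum by (rule sum.cong[OF refl]) (simp add: qa)
  then have g2: "mul ?G psi = 4 *s psi" using cc by (simp add: sum_const_vec del: sum_constant)
  have "mul psi ?G = (\<Sum>g\<in>D.Gd. psi)" unfolding msum by (rule sum.cong[OF refl]) (simp add: qa')
  then have g3: "mul psi ?G = 4 *s psi" using cc by (simp add: sum_const_vec del: sum_constant)
  show ?thesis unfolding L_def by (simp add: mdist g1 g2 g3 q(9)) (simp add: vec_eq_iff field_simps)
 qed
 have rG: "(\<Sum>g\<in>D.Gd. dot rho g) = 56"
 proof -
  have "(\<Sum>g\<in>D.Gd. dot rho g) = (\<Sum>g\<in>D.Gd. if g = one then 56 else 0)"
   by (rule sum.cong[OF refl]) (use gl_rho0 N in auto)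
  then show ?thesis using D.gd_finite D.gd_eps by simp
 qed
 have "dot rho psi = 0"
 proof -
  have "psi \<noteq> one" using q(2) D.gd_eps by auto
  then have "dot psi Lm = 0" using D.IX_Lam[OF q(1)] by simp
  then show ?thesis by (simp add: Lm_def dot_sym[of rho])
 qed
 then have rL: "dot rho L = 7" by (simp add: L_def dot_sum rG)
 have dp: "dot psi eps = 2" using D.deg_char[OF D.IX_char[OF q(1)]] q(3) by simp
 have lin: "dot al L = (if al = eps then 1 else 0)" if a': "gd al" for al
 proof -
  have "dot al L = (1/8) * ((\<Sum>g\<in>D.Gd. dot al g) + 2 * dot psi al)" by (simp add: L_def dot_sum dot_sym[of psi])
  also have "\<dots> = (1/8) * ((if al \<in> ann then 4 else 0) + 2 * dot psi al)" unfolding sum_char_G[OF a'] by (simp add: cc)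
  also have "\<dots> = (if al = eps then 1 else 0)" using qv[OF a'] q(5,7,8) dp by auto
  finally show ?thesis .
 qed
 show False
 proof (rule special_contradiction[OF N ev sp LL rL])
  show "dot eps L = 1" using lin[OF gd_eps] by simp
  show "dot al L = 0" if "gd al" "al \<noteq> eps" for al using lin that by simp
  show "8 * dot (cm xi x) L = 2 * of_nat (deg x) - 2 * dot x z" if "x \<in> IX" for x
   using sum_special[OF sp that] psi0[of x] by (simp add: L_def dot_sum)
 qed
qed

theorem central_subgroup: assumes N: "CARD('n) = 56" shows "(\<exists>P. centr P) \<or> (\<exists>P. D.centr P)"
proof -
 interpret X: pair cm mul eps one "adj S" Lm m' r' E' p' m r E p by (rule swap)
 have an: "X.ann = annD" "X.annD = ann" by (auto simp: X.ann_def X.annD_def ann_def annD_def dot_sym)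
 have Xc: "X.D.centr = centr" by (simp add: adj_adjS)
 note tH = type56[OF N] and tD = D.type56[OF N]
 show ?thesis
 proof (cases "card Gd = 28 \<or> card Gd = 56 \<or> card Gd = 7 \<or> card D.Gd = 28 \<or> card D.Gd = 56 \<or> card D.Gd = 7")
  case True
  then consider "card Gd = 28" | "card Gd = 56" | "card Gd = 7" | "card D.Gd = 28" | "card D.Gd = 56" | "card D.Gd = 7" by blast
  then show ?thesis
  proof cases
   case 1 then show ?thesis using X.case28[OF N] Xc by auto
  next
   case 2 then show ?thesis using case56[OF N] by blast
  next
   case 3
   then obtain v where v: "deg v = 7" "IX = insert v Gd" using tH by auto
   then have "centr Gd" unfolding centr_def using seven_central[OF N 3 v] sgd_all 3 N by simp
   then show ?thesis by blast
  next
   case 4 then show ?thesis using case28[OF N] by blast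
  next
   case 5 then show ?thesis using X.case56[OF N] Xc by auto
  next
   case 6
   then obtain v where v: "D.deg v = 7" "D.IX = insert v D.Gd" using tD by auto
   then have "D.centr D.Gd" unfolding D.centr_def using D.seven_central[OF N 6 v] D.sgd_all 6 N by simp
   then show ?thesis by blast
  qed
 next
  case False
  have ev: "even (deg x)" if "x \<in> IX" "\<not> gd x" for x using tH False that by auto
  have evD: "even (D.deg x)" if "x \<in> D.IX" "\<not> D.gd x" for x using tD False that by auto
  have h: "card Gd = 4 \<or> card Gd = 8" "card D.Gd = 4 \<or> card D.Gd = 8" using tH tD False by auto
  have A: "card D.Gd = 8 \<Longrightarrow> ann = {eps}" "card D.Gd = 4 \<Longrightarrow> card ann = 2"
   "card Gd = 8 \<Longrightarrow> annD = {one}" "card Gd = 4 \<Longrightarrow> card annD = 2"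
   using ann_card[OF N ev h(1)] X.ann_card[OF N evD] h(2) unfolding an by blast+
  from h consider "card Gd = 8" "card D.Gd = 8" | "card Gd = 4" "card D.Gd = 8" | "card Gd = 8" "card D.Gd = 4" | "card Gd = 4" "card D.Gd = 4" by blast
  then show ?thesis
  proof cases
   case 1 then show ?thesis using case88[OF N 1 ev evD A(3)[OF 1(1)]] by blast
  next
   case 2 then show ?thesis using case84[OF N 2 A(1)[OF 2(2)] A(4)[OF 2(1)] ev evD] by blast
  next
   case 3
   have "\<exists>P. X.D.centr P" by (rule X.case84[OF N 3(2,1)]) (use A(2,3) 3 an evD ev in auto)
   then show ?thesis using Xc by auto
  next
   case 4 then show ?thesis using case44[OF N 4 A(2)[OF 4(2)] A(4)[OF 4(1)] ev evD] by blast
  qed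
 qed
qed

end

section \<open>Coordinates of an abstract Hopf algebra\<close>

lemma additive_sum: assumes "\<And>x y. L (x + y) = L x + (L y :: 'b::ab_group_add)" shows "L (\<Sum>i\<in>A. g i) = (\<Sum>i\<in>A. L (g i :: 'c::ab_group_add))"
proof -
 have "L 0 + L 0 = L 0" using assms[of 0 0] by simp
 then have z: "L 0 = 0" by simp
 show ?thesis by (induction A rule: infinite_finite_induct) (simp_all add: assms z)
qed

lemma lin_ext_comp:
 assumes "\<And>x y. L (x + y) = L x + L y" "\<And>c x. L (s c x) = s' c (L x)"
 shows "L (lin_ext s f t) = lin_ext s' (\<lambda>b. L (f b)) t"
 unfolding lin_ext_def additive_sum[of L, OF assms(1)] assms(2) ..

abbreviation "sing \<equiv> Poly_Mapping.single"
abbreviation klin :: "('b \<Rightarrow> 'k::field) \<Rightarrow> ('b \<Rightarrow>\<^sub>0 'k) \<Rightarrow> 'k" where "klin \<equiv> lin_ext (*)"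

lemma klin_linear: "klin G (t + u) = klin G t + klin G u" "klin G (free_scale c t) = c * klin G t" "klin G (t - u) = klin G t - klin G u"
proof -
 interpret L: Vector_Spaces.linear free_scale "(*)" "klin G" by (rule vector_space.linear_lin_ext[OF vector_space_over_itself.vector_space_axioms])
 show "klin G (t + u) = klin G t + klin G u" "klin G (free_scale c t) = c * klin G t" "klin G (t - u) = klin G t - klin G u"
  by (rule L.add L.scale L.diff)+
qed
lemma klin_comp: "klin G (lin_ext free_scale f t) = klin (\<lambda>b. klin G (f b)) t"
 by (rule lin_ext_comp) (rule klin_linear)+
lemma klin_single [simp]: "klin G (sing b c) = c * G b"
 by (rule vector_space.lin_ext_single[OF vector_space_over_itself.vector_space_axioms])
lemma klin_fun: "klin (\<lambda>b. F b + G b) t = klin F t + klin G t" "klin (\<lambda>b. c * F b) t = c * klin F t" "klin (\<lambda>b. F b * c) t = klin F t * c"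
 "klin (\<lambda>b. \<Sum>i\<in>I. H i b) t = (\<Sum>i\<in>I. klin (H i) t)"
 by (simp_all add: lin_ext_def sum.distrib distrib_left sum_distrib_left sum_distrib_right mult_ac sum.swap[of _ I])
lemma klin_cong3:
 fixes f :: "'v::ab_group_add \<times> 'v \<times> 'v \<Rightarrow> 'k::field"
 assumes "\<And>x x' y z. f (x + x', y, z) = f (x, y, z) + f (x', y, z)" "\<And>x y y' z. f (x, y + y', z) = f (x, y, z) + f (x, y', z)"
  "\<And>x y z z'. f (x, y, z + z') = f (x, y, z) + f (x, y, z')"
  and "\<And>c x y z. f (s c x, y, z) = c * f (x, y, z)" "\<And>c x y z. f (x, s c y, z) = c * f (x, y, z)" "\<And>c x y z. f (x, y, s c z) = c * f (x, y, z)"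
  and eq: "tensor3_eq s t u"
 shows "klin f t = klin f u"
proof -
 interpret L: Vector_Spaces.linear free_scale "(*)" "klin f" by (rule vector_space.linear_lin_ext[OF vector_space_over_itself.vector_space_axioms])
 have "klin f d = 0" if "d \<in> tensor3_null s" for d
  using that unfolding tensor3_null_def
  by (rule L.eq_0_on_span[rotated]) (auto simp: L.diff assms)
 with eq have "klin f (t - u) = 0" by (simp add: tensor3_eq_def)
 then show ?thesis by (simp add: L.diff)
qed

locale coordinates = hopf_algebra scale comult counit antipode
 for scale :: "'k::field \<Rightarrow> 'h::ring_1 \<Rightarrow> 'h" and comult counit antipode +
 fixes J :: "'k^'n::finite \<Rightarrow> 'h" and K :: "'h \<Rightarrow> 'k^'n"
 assumes J_add: "J (x + y) = J x + J y" and J_scale: "J (c *s x) = scale c (J x)"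
  and KJ [simp]: "K (J x) = x" and JK [simp]: "J (K h) = h"
begin

abbreviation "teq \<equiv> tensor2_eq scale"

lemma K_add: "K (a + b) = K a + K b" by (metis J_add KJ JK)
lemma K_scale: "K (scale c a) = c *s K a" by (metis J_scale KJ JK)
lemma J_sum: "J (\<Sum>i\<in>I. x i) = (\<Sum>i\<in>I. J (x i))" by (rule additive_sum) (rule J_add)
lemma antip: "antipode (a + b) = antipode a + antipode b" "antipode (scale c a) = scale c (antipode a)"
proof -
 interpret Vector_Spaces.linear scale scale antipode by (rule antipode_linear)
 show "antipode (a + b) = antipode a + antipode b" "antipode (scale c a) = scale c (antipode a)" by (rule add scale)+
qed
lemma counit: "counit (a + b) = counit a + counit b" "counit (scale c a) = c * counit a"
proof -
 interpret Vector_Spaces.linear scale "(*)" counit by (rule counit_linear)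
 show "counit (a + b) = counit a + counit b" "counit (scale c a) = c * counit a" by (rule add scale)+
qed

definition "mulV x y = K (J x * J y)"
definition "oneV = K 1"
definition "SV x = K (antipode (J x))"
definition "epsV = repf (\<lambda>x. counit (J x))"
text \<open>Evaluated on a representative; for bilinear F only the class of the tensor matters
  (\<open>Sw_cong\<close>).\<close>

definition "Sw F h = klin (\<lambda>(a,b). F (K a) (K b)) (comult h)"
definition "cmV f g = repf (\<lambda>x. Sw (\<lambda>a b. dot f a * dot g b) (J x))"

lemma Sw_cong: assumes F: "blin F" and eq: "teq t u"
 shows "klin (\<lambda>(a,b). F (K a) (K b)) t = klin (\<lambda>(a,b). F (K a) (K b)) u"
 by (rule vector_space.lin_ext_cong[OF vector_space_over_itself.vector_space_axioms _ _ _ _ eq])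
  (use linfD[OF blinD(1)[OF F]] linfD[OF blinD(2)[OF F]] in \<open>simp_all add: K_add K_scale\<close>)
lemma Sw_linear: assumes F: "blin F" shows "Sw F (x + y) = Sw F x + Sw F y" "Sw F (scale c x) = c * Sw F x"
 unfolding Sw_def using Sw_cong[OF F comult_add] Sw_cong[OF F comult_scale] by (simp_all add: klin_linear)
lemma dot_cmV: "dot (cmV f g) x = Sw (\<lambda>a b. dot f a * dot g b) (J x)"
proof -
 have "blin (\<lambda>a b. dot f a * dot g b)" by (intro lins)
 then have "linf (\<lambda>x. Sw (\<lambda>a b. dot f a * dot g b) (J x))" by (simp add: linf_def J_add J_scale Sw_linear)
 then show ?thesis by (simp add: cmV_def dot_repf)
qed
lemma dot_epsV: "dot epsV x = counit (J x)"
proof -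
 have "linf (\<lambda>x. counit (J x))" by (simp add: linf_def J_add J_scale counit)
 then show ?thesis by (simp add: epsV_def dot_repf)
qed
lemma bop_cmV: "bop cmV"
proof (rule bopI)
 show "lin (\<lambda>y. cmV x y)" for x
  unfolding lin_def by (intro conjI allI; rule dot_eqI, subst (1 2) dot_sym)
   (simp_all add: dot_cmV Sw_def distrib_left klin_fun[symmetric] case_prod_beta' mult.left_commute)
 show "lin (\<lambda>x. cmV x y)" for y
  unfolding lin_def by (intro conjI allI; rule dot_eqI, subst (1 2) dot_sym)
   (simp_all add: dot_cmV Sw_def distrib_right klin_fun[symmetric] case_prod_beta' mult.assoc)
qed
lemma sw_Sw: assumes "blin F" shows "sw cmV x F = Sw F (J x)"
proof -
 obtain c where c: "F = (\<lambda>a b. \<Sum>i\<in>UNIV. \<Sum>j\<in>UNIV. c i j * (dot (ax i) a * dot (ax j) b))"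
  using blin_ex[OF assms] by blast
 have "sw cmV x F = (\<Sum>i\<in>UNIV. \<Sum>j\<in>UNIV. c i j * Sw (\<lambda>a b. dot (ax i) a * dot (ax j) b) (J x))"
  by (simp only: c sw_sum sw_mult sw_dot[OF bop_cmV] dot_cmV)
 also have "\<dots> = Sw F (J x)"
  unfolding Sw_def c by (simp only: case_prod_beta' klin_fun(4) klin_fun(2))
 finally show ?thesis .
qed
lemma dot_K_lin_ext: "dot f (K (lin_ext scale g t)) = klin (\<lambda>b. dot f (K (g b))) t"
 by (rule lin_ext_comp) (simp_all add: K_add K_scale)
lemma bop_mulV: "bop mulV"
 by (rule bopI) (simp_all add: lin_def mulV_def J_add J_scale K_add K_scale distrib_left distrib_right scale_mult_left scale_mult_right)
lemma lin_SV: "lin SV" by (simp add: lin_def SV_def J_add J_scale K_add K_scale antip)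

lemma linf_mulV: "linf (\<lambda>x. dot f (mulV x c))" "linf (\<lambda>x. dot f (mulV c x))"
 using bop_mulV by (auto simp: bop_def intro: lins)
lemma blin_mulV2: "blin (\<lambda>a b. dot f (mulV a c) * dot g (mulV b d))" "blin (\<lambda>a b. dot f (mulV c a) * dot g (mulV d b))"
 by (intro lins linf_mulV)+

lemma cmV_assoc: "cmV (cmV f g) h = cmV f (cmV g h)"
proof (rule dot_eqI, subst (1 2) dot_sym)
 fix x
 let ?G = "\<lambda>(a,b,c). dot f (K a) * dot g (K b) * dot h (K c)"
 have "dot (cmV (cmV f g) h) x = klin (\<lambda>(a,b). klin (\<lambda>(c,d). dot f (K c) * dot g (K d)) (comult a) * dot h (K b)) (comult (J x))"
  by (simp add: dot_cmV Sw_def)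
 also have "\<dots> = klin ?G (lin_ext free_scale (\<lambda>(x, y). lin_ext free_scale (\<lambda>(a, b). sing (a, b, y) 1) (comult x)) (comult (J x)))"
  by (simp add: klin_comp case_prod_beta' klin_fun(3)[symmetric])
 also have "\<dots> = klin ?G (lin_ext free_scale (\<lambda>(x, y). lin_ext free_scale (\<lambda>(a, b). sing (x, a, b) 1) (comult y)) (comult (J x)))"
  by (rule klin_cong3[OF _ _ _ _ _ _ coassoc]) (simp_all add: K_add K_scale algebra_simps)
 also have "\<dots> = klin (\<lambda>(a,b). dot f (K a) * klin (\<lambda>(c,d). dot g (K c) * dot h (K d)) (comult b)) (comult (J x))"
  by (simp add: klin_comp case_prod_beta' klin_fun(2)[symmetric] mult.assoc)
 also have "\<dots> = dot (cmV f (cmV g h)) x" by (simp add: dot_cmV Sw_def)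
 finally show "dot (cmV (cmV f g) h) x = dot (cmV f (cmV g h)) x" .
qed

sublocale H: hopf mulV cmV oneV epsV SV
proof
 show "bop mulV" "bop cmV" "lin SV" by (rule bop_mulV bop_cmV lin_SV)+
 show "mulV (mulV x y) z = mulV x (mulV y z)" for x y z by (simp add: mulV_def mult.assoc)
 show "mulV oneV x = x" "mulV x oneV = x" for x by (simp_all add: mulV_def oneV_def)
 show "cmV (cmV x y) z = cmV x (cmV y z)" for x y z by (rule cmV_assoc)
 show "cmV epsV f = f" for f
 proof (rule dot_eqI, subst (1 2) dot_sym)
  fix x
  have "dot f (K (lin_ext scale (\<lambda>(x, y). scale (counit x) y) (comult (J x)))) = dot f x" by (simp add: counit_left)
  then show "dot (cmV epsV f) x = dot f x"
   unfolding dot_K_lin_ext by (simp add: dot_cmV Sw_def dot_epsV case_prod_beta' K_scale)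
 qed
 show "cmV f epsV = f" for f
 proof (rule dot_eqI, subst (1 2) dot_sym)
  fix x
  have "dot f (K (lin_ext scale (\<lambda>(x, y). scale (counit y) x) (comult (J x)))) = dot f x" by (simp add: counit_right)
  then show "dot (cmV f epsV) x = dot f x"
   unfolding dot_K_lin_ext by (simp add: dot_cmV Sw_def dot_epsV case_prod_beta' K_scale mult.commute)
 qed
 show "dot epsV (mulV x y) = dot epsV x * dot epsV y" for x y by (simp add: dot_epsV mulV_def counit_mult)
 show "dot epsV oneV = 1" by (simp add: dot_epsV oneV_def counit_one)
 show "dot (cmV f g) oneV = dot f oneV * dot g oneV" for f g
 proof -
  have "blin (\<lambda>a b. dot f a * dot g b)" by (intro lins)
  from Sw_cong[OF this comult_one] show ?thesis by (simp add: dot_cmV Sw_def oneV_def)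
 qed
 show "dot (cmV f g) (mulV x y) = sw cmV x (\<lambda>a b. sw cmV y (\<lambda>c d. dot f (mulV a c) * dot g (mulV b d)))" for f g x y
 proof -
  have b: "blin (\<lambda>a b. dot f a * dot g b)" by (intro lins)
  have b2: "blin (\<lambda>a b. sw cmV y (\<lambda>c d. dot f (mulV a c) * dot g (mulV b d)))"
   by (intro lins linf_mulV)
  have "dot (cmV f g) (mulV x y) = klin (\<lambda>(a,b). dot f (K a) * dot g (K b)) (comult (J x * J y))"
   by (simp add: dot_cmV Sw_def mulV_def)
  also have "\<dots> = klin (\<lambda>(a,b). dot f (K a) * dot g (K b)) (tensor2_mult (comult (J x)) (comult (J y)))"
   by (rule Sw_cong[OF b comult_mult])
  also have "\<dots> = klin (\<lambda>(a,b). klin (\<lambda>(c,d). dot f (K (a * c)) * dot g (K (b * d))) (comult (J y))) (comult (J x))"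
   by (simp add: tensor2_mult_def klin_comp case_prod_beta')
  also have "\<dots> = Sw (\<lambda>a b. Sw (\<lambda>c d. dot f (mulV a c) * dot g (mulV b d)) (J y)) (J x)"
   by (simp add: Sw_def mulV_def)
  also have "\<dots> = sw cmV x (\<lambda>a b. sw cmV y (\<lambda>c d. dot f (mulV a c) * dot g (mulV b d)))"
   using sw_Sw[OF b2, of x] by (simp add: sw_Sw[OF blin_mulV2(2)])
  finally show ?thesis .
 qed
 show "sw cmV x (\<lambda>a b. dot f (mulV (SV a) b)) = dot epsV x * dot f oneV" for x f
 proof -
  have b: "blin (\<lambda>a b. dot f (mulV (SV a) b))"
   by (intro lins linf_mulV linf_comp[OF linf_mulV(1) lin_SV])
  have "dot f (K (lin_ext scale (\<lambda>(x, y). antipode x * y) (comult (J x)))) = dot epsV x * dot f oneV"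
   by (simp add: antipode_left K_scale dot_epsV oneV_def)
  then show ?thesis unfolding dot_K_lin_ext sw_Sw[OF b] by (simp add: Sw_def mulV_def SV_def case_prod_beta')
 qed
 show "sw cmV x (\<lambda>a b. dot f (mulV a (SV b))) = dot epsV x * dot f oneV" for x f
 proof -
  have b: "blin (\<lambda>a b. dot f (mulV a (SV b)))"
   by (intro lins linf_mulV linf_comp[OF linf_mulV(2) lin_SV])
  have "dot f (K (lin_ext scale (\<lambda>(x, y). x * antipode y) (comult (J x)))) = dot epsV x * dot f oneV"
   by (simp add: antipode_right K_scale dot_epsV oneV_def)
  then show ?thesis unfolding dot_K_lin_ext sw_Sw[OF b] by (simp add: Sw_def mulV_def SV_def case_prod_beta')
 qed
qed

text \<open>Let M be a left ideal complementary to the kernel of the counit. The component y of 1 in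
  M has counit 1, and h y - counit(h) y lies in M and in that kernel.\<close>

lemma ex_Lam: assumes "semisimple" shows "\<exists>L. (\<forall>h. mulV h L = dot epsV h *s L) \<and> dot epsV L = 1"
proof -
 let ?I = "{h. counit h = 0}"
 have c0: "counit 0 = 0" using counit(2)[of 0 0] by simp
 have li: "left_ideal ?I" unfolding left_ideal_def subspace_def by (auto simp: counit counit_mult c0)
 then obtain M where M: "left_ideal M" "?I \<inter> M = {0}" "\<forall>h. \<exists>x\<in>?I. \<exists>y\<in>M. h = x + y"
  using assms[unfolded semisimple_def, rule_format, OF li] by blast
 obtain x y where xy: "counit x = 0" "y \<in> M" "1 = x + y" using M(3) by blast
 have y1: "counit y = 1"
 proof -
  have "counit (x + y) = 1" using xy(3) counit_one by simp
  then show ?thesis using xy(1) by (simp add: counit)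
 qed
 have int: "h * y = scale (counit h) y" for h
 proof -
  have "h * y \<in> M" "scale (counit h) y \<in> M" using M(1) xy(2) unfolding left_ideal_def subspace_def by auto
  then have "h * y + scale (- 1) (scale (counit h) y) \<in> M"
   using M(1) unfolding left_ideal_def subspace_def by blast
  moreover have "counit (h * y + scale (- 1) (scale (counit h) y)) = 0" by (simp only: counit counit_mult y1) simp
  ultimately have "h * y + scale (- 1) (scale (counit h) y) = 0" using M(2) by blast
  then show ?thesis by (simp add: scale_minus_left)
 qed
 show ?thesis
  by (rule exI[of _ "K y"]) (simp add: mulV_def dot_epsV int K_scale y1)
qed

section \<open>Equality of tensors in a basis\<close>

lemma null_subspace: "free.subspace (tensor2_null scale)" unfolding tensor2_null_def by (rule free.subspace_span)
lemma teq_refl: "teq t t" using free.subspace_0[OF null_subspace] by (simp add: tensor2_eq_def)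
lemma teq_sym: "teq t u \<Longrightarrow> teq u t"
 using free.subspace_neg[OF null_subspace, of "t - u"] by (simp add: tensor2_eq_def)
lemma teq_trans [trans]: "teq t u \<Longrightarrow> teq u v \<Longrightarrow> teq t v"
 using free.subspace_add[OF null_subspace, of "t - u" "u - v"] by (simp add: tensor2_eq_def)
lemma teq_sum: "(\<And>i. i \<in> I \<Longrightarrow> teq (t i) (u i)) \<Longrightarrow> teq (\<Sum>i\<in>I. t i) (\<Sum>i\<in>I. u i)"
 using free.subspace_sum[OF null_subspace, of I "\<lambda>i. t i - u i"] by (simp add: tensor2_eq_def sum_subtractf)
lemma teq_scale: "teq t u \<Longrightarrow> teq (free_scale c t) (free_scale c u)"
 using free.subspace_scale[OF null_subspace, of "t - u" c] by (simp add: tensor2_eq_def free.scale_right_diff_distrib)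
lemma fs_single: "free_scale c (sing p d) = sing p (c * d)"
 by (rule poly_mapping_eqI) (simp add: lookup_single when_def)
lemma fs_add: "free_scale c (t + u) = free_scale c t + free_scale c u" by (rule free.scale_right_distrib)

lemma teq_rel:
 "teq (sing (x + x', y) c) (sing (x, y) c + sing (x', y) c)"
 "teq (sing (x, y + y') c) (sing (x, y) c + sing (x, y') c)"
 "teq (sing (scale d x, y) c) (sing (x, y) (c * d))"
 "teq (sing (x, scale d y) c) (sing (x, y) (c * d))"
proof -
 have 1: "teq (sing (x + x', y) 1) (sing (x, y) 1 + sing (x', y) 1)"
  unfolding tensor2_eq_def tensor2_null_def diff_diff_eq[symmetric] by (rule free.span_base) blast
 have 2: "teq (sing (x, y + y') 1) (sing (x, y) 1 + sing (x, y') 1)"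
  unfolding tensor2_eq_def tensor2_null_def diff_diff_eq[symmetric] by (rule free.span_base) blast
 have 3: "teq (sing (scale d x, y) 1) (sing (x, y) d)"
  unfolding tensor2_eq_def tensor2_null_def by (rule free.span_base) blast
 have 4: "teq (sing (x, scale d y) 1) (sing (x, y) d)"
  unfolding tensor2_eq_def tensor2_null_def by (rule free.span_base) blast
 show "teq (sing (x + x', y) c) (sing (x, y) c + sing (x', y) c)"
  using teq_scale[OF 1, of c] by (simp add: fs_single fs_add)
 show "teq (sing (x, y + y') c) (sing (x, y) c + sing (x, y') c)"
  using teq_scale[OF 2, of c] by (simp add: fs_single fs_add)
 show "teq (sing (scale d x, y) c) (sing (x, y) (c * d))"
  using teq_scale[OF 3, of c] by (simp add: fs_single)
 show "teq (sing (x, scale d y) c) (sing (x, y) (c * d))"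
  using teq_scale[OF 4, of c] by (simp add: fs_single)
qed
lemma teq_add: "teq t u \<Longrightarrow> teq t' u' \<Longrightarrow> teq (t + t') (u + u')"
 using free.subspace_add[OF null_subspace, of "t - u" "t' - u'"] by (simp add: tensor2_eq_def add_diff_add)
lemma teq_zero: "teq (sing (0, y) c) 0" "teq (sing (y, 0) c) 0"
 using teq_rel(3)[of 0 0 y c] teq_rel(4)[of y 0 0 c] by simp_all
lemma teq_sum_left: "finite I \<Longrightarrow> teq (sing (\<Sum>i\<in>I. x i, y) c) (\<Sum>i\<in>I. sing (x i, y) c)"
proof (induction I rule: finite_induct)
 case (insert a I)
 have "teq (sing (x a + (\<Sum>i\<in>I. x i), y) c) (sing (x a, y) c + sing (\<Sum>i\<in>I. x i, y) c)"
  by (rule teq_rel)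
 also have "teq \<dots> (sing (x a, y) c + (\<Sum>i\<in>I. sing (x i, y) c))"
  by (rule teq_add[OF teq_refl insert.IH])
 finally show ?case using insert.hyps by simp
qed (simp add: teq_zero)
lemma teq_sum_right: "finite I \<Longrightarrow> teq (sing (y, \<Sum>i\<in>I. x i) c) (\<Sum>i\<in>I. sing (y, x i) c)"
proof (induction I rule: finite_induct)
 case (insert a I)
 have "teq (sing (y, x a + (\<Sum>i\<in>I. x i)) c) (sing (y, x a) c + sing (y, \<Sum>i\<in>I. x i) c)"
  by (rule teq_rel)
 also have "teq \<dots> (sing (y, x a) c + (\<Sum>i\<in>I. sing (y, x i) c))"
  by (rule teq_add[OF teq_refl insert.IH])
 finally show ?case using insert.hyps by simp
qed (simp add: teq_zero)
lemma J_expand: "x = (\<Sum>i\<in>UNIV. scale (K x $ i) (J (ax i)))"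
 by (subst JK[of x, symmetric], subst vec_expand[of "K x"]) (simp add: J_sum J_scale)
lemma tensor_basis: "teq (sing (x, y) c)
  (\<Sum>i\<in>UNIV. \<Sum>j\<in>UNIV. sing (J (ax i), J (ax j)) (c * (K x $ i * K y $ j)))"
proof -
 have "teq (sing (x, y) c) (\<Sum>i\<in>UNIV. sing (scale (K x $ i) (J (ax i)), y) c)"
  by (subst J_expand[of x]) (rule teq_sum_left, simp)
 also have "teq \<dots> (\<Sum>i\<in>UNIV. sing (J (ax i), y) (c * K x $ i))"
  by (rule teq_sum, rule teq_rel)
 also have "teq \<dots> (\<Sum>i\<in>UNIV. \<Sum>j\<in>UNIV. sing (J (ax i), scale (K y $ j) (J (ax j))) (c * K x $ i))"
  by (rule teq_sum, subst J_expand[of y]) (rule teq_sum_right, simp)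
 also have "teq \<dots> (\<Sum>i\<in>UNIV. \<Sum>j\<in>UNIV. sing (J (ax i), J (ax j)) (c * (K x $ i * K y $ j)))"
  unfolding mult.assoc[symmetric] by (rule teq_sum, rule teq_sum, rule teq_rel)
 finally show ?thesis .
qed
text \<open>Normal form of a representative over a basis. Its coefficients are values of products of
  coordinate functionals, so such products decide equality of tensors.\<close>

lemma tensor_normal: "teq t
  (\<Sum>i\<in>UNIV. \<Sum>j\<in>UNIV. sing (J (ax i), J (ax j)) (klin (\<lambda>(a,b). K a $ i * K b $ j) t))"
proof -
 let ?s = "\<lambda>i j. sing (J (ax i), J (ax j)) "
 have sm: "(\<Sum>p\<in>A. ?s i j (g p)) = ?s i j (\<Sum>p\<in>A. g p)" for A :: "('h \<times> 'h) set" and g :: "'h \<times> 'h \<Rightarrow> 'k" and i j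
  by (rule additive_sum[of "sing (J (ax i), J (ax j))", OF single_add, symmetric])
 have "t = (\<Sum>p\<in>Poly_Mapping.keys t. sing p (Poly_Mapping.lookup t p))"
  by (rule poly_mapping_eqI) (simp add: lookup_sum lookup_single when_def in_keys_iff)
 moreover have "teq (\<Sum>p\<in>Poly_Mapping.keys t. sing p (Poly_Mapping.lookup t p))
   (\<Sum>p\<in>Poly_Mapping.keys t. \<Sum>i\<in>UNIV. \<Sum>j\<in>UNIV. ?s i j (Poly_Mapping.lookup t p * (K (fst p) $ i * K (snd p) $ j)))"
 proof (rule teq_sum)
  fix p
  show "teq (sing p (Poly_Mapping.lookup t p)) (\<Sum>i\<in>UNIV. \<Sum>j\<in>UNIV. ?s i j (Poly_Mapping.lookup t p * (K (fst p) $ i * K (snd p) $ j)))"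
   using tensor_basis[of "fst p" "snd p"] by simp
 qed
 moreover have "(\<Sum>p\<in>Poly_Mapping.keys t. \<Sum>i\<in>UNIV. \<Sum>j\<in>UNIV. ?s i j (Poly_Mapping.lookup t p * (K (fst p) $ i * K (snd p) $ j)))
  = (\<Sum>i\<in>UNIV. \<Sum>j\<in>UNIV. ?s i j (klin (\<lambda>(a,b). K a $ i * K b $ j) t))"
  by (subst sum.swap, rule sum.cong[OF refl], subst sum.swap, rule sum.cong[OF refl]) (simp add: sm lin_ext_def case_prod_beta')
 ultimately show ?thesis by simp
qed
lemma tensor_eqI: assumes "\<And>f g. klin (\<lambda>(a,b). dot f (K a) * dot g (K b)) t = klin (\<lambda>(a,b). dot f (K a) * dot g (K b)) u"
 shows "teq t u"
proof -
 have "klin (\<lambda>(a,b). K a $ i * K b $ j) t = klin (\<lambda>(a,b). K a $ i * K b $ j) u" for i j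
  using assms[of "ax i" "ax j"] by simp
 then have "teq (\<Sum>i\<in>UNIV. \<Sum>j\<in>UNIV. sing (J (ax i), J (ax j)) (klin (\<lambda>(a,b). K a $ i * K b $ j) t)) u"
  using teq_sym[OF tensor_normal[of u]] by simp
 then show ?thesis using teq_trans[OF tensor_normal[of t]] by blast
qed

text \<open>Turns an identity between functionals into a representative of the coproduct with both
  legs in A, as \<open>hopf_subalgebra\<close> demands.\<close>

lemma comult_in:
 assumes "\<And>i. i \<in> I \<Longrightarrow> u i \<in> A \<and> v i \<in> A" and "\<And>f g. dot (cmV f g) x = (\<Sum>i\<in>I. dot f (u i) * dot g (v i))"
 shows "\<exists>t. Poly_Mapping.keys t \<subseteq> J ` A \<times> J ` A \<and> teq (comult (J x)) t"
proof (intro exI conjI)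
 let ?t = "\<Sum>i\<in>I. sing (J (u i), J (v i)) (1::'k)"
 have "Poly_Mapping.keys ?t \<subseteq> (\<Union>i\<in>I. Poly_Mapping.keys (sing (J (u i), J (v i)) (1::'k)))"
  by (rule keys_sum)
 then show "Poly_Mapping.keys ?t \<subseteq> J ` A \<times> J ` A" using assms(1) by fastforce
 show "teq (comult (J x)) ?t"
 proof (rule tensor_eqI)
  fix f g
  have "klin G ?t = (\<Sum>i\<in>I. klin G (sing (J (u i), J (v i)) 1))" for G
   by (rule additive_sum) (rule klin_linear)
  then show "klin (\<lambda>(a,b). dot f (K a) * dot g (K b)) (comult (J x)) = klin (\<lambda>(a,b). dot f (K a) * dot g (K b)) ?t"
   using assms(2)[of f g] by (simp add: dot_cmV Sw_def)
 qed
qed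

lemma not_simple:
 assumes A: "0 \<in> A" "\<And>x y. x \<in> A \<Longrightarrow> y \<in> A \<Longrightarrow> x + y \<in> A" "\<And>c x. x \<in> A \<Longrightarrow> c *s x \<in> A"
  "oneV \<in> A" "\<And>x y. x \<in> A \<Longrightarrow> y \<in> A \<Longrightarrow> mulV x y \<in> A" "\<And>x. x \<in> A \<Longrightarrow> SV x \<in> A"
  and cm: "\<And>x. x \<in> A \<Longrightarrow> \<exists>t. Poly_Mapping.keys t \<subseteq> J ` A \<times> J ` A \<and> teq (comult (J x)) t"
  and n: "\<And>h a y. a \<in> A \<Longrightarrow> (\<And>f. dot f y = sw cmV h (\<lambda>u v. dot f (mulV (mulV u a) (SV v)))) \<Longrightarrow> y \<in> A"
  and p: "A \<noteq> UNIV" "A \<noteq> range (\<lambda>c. c *s oneV)"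
 shows "\<not> simple"
proof -
 have JA: "x \<in> J ` A \<longleftrightarrow> K x \<in> A" for x by (metis JK KJ image_iff)
 have K0: "K 0 = 0" using K_add[of 0 0] by simp
 have "hopf_subalgebra (J ` A)"
  unfolding hopf_subalgebra_def
 proof (intro conjI ballI)
  show "subspace (J ` A)" unfolding subspace_def using A by (auto simp: JA K0 K_add K_scale)
  show "1 \<in> J ` A" using A(4) by (simp add: JA oneV_def)
  show "x * y \<in> J ` A" if "x \<in> J ` A" "y \<in> J ` A" for x y
   using A(5)[of "K x" "K y"] that by (simp add: JA mulV_def)
  show "antipode a \<in> J ` A" if "a \<in> J ` A" for a using A(6)[of "K a"] that by (simp add: JA SV_def)
  show "\<exists>t. Poly_Mapping.keys t \<subseteq> J ` A \<times> J ` A \<and> teq (comult a) t" if "a \<in> J ` A" for a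
   using cm that by auto
 qed
 moreover have "normal (J ` A)"
  unfolding normal_def
 proof (intro allI ballI)
  fix h a assume a: "a \<in> J ` A"
  show "lin_ext scale (\<lambda>(x, y). x * a * antipode y) (comult h) \<in> J ` A"
   unfolding JA
  proof (rule n[of "K a" _ "K h"])
   show "K a \<in> A" using a by (simp add: JA)
   fix f
   have b: "blin (\<lambda>u v. dot f (mulV (mulV u (K a)) (SV v)))" by (intro lins)
   show "dot f (K (lin_ext scale (\<lambda>(x, y). x * a * antipode y) (comult h))) = sw cmV (K h) (\<lambda>u v. dot f (mulV (mulV u (K a)) (SV v)))"
    unfolding dot_K_lin_ext sw_Sw[OF b] by (simp add: Sw_def mulV_def SV_def case_prod_beta')
  qed
 qed
 moreover have "proper (J ` A)"
  unfolding proper_def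
 proof
  show "J ` A \<noteq> range (\<lambda>c. scale c 1)"
  proof
   assume e: "J ` A = range (\<lambda>c. scale c 1)"
   have "x \<in> A \<longleftrightarrow> (\<exists>c. x = c *s oneV)" for x
   proof -
    have "x \<in> A \<longleftrightarrow> J x \<in> range (\<lambda>c. scale c 1)" unfolding e[symmetric] by (simp add: JA)
    also have "\<dots> \<longleftrightarrow> (\<exists>c. x = c *s oneV)"
    proof -
     have "J x = scale c 1 \<longleftrightarrow> x = c *s oneV" for c by (metis JK J_scale KJ oneV_def)
     then show ?thesis by auto
    qed
    finally show ?thesis .
   qed
   then show False using p(2) by auto
  qed
  show "J ` A \<noteq> UNIV"
  proof
   assume e: "J ` A = UNIV"
   have "x \<in> A" for x using e JA[of "J x"] by simp
   then show False using p(1) by blast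
  qed
 qed
 ultimately show ?thesis unfolding simple_def by blast
qed

end

section \<open>Normal Hopf subalgebras\<close>

context hopf begin

text \<open>A proper normal Hopf subalgebra in coordinates. The adjoint element h_1 a S(h_2) is
  given implicitly, as the vector y with the prescribed pairings.\<close>

definition nsub :: "('k^'n) set \<Rightarrow> bool" where
 "nsub A \<longleftrightarrow> 0 \<in> A \<and> (\<forall>x\<in>A. \<forall>y\<in>A. x + y \<in> A) \<and> (\<forall>c. \<forall>x\<in>A. c *s x \<in> A) \<and>
  one \<in> A \<and> (\<forall>x\<in>A. \<forall>y\<in>A. mul x y \<in> A) \<and> (\<forall>x\<in>A. S x \<in> A) \<and>
  (\<forall>x\<in>A. \<exists>(m::nat) u v. (\<forall>i<m. u i \<in> A \<and> v i \<in> A) \<and> (\<forall>f g. dot (cm f g) x = (\<Sum>i<m. dot f (u i) * dot g (v i)))) \<and>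
  (\<forall>h. \<forall>a\<in>A. \<forall>y. (\<forall>f. dot f y = sw cm h (\<lambda>u v. dot f (mul (mul u a) (S v)))) \<longrightarrow> y \<in> A) \<and>
  A \<noteq> UNIV \<and> A \<noteq> range (\<lambda>c. c *s one)"

lemma reindex_nat:
 assumes I: "finite I" and "\<And>i. i \<in> I \<Longrightarrow> u i \<in> A \<and> v i \<in> A" "\<And>f g. dot (cm f g) x = (\<Sum>i\<in>I. dot f (u i) * dot g (v i))"
 shows "\<exists>(m::nat) u v. (\<forall>i<m. u i \<in> A \<and> v i \<in> A) \<and> (\<forall>f g. dot (cm f g) x = (\<Sum>i<m. dot f (u i) * dot g (v i)))"
proof -
 obtain h where h: "bij_betw h {..<card I} I" using ex_bij_betw_nat_finite[OF I] by (auto simp: atLeast0LessThan)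
 have "(\<Sum>i\<in>I. dot f (u i) * dot g (v i)) = (\<Sum>i<card I. dot f (u (h i)) * dot g (v (h i)))" for f g
  using sum.reindex_bij_betw[OF h, of "\<lambda>i. dot f (u i) * dot g (v i)"] by simp
 moreover have "h i \<in> I" if "i < card I" for i using h that by (auto simp: bij_betw_def)
 ultimately show ?thesis using assms by (intro exI[of _ "card I"] exI[of _ "\<lambda>i. u (h i)"] exI[of _ "\<lambda>i. v (h i)"]) simp
qed

end

context hopf_int begin

text \<open>Centrality of the average makes left-fixed and right-fixed elements coincide. Hence both
  legs of the coproduct of a fixed element can be averaged, and under the adjoint action the
  translations of h_1 and of S(h_2) cancel.\<close>

lemma centr_nsub: assumes P: "centr P" shows "nsub {x. T (avg P) x = x}"
proof -
 let ?a = "avg P" let ?A = "{x. T (avg P) x = x}" let ?n = "of_nat (card P) :: 'k"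
 have sP: "sgd P" and cP: "1 < card P" "card P < CARD('n)" and ce: "cm ?a h = cm h ?a" for h using P by (auto simp: centr_def)
 have gP: "al \<in> P \<Longrightarrow> gd al" and iP: "al \<in> P \<Longrightarrow> adj S al \<in> P" for al using sP by (auto simp: sgd_def)
 have n0: "?n \<noteq> 0" using cP by simp
 have TT': "T' ?a x = T ?a x" for x by (rule dot_eqI) (simp add: dot_T dot_T' ce)
 have F1: "T al x = x" "T' al x = x" if "x \<in> ?A" "al \<in> P" for x al
 proof -
  have "T al (T ?a x) = T ?a x" "T' al (T' ?a x) = T' ?a x" by (simp_all add: TT avg_shift[OF sP that(2)])
  then show "T al x = x" "T' al x = x" using that(1) TT' by auto
 qed
 have F2: "x \<in> ?A" if "\<And>al. al \<in> P \<Longrightarrow> T al x = x" for x using T_avg_fixed(1)[OF sP that] by simp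
 have F3: "x \<in> ?A" if "\<And>al. al \<in> P \<Longrightarrow> T' al x = x" for x using T_avg_fixed(2)[OF sP that] TT' by simp
 have pi: "T ?a (T ?a x) = T ?a x" for x by (simp add: TT avg_idem[OF sP])
 have l: "lin (T ?a)" by (rule lin_T(1)[OF lin_id])
 have c7: "\<exists>(m::nat) u v. (\<forall>i<m. u i \<in> ?A \<and> v i \<in> ?A) \<and> (\<forall>f g. dot (cm f g) x = (\<Sum>i<m. dot f (u i) * dot g (v i)))"
  if x: "x \<in> ?A" for x
 proof (rule reindex_nat)
  let ?u = "\<lambda>(i,j). dot (cm (ax i) (ax j)) x *s T ?a (ax i)" let ?v = "\<lambda>(i,j). T ?a (ax j)"
  show "finite (UNIV :: ('n \<times> 'n) set)" by simp
  show "?u i \<in> ?A \<and> ?v i \<in> ?A" for i by (cases i) (simp add: linD(2)[OF l] pi)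
  fix f g
  have "dot (cm f g) x = dot (cm f g) (T ?a (T' ?a x))" using x TT' by simp
  also have "\<dots> = dot (cm (cm ?a f) (cm g ?a)) x" by (simp add: dot_T dot_T' cm_assoc)
  also have "\<dots> = sw cm x (\<lambda>p q. dot (cm ?a f) p * dot (cm g ?a) q)" by (rule sw_cm[symmetric])
  also have "\<dots> = sw cm x (\<lambda>p q. dot f (T ?a p) * dot g (T ?a q))" by (simp add: dot_T ce)
  also have "\<dots> = (\<Sum>i\<in>UNIV. dot f (?u i) * dot g (?v i))"
   by (simp add: sw_def case_prod_beta' sum.cartesian_product UNIV_Times_UNIV mult.assoc del: dot_ax)
  finally show "dot (cm f g) x = (\<Sum>i\<in>UNIV. dot f (?u i) * dot g (?v i))" .
 qed
 have c8: "y \<in> ?A" if a: "a \<in> ?A" and y: "\<And>f. dot f y = sw cm h (\<lambda>u v. dot f (mul (mul u a) (S v)))" for h a y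
 proof (rule F3)
  fix al assume al: "al \<in> P"
  have ga: "gd al" by (rule gP[OF al])
  have ST: "T' al (S v) = S (T (adj S al) v)" for v
   using arg_cong[OF T_S[of "adj S al" "S v"], of S] by simp
  show "T' al y = y"
  proof (rule dot_eqI)
   fix f
   define F where "F u v = dot f (mul (mul u a) (S v))" for u v
   have bF: "blin F" unfolding F_def by (intro lins)
   have "dot f (T' al y) = sw cm h (\<lambda>u v. dot f (T' al (mul (mul u a) (S v))))" by (simp add: dot_T' y)
   also have "\<dots> = sw cm h (\<lambda>u v. F (T' al u) (T (adj S al) v))"
    by (simp add: T'_mul[OF ga] F1[OF a al] ST F_def)
   also have "\<dots> = sw cm h (\<lambda>u v. sw cm v (\<lambda>p q. dot (adj S al) p * F (T' al u) q))"
    by (simp only: linf_T[OF blinD(1)[OF bF]])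
   also have "\<dots> = sw cm h (\<lambda>u v. sw cm u (\<lambda>p q. dot (adj S al) q * F (T' al p) v))"
   proof (rule sw_coassoc[symmetric])
    show "tlin (\<lambda>p q v. dot (adj S al) q * F (T' al p) v)" unfolding F_def by (intro lins)
   qed
   also have "\<dots> = sw cm h (\<lambda>u v. F u v)"
   proof -
    have "sw cm u (\<lambda>p q. dot (adj S al) q * F (T' al p) v) = F u v" for u v
    proof -
     have lv: "linf (\<lambda>p. F (T' al p) v)" unfolding F_def by (intro lins)
     have "F u v = F (T' al (T' (adj S al) u)) v" by (simp add: TT gd_inv[OF ga])
     also have "\<dots> = sw cm u (\<lambda>p q. F (T' al p) v * dot (adj S al) q)" by (rule linf_T'[OF lv])
     finally show ?thesis by (simp add: mult.commute)
    qed
    then show ?thesis by simp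
   qed
   also have "\<dots> = dot f y" by (simp add: F_def y)
   finally show "dot f (T' al y) = dot f y" .
  qed
 qed
 have aL: "dot ?a Lam = 1 / ?n" using sgd_Lam[OF sP] by (simp add: avg_def)
 have c9: "?A \<noteq> UNIV"
 proof
  assume "?A = UNIV"
  then have "T ?a x = x" for x by blast
  then have "dot (cm ?a eps) Lam = dot eps Lam" using dot_T[of eps ?a Lam] by simp
  then have "?n = of_nat 1" using aL n0 by simp
  then have "card P = 1" by (simp only: of_nat_eq_iff)
  then show False using cP by simp
 qed
 have c10: "?A \<noteq> range (\<lambda>c. c *s one)"
 proof
  assume e: "?A = range (\<lambda>c. c *s one)"
  have Tx: "T ?a x = dot ?a x *s one" for x
  proof -
   have "T ?a x \<in> ?A" using pi by simp
   then obtain c where c: "T ?a x = c *s one" using e by blast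
   have "dot ?a x = dot eps (T ?a x)" by (simp add: dot_T)
   then show ?thesis using c by simp
  qed
  have "tr (T ?a) = (1 / ?n) * (\<Sum>al\<in>P. tr (T al))"
   unfolding T_avg(1)[abs_def] tr_scale tr_sum ..
  also have "(\<Sum>al\<in>P. tr (T al)) = (\<Sum>al\<in>P. if al = eps then of_nat CARD('n) else 0)"
  proof (rule sum.cong[OF refl])
   fix al assume "al \<in> P"
   then show "tr (T al) = (if al = eps then of_nat CARD('n) else 0)"
    using tr_T[OF gP, of al one] tr_id by (auto simp: T_eps[abs_def])
  qed
  also have "\<dots> = of_nat CARD('n)" using sP sgd_finite[OF sP] by (simp add: sgd_def)
  finally have t1: "tr (T ?a) = of_nat CARD('n) / ?n" by simp
  have "tr (T ?a) = (\<Sum>i\<in>UNIV. ?a $ i * one $ i)" by (simp add: tr_def Tx)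
  also have "\<dots> = dot ?a one" by (simp add: dot_def)
  also have "\<dots> = 1"
  proof -
   have "(\<Sum>al\<in>P. dot al one) = ?n" using gP by (simp add: gd_def)
   then show ?thesis using n0 by (simp add: avg_def dot_sum)
  qed
  finally have "(of_nat CARD('n) :: 'k) = of_nat (card P)" using t1 n0 by simp
  then show False using cP by (simp only: of_nat_eq_iff)
 qed
 show ?thesis
  unfolding nsub_def
 proof (intro conjI ballI allI impI)
  show "0 \<in> ?A" using lin_0[OF l] by simp
  show "x + y \<in> ?A" if "x \<in> ?A" "y \<in> ?A" for x y using that by (simp add: linD(1)[OF l])
  show "c *s x \<in> ?A" if "x \<in> ?A" for c x using that by (simp add: linD(2)[OF l])
  show "one \<in> ?A" by (rule F2) (simp add: T_one gP)
  show "mul x y \<in> ?A" if "x \<in> ?A" "y \<in> ?A" for x y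
   by (rule F2) (simp add: T_mul gP F1(1)[OF that(1)] F1(1)[OF that(2)])
  show "S x \<in> ?A" if "x \<in> ?A" for x
   by (rule F2) (simp add: T_S F1(2)[OF that iP])
 qed (rule c7 c8 c9 c10; blast)+
qed

end

context pair begin

text \<open>The span of a group of grouplike elements is a Hopf subalgebra; normality uses that the
  average e is central and absorbs P.\<close>

lemma centrD_nsub: assumes P: "D.centr P" shows "nsub (range (\<lambda>c. \<Sum>g\<in>P. c g *s g))"
proof -
 let ?A = "range (\<lambda>c. \<Sum>g\<in>P. c g *s g)" let ?e = "D.avg P" let ?n = "of_nat (card P) :: 'k"
 have sP: "D.sgd P" and cP: "1 < card P" "card P < CARD('n)" and ce: "mul ?e h = mul h ?e" for h using P by (auto simp: D.centr_def)
 have fP: "finite P" by (rule D.sgd_finite[OF sP])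
 have gP: "g \<in> P \<Longrightarrow> D.gd g" and iP: "g \<in> P \<Longrightarrow> S g \<in> P" and mP: "g \<in> P \<Longrightarrow> h \<in> P \<Longrightarrow> mul g h \<in> P" for g h
  using sP by (auto simp: D.sgd_def adj_adjS)
 have oP: "one \<in> P" using sP by (simp add: D.sgd_def)
 have n0: "?n \<noteq> 0" using cP by simp
 have AI: "(\<Sum>g\<in>P. c g *s g) \<in> ?A" for c by blast
 have Aadd: "x + y \<in> ?A" if xy: "x \<in> ?A" "y \<in> ?A" for x y
 proof -
  obtain c c' where "x = (\<Sum>g\<in>P. c g *s g)" "y = (\<Sum>g\<in>P. c' g *s g)" using xy by blast
  then have "x + y = (\<Sum>g\<in>P. (c g + c' g) *s g)" by (simp add: vec.scale_left_distrib sum.distrib)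
  then show ?thesis by simp
 qed
 have Asc: "k *s x \<in> ?A" if xA: "x \<in> ?A" for k x
 proof -
  obtain c where "x = (\<Sum>g\<in>P. c g *s g)" using xA by blast
  then have "k *s x = (\<Sum>g\<in>P. (k * c g) *s g)" by (simp add: vec.scale_sum_right)
  then show ?thesis by simp
 qed
 have A0: "0 \<in> ?A" using AI[of "\<lambda>_. 0"] by simp
 have Asum: "(\<Sum>i\<in>I. y i) \<in> ?A" if "\<And>i. i \<in> I \<Longrightarrow> y i \<in> ?A" for I and y :: "'k^'n \<Rightarrow> 'k^'n"
  using that by (induction I rule: infinite_finite_induct) (auto intro: A0 Aadd)
 have gA: "g \<in> ?A" if "g \<in> P" for g
 proof -
  have "(\<Sum>h\<in>P. (if h = g then 1 else 0) *s h) = (\<Sum>h\<in>P. if h = g then g else 0)" by (rule sum.cong) auto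
  then have "(\<Sum>h\<in>P. (if h = g then 1 else 0) *s h) = g" using that fP by simp
  then show ?thesis using AI[of "\<lambda>h. if h = g then 1 else 0"] by simp
 qed
 have Alin: "F x \<in> ?A" if xA: "x \<in> ?A" and lF: "lin F" and FA: "\<And>g. g \<in> P \<Longrightarrow> F g \<in> ?A" for F x
 proof -
  obtain c where "x = (\<Sum>g\<in>P. c g *s g)" using xA by blast
  then have "F x = (\<Sum>g\<in>P. c g *s F g)" by (simp add: lin_sum[OF lF] linD(2)[OF lF])
  also have "\<dots> \<in> ?A" by (rule Asum, rule Asc, rule FA)
  finally show ?thesis .
 qed
 have Amul: "mul x y \<in> ?A" if x: "x \<in> ?A" and y: "y \<in> ?A" for x y
 proof (rule Alin[OF x, of "\<lambda>x. mul x y"])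
  show "lin (\<lambda>x. mul x y)" by (intro lins)
  fix g assume g: "g \<in> P"
  show "mul g y \<in> ?A" by (rule Alin[OF y, of "mul g"]) (intro lins, rule gA, rule mP[OF g])
 qed
 have c7: "\<exists>(m::nat) u v. (\<forall>i<m. u i \<in> ?A \<and> v i \<in> ?A) \<and> (\<forall>f g. dot (cm f g) x = (\<Sum>i<m. dot f (u i) * dot g (v i)))"
  if x: "x \<in> ?A" for x
 proof -
  obtain c where c: "x = (\<Sum>g\<in>P. c g *s g)" using x by blast
  show ?thesis
   by (rule reindex_nat[of P "\<lambda>g. c g *s g" _ "\<lambda>g. g"])
    (use fP gA Asc gP in \<open>auto simp: c dot_sum gl_cm mult.assoc intro!: sum.cong\<close>)
 qed
 have re: "dot rho ?e = of_nat CARD('n) / ?n" by (rule rho_avg[OF sP])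
 have ge: "mul g ?e = ?e" if "g \<in> P" for g by (rule D.avg_shift(1)[OF sP that])
 have c8: "y \<in> ?A" if a: "a \<in> ?A" and y: "\<And>f. dot f y = sw cm h (\<lambda>u v. dot f (mul (mul u a) (S v)))" for h a y
 proof -
  define Y where "Y b = (\<chi> i. sw cm h (\<lambda>u v. dot (ax i) (mul (mul u b) (S v))))" for b
  have dY: "dot f (Y b) = sw cm h (\<lambda>u v. dot f (mul (mul u b) (S v)))" for f b
  proof -
   have "dot f (Y b) = (\<Sum>i\<in>UNIV. f $ i * sw cm h (\<lambda>u v. dot (ax i) (mul (mul u b) (S v))))" by (simp add: dot_def Y_def)
   also have "\<dots> = sw cm h (\<lambda>u v. \<Sum>i\<in>UNIV. f $ i * dot (ax i) (mul (mul u b) (S v)))" by (simp only: sw_sum sw_mult)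
   finally show ?thesis by (simp add: dot_def[of f])
  qed
  have "y = Y a" by (rule dot_eqI) (simp add: dY y)
  moreover have "Y a \<in> ?A"
  proof (rule Alin[OF a])
   show "lin Y" unfolding lin_def
    by (intro conjI allI; rule dot_eqI) (simp_all add: dY mdist sw_plus sw_mult)
   fix g assume g: "g \<in> P"
   let ?y = "Y g"
   text \<open>The key identity \<open>y\<^sub>1 \<otimes> y\<^sub>2 e = y \<otimes> e\<close> for \<open>y = h\<^sub>1 g S(h\<^sub>2)\<close>, followed by \<open>id \<otimes> \<rho>\<close>.\<close>
   have key: "sw cm ?y (\<lambda>a b. dot f a * dot f' (mul b ?e)) = dot f ?y * dot f' ?e" for f f'
   proof -
    define G where "G a b = dot f a * dot f' (mul b ?e)" for a b
    have bG: "blin G" unfolding G_def by (intro lins)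
    have lG: "linf (\<lambda>y. sw cm y G)" by (intro lins)
    have "sw cm ?y G = sw cm h (\<lambda>u v. sw cm (mul (mul u g) (S v)) G)"
     using dY[of "repf (\<lambda>y. sw cm y G)" g] by (simp add: dot_repf[OF lG])
    also have "\<dots> = sw cm h (\<lambda>u v. sw cm u (\<lambda>u1 u2. sw cm v (\<lambda>v1 v2. G (mul (mul u1 g) (S v2)) (mul (mul u2 g) (S v1)))))"
    proof -
     have "sw cm (mul (mul u g) (S v)) G = sw cm u (\<lambda>u1 u2. sw cm v (\<lambda>v1 v2. G (mul (mul u1 g) (S v2)) (mul (mul u2 g) (S v1))))" for u v
     proof -
      have b1: "blin (\<lambda>a b. sw cm (S v) (\<lambda>c d. G (mul a c) (mul b d)))" unfolding G_def by (intro lins)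
      have b2: "blin (\<lambda>c d. G (mul (mul u1 g) c) (mul (mul u2 g) d))" for u1 u2 unfolding G_def by (intro lins)
      have b3: "blin (\<lambda>a b. sw cm g (\<lambda>c d. sw cm (S v) (\<lambda>c' d'. G (mul (mul a c) c') (mul (mul b d) d'))))" unfolding G_def by (intro lins)
      have b4: "blin (\<lambda>c d. sw cm (S v) (\<lambda>c' d'. G (mul (mul u1 c) c') (mul (mul u2 d) d')))" for u1 u2 unfolding G_def by (intro lins)
      have sg: "sw cm g F = F g g" if "blin F" for F
       using sw_gl[OF _ that] gP[OF g] by (simp add: D.gd_gl)
      have "sw cm (mul (mul u g) (S v)) G = sw cm (mul u g) (\<lambda>a b. sw cm (S v) (\<lambda>c d. G (mul a c) (mul b d)))"
       by (rule sw_mul[OF bG])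
      also have "\<dots> = sw cm u (\<lambda>u1 u2. sw cm (S v) (\<lambda>c d. G (mul (mul u1 g) c) (mul (mul u2 g) d)))"
       unfolding sw_mul[OF b1] by (simp only: sg[OF b4])
      also have "\<dots> = sw cm u (\<lambda>u1 u2. sw cm v (\<lambda>v1 v2. G (mul (mul u1 g) (S v2)) (mul (mul u2 g) (S v1))))"
       by (simp only: sw_S[OF b2])
      finally show ?thesis .
     qed
     then show ?thesis by simp
    qed
    also have "\<dots> = sw cm h (\<lambda>u v. sw cm u (\<lambda>u1 u2. sw cm v (\<lambda>v1 v2. dot f (mul (mul u1 g) (S v2)) * dot f' (mul ?e (mul u2 (S v1))))))"
    proof -
     have "mul (mul (mul u2 g) (S v1)) ?e = mul ?e (mul u2 (S v1))" for u2 v1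
     proof -
      have "mul (mul (mul u2 g) (S v1)) ?e = mul u2 (mul g (mul (S v1) ?e))" by (simp only: mul_assoc)
      also have "mul (S v1) ?e = mul ?e (S v1)" by (rule ce[symmetric])
      also have "mul g (mul ?e (S v1)) = mul ?e (S v1)" by (simp only: mul_assoc[symmetric] ge[OF g])
      also have "mul u2 (mul ?e (S v1)) = mul (mul ?e u2) (S v1)" by (simp only: mul_assoc[symmetric] ce[of u2])
      finally show ?thesis by (simp only: mul_assoc)
     qed
     then show ?thesis by (simp only: G_def)
    qed
    also have "\<dots> = sw cm h (\<lambda>u v. sw cm v (\<lambda>v1 v2. sw cm u (\<lambda>u1 u2. dot f (mul (mul u1 g) (S v2)) * dot f' (mul ?e (mul u2 (S v1))))))"
     by (subst sw_swap) (rule refl)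
    also have "\<dots> = sw cm h (\<lambda>w v2. sw cm w (\<lambda>u v1. sw cm u (\<lambda>u1 u2. dot f (mul (mul u1 g) (S v2)) * dot f' (mul ?e (mul u2 (S v1))))))"
     by (rule sw_coassoc[symmetric]) (intro lins)
    also have "\<dots> = sw cm h (\<lambda>w v2. sw cm w (\<lambda>u1 x. sw cm x (\<lambda>u2 v1. dot f (mul (mul u1 g) (S v2)) * dot f' (mul ?e (mul u2 (S v1))))))"
    proof -
     have t: "tlin (\<lambda>u1 u2 v1. dot f (mul (mul u1 g) (S v2)) * dot f' (mul ?e (mul u2 (S v1))))" for v2 by (intro lins)
     show ?thesis by (simp only: sw_coassoc[OF t])
    qed
    also have "\<dots> = sw cm h (\<lambda>w v2. sw cm w (\<lambda>u1 x. dot eps x * (dot f (mul (mul u1 g) (S v2)) * dot f' ?e)))"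
    proof -
     have "sw cm x (\<lambda>u2 v1. k * dot f' (mul ?e (mul u2 (S v1)))) = dot eps x * (k * dot f' ?e)" for x k
     proof -
      have "linf (\<lambda>t. dot f' (mul ?e t))" by (intro lins)
      from sw_antir[OF this, of x] show ?thesis by (simp add: sw_mult)
     qed
     then show ?thesis by (simp only:)
    qed
    also have "\<dots> = sw cm h (\<lambda>w v2. dot f (mul (mul w g) (S v2)) * dot f' ?e)"
    proof -
     have "linf (\<lambda>u1. dot f (mul (mul u1 g) (S v2)) * dot f' ?e)" for v2 by (intro lins)
     then show ?thesis by (simp only: sw_counitr)
    qed
    also have "\<dots> = dot f ?y * dot f' ?e" by (simp add: dY sw_mult)
    finally show ?thesis by (simp add: G_def[abs_def])
   qed
   \<comment> \<open>As rho is an integral, y_1 rho(y_2 k) = rho(y k) S(k) for grouplike k.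
     Expanding e into its members therefore puts the left leg into the span of P.\<close>
   have ky: "dot rho ?e *s ?y = (1 / ?n) *s (\<Sum>k\<in>P. dot rho (mul ?y k) *s S k)"
   proof (rule dot_eqI)
    fix f
    have one: "sw cm ?y (\<lambda>a b. dot f a * dot rho (mul b k)) = dot rho (mul ?y k) * dot f (S k)" if k: "k \<in> P" for k
    proof -
     have gk: "D.gd k" "D.gd (S k)" using gP k iP by auto
     define R where "R z = mul z k" for z
     have sg: "sw cm k F = F k k" if "blin F" for F
       using sw_gl[OF _ that] gk(1) by (simp add: D.gd_gl)
     have b: "blin (\<lambda>a b. dot f (mul a (S k)) * dot rho b)" by (intro lins)
     have b2: "blin (\<lambda>c d. dot f (mul (mul a c) (S k)) * dot rho (mul b d))" for a b by (intro lins)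
     have "sw cm (mul ?y k) (\<lambda>a b. dot f (mul a (S k)) * dot rho b) = sw cm ?y (\<lambda>a b. dot f (mul (mul a k) (S k)) * dot rho (mul b k))"
      unfolding sw_mul[OF b] by (simp only: sg[OF b2])
     also have "\<dots> = sw cm ?y (\<lambda>a b. dot f a * dot rho (mul b k))" by (simp add: mul_assoc gl_S(2)[OF gk(1)])
     finally have e1: "sw cm ?y (\<lambda>a b. dot f a * dot rho (mul b k)) = sw cm (mul ?y k) (\<lambda>a b. dot f (mul a (S k)) * dot rho b)" ..
     have lf: "linf (\<lambda>a. dot f (mul a (S k)))" by (intro lins)
     have "sw cm (mul ?y k) (\<lambda>a b. dot f (mul a (S k)) * dot rho b) = dot (cm (repf (\<lambda>a. dot f (mul a (S k)))) rho) (mul ?y k)"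
      unfolding sw_cm[symmetric] by (simp add: dot_repf[OF lf])
     also have "\<dots> = dot f (S k) * dot rho (mul ?y k)" by (simp add: cm_rho_l dot_repf[OF lf])
     finally show ?thesis using e1 by (simp add: mult.commute)
    qed
    have "dot f ?y * dot rho ?e = sw cm ?y (\<lambda>a b. dot f a * dot rho (mul b ?e))" by (rule key[symmetric])
    also have "\<dots> = sw cm ?y (\<lambda>a b. (1 / ?n) * (\<Sum>k\<in>P. dot f a * dot rho (mul b k)))"
     by (simp add: D.avg_def mdist msum dot_sum sum_distrib_left mult.left_commute)
    also have "\<dots> = (1 / ?n) * (\<Sum>k\<in>P. dot rho (mul ?y k) * dot f (S k))"
     unfolding sw_mult sw_sum by (simp add: one)
    finally show "dot f (dot rho ?e *s ?y) = dot f ((1 / ?n) *s (\<Sum>k\<in>P. dot rho (mul ?y k) *s S k))"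
     by (simp add: dot_sum mult.commute)
   qed
   have "(1 / ?n) *s (\<Sum>k\<in>P. dot rho (mul ?y k) *s S k) \<in> ?A"
    by (rule Asc, rule Asum, rule Asc, rule gA, rule iP)
   then have "(1 / dot rho ?e) *s (dot rho ?e *s ?y) \<in> ?A" unfolding ky by (rule Asc)
   moreover have "dot rho ?e \<noteq> 0" using re n0 by simp
   ultimately show "?y \<in> ?A" by simp
  qed
  ultimately show ?thesis by simp
 qed
 \<comment> \<open>If the span were everything, e would be the integral \<open>Lam\<close>, although
   rho(e) = n / card P is not 1.\<close>
 have c9: "?A \<noteq> UNIV"
 proof
  assume e: "?A = UNIV"
  have "mul x ?e = dot eps x *s ?e" for x
  proof -
   have "x \<in> ?A" using e by blast
   then obtain c where c: "x = (\<Sum>g\<in>P. c g *s g)" by blast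
   have "mul x ?e = (\<Sum>g\<in>P. c g *s ?e)" unfolding c msum mdist by (rule sum.cong[OF refl]) (simp add: ge)
   moreover have "dot eps x = (\<Sum>g\<in>P. c g)" unfolding c dot_sum by (rule sum.cong[OF refl]) (simp add: gP)
   ultimately show ?thesis by (simp add: vec.scale_sum_left)
  qed
  then have "?e = dot eps ?e *s Lam" by (rule Lam_unique)
  then have "?e = Lam" by (simp add: eps_avg[OF sP])
  then have "of_nat CARD('n) / ?n = 1" using re rho_Lam by simp
  then have "(of_nat CARD('n) :: 'k) = of_nat (card P)" using n0 by (simp add: field_simps)
  then show False using cP by (simp only: of_nat_eq_iff)
 qed
 have c10: "?A \<noteq> range (\<lambda>c. c *s one)"
 proof
  assume e: "?A = range (\<lambda>c. c *s one)"
  have "P \<subseteq> {one}"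
  proof
   fix g assume g: "g \<in> P"
   then obtain c where c: "g = c *s one" using gA e by blast
   have "dot eps g = 1" using gP[OF g] by simp
   then have "c = 1" unfolding c by simp
   then show "g \<in> {one}" using c by simp
  qed
  then have "card P \<le> card {one}" by (rule card_mono[rotated]) simp
  then show False using cP by simp
 qed
 show ?thesis
  unfolding nsub_def
 proof (intro conjI ballI allI impI)
  show "S x \<in> ?A" if "x \<in> ?A" for x
   by (rule Alin[OF that lin_S]) (rule gA, rule iP)
  show "y \<in> ?A" if "a \<in> ?A" "\<forall>f. dot f y = sw cm h (\<lambda>u v. dot f (mul (mul u a) (S v)))" for h a y
   using c8[OF that(1)] that(2) by blast
  show "?A \<noteq> UNIV" "?A \<noteq> range (\<lambda>c. c *s one)" by (rule c9 c10)+
 qed (rule A0 Aadd Asc gA[OF oP] Amul c7; assumption)+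
qed

end

context coordinates begin

lemma nsub_not_simple: assumes "H.nsub A" shows "\<not> simple"
proof -
 have n: "0 \<in> A" "\<forall>x\<in>A. \<forall>y\<in>A. x + y \<in> A" "\<forall>c. \<forall>x\<in>A. c *s x \<in> A" "oneV \<in> A" "\<forall>x\<in>A. \<forall>y\<in>A. mulV x y \<in> A" "\<forall>x\<in>A. SV x \<in> A"
  "\<forall>x\<in>A. \<exists>(m::nat) u v. (\<forall>i<m. u i \<in> A \<and> v i \<in> A) \<and> (\<forall>f g. dot (cmV f g) x = (\<Sum>i<m. dot f (u i) * dot g (v i)))"
  "\<forall>h. \<forall>a\<in>A. \<forall>y. (\<forall>f. dot f y = sw cmV h (\<lambda>u v. dot f (mulV (mulV u a) (SV v)))) \<longrightarrow> y \<in> A"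
  "A \<noteq> UNIV" "A \<noteq> range (\<lambda>c. c *s oneV)"
  using assms unfolding H.nsub_def by - (elim conjE, assumption)+
 show ?thesis
 proof (rule not_simple[of A])
  show "y \<in> A" if "a \<in> A" "\<And>f. dot f y = sw cmV h (\<lambda>u v. dot f (mulV (mulV u a) (SV v)))" for h a y
   using n(8) that by blast
  fix x assume "x \<in> A"
  from bspec[OF n(7) this]
  show "\<exists>t. Poly_Mapping.keys t \<subseteq> J ` A \<times> J ` A \<and> teq (comult (J x)) t"
  proof (elim exE conjE)
   fix m :: nat and u v
   assume "\<forall>i<m. u i \<in> A \<and> v i \<in> A" "\<forall>f g. dot (cmV f g) x = (\<Sum>i<m. dot f (u i) * dot g (v i))"
   then show ?thesis by (intro comult_in[of "{..<m}" u A v]) auto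
  qed
 qed (use n(1-6,9,10) in blast)+
qed

end

lemma coordinates_not_simple:
 fixes J :: "'k::{alg_closed_field,field_char_0}^'n::finite \<Rightarrow> 'h::ring_1" and scale :: "'k \<Rightarrow> 'h \<Rightarrow> 'h"
 assumes "coordinates scale comult counit antipode J K" "k_algebra.semisimple scale" "CARD('n) = 56"
 shows "\<not> hopf_algebra.simple scale comult antipode"
proof -
 interpret coordinates scale comult counit antipode J K by (rule assms(1))
 obtain Lam where Lam: "\<And>h. mulV h Lam = dot epsV h *s Lam" "dot epsV Lam = 1" using ex_Lam[OF assms(2)] by blast
 interpret hopf_int mulV cmV oneV epsV SV Lam by unfold_locales (rule Lam)+
 interpret D: hopf_int cmV mulV epsV oneV "adj SV" Lm by (rule hopf_int_dual)
 obtain m r E p where w: "wed mulV oneV m r E p" using ex_wed by blast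
 obtain m' r' E' p' where w': "wed cmV epsV m' r' E' p'" using D.ex_wed by blast
 have h: "hopf_wed mulV cmV oneV epsV SV Lam m r E p" by (intro hopf_wed.intro w hopf_int_axioms)
 have h': "hopf_wed cmV mulV epsV oneV (adj SV) Lm m' r' E' p'" by (intro hopf_wed.intro w' D.hopf_int_axioms)
 interpret pair mulV cmV oneV epsV SV Lam m r E p m' r' E' p' by (rule pair.intro[OF h h'])
 show ?thesis using central_subgroup[OF assms(3)] centr_nsub centrD_nsub nsub_not_simple by blast
qed

lemma coordinates_exist:
 fixes scale :: "'k::field \<Rightarrow> 'h::ring_1 \<Rightarrow> 'h"
 assumes H: "hopf_algebra scale comult counit antipode" and d: "vector_space.dim scale (UNIV :: 'h set) = CARD('n::finite)"
 shows "\<exists>(J :: 'k^'n \<Rightarrow> 'h) K. coordinates scale comult counit antipode J K"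
proof -
 interpret hopf_algebra scale comult counit antipode by (rule H)
 obtain B where B: "independent B" "UNIV \<subseteq> span B" "card B = CARD('n)" using basis_exists[of UNIV] d by auto
 have fB: "finite B" using B(3) by (metis card.infinite zero_less_card_finite less_irrefl)
 have sB: "x \<in> span B" for x using B(2) by blast
 obtain be :: "'n \<Rightarrow> 'h" where b: "bij_betw be UNIV B" using finite_same_card_bij[of "UNIV :: 'n set" B] fB B(3) by auto
 define J where "J v = (\<Sum>i\<in>UNIV. scale (v $ i) (be i))" for v :: "'k^'n"
 define K where "K h = (\<chi> i. representation B h (be i))" for h
 have bB: "be i \<in> B" for i using b by (auto simp: bij_betw_def)
 have JK: "J (K h) = h" for h
 proof -
  have "J (K h) = (\<Sum>b\<in>B. scale (representation B h b) b)"
   unfolding J_def K_def using sum.reindex_bij_betw[OF b, of "\<lambda>b. scale (representation B h b) b"] by simp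
  also have "\<dots> = h" by (rule sum_representation_eq[OF B(1) sB fB]) simp
  finally show ?thesis .
 qed
 have KJ: "K (J v) = v" for v
 proof -
  have "representation B (J v) (be j) = v $ j" for j
  proof -
   have "representation B (J v) (be j) = (\<Sum>i\<in>UNIV. v $ i * representation B (be i) (be j))"
    unfolding J_def by (simp add: representation_sum[OF B(1)] representation_scale[OF B(1)] sB)
   also have "\<dots> = (\<Sum>i\<in>UNIV. if i = j then v $ j else 0)"
   proof (rule sum.cong[OF refl])
    fix i
    have "be i = be j \<longleftrightarrow> i = j" using b by (auto simp: bij_betw_def inj_def)
    then show "v $ i * representation B (be i) (be j) = (if i = j then v $ j else 0)"
     using representation_basis[OF B(1) bB[of i]] by auto
   qed
   finally show ?thesis by simp
  qed
  then show ?thesis by (simp add: K_def vec_eq_iff)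
 qed
 have "coordinates scale comult counit antipode J K"
  by unfold_locales (simp_all add: KJ JK, simp_all add: J_def scale_left_distrib sum.distrib scale_sum_right)
 then show ?thesis by blast
qed

theorem theorem13p2p1:
 fixes scale :: "'k::{alg_closed_field, field_char_0} \<Rightarrow> 'h::ring_1 \<Rightarrow> 'h"
  and comult :: "'h \<Rightarrow> ('h \<times> 'h \<Rightarrow>\<^sub>0 'k)"
  and counit :: "'h \<Rightarrow> 'k"
  and antipode :: "'h \<Rightarrow> 'h"
 assumes "hopf_algebra scale comult counit antipode"
  and "k_algebra.semisimple scale"
  and "vector_space.dim scale (UNIV :: 'h set) = 56"
 shows "\<not> hopf_algebra.simple scale comult antipode"
proof -
 \<comment> \<open>The numeral type 56 has 56 elements and serves as the index type of the
   coordinates.\<close>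
 have "vector_space.dim scale (UNIV :: 'h set) = CARD(56)" using assms(3) by simp
 then obtain J :: "'k^56 \<Rightarrow> 'h" and K where "coordinates scale comult counit antipode J K"
  using coordinates_exist[OF assms(1)] by blast
 then show ?thesis by (rule coordinates_not_simple[OF _ assms(2)]) simp
qed

end
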